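(* For every real $p>1$ there is a constant $m(p)$ such that for every integer $m>m(p)$ there exist a smooth Riemannian manifold $N$ of dimension $n\ge m+2$ and a $p$-harmonic map $U\colon B_1^m\to N$ such that $U$ has an isolated singularity at $0$ and $U$ has a continuum of distinct tangent maps at $0$. Furthermore, $U$ is the unique map minimizing the $p$-energy among maps with the same boundary data as $U$.
   Context: $B_1^m$ is the open unit ball of $\mathbb{R}^m$. A Riemannian manifold $N$ is regarded as isometrically embedded in some Euclidean space $\mathbb{R}^l$, and for a bounded domain $\Omega\subset\mathbb{R}^m$ one sets $W^{1,p}(\Omega,N)=\{v\in W^{1,p}(\Omega,\mathbb{R}^l): v(x)\in N \text{ for a.e. } x\}$. The $p$-energy of $u\in W^{1,p}(\Omega,N)$ is $E_p(u)=\int_\Omega |Du|^p$. A map $u\in W^{1,p}(\Omega,N)$ is $p$-harmonic if it is a critical point of $E_p$, i.e. a weak solution of the Euler-Lagrange equation. It is minimizing in $\Omega$ if $E_p(u)\le E_p(v)$ for all $v\in W^{1,p}(\Omega,N)$ with $u-v\in W^{1,p}_0(\Omega,\mathbb{R}^l)$ (i.e. $v$ has the same boundary data as $u$); it is the unique minimizer with its boundary data if moreover equality holds only for $v=u$ a.e. An isolated singularity at $0$ means that $U$ is of class $C^1$ in a punctured neighbourhood of $0$ but is not continuous at $0$ (after any modification on a null set). A tangent map of $U$ at a point $y$ is a map $U_\infty\colon\mathbb{R}^m\to N$ for which there is a sequence $r_i\searrow 0$ such that the maps $x\mapsto U(y+r_i x)$ converge to $U_\infty$ locally in energy (strongly in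 $W^{1,p}_{\mathrm{loc}}$). "A continuum of distinct tangent maps" means that the set of tangent maps at $0$ has the cardinality of the continuum. *)

theory Defs
  imports "HOL-Analysis.Analysis" "HOL-Library.Equipollence"
begin

section \<open>Euclidean spaces of variable dimension\<close>

text \<open>
  The dimensions of domain and target are quantified inside the main statement, so \<open>\<real>\<^sup>d\<close> cannot be
  a type. It is the set of functions on \<open>{..<d}\<close>, extensional in the sense of
  \<^theory>\<open>HOL-Library.FuncSet\<close>, which is the carrier of the library's product measure. Its topology
  is the subspace topology of the type class topology (product topology) on \<^typ>\<open>nat \<Rightarrow> real\<close>.
\<close>

definition Rn :: "nat \<Rightarrow> (nat \<Rightarrow> real) set" where
  "Rn d = (\<Pi>\<^sub>E i\<in>{..<d}. UNIV)"

definition origin :: "nat \<Rightarrow> nat \<Rightarrow> real" where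
  "origin d = (\<lambda>i\<in>{..<d}. 0)"

definition vdiff :: "nat \<Rightarrow> (nat \<Rightarrow> real) \<Rightarrow> (nat \<Rightarrow> real) \<Rightarrow> nat \<Rightarrow> real" where
  "vdiff d x y = (\<lambda>i\<in>{..<d}. x i - y i)"

definition vnorm :: "nat \<Rightarrow> (nat \<Rightarrow> real) \<Rightarrow> real" where
  "vnorm d x = L2_set x {..<d}"

definition vball :: "nat \<Rightarrow> (nat \<Rightarrow> real) \<Rightarrow> real \<Rightarrow> (nat \<Rightarrow> real) set" where
  "vball d y r = {x \<in> Rn d. vnorm d (vdiff d x y) < r}"

definition leb :: "nat \<Rightarrow> (nat \<Rightarrow> real) measure" where
  "leb d = completion (PiM {..<d} (\<lambda>_. lborel))"


section \<open>Classical differentiability\<close>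

definition pd :: "nat \<Rightarrow> ((nat \<Rightarrow> real) \<Rightarrow> real) \<Rightarrow> (nat \<Rightarrow> real) \<Rightarrow> real" where
  "pd i f x = deriv (\<lambda>t. f (x(i := t))) (x i)"

text \<open>Only meant for \<open>W\<close> relatively open in \<^term>\<open>Rn d\<close>.\<close>

primrec Ck :: "nat \<Rightarrow> nat \<Rightarrow> (nat \<Rightarrow> real) set \<Rightarrow> ((nat \<Rightarrow> real) \<Rightarrow> real) \<Rightarrow> bool" where
  "Ck 0 d W f = continuous_on W f"
| "Ck (Suc k) d W f = (continuous_on W f \<and>
     (\<forall>i<d. (\<forall>x\<in>W. (\<lambda>t. f (x(i := t))) field_differentiable at (x i)) \<and> Ck k d W (pd i f)))"

definition Ck_map ::
  "nat \<Rightarrow> nat \<Rightarrow> nat \<Rightarrow> (nat \<Rightarrow> real) set \<Rightarrow> ((nat \<Rightarrow> real) \<Rightarrow> nat \<Rightarrow> real) \<Rightarrow> bool" where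
  "Ck_map k d l W f \<longleftrightarrow> (\<forall>a<l. Ck k d W (\<lambda>x. f x a))"

definition smooth_map ::
  "nat \<Rightarrow> nat \<Rightarrow> (nat \<Rightarrow> real) set \<Rightarrow> ((nat \<Rightarrow> real) \<Rightarrow> nat \<Rightarrow> real) \<Rightarrow> bool" where
  "smooth_map d l W f \<longleftrightarrow> (\<forall>k. Ck_map k d l W f)"


section \<open>Riemannian manifolds isometrically embedded in Euclidean space\<close>

text \<open>
  \<open>N\<close> is an \<open>n\<close>-dimensional embedded smooth submanifold of \<open>\<real>\<^sup>l\<close> (by slice charts), carrying the
  induced metric. Neither compactness nor completeness nor connectedness is required.
\<close>

definition smooth_submanifold :: "nat \<Rightarrow> nat \<Rightarrow> (nat \<Rightarrow> real) set \<Rightarrow> bool" where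
  "smooth_submanifold l n N \<longleftrightarrow> n \<le> l \<and> N \<subseteq> Rn l \<and>
     (\<forall>y\<in>N. \<exists>W W' \<Phi> \<Psi>.
        openin (top_of_set (Rn l)) W \<and> openin (top_of_set (Rn l)) W' \<and> y \<in> W \<and>
        \<Phi> ` W = W' \<and> \<Psi> ` W' = W \<and> (\<forall>x\<in>W. \<Psi> (\<Phi> x) = x) \<and> (\<forall>z\<in>W'. \<Phi> (\<Psi> z) = z) \<and>
        smooth_map l l W \<Phi> \<and> smooth_map l l W' \<Psi> \<and>
        \<Phi> ` (N \<inter> W) = {z \<in> W'. \<forall>i\<in>{n..<l}. z i = 0})"

text \<open>The tangent space at \<open>y\<close>: velocities at time \<open>0\<close> of curves in \<open>N\<close> through \<open>y\<close>.\<close>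

definition tangent_space ::
  "nat \<Rightarrow> (nat \<Rightarrow> real) set \<Rightarrow> (nat \<Rightarrow> real) \<Rightarrow> (nat \<Rightarrow> real) set" where
  "tangent_space l N y = {v \<in> Rn l. \<exists>c :: real \<Rightarrow> nat \<Rightarrow> real.
     c 0 = y \<and> (\<forall>\<^sub>F t in nhds 0. c t \<in> N) \<and>
     (\<forall>a<l. ((\<lambda>t. c t a) has_real_derivative v a) (at 0))}"


section \<open>Sobolev spaces\<close>

definition test_fun :: "nat \<Rightarrow> (nat \<Rightarrow> real) set \<Rightarrow> ((nat \<Rightarrow> real) \<Rightarrow> real) \<Rightarrow> bool" where
  "test_fun m \<Omega> \<phi> \<longleftrightarrow> (\<forall>k. Ck k m (Rn m) \<phi>) \<and>
     (\<exists>K. compact K \<and> K \<subseteq> \<Omega> \<and> (\<forall>x\<in>Rn m - K. \<phi> x = 0))"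

definition test_map ::
  "nat \<Rightarrow> nat \<Rightarrow> (nat \<Rightarrow> real) set \<Rightarrow> ((nat \<Rightarrow> real) \<Rightarrow> nat \<Rightarrow> real) \<Rightarrow> bool" where
  "test_map m l \<Omega> \<phi> \<longleftrightarrow> \<phi> \<in> Rn m \<rightarrow> Rn l \<and> (\<forall>a<l. test_fun m \<Omega> (\<lambda>x. \<phi> x a))"

definition locally_integrable ::
  "nat \<Rightarrow> (nat \<Rightarrow> real) set \<Rightarrow> ((nat \<Rightarrow> real) \<Rightarrow> real) \<Rightarrow> bool" where
  "locally_integrable m \<Omega> f \<longleftrightarrow> (\<forall>K. compact K \<longrightarrow> K \<subseteq> \<Omega> \<longrightarrow> set_integrable (leb m) K f)"

definition has_weak_pd ::
  "nat \<Rightarrow> (nat \<Rightarrow> real) set \<Rightarrow> nat \<Rightarrow> ((nat \<Rightarrow> real) \<Rightarrow> real) \<Rightarrow> ((nat \<Rightarrow> real) \<Rightarrow> real) \<Rightarrow> bool" where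
  "has_weak_pd m \<Omega> i f g \<longleftrightarrow> locally_integrable m \<Omega> f \<and> locally_integrable m \<Omega> g \<and>
     (\<forall>\<phi>. test_fun m \<Omega> \<phi> \<longrightarrow>
        (LINT x:\<Omega>|leb m. f x * pd i \<phi> x) = - (LINT x:\<Omega>|leb m. g x * \<phi> x))"

text \<open>A representative; weak derivatives are unique up to null sets.\<close>

definition wpd ::
  "nat \<Rightarrow> (nat \<Rightarrow> real) set \<Rightarrow> nat \<Rightarrow> ((nat \<Rightarrow> real) \<Rightarrow> real) \<Rightarrow> (nat \<Rightarrow> real) \<Rightarrow> real" where
  "wpd m \<Omega> i f = (SOME g. has_weak_pd m \<Omega> i f g)"

definition Lp :: "nat \<Rightarrow> real \<Rightarrow> (nat \<Rightarrow> real) set \<Rightarrow> ((nat \<Rightarrow> real) \<Rightarrow> real) \<Rightarrow> bool" where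
  "Lp m p \<Omega> f \<longleftrightarrow> set_borel_measurable (leb m) \<Omega> f \<and>
     set_integrable (leb m) \<Omega> (\<lambda>x. \<bar>f x\<bar> powr p)"

definition W1p :: "nat \<Rightarrow> nat \<Rightarrow> real \<Rightarrow> (nat \<Rightarrow> real) set \<Rightarrow> ((nat \<Rightarrow> real) \<Rightarrow> nat \<Rightarrow> real) set" where
  "W1p m l p \<Omega> = {u. u \<in> \<Omega> \<rightarrow> Rn l \<and>
     (\<forall>a<l. Lp m p \<Omega> (\<lambda>x. u x a) \<and>
        (\<forall>i<m. \<exists>g. has_weak_pd m \<Omega> i (\<lambda>x. u x a) g \<and> Lp m p \<Omega> g))}"

text \<open>The inner product and norm on gradients are the Euclidean (Hilbert--Schmidt) ones.\<close>

definition grad_inner :: "nat \<Rightarrow> nat \<Rightarrow> (nat \<Rightarrow> real) set \<Rightarrow> ((nat \<Rightarrow> real) \<Rightarrow> nat \<Rightarrow> real) \<Rightarrow>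
    ((nat \<Rightarrow> real) \<Rightarrow> nat \<Rightarrow> real) \<Rightarrow> (nat \<Rightarrow> real) \<Rightarrow> real" where
  "grad_inner m l \<Omega> u v x =
     (\<Sum>a<l. \<Sum>i<m. wpd m \<Omega> i (\<lambda>x. u x a) x * wpd m \<Omega> i (\<lambda>x. v x a) x)"

definition grad_norm :: "nat \<Rightarrow> nat \<Rightarrow> (nat \<Rightarrow> real) set \<Rightarrow> ((nat \<Rightarrow> real) \<Rightarrow> nat \<Rightarrow> real) \<Rightarrow>
    (nat \<Rightarrow> real) \<Rightarrow> real" where
  "grad_norm m l \<Omega> u x = sqrt (grad_inner m l \<Omega> u u x)"

definition W1p_norm :: "nat \<Rightarrow> nat \<Rightarrow> real \<Rightarrow> (nat \<Rightarrow> real) set \<Rightarrow>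
    ((nat \<Rightarrow> real) \<Rightarrow> nat \<Rightarrow> real) \<Rightarrow> real" where
  "W1p_norm m l p \<Omega> u =
     ((LINT x:\<Omega>|leb m. vnorm l (u x) powr p) +
      (LINT x:\<Omega>|leb m. grad_norm m l \<Omega> u x powr p)) powr (1 / p)"

definition W1p_tendsto :: "nat \<Rightarrow> nat \<Rightarrow> real \<Rightarrow> (nat \<Rightarrow> real) set \<Rightarrow>
    (nat \<Rightarrow> (nat \<Rightarrow> real) \<Rightarrow> nat \<Rightarrow> real) \<Rightarrow> ((nat \<Rightarrow> real) \<Rightarrow> nat \<Rightarrow> real) \<Rightarrow> bool" where
  "W1p_tendsto m l p \<Omega> f u \<longleftrightarrow> u \<in> W1p m l p \<Omega> \<and>
     (\<forall>\<^sub>F k in sequentially. f k \<in> W1p m l p \<Omega>) \<and>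
     (\<lambda>k. W1p_norm m l p \<Omega> (\<lambda>x. vdiff l (f k x) (u x))) \<longlonglongrightarrow> 0"

definition W01p :: "nat \<Rightarrow> nat \<Rightarrow> real \<Rightarrow> (nat \<Rightarrow> real) set \<Rightarrow> ((nat \<Rightarrow> real) \<Rightarrow> nat \<Rightarrow> real) set" where
  "W01p m l p \<Omega> = {u. \<exists>\<phi>. (\<forall>k. test_map m l \<Omega> (\<phi> k)) \<and> W1p_tendsto m l p \<Omega> \<phi> u}"

definition W1p_into :: "nat \<Rightarrow> nat \<Rightarrow> real \<Rightarrow> (nat \<Rightarrow> real) set \<Rightarrow> (nat \<Rightarrow> real) set \<Rightarrow>
    ((nat \<Rightarrow> real) \<Rightarrow> nat \<Rightarrow> real) set" where
  "W1p_into m l p \<Omega> N = {u \<in> W1p m l p \<Omega>. AE x in leb m. x \<in> \<Omega> \<longrightarrow> u x \<in> N}"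


section \<open>\<open>p\<close>-harmonic and minimizing maps\<close>

definition energy :: "nat \<Rightarrow> nat \<Rightarrow> real \<Rightarrow> (nat \<Rightarrow> real) set \<Rightarrow>
    ((nat \<Rightarrow> real) \<Rightarrow> nat \<Rightarrow> real) \<Rightarrow> real" where
  "energy m l p \<Omega> u = (LINT x:\<Omega>|leb m. grad_norm m l \<Omega> u x powr p)"

text \<open>
  The Euler--Lagrange equation of \<open>E\<^sub>p\<close> for maps into \<open>N\<close> is
  \<open>div (|Du|\<^bsup>p-2\<^esup> Du) \<bottom> T\<^sub>u N\<close>. Its weak form says that the first variation
  \<open>\<integral> |Du|\<^bsup>p-2\<^esup> \<langle>Du, D\<psi>\<rangle>\<close> vanishes for every bounded variation field
  \<open>\<psi> \<in> W\<^bsup>1,p\<^esup>\<^sub>0\<close> tangent to \<open>N\<close> along \<open>u\<close>. For \<open>p < 2\<close> the integrand is \<open>0\<close> where \<open>Du = 0\<close>.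
\<close>

definition p_harmonic :: "nat \<Rightarrow> nat \<Rightarrow> real \<Rightarrow> (nat \<Rightarrow> real) set \<Rightarrow> (nat \<Rightarrow> real) set \<Rightarrow>
    ((nat \<Rightarrow> real) \<Rightarrow> nat \<Rightarrow> real) \<Rightarrow> bool" where
  "p_harmonic m l p \<Omega> N u \<longleftrightarrow> u \<in> W1p_into m l p \<Omega> N \<and>
     (\<forall>\<psi> \<in> W01p m l p \<Omega>.
        (\<exists>B. AE x in leb m. x \<in> \<Omega> \<longrightarrow> vnorm l (\<psi> x) \<le> B) \<longrightarrow>
        (AE x in leb m. x \<in> \<Omega> \<longrightarrow> \<psi> x \<in> tangent_space l N (u x)) \<longrightarrow>
        (LINT x:\<Omega>|leb m. grad_norm m l \<Omega> u x powr (p - 2) * grad_inner m l \<Omega> u \<psi> x) = 0)"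

definition minimizing :: "nat \<Rightarrow> nat \<Rightarrow> real \<Rightarrow> (nat \<Rightarrow> real) set \<Rightarrow> (nat \<Rightarrow> real) set \<Rightarrow>
    ((nat \<Rightarrow> real) \<Rightarrow> nat \<Rightarrow> real) \<Rightarrow> bool" where
  "minimizing m l p \<Omega> N u \<longleftrightarrow> u \<in> W1p_into m l p \<Omega> N \<and>
     (\<forall>v \<in> W1p_into m l p \<Omega> N. (\<lambda>x. vdiff l (u x) (v x)) \<in> W01p m l p \<Omega> \<longrightarrow>
        energy m l p \<Omega> u \<le> energy m l p \<Omega> v)"

definition unique_minimizing :: "nat \<Rightarrow> nat \<Rightarrow> real \<Rightarrow> (nat \<Rightarrow> real) set \<Rightarrow> (nat \<Rightarrow> real) set \<Rightarrow>
    ((nat \<Rightarrow> real) \<Rightarrow> nat \<Rightarrow> real) \<Rightarrow> bool" where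
  "unique_minimizing m l p \<Omega> N u \<longleftrightarrow> minimizing m l p \<Omega> N u \<and>
     (\<forall>v \<in> W1p_into m l p \<Omega> N. (\<lambda>x. vdiff l (u x) (v x)) \<in> W01p m l p \<Omega> \<longrightarrow>
        energy m l p \<Omega> u = energy m l p \<Omega> v \<longrightarrow> (AE x in leb m. x \<in> \<Omega> \<longrightarrow> v x = u x))"


section \<open>Singularities and tangent maps\<close>

definition isolated_singularity :: "nat \<Rightarrow> nat \<Rightarrow> (nat \<Rightarrow> real) set \<Rightarrow>
    ((nat \<Rightarrow> real) \<Rightarrow> nat \<Rightarrow> real) \<Rightarrow> (nat \<Rightarrow> real) \<Rightarrow> bool" where
  "isolated_singularity m l \<Omega> u y \<longleftrightarrow>
     (\<exists>\<rho>>0. vball m y \<rho> \<subseteq> \<Omega> \<and> Ck_map 1 m l (vball m y \<rho> - {y}) u) \<and>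
     \<not> (\<exists>v \<in> \<Omega> \<rightarrow> Rn l. (AE x in leb m. x \<in> \<Omega> \<longrightarrow> v x = u x) \<and> continuous (at y within \<Omega>) v)"

definition rescale :: "nat \<Rightarrow> ((nat \<Rightarrow> real) \<Rightarrow> nat \<Rightarrow> real) \<Rightarrow> (nat \<Rightarrow> real) \<Rightarrow> real \<Rightarrow>
    (nat \<Rightarrow> real) \<Rightarrow> nat \<Rightarrow> real" where
  "rescale m u y r x = u (\<lambda>i\<in>{..<m}. y i + r * x i)"

text \<open>
  Each rescaled map is defined on any given ball about the origin once its scale is small enough;
  the finitely many others do not affect the limit.
\<close>

definition tangent_maps :: "nat \<Rightarrow> nat \<Rightarrow> real \<Rightarrow> (nat \<Rightarrow> real) set \<Rightarrow>
    ((nat \<Rightarrow> real) \<Rightarrow> nat \<Rightarrow> real) \<Rightarrow> (nat \<Rightarrow> real) \<Rightarrow> ((nat \<Rightarrow> real) \<Rightarrow> nat \<Rightarrow> real) set" where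
  "tangent_maps m l p N u y = {T \<in> Rn m \<rightarrow> N. \<exists>r :: nat \<Rightarrow> real.
     (\<forall>k. r k > 0) \<and> decseq r \<and> r \<longlonglongrightarrow> 0 \<and>
     (\<forall>R>0. W1p_tendsto m l p (vball m (origin m) R) (\<lambda>k. rescale m u y (r k)) T)}"

text \<open>
  Tangent maps are Sobolev maps, so they are counted up to equality almost everywhere;
  as plain functions there would be too many of them for trivial reasons.
\<close>

definition ae_eq :: "nat \<Rightarrow> (((nat \<Rightarrow> real) \<Rightarrow> nat \<Rightarrow> real) \<times> ((nat \<Rightarrow> real) \<Rightarrow> nat \<Rightarrow> real)) set" where
  "ae_eq m = {(S, T). AE x in leb m. S x = T x}"

definition continuum_of_tangent_maps :: "nat \<Rightarrow> nat \<Rightarrow> real \<Rightarrow> (nat \<Rightarrow> real) set \<Rightarrow>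
    ((nat \<Rightarrow> real) \<Rightarrow> nat \<Rightarrow> real) \<Rightarrow> (nat \<Rightarrow> real) \<Rightarrow> bool" where
  "continuum_of_tangent_maps m l p N u y \<longleftrightarrow>
     tangent_maps m l p N u y // ae_eq m \<approx> (UNIV :: real set)"

end

theory Submission
  imports Defs
begin

text \<open>
  The map is \<open>U(x) = (\<rho> \<omega>, cos \<phi>, sin \<phi>, s, \<rho> \<omega>)\<close> with \<open>\<omega> = x / |x|\<close>, where \<open>\<rho>\<close> and \<open>\<phi>\<close> are functions of
  \<open>s = 1 / ln t\<close>, \<open>t = T\<^sub>0 - ln |x|\<close>. The phase \<open>\<phi>\<close> grows like \<open>ln t\<close>: it tends to infinity, but so slowly that
  the blow-ups at \<open>0\<close> along radii of equal phase converge, to the maps \<open>(\<omega>, c, 0, \<omega>)\<close> with \<open>c\<close> on the unit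
  circle. The target is the graph of a function fitted so that \<open>U\<close> takes values in it and
  \<open>A = - div (|DU|\<^bsup>p-2\<^esup> DU)\<close> is normal to it along \<open>U\<close>; the rapid oscillation of the coefficients is damped by
  \<open>1 / t = exp (- 1 / s)\<close>, so the graph is smooth.

  The curvature of the graph is bounded independently of \<open>m\<close>, hence
  \<open>|A \<cdot> (V - U)| \<le> K |x|\<^bsup>-p\<^esup> |V - U|\<^sup>2\<close> on the target. In the expansion of the energy of a competitor \<open>v\<close> about \<open>U\<close>
  this error is absorbed by the strict convexity of \<open>|\<cdot>|\<^bsup>p\<^esup>\<close> through a Hardy inequality whose constant
  improves as \<open>m\<close> grows, so for large \<open>m\<close> the map is the unique minimizer.
\<close>

section \<open>Smooth functions of one variable\<close>

text \<open>Two obstacles shape the construction. The \<omega>-component of A has size about m and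
  must be normal to the target; this is why \<omega> occurs twice. A graph over the first copy whose
  radial slope is -1 has a normal vector with parts \<omega> and \<omega>. Secondly, the motion of
  the phase has to solve a differential equation. Prescribing |x|^2 |DU|^2 first and solving for rho
  and the angular speed afterwards turns it into algebra: with q = 1 / t everything rests on q' = -
  q^2. The coordinate s = 1 / ln t makes the angular speed smooth and q flat, so the oscillating
  coefficients extend smoothly past s = 0.

  The dimension enters the final comparison as follows. Curvature costs about m^(p/2), the convexity
  gain has weight m^(p/2 - 1), and Hardy's inequality brings 1 / m. For small gradients of the
  perturbation the loss relative to the gain is of order 1 / m; for large ones only a linear gain is
  available and the ratio is 1 / sqrt m. Both fall below the constant of strict convexity, which
  depends on p alone.\<close>

primrec diff_upto :: "nat \<Rightarrow> real set \<Rightarrow> (real \<Rightarrow> real) \<Rightarrow> bool" where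
  "diff_upto 0 S f = continuous_on S f"
| "diff_upto (Suc k) S f =
     (\<exists>f'. (\<forall>x\<in>S. (f has_real_derivative f' x) (at x)) \<and> diff_upto k S f')"

definition smooth1 :: "real set \<Rightarrow> (real \<Rightarrow> real) \<Rightarrow> bool" where
  "smooth1 S f \<longleftrightarrow> (\<forall>k. diff_upto k S f)"

lemma diff_upto_Suc_imp: "diff_upto (Suc k) S f \<Longrightarrow> diff_upto k S f"
proof (induction k arbitrary: f)
  case 0
  then show ?case
    by (auto intro!: continuous_at_imp_continuous_on) (blast intro: DERIV_isCont)
qed auto

lemma diff_upto_mono: "diff_upto n S f \<Longrightarrow> k \<le> n \<Longrightarrow> diff_upto k S f"
  by (induction n) (auto simp: le_Suc_eq simp del: diff_upto.simps dest: diff_upto_Suc_imp)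

lemma diff_upto_subset: "diff_upto k S f \<Longrightarrow> T \<subseteq> S \<Longrightarrow> diff_upto k T f"
  by (induction k arbitrary: f) (auto intro: continuous_on_subset)

lemma diff_upto_cong:
  assumes "open S" "\<And>x. x \<in> S \<Longrightarrow> f x = g x"
  shows "diff_upto k S f \<longleftrightarrow> diff_upto k S g"
proof (cases k)
  case 0
  then show ?thesis using assms by (auto cong: continuous_on_cong)
next
  case (Suc n)
  have "(f has_real_derivative d) (at x) \<longleftrightarrow> (g has_real_derivative d) (at x)" if "x \<in> S" for x d
    using assms that
    by (intro has_field_derivative_cong_ev refl) (auto simp: eventually_nhds)
  then show ?thesis using Suc by auto
qed

lemma diff_upto_const: "diff_upto k S (\<lambda>x. c)"
proof (induction k arbitrary: c)
  case (Suc k)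
  then show ?case by (auto intro!: exI[of _ "\<lambda>x. 0"])
qed auto

lemma diff_upto_id: "diff_upto k S (\<lambda>x. x)"
  by (cases k) (auto intro!: exI[of _ "\<lambda>x. 1"] diff_upto_const)

lemma diff_upto_add: "diff_upto k S f \<Longrightarrow> diff_upto k S g \<Longrightarrow> diff_upto k S (\<lambda>x. f x + g x)"
proof (induction k arbitrary: f g)
  case (Suc k)
  then obtain f' g' where "\<forall>x\<in>S. (f has_real_derivative f' x) (at x)" "diff_upto k S f'"
     "\<forall>x\<in>S. (g has_real_derivative g' x) (at x)" "diff_upto k S g'" by auto
  then show ?case using Suc.IH by (auto intro!: exI[of _ "\<lambda>x. f' x + g' x"] DERIV_add)
qed (auto intro: continuous_on_add)

lemma diff_upto_mult: "diff_upto k S f \<Longrightarrow> diff_upto k S g \<Longrightarrow> diff_upto k S (\<lambda>x. f x * g x)"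
proof (induction k arbitrary: f g)
  case (Suc k)
  then obtain f' g' where d: "\<forall>x\<in>S. (f has_real_derivative f' x) (at x)" "diff_upto k S f'"
     "\<forall>x\<in>S. (g has_real_derivative g' x) (at x)" "diff_upto k S g'" by auto
  have "diff_upto k S f" "diff_upto k S g" using Suc.prems by (blast dest: diff_upto_Suc_imp)+
  then have "diff_upto k S (\<lambda>x. f' x * g x + g' x * f x)"
    using Suc.IH d by (intro diff_upto_add) blast+
  with d show ?case by (auto intro!: exI[of _ "\<lambda>x. f' x * g x + g' x * f x"] DERIV_mult)
qed (auto intro: continuous_on_mult)

lemma diff_upto_compose:
  "diff_upto k T h \<Longrightarrow> diff_upto k S f \<Longrightarrow> f ` S \<subseteq> T \<Longrightarrow> diff_upto k S (\<lambda>x. h (f x))"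
proof (induction k arbitrary: h f)
  case 0
  then show ?case by (auto intro: continuous_on_compose2)
next
  case (Suc k)
  then obtain f' h' where d: "\<forall>x\<in>S. (f has_real_derivative f' x) (at x)" "diff_upto k S f'"
     "\<forall>x\<in>T. (h has_real_derivative h' x) (at x)" "diff_upto k T h'" by auto
  have "diff_upto k S f" using Suc.prems by (blast dest: diff_upto_Suc_imp)
  then have "diff_upto k S (\<lambda>x. h' (f x) * f' x)"
    using Suc d by (intro diff_upto_mult) blast+
  moreover have "((\<lambda>x. h (f x)) has_real_derivative h' (f x) * f' x) (at x)" if "x \<in> S" for x
    using d Suc.prems that DERIV_chain2[of h "h' (f x)" f x "f' x" UNIV] by auto
  ultimately show ?case by (auto intro!: exI[of _ "\<lambda>x. h' (f x) * f' x"])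
qed

lemma smooth1I: "(\<And>k. diff_upto k S f) \<Longrightarrow> smooth1 S f" and smooth1D: "smooth1 S f \<Longrightarrow> diff_upto k S f"
  by (simp_all add: smooth1_def)

lemma smooth1_const: "smooth1 S (\<lambda>x. c)" by (simp add: smooth1_def diff_upto_const)
lemma smooth1_id: "smooth1 S (\<lambda>x. x)" by (simp add: smooth1_def diff_upto_id)
lemma smooth1_add: "smooth1 S f \<Longrightarrow> smooth1 S g \<Longrightarrow> smooth1 S (\<lambda>x. f x + g x)"
  by (simp add: smooth1_def diff_upto_add)
lemma smooth1_mult: "smooth1 S f \<Longrightarrow> smooth1 S g \<Longrightarrow> smooth1 S (\<lambda>x. f x * g x)"
  by (simp add: smooth1_def diff_upto_mult)
lemma smooth1_minus: "smooth1 S f \<Longrightarrow> smooth1 S (\<lambda>x. - f x)"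
  using smooth1_mult[OF smooth1_const[of S "-1"], of f] by simp
lemma smooth1_diff: "smooth1 S f \<Longrightarrow> smooth1 S g \<Longrightarrow> smooth1 S (\<lambda>x. f x - g x)"
  using smooth1_add[of S f, OF _ smooth1_minus[of S g]] by simp
lemma smooth1_power: "smooth1 S f \<Longrightarrow> smooth1 S (\<lambda>x. f x ^ n)"
  by (induction n) (auto intro: smooth1_const smooth1_mult)
lemma smooth1_compose: "smooth1 T h \<Longrightarrow> smooth1 S f \<Longrightarrow> f ` S \<subseteq> T \<Longrightarrow> smooth1 S (\<lambda>x. h (f x))"
  by (rule smooth1I, rule diff_upto_compose[of _ T]) (erule smooth1D | assumption)+
lemma smooth1_subset: "smooth1 S f \<Longrightarrow> T \<subseteq> S \<Longrightarrow> smooth1 T f"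
  by (rule smooth1I, rule diff_upto_subset[of _ S]) (erule smooth1D | assumption)+
lemma smooth1_cong: "open S \<Longrightarrow> (\<And>x. x \<in> S \<Longrightarrow> f x = g x) \<Longrightarrow> smooth1 S f \<longleftrightarrow> smooth1 S g"
  unfolding smooth1_def using diff_upto_cong[of S f g] by simp

lemma smooth1_continuous: "smooth1 S f \<Longrightarrow> continuous_on S f"
  unfolding smooth1_def by (metis diff_upto.simps(1))

lemma smooth1_DERIV: "smooth1 S f \<Longrightarrow> x \<in> S \<Longrightarrow> (f has_real_derivative deriv f x) (at x)"
  by (drule smooth1D[of _ _ "Suc 0"], clarsimp, metis DERIV_imp_deriv)

lemma smooth1_deriv: assumes "smooth1 S f" "open S" shows "smooth1 S (deriv f)"
  unfolding smooth1_def
proof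
  fix k
  obtain f' where f': "\<forall>x\<in>S. (f has_real_derivative f' x) (at x)" "diff_upto k S f'"
    using smooth1D[OF assms(1), of "Suc k"] by auto
  then have "\<And>x. x \<in> S \<Longrightarrow> deriv f x = f' x" by (auto dest: DERIV_imp_deriv)
  then show "diff_upto k S (deriv f)" using f' diff_upto_cong[OF assms(2)] by blast
qed

lemma smooth1_exp: "smooth1 UNIV exp"
  unfolding smooth1_def
proof
  show "diff_upto k UNIV exp" for k
    by (induction k) (auto intro!: exI[of _ exp] continuous_intros derivative_eq_intros)
qed

lemma diff_upto_sin_cos: "diff_upto k UNIV (sin :: real \<Rightarrow> real) \<and> diff_upto k UNIV (cos :: real \<Rightarrow> real)"
proof (induction k)
  case 0
  show ?case by (auto intro!: continuous_intros)
next
  case (Suc k)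
  have "diff_upto k UNIV (\<lambda>x::real. (-1) * sin x)" using Suc by (intro diff_upto_mult diff_upto_const) auto
  then show ?case using Suc
    unfolding diff_upto.simps
    by (intro conjI exI[of _ cos] exI[of _ "\<lambda>x. - sin x"]) (auto intro!: derivative_eq_intros)
qed

lemma smooth1_sin: "smooth1 UNIV sin" and smooth1_cos: "smooth1 UNIV cos"
  using diff_upto_sin_cos by (auto simp: smooth1_def)

lemma smooth1_inverse_pos: "smooth1 {0<..} (inverse :: real \<Rightarrow> real)"
  unfolding smooth1_def
proof
  show "diff_upto k {0<..} (inverse :: real \<Rightarrow> real)" for k
  proof (induction k)
    case 0
    show ?case by (auto intro!: continuous_intros)
  next
    case (Suc k)
    have "diff_upto k {0<..} (\<lambda>x::real. (-1) * (inverse x * inverse x))"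
      using Suc by (intro diff_upto_mult diff_upto_const) auto
    then show ?case
      by (auto intro!: exI[of _ "\<lambda>x. - (inverse x * inverse x)"] derivative_eq_intros simp: power2_eq_square)
  qed
qed

lemma smooth1_ln: "smooth1 {0<..} (ln :: real \<Rightarrow> real)"
  unfolding smooth1_def
proof
  show "diff_upto k {0<..} (ln :: real \<Rightarrow> real)" for k
  proof (cases k)
    case 0
    show ?thesis unfolding 0 by (auto intro!: continuous_intros)
  next
    case (Suc k)
    show ?thesis unfolding Suc using smooth1_inverse_pos
      by (auto intro!: exI[of _ inverse] derivative_eq_intros simp: smooth1_def field_simps)
  qed
qed

lemma smooth1_inverse: "smooth1 S f \<Longrightarrow> (\<And>x. x \<in> S \<Longrightarrow> f x > 0) \<Longrightarrow> smooth1 S (\<lambda>x. inverse (f x))"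
  by (rule smooth1_compose[OF smooth1_inverse_pos]) auto

lemma smooth1_divide:
  "smooth1 S f \<Longrightarrow> smooth1 S g \<Longrightarrow> (\<And>x. x \<in> S \<Longrightarrow> g x > 0) \<Longrightarrow> smooth1 S (\<lambda>x. f x / g x)"
  unfolding divide_inverse by (intro smooth1_mult smooth1_inverse)

lemma smooth1_powr:
  assumes "smooth1 S f" "\<And>x. x \<in> S \<Longrightarrow> f x > 0" "open S"
  shows "smooth1 S (\<lambda>x. f x powr a)"
proof -
  have "smooth1 S (\<lambda>x. exp (a * ln (f x)))"
    by (rule smooth1_compose[OF smooth1_exp])
      (auto intro!: smooth1_mult smooth1_const smooth1_compose[OF smooth1_ln] assms)
  then show ?thesis
    by (subst smooth1_cong[OF assms(3), of _ "\<lambda>x. exp (a * ln (f x))"])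
      (use assms(2) in \<open>force simp: powr_def\<close>, assumption)
qed

lemma smooth1_sqrt:
  assumes "smooth1 S f" "\<And>x. x \<in> S \<Longrightarrow> f x > 0" "open S"
  shows "smooth1 S (\<lambda>x. sqrt (f x))"
  by (subst smooth1_cong[OF assms(3), of _ "\<lambda>x. f x powr (1/2)"])
    (use assms(2) in \<open>force intro!: smooth1_powr assms simp: powr_half_sqrt less_imp_le\<close>)+

lemmas smooth1_intros = smooth1_const smooth1_id smooth1_add smooth1_mult smooth1_minus smooth1_diff
  smooth1_power smooth1_inverse smooth1_divide smooth1_powr smooth1_sqrt

text \<open>The derivative can be computed from the left, where \<open>f\<close> is constant.
  Applied to a function and then to its derivative, this makes the coefficients of the target flat
  to second order at 0.\<close>

lemma smooth1_deriv_zero_at_0: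
  assumes "smooth1 S f" "open S" "0 \<in> S" "\<And>s. s \<in> S \<Longrightarrow> s \<le> 0 \<Longrightarrow> f s = c"
  shows "deriv f 0 = 0"
proof -
  have "((\<lambda>x. (f x - f 0) / (x - 0)) \<longlongrightarrow> deriv f 0) (at_left 0)"
    using smooth1_DERIV[OF assms(1,3)]
    unfolding has_field_derivative_iff by (rule tendsto_mono[OF at_le[OF subset_UNIV]])
  moreover have "\<forall>\<^sub>F x in at_left 0. (f x - f 0) / (x - 0) = 0"
  proof -
    have "\<forall>\<^sub>F x in at_left 0. x \<in> S"
      using eventually_nhds_in_open[OF assms(2,3)] by (auto simp: eventually_at_filter elim: eventually_mono)
    moreover have "\<forall>\<^sub>F x in at_left (0::real). x < 0" by (auto simp: eventually_at_filter)
    ultimately show ?thesis by eventually_elim (use assms in simp)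
  qed
  ultimately show ?thesis
    by (intro tendsto_unique[OF trivial_limit_at_left_real _ tendsto_eventually])
qed

section \<open>Flat functions\<close>

text \<open>Oscillating factors are killed by \<open>exp (- 1 / s)\<close>, and the class of these functions
  is closed under differentiation.\<close>

definition flat_osc ::
  "(real \<Rightarrow> real) \<Rightarrow> (real \<Rightarrow> real) \<Rightarrow> (real \<Rightarrow> real) \<Rightarrow> nat \<Rightarrow> real \<Rightarrow> real" where
  "flat_osc \<phi> k1 k2 n s =
     (if s \<le> 0 then 0 else exp (- 1 / s) * (k1 s * cos (\<phi> s) + k2 s * sin (\<phi> s)) / s ^ n)"

lemma exp_inverse_power_tendsto_0: "((\<lambda>s::real. exp (- 1 / s) / s ^ n) \<longlongrightarrow> 0) (at_right 0)"
proof -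
  have "((\<lambda>t::real. t ^ n / exp t) \<longlongrightarrow> 0) at_top" by (rule tendsto_power_div_exp_0)
  from filterlim_compose[OF this filterlim_inverse_at_top_right]
  show ?thesis
    by (simp add: exp_minus field_simps power_inverse)
qed

text \<open>Differentiation keeps the form: with \<phi>' = - w / s^2 all terms share the factor exp
  (- 1 / s) / s^(n + 2), and the new coefficients are again smooth across 0. This closure is what
  gives smoothness at 0, although \<phi> need not have a limit there.\<close>

lemma flat_osc_deriv:
  assumes "smooth1 S k1" "smooth1 S k2" "open S" "s \<in> S"
    and \<phi>: "\<And>s. s \<in> S \<Longrightarrow> s > 0 \<Longrightarrow> (\<phi> has_real_derivative - w s / s\<^sup>2) (at s)"
  shows "(flat_osc \<phi> k1 k2 n has_real_derivative
     flat_osc \<phi> (\<lambda>s. k1 s - n * s * k1 s + s\<^sup>2 * deriv k1 s - k2 s * w s)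
       (\<lambda>s. k2 s - n * s * k2 s + s\<^sup>2 * deriv k2 s + k1 s * w s) (n + 2) s) (at s)"
proof -
  consider "s < 0" | "s = 0" | "s > 0" by linarith
  then show ?thesis
  proof cases
    case 1
    have "\<forall>\<^sub>F x in nhds s. x \<in> {..<0}"
      using 1 by (intro eventually_nhds_in_open) auto
    then have "\<forall>\<^sub>F x in nhds s. flat_osc \<phi> k1 k2 n x = 0"
      by eventually_elim (auto simp: flat_osc_def)
    then have "(flat_osc \<phi> k1 k2 n has_real_derivative 0) (at s)"
      using DERIV_cong_ev[OF refl _ refl, of "flat_osc \<phi> k1 k2 n" "\<lambda>_. 0" s 0] by auto
    then show ?thesis using 1 by (simp add: flat_osc_def)
  next
    case 2
    \<comment> \<open>At 0 the difference quotient vanishes from the left; from the right the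
      trigonometric factors are bounded and exp (- 1 / s) beats the power
      \<open>s ^ Suc n\<close>.\<close>
    have "isCont k1 0" "isCont k2 0"
      using smooth1_continuous[OF assms(1)] smooth1_continuous[OF assms(2)] assms(3,4) 2
      by (auto simp: continuous_on_eq_continuous_at)
    then have "((\<lambda>s. \<bar>k1 s\<bar> + \<bar>k2 s\<bar>) \<longlongrightarrow> \<bar>k1 0\<bar> + \<bar>k2 0\<bar>) (at_right 0)"
      by (intro tendsto_add tendsto_rabs) (auto simp: isCont_def intro: tendsto_mono[OF at_le[OF subset_UNIV]])
    from tendsto_mult[OF exp_inverse_power_tendsto_0[of "Suc n"] this]
    have *: "((\<lambda>s. exp (- 1 / s) / s ^ Suc n * (\<bar>k1 s\<bar> + \<bar>k2 s\<bar>)) \<longlongrightarrow> 0) (at_right 0)" by simp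
    have "((\<lambda>s. flat_osc \<phi> k1 k2 n s / s) \<longlongrightarrow> 0) (at_right 0)"
    proof (rule Lim_null_comparison[OF _ *])
      have "\<bar>k1 s * cos (\<phi> s) + k2 s * sin (\<phi> s)\<bar> \<le> \<bar>k1 s\<bar> + \<bar>k2 s\<bar>" for s
        by (rule order_trans[OF abs_triangle_ineq]) (auto simp: abs_mult intro!: add_mono mult_left_le)
      then have "norm (flat_osc \<phi> k1 k2 n s / s) \<le> exp (- 1 / s) / s ^ Suc n * (\<bar>k1 s\<bar> + \<bar>k2 s\<bar>)" if "s > 0" for s
        using that mult_left_mono[of "\<bar>k1 s * cos (\<phi> s) + k2 s * sin (\<phi> s)\<bar>" "\<bar>k1 s\<bar> + \<bar>k2 s\<bar>" "exp (- 1 / s) / s ^ Suc n"]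
        by (simp add: flat_osc_def abs_mult mult.commute del: mult_le_cancel_left_pos mult_le_cancel_left)
      then show "\<forall>\<^sub>F s in at_right 0. norm (flat_osc \<phi> k1 k2 n s / s) \<le> exp (- 1 / s) / s ^ Suc n * (\<bar>k1 s\<bar> + \<bar>k2 s\<bar>)"
        by (auto simp: eventually_at_filter)
    qed
    moreover have "((\<lambda>s. flat_osc \<phi> k1 k2 n s / s) \<longlongrightarrow> 0) (at_left 0)"
      by (rule tendsto_eventually) (auto simp: eventually_at_filter flat_osc_def)
    ultimately have "((\<lambda>s. flat_osc \<phi> k1 k2 n s / s) \<longlongrightarrow> 0) (at 0)"
      by (simp add: filterlim_at_split)
    then have "(flat_osc \<phi> k1 k2 n has_real_derivative 0) (at 0)"
      by (auto simp: has_field_derivative_iff flat_osc_def)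
    then show ?thesis using 2 by (simp add: flat_osc_def)
  next
    case 3
    have "\<forall>\<^sub>F x in nhds s. x \<in> {0<..}"
      using 3 by (intro eventually_nhds_in_open) auto
    then have ev: "\<forall>\<^sub>F x in nhds s. flat_osc \<phi> k1 k2 n x = exp (- 1 / x) * (k1 x * cos (\<phi> x) + k2 x * sin (\<phi> x)) / x ^ n"
      by eventually_elim (auto simp: flat_osc_def)
    note d = smooth1_DERIV[OF assms(1,4)] smooth1_DERIV[OF assms(2,4)] \<phi>[OF assms(4) 3]
    \<comment> \<open>The power rule produces the truncated exponent \<open>n - Suc 0\<close>; for
      \<open>n = 0\<close> the factor \<open>real n\<close> vanishes, so the identity holds in that
      case as well.\<close>
    have n: "real n * inverse s ^ (n - Suc 0) = real n * (inverse s ^ n * s)" using 3 by (cases n) auto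
    define I where "I = exp (- 1 / s) * inverse s ^ (n + 2)"
    have E: "((\<lambda>x. exp (- 1 / x) * inverse x ^ n) has_real_derivative I * (1 - n * s)) (at s)"
    proof -
      have "((\<lambda>x. inverse x) has_real_derivative - (inverse s ^ 2)) (at s)"
        using DERIV_inverse[of s] 3 by (simp add: numeral_2_eq_2)
      moreover from this have "((\<lambda>x. exp (- 1 / x)) has_real_derivative exp (- 1 / s) * inverse s ^ 2) (at s)"
        using 3 by (auto intro!: derivative_eq_intros simp: divide_inverse power2_eq_square)
      ultimately have "((\<lambda>x. exp (- 1 / x) * inverse x ^ n) has_real_derivative
          (exp (- 1 / s) * inverse s ^ 2) * inverse s ^ n +
          (real n * inverse s ^ (n - Suc 0)) * - (inverse s ^ 2) * exp (- 1 / s)) (at s)"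
        using 3 by (auto intro!: derivative_eq_intros simp: power2_eq_square divide_inverse)
      then show ?thesis unfolding n I_def by (simp add: algebra_simps power_add power2_eq_square)
    qed
    have C: "((\<lambda>x. k1 x * cos (\<phi> x) + k2 x * sin (\<phi> x)) has_real_derivative
      deriv k1 s * cos (\<phi> s) + k1 s * sin (\<phi> s) * (w s / s\<^sup>2)
      + (deriv k2 s * sin (\<phi> s) - k2 s * cos (\<phi> s) * (w s / s\<^sup>2))) (at s)"
      by (rule derivative_eq_intros d refl)+ (simp add: algebra_simps)
    have I: "exp (- 1 / s) * inverse s ^ n = I * s\<^sup>2"
      using 3 by (simp add: I_def power_add field_simps power2_eq_square)
    have I': "flat_osc \<phi> a b (n + 2) s = I * (a s * cos (\<phi> s) + b s * sin (\<phi> s))" for a b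
      using 3 by (simp add: flat_osc_def I_def divide_inverse power_inverse mult_ac)
    have w: "s\<^sup>2 * (w s / s\<^sup>2) = w s" using 3 by simp
    have "((\<lambda>x. exp (- 1 / x) * inverse x ^ n * (k1 x * cos (\<phi> x) + k2 x * sin (\<phi> x))) has_real_derivative
      I * ((1 - n * s) * (k1 s * cos (\<phi> s) + k2 s * sin (\<phi> s)) + (s\<^sup>2 * deriv k1 s * cos (\<phi> s)
      + k1 s * sin (\<phi> s) * (s\<^sup>2 * (w s / s\<^sup>2)) + (s\<^sup>2 * deriv k2 s * sin (\<phi> s)
      - k2 s * cos (\<phi> s) * (s\<^sup>2 * (w s / s\<^sup>2)))))) (at s)"
      using DERIV_mult[OF E C] unfolding I by (simp only: algebra_simps)
    moreover have "(\<lambda>x. exp (- 1 / x) * inverse x ^ n * (k1 x * cos (\<phi> x) + k2 x * sin (\<phi> x)))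
      = (\<lambda>x. exp (- 1 / x) * (k1 x * cos (\<phi> x) + k2 x * sin (\<phi> x)) / x ^ n)"
      by (simp add: fun_eq_iff divide_inverse power_inverse)
    ultimately show ?thesis
      unfolding I' w DERIV_cong_ev[OF refl ev refl] by (simp only: algebra_simps mult_1_left mult_1_right)
  qed
qed

text \<open>Induction on the order with \<open>k1\<close>, \<open>k2\<close> and \<open>n\<close>
  free, because each differentiation replaces all three.\<close>

lemma smooth1_flat_osc:
  assumes "smooth1 S k1" "smooth1 S k2" "smooth1 S w" "open S"
    and \<phi>: "\<And>s. s \<in> S \<Longrightarrow> s > 0 \<Longrightarrow> (\<phi> has_real_derivative - w s / s\<^sup>2) (at s)"
  shows "smooth1 S (flat_osc \<phi> k1 k2 n)"
proof -
  have "diff_upto k S (flat_osc \<phi> k1 k2 n)" if "smooth1 S k1" "smooth1 S k2" for k k1 k2 n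
    using that
  proof (induction k arbitrary: n k1 k2)
    case 0
    then show ?case using flat_osc_deriv[OF 0 assms(4) _ \<phi>]
      by (auto intro!: continuous_at_imp_continuous_on intro: DERIV_isCont)
  next
    case (Suc k)
    show ?case
      unfolding diff_upto.simps
      by (intro exI conjI ballI, rule flat_osc_deriv[OF Suc.prems assms(4) _ \<phi>], assumption+)
        (rule Suc.IH; intro smooth1_intros smooth1_deriv Suc.prems assms)
  qed
  then show ?thesis using assms by (auto simp: smooth1_def)
qed

definition flat :: "real \<Rightarrow> real" where
  "flat s = (if s \<le> 0 then 0 else exp (- 1 / s))"

lemma flat_nonneg: "0 \<le> flat s" by (simp add: flat_def)

lemma smooth1_flat: "smooth1 UNIV flat"
proof -
  have *: "flat = flat_osc (\<lambda>_. 0) (\<lambda>_. 1) (\<lambda>_. 0) 0" by (auto simp: fun_eq_iff flat_def flat_osc_def)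
  show ?thesis
    unfolding * by (rule smooth1_flat_osc[where w = "\<lambda>_. 0"]; auto intro!: smooth1_intros)
qed

lemma flat_deriv: "s > 0 \<Longrightarrow> (flat has_real_derivative flat s / s\<^sup>2) (at s)"
proof -
  assume s: "s > 0"
  then have ev: "\<forall>\<^sub>F x in nhds s. flat x = exp (- 1 / x)"
    by (auto simp: flat_def eventually_nhds intro!: exI[of _ "{0<..}"])
  show ?thesis
    apply (subst DERIV_cong_ev[OF refl ev refl])
    apply (rule derivative_eq_intros refl | use s in \<open>simp add: flat_def power2_eq_square field_simps\<close>)+
    done
qed

section \<open>The radial profile\<close>

text \<open>Integration starts at the interior point \<open>c\<close> because the intended integrand
  - Wf s / s^2 is not integrable at the left endpoint 0: the phase is unbounded there.\<close>

lemma antiderivative_open_interval: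
  fixes g :: "real \<Rightarrow> real"
  assumes "continuous_on {a<..<b} g" "c \<in> {a<..<b}"
  obtains G where "\<And>s. a < s \<Longrightarrow> s < c \<Longrightarrow> (G has_real_derivative g s) (at s)"
proof
  fix s assume s: "a < s" "s < c"
  \<comment> \<open>An auxiliary base point to the left of \<open>s\<close>: minus the integral from
    \<open>u\<close> to \<open>c\<close> equals, up to a constant, the integral from
    \<open>e\<close> to \<open>u\<close>, and the fundamental theorem applies to the latter.\<close>
  define e where "e = (a + s) / 2"
  have e: "a < e" "e < s" using s by (auto simp: e_def)
  have cont: "continuous_on {e..c} g" using assms e by (auto intro: continuous_on_subset)
  then have int: "g integrable_on {e..c}" by (rule integrable_continuous_real)
  have "((\<lambda>u. integral {e..u} g) has_real_derivative g s) (at s within {e..c})"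
    using cont s e by (intro integral_has_real_derivative) auto
  then have "((\<lambda>u. integral {e..u} g) has_real_derivative g s) (at s)"
    using s e by (subst (asm) at_within_interior) auto
  then have "((\<lambda>u. integral {e..u} g - integral {e..c} g) has_real_derivative g s) (at s)"
    using DERIV_diff[OF _ DERIV_const, of _ "g s" s UNIV "integral {e..c} g"] by simp
  moreover have "\<forall>\<^sub>F u in nhds s. u \<in> {e<..<c}"
    using s e by (intro eventually_nhds_in_open) auto
  then have "\<forall>\<^sub>F u in nhds s. integral {e..u} g - integral {e..c} g = - integral {u..c} g"
  proof eventually_elim
    case (elim u)
    then show ?case
      using Henstock_Kurzweil_Integration.integral_combine[of e u c g] int by simp
  qed
  ultimately show "((\<lambda>u. - integral {u..c} g) has_real_derivative g s) (at s)"
    by (subst (asm) DERIV_cong_ev[OF refl _ refl]) auto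
qed

lemma continuous_at_0_bound:
  fixes f :: "real \<Rightarrow> real"
  assumes "isCont f 0" "a < f 0" "f 0 < b"
  shows "\<forall>\<^sub>F s in nhds 0. a < f s \<and> f s < b"
proof -
  have "(f \<longlongrightarrow> f 0) (nhds 0)"
    using assms(1) by (simp add: isCont_def tendsto_at_iff_tendsto_nhds)
  then show ?thesis using order_tendstoD[of f "f 0" "nhds 0"] assms by (auto intro: eventually_conj)
qed

locale exponents =
  fixes p :: real and m :: nat
  assumes p1: "1 < p" and pm: "p < m"
begin

text \<open>\<open>mu\<close> is |x|^2 |D\<omega>|^2 for \<omega> = x / |x|. \<open>kap\<close> is
  the constant in the divergence of x |x|^(-p), and therefore also the constant in Hardy's
  inequality.\<close>

definition mu :: real where "mu = real m - 1"
definition kap :: real where "kap = real m - p"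

lemma mu_pos: "mu > 0" and kap_pos: "kap > 0" and p_pos: "p > 0"
  using p1 pm by (auto simp: mu_def kap_def)

text \<open>The profiles below are functions of \<open>s = 1 / ln t\<close>, \<open>t = T\<^sub>0 - ln |x|\<close>, which is small near the
  singularity; \<open>flat s = 1 / t\<close>. For a map of the form \<open>(rho \<omega>, cos \<phi>, sin \<phi>, s, rho \<omega>)\<close> prescribing
  \<open>|x|\<^sup>2 |DU|\<^sup>2 = Qf\<close> in this form makes the tangential part of the Euler--Lagrange equation integrable in
  closed form: it forces \<open>rho\<close>, and \<open>Wf\<close> is the angular speed that remains.\<close>

definition Pf :: "real \<Rightarrow> real" where "Pf s = 1 + kap * flat s + (flat s)\<^sup>2"
definition Qf :: "real \<Rightarrow> real" where "Qf s = 2 * mu * Pf s powr (2 / p)"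
definition Lam :: "real \<Rightarrow> real" where "Lam s = (2 * mu) powr (p / 2 - 1) * Pf s powr (1 - 2 / p)"
text \<open>The solution of 2 mu rho^2 + E = Qf, where E is the part of |x|^2 |DU|^2 due to radial
  derivatives. Integrability in closed form fixes E as
  \<open>2 * mu / p * (flat s)\<^sup>2 * Pf s powr (2 / p - 1)\<close>.\<close>

definition rho :: "real \<Rightarrow> real" where
  "rho s = sqrt (Pf s powr (2 / p) - (flat s)\<^sup>2 * Pf s powr (2 / p - 1) / p)"

text \<open>The derivative \<open>d/dt\<close> for \<open>t = exp (1 / s)\<close>.\<close>

definition Dt :: "(real \<Rightarrow> real) \<Rightarrow> real \<Rightarrow> real" where "Dt f s = - flat s * s\<^sup>2 * deriv f s"

text \<open>What the radial energy leaves for the rotation once the motion of s and of the two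
  copies of \<open>rho\<close> is subtracted, divided by the square of \<open>flat s\<close>. The
  subtracted terms carry s^4, so the value at 0 is 2 mu / p, which is positive.\<close>

definition Wsq :: "real \<Rightarrow> real" where
  "Wsq s = 2 * mu / p * Pf s powr (2 / p - 1) - s ^ 4 * (1 + 2 * (deriv rho s)\<^sup>2)"
definition Wf :: "real \<Rightarrow> real" where "Wf s = sqrt (Wsq s)"
text \<open>|x|^p times - div (|DU|^(p-2) D(rho \<omega>)) equals \<open>al\<close> times \<omega>.
  The signs come from d / d ln |x| = - \<open>Dt\<close>.\<close>

definition al :: "real \<Rightarrow> real" where
  "al s = mu * Lam s * rho s + kap * Lam s * Dt rho s - Dt (\<lambda>s. Lam s * Dt rho s) s"
text \<open>\<open>Gam\<close>, \<open>B1\<close>, \<open>B2\<close> solve the linear equations saying that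
  \<open>Gam + B1 cos \<phi> + B2 sin \<phi> = 1 / rho\<^sup>2\<close> and that the normal part of the Euler--Lagrange equation holds. They
  oscillate rapidly as \<open>s\<close> tends to \<open>0\<close>, but the factor \<open>flat s\<close> makes them smooth at \<open>0\<close>.\<close>

definition k1 :: "real \<Rightarrow> real" where "k1 s = flat s * Lam s * Wsq s / (al s * rho s ^ 3)"
definition k2 :: "real \<Rightarrow> real" where
  "k2 s = (kap * Lam s * Wf s + flat s * s\<^sup>2 * deriv (\<lambda>s. Lam s * Wf s) s + flat s * Lam s * Wf s)
     / (al s * rho s ^ 3)"
definition Gam :: "real \<Rightarrow> real" where "Gam s = 1 / (rho s)\<^sup>2 - flat s * k1 s"
definition B1 :: "(real \<Rightarrow> real) \<Rightarrow> real \<Rightarrow> real" where "B1 \<phi> = flat_osc \<phi> k1 (\<lambda>s. - k2 s) 0"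
definition B2 :: "(real \<Rightarrow> real) \<Rightarrow> real \<Rightarrow> real" where "B2 \<phi> = flat_osc \<phi> k2 k1 0"

lemma smooth1_flat': "smooth1 S flat"
  using smooth1_subset[OF smooth1_flat] by simp

lemma Pf_ge: "Pf s \<ge> 1" "Pf s > 0" "(flat s)\<^sup>2 \<le> Pf s"
proof -
  have "kap * flat s \<ge> 0" using kap_pos flat_nonneg[of s] by simp
  moreover have "(flat s)\<^sup>2 \<ge> 0" by simp
  ultimately show "Pf s \<ge> 1" "Pf s > 0" "(flat s)\<^sup>2 \<le> Pf s" by (simp_all add: Pf_def add_pos_nonneg)
qed

text \<open>Since q^2 \<le> P for q = \<open>flat s\<close>, the subtracted term is at most P^(2/p)
  / p, and p > 1.\<close>

lemma rho_arg_pos: "Pf s powr (2 / p) - (flat s)\<^sup>2 * Pf s powr (2 / p - 1) / p > 0"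
proof -
  have "Pf s powr (2 / p) = Pf s * Pf s powr (2 / p - 1)"
    using Pf_ge[of s] by (simp add: powr_diff)
  moreover have "(flat s)\<^sup>2 * Pf s powr (2 / p - 1) / p \<le> Pf s * Pf s powr (2 / p - 1) / p"
    using Pf_ge[of s] p_pos by (intro divide_right_mono mult_right_mono) auto
  moreover have "Pf s * Pf s powr (2 / p - 1) / p < Pf s * Pf s powr (2 / p - 1)"
    using Pf_ge[of s] p1 by (simp add: divide_less_eq)
  ultimately show ?thesis by linarith
qed

lemma rho_pos: "rho s > 0" using rho_arg_pos by (simp add: rho_def)

lemma smooth_Pf: "smooth1 S Pf"
  unfolding Pf_def[abs_def] by (intro smooth1_intros smooth1_flat')
lemma smooth_Qf: "open S \<Longrightarrow> smooth1 S Qf"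
  unfolding Qf_def[abs_def] by (intro smooth1_intros smooth_Pf) (auto simp: Pf_ge)
lemma smooth_Lam: "open S \<Longrightarrow> smooth1 S Lam"
  unfolding Lam_def[abs_def] by (intro smooth1_intros smooth_Pf) (auto simp: Pf_ge)
lemma smooth_rho: "open S \<Longrightarrow> smooth1 S rho"
  unfolding rho_def[abs_def] by (intro smooth1_intros smooth_Pf smooth1_flat') (use rho_arg_pos in \<open>auto simp: Pf_ge p_pos\<close>)
lemma smooth_Dt: "smooth1 S f \<Longrightarrow> open S \<Longrightarrow> smooth1 S (Dt f)"
  unfolding Dt_def[abs_def] by (intro smooth1_intros smooth1_flat' smooth1_deriv)
lemma smooth_Wsq: "open S \<Longrightarrow> smooth1 S Wsq"
  unfolding Wsq_def[abs_def] by (intro smooth1_intros smooth_Pf smooth1_deriv smooth_rho) (auto simp: Pf_ge p_pos)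
lemma smooth_al: "open S \<Longrightarrow> smooth1 S al"
  unfolding al_def[abs_def] by (intro smooth1_intros smooth_Dt smooth_rho smooth_Lam)

lemma values_at_0: "flat 0 = 0" "Pf 0 = 1" "Qf 0 = 2 * mu" "Lam 0 = (2 * mu) powr (p / 2 - 1)"
  "rho 0 = 1" "Wsq 0 = 2 * mu / p" "al 0 = mu * (2 * mu) powr (p / 2 - 1)"
  by (simp_all add: flat_def Pf_def Qf_def Lam_def rho_def Wsq_def al_def Dt_def)

lemma smooth_Wf: "open S \<Longrightarrow> (\<And>s. s \<in> S \<Longrightarrow> Wsq s > 0) \<Longrightarrow> smooth1 S Wf"
  unfolding Wf_def[abs_def] by (intro smooth1_intros smooth_Wsq)
lemma smooth_k1: "open S \<Longrightarrow> (\<And>s. s \<in> S \<Longrightarrow> al s > 0) \<Longrightarrow> smooth1 S k1"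
  unfolding k1_def[abs_def] by (intro smooth1_intros smooth_Wsq smooth1_flat' smooth_Lam smooth_al smooth_rho)
    (auto simp: rho_pos)
lemma smooth_k2: "open S \<Longrightarrow> (\<And>s. s \<in> S \<Longrightarrow> al s > 0) \<Longrightarrow> (\<And>s. s \<in> S \<Longrightarrow> Wsq s > 0) \<Longrightarrow> smooth1 S k2"
  unfolding k2_def[abs_def]
  by (intro smooth1_intros smooth_Wf smooth1_deriv smooth1_flat' smooth_Lam smooth_al smooth_rho)
    (auto simp: rho_pos)
lemma smooth_Gam: "open S \<Longrightarrow> (\<And>s. s \<in> S \<Longrightarrow> al s > 0) \<Longrightarrow> smooth1 S Gam"
  unfolding Gam_def[abs_def]
  by (intro smooth1_intros smooth_k1 smooth1_flat' smooth_rho) (use rho_pos in \<open>auto simp: less_imp_neq[THEN not_sym]\<close>)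

lemma smooth_B:
  assumes "open S" "\<And>s. s \<in> S \<Longrightarrow> al s > 0" "\<And>s. s \<in> S \<Longrightarrow> Wsq s > 0"
    "\<And>s. s \<in> S \<Longrightarrow> s > 0 \<Longrightarrow> (\<phi> has_real_derivative - Wf s / s\<^sup>2) (at s)"
  shows "smooth1 S (B1 \<phi>)" "smooth1 S (B2 \<phi>)"
  unfolding B1_def B2_def using assms
  by (intro smooth1_flat_osc[of S _ _ Wf] smooth1_intros smooth_k1 smooth_k2 smooth_Wf; blast)+

text \<open>The bounds 2, 1, 1 do not involve \<open>m\<close>; they are the source of a curvature
  bound for the target that is uniform in the dimension.\<close>

definition controlled :: "(real \<Rightarrow> real) \<Rightarrow> real \<Rightarrow> bool" where
  "controlled f s \<longleftrightarrow> \<bar>f s\<bar> \<le> 2 \<and> \<bar>deriv f s\<bar> \<le> 1 \<and> \<bar>deriv (deriv f) s\<bar> \<le> 1"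

text \<open>The first two derivatives vanish at 0, where \<open>f\<close> takes the value
  \<open>c\<close>; continuity does the rest. The neighbourhood may depend on \<open>m\<close>, the
  bounds do not.\<close>

lemma eventually_controlled:
  assumes "smooth1 S f" "open S" "0 \<in> S" "\<And>s. s \<in> S \<Longrightarrow> s \<le> 0 \<Longrightarrow> f s = c" "\<bar>c\<bar> \<le> 1"
  shows "\<forall>\<^sub>F s in nhds 0. controlled f s"
proof -
  have d0: "deriv f s = 0" if s: "s \<in> S" "s \<le> 0" for s
  proof (cases "s = 0")
    case True then show ?thesis using smooth1_deriv_zero_at_0[OF assms(1-4)] by simp
  next
    case False
    then have "\<forall>\<^sub>F x in nhds s. x \<in> S \<inter> {..<0}" using s assms(2) by (intro eventually_nhds_in_open) auto
    then have "\<forall>\<^sub>F x in nhds s. f x = c" by eventually_elim (use assms in auto)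
    then have "(f has_real_derivative 0) (at s)"
      using DERIV_cong_ev[OF refl _ refl, of f "\<lambda>_. c" s 0] by auto
    then show ?thesis by (rule DERIV_imp_deriv)
  qed
  have s1: "smooth1 S (deriv f)" "smooth1 S (deriv (deriv f))" using assms by (auto intro!: smooth1_deriv)
  have z: "deriv f 0 = 0" "deriv (deriv f) 0 = 0" "f 0 = c"
    using d0 assms smooth1_deriv_zero_at_0[OF s1(1) assms(2,3), of 0] by auto
  have c: "isCont f 0" "isCont (deriv f) 0" "isCont (deriv (deriv f)) 0"
    using smooth1_continuous[OF assms(1)] smooth1_continuous[OF s1(1)] smooth1_continuous[OF s1(2)] assms(2,3)
    by (auto simp: continuous_on_eq_continuous_at)
  have "\<forall>\<^sub>F s in nhds 0. -2 < f s \<and> f s < 2" "\<forall>\<^sub>F s in nhds 0. -1 < deriv f s \<and> deriv f s < 1"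
    "\<forall>\<^sub>F s in nhds 0. -1 < deriv (deriv f) s \<and> deriv (deriv f) s < 1"
    using assms(5) z by (intro continuous_at_0_bound c; simp)+
  then show ?thesis by eventually_elim (auto simp: controlled_def)
qed

end

text \<open>All smallness is obtained by shrinking \<open>s1\<close>; the unit ball is later placed
  inside this range by the constant \<open>T0\<close>. The phase is given only for positive s,
  because it diverges as s tends to 0.\<close>

locale spiral = exponents +
  fixes s1 :: real and \<phi> :: "real \<Rightarrow> real"
  assumes s1: "0 < s1" "s1 \<le> 1"
    and phi_deriv: "\<And>s. 0 < s \<Longrightarrow> s < s1 \<Longrightarrow> (\<phi> has_real_derivative - Wf s / s\<^sup>2) (at s)"
    and Wsq_ge: "\<And>s. \<bar>s\<bar> < s1 \<Longrightarrow> mu / p \<le> Wsq s"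
    and al_bounds: "\<And>s. \<bar>s\<bar> < s1 \<Longrightarrow> 0 < al s \<and> al s \<le> (2 * mu) powr (p / 2)"
    and rho_bounds: "\<And>s. \<bar>s\<bar> < s1 \<Longrightarrow> 1 / 2 \<le> rho s \<and> rho s \<le> 2"
    and Qf_bounds: "\<And>s. \<bar>s\<bar> < s1 \<Longrightarrow> mu \<le> Qf s \<and> Qf s \<le> 4 * mu"
    and controlled: "\<And>s. \<bar>s\<bar> < s1 \<Longrightarrow> controlled Gam s \<and> controlled (B1 \<phi>) s \<and> controlled (B2 \<phi>) s"

lemma (in exponents) ex_spiral: "\<exists>s1 \<phi>. spiral p m s1 \<phi>"
proof -
  have c: "isCont Wsq 0" "isCont al 0" "isCont rho 0" "isCont Qf 0"
    using smooth1_continuous[OF smooth_Wsq[of UNIV]] smooth1_continuous[OF smooth_al[of UNIV]]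
      smooth1_continuous[OF smooth_rho[of UNIV]] smooth1_continuous[OF smooth_Qf[of UNIV]]
    by (auto simp: continuous_on_eq_continuous_at)
  have pw: "mu * (2 * mu) powr (p / 2 - 1) = (2 * mu) powr (p / 2) / 2"
    using mu_pos by (simp add: powr_diff)
  have "\<forall>\<^sub>F s in nhds 0. mu / p < Wsq s \<and> Wsq s < 3 * mu / p"
    "\<forall>\<^sub>F s in nhds 0. 0 < al s \<and> al s < (2 * mu) powr (p / 2)"
    "\<forall>\<^sub>F s in nhds 0. 1 / 2 < rho s \<and> rho s < 2"
    "\<forall>\<^sub>F s in nhds 0. mu < Qf s \<and> Qf s < 4 * mu"
    using mu_pos p_pos by (intro continuous_at_0_bound c; simp only: values_at_0 pw; simp add: field_simps)+
  then have "\<forall>\<^sub>F s in nhds 0. mu / p \<le> Wsq s \<and> 0 < al s \<and> al s \<le> (2 * mu) powr (p / 2) \<and>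
    1 / 2 \<le> rho s \<and> rho s \<le> 2 \<and> mu \<le> Qf s \<and> Qf s \<le> 4 * mu"
    by eventually_elim auto
  then obtain d where d: "d > 0" "\<And>s. \<bar>s\<bar> < d \<Longrightarrow> mu / p \<le> Wsq s \<and> 0 < al s \<and> al s \<le> (2 * mu) powr (p / 2) \<and>
    1 / 2 \<le> rho s \<and> rho s \<le> 2 \<and> mu \<le> Qf s \<and> Qf s \<le> 4 * mu"
    by (auto simp: eventually_nhds_metric dist_real_def)
  let ?S = "{-d<..<d}"
  have W: "Wsq s > 0" "al s > 0" if "s \<in> ?S" for s
    using d(2)[of s] that mu_pos p_pos by (auto simp: abs_less_iff intro: less_le_trans[of 0 "mu / p"])
  have sm: "smooth1 ?S Wf" using W by (intro smooth_Wf) auto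
  have "continuous_on {0<..<d} (\<lambda>s. - Wf s / s\<^sup>2)"
    by (intro continuous_intros continuous_on_subset[OF smooth1_continuous[OF sm]]) auto
  then obtain \<phi> where \<phi>: "\<And>s. 0 < s \<Longrightarrow> s < d / 2 \<Longrightarrow> (\<phi> has_real_derivative - Wf s / s\<^sup>2) (at s)"
    by (rule antiderivative_open_interval[where c = "d / 2"]) (use d in auto)
  let ?T = "{-(d/2)<..<d/2}"
  have sub: "\<And>s. s \<in> ?T \<Longrightarrow> s \<in> ?S" by auto
  have smB: "smooth1 ?T (B1 \<phi>)" "smooth1 ?T (B2 \<phi>)" "smooth1 ?T Gam"
    by (intro smooth_B smooth_Gam; use W sub \<phi> in force)+
  \<comment> \<open>For s \<le> 0 the target is continued by the limiting profile:
    \<open>flat\<close> vanishes there, so the coefficients are 0, 0 and 1.\<close>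
  have z: "B1 \<phi> s = 0" "B2 \<phi> s = 0" "Gam s = 1" if "s \<le> 0" for s
    using that by (auto simp: B1_def B2_def flat_osc_def Gam_def flat_def rho_def Pf_def)
  have "\<forall>\<^sub>F s in nhds 0. controlled Gam s" "\<forall>\<^sub>F s in nhds 0. controlled (B1 \<phi>) s"
     "\<forall>\<^sub>F s in nhds 0. controlled (B2 \<phi>) s"
    by (rule eventually_controlled[of ?T _ 1] eventually_controlled[of ?T _ 0]; use smB z d in simp)+
  then have "\<forall>\<^sub>F s in nhds 0. controlled Gam s \<and> controlled (B1 \<phi>) s \<and> controlled (B2 \<phi>) s"
    by eventually_elim auto
  then obtain e where e: "e > 0" "\<And>s. \<bar>s\<bar> < e \<Longrightarrow> controlled Gam s \<and> controlled (B1 \<phi>) s \<and> controlled (B2 \<phi>) s"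
    by (auto simp: eventually_nhds_metric dist_real_def)
  have "spiral p m (min 1 (min (d/2) e)) \<phi>"
    by unfold_locales (use d e \<phi> in auto)
  then show ?thesis by blast
qed

text \<open>The remainder has derivative \<open>deriv f x - deriv f s0\<close>, which is at most |x
  - s0|; one application of the mean value inequality then gives (s - s0)^2. The factor 1/2 of
  Taylor's formula is given away.\<close>

lemma second_order_bound:
  assumes f: "smooth1 {-r<..<r} f" and s: "s \<in> {-r<..<r}" "s0 \<in> {-r<..<r}"
    and B: "\<And>x. x \<in> {-r<..<r} \<Longrightarrow> \<bar>deriv f x\<bar> \<le> 1" "\<And>x. x \<in> {-r<..<r} \<Longrightarrow> \<bar>deriv (deriv f) x\<bar> \<le> 1"
  shows "\<bar>f s - f s0\<bar> \<le> \<bar>s - s0\<bar>" (is ?PA) "\<bar>f s - f s0 - deriv f s0 * (s - s0)\<bar> \<le> (s - s0)\<^sup>2" (is ?PB)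
proof -
  have lip: "\<bar>g x - g y\<bar> \<le> 1 * \<bar>x - y\<bar>" if "smooth1 {-r<..<r} g" "\<And>x. x \<in> {-r<..<r} \<Longrightarrow> \<bar>deriv g x\<bar> \<le> 1"
    "x \<in> {-r<..<r}" "y \<in> {-r<..<r}" for g x y
  proof -
    have "norm (g x - g y) \<le> 1 * norm (x - y)"
    proof (rule field_differentiable_bound[of "{-r<..<r}" g "deriv g" 1])
      show "(g has_field_derivative deriv g z) (at z within {-r<..<r})" if "z \<in> {-r<..<r}" for z
        by (rule has_field_derivative_at_within[OF smooth1_DERIV[OF \<open>smooth1 {-r<..<r} g\<close> that]])
    qed (use that in \<open>simp_all add: convex_real_interval\<close>)
    then show ?thesis by simp
  qed
  show ?PA using lip[OF f B(1) s] by simp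
  define I where "I = {min s s0..max s s0}"
  have I: "I \<subseteq> {-r<..<r}" "convex I" "s \<in> I" "s0 \<in> I" using s by (auto simp: I_def min_def max_def)
  have d: "((\<lambda>x. f x - deriv f s0 * x) has_real_derivative deriv f x - deriv f s0) (at x within I)" if "x \<in> I" for x
    by (rule derivative_eq_intros has_field_derivative_at_within[OF smooth1_DERIV[OF f]] refl | use that I in force)+
  have b: "norm (deriv f x - deriv f s0) \<le> \<bar>s - s0\<bar>" if "x \<in> I" for x
  proof -
    have "\<bar>deriv f x - deriv f s0\<bar> \<le> 1 * \<bar>x - s0\<bar>"
      using that I s by (intro lip smooth1_deriv f B) auto
    also have "\<bar>x - s0\<bar> \<le> \<bar>s - s0\<bar>" using that by (auto simp: I_def min_def max_def split: if_splits)
    finally show ?thesis by simp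
  qed
  have "norm ((f s - deriv f s0 * s) - (f s0 - deriv f s0 * s0)) \<le> \<bar>s - s0\<bar> * norm (s - s0)"
    by (rule field_differentiable_bound[OF I(2) d b I(3,4)])
  then show ?PB
    by (simp add: algebra_simps power2_eq_square abs_mult[symmetric] flip: abs_mult)
qed

text \<open>For differentiating identities between profiles, which are known on an open set of
  s.\<close>

lemma deriv_eq_on_open:
  assumes "open S" "s \<in> S" "\<And>x. x \<in> S \<Longrightarrow> F x = G x"
    "(F has_real_derivative a) (at s)" "(G has_real_derivative b) (at s)"
  shows "a = b"
  using has_field_derivative_transform_within_open[OF assms(4,1,2,3)] assms(5) DERIV_unique by blast

section \<open>The Euler-Lagrange equation along the curve, in the variable s\<close>

context spiral
begin

definition S where "S = {-s1<..<s1}"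
text \<open>With t = exp (1 / s), \<open>th\<close> and \<open>sg\<close> are the t-derivatives of
  the phase and of s.\<close>

definition th :: "real \<Rightarrow> real" where "th s = flat s * Wf s"
definition sg :: "real \<Rightarrow> real" where "sg s = - flat s * s\<^sup>2"

lemma S: "open S" "s \<in> S \<longleftrightarrow> \<bar>s\<bar> < s1" by (auto simp: S_def)

lemma pos: "s \<in> S \<Longrightarrow> Wsq s > 0" "s \<in> S \<Longrightarrow> al s > 0"
  using Wsq_ge[of s] al_bounds[of s] mu_pos p_pos by (auto simp: S(2) intro: less_le_trans[of 0 "mu / p"])

lemma Dt_S:
  "smooth1 S f \<Longrightarrow> smooth1 S g \<Longrightarrow> s \<in> S \<Longrightarrow> Dt (\<lambda>s. f s * g s) s = Dt f s * g s + f s * Dt g s"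
  using DERIV_imp_deriv[OF DERIV_mult[OF smooth1_DERIV[of S f] smooth1_DERIV[of S g]]]
  by (auto simp: Dt_def algebra_simps)

lemma smooth_th: "smooth1 S th"
  unfolding th_def[abs_def] by (intro smooth1_intros smooth1_flat' smooth_Wf S pos)
lemma smooth_sg: "smooth1 S sg"
  unfolding sg_def[abs_def] by (intro smooth1_intros smooth1_flat')

lemma smooth_Wf_S: "smooth1 S Wf"
  by (rule smooth_Wf[OF S(1) pos(1)])

lemmas smooth_S = smooth_th smooth_sg smooth_rho[OF S(1)] smooth_Lam[OF S(1)] smooth_Qf[OF S(1)]
  smooth_Pf[of S] smooth1_flat'[of S] smooth_al[OF S(1)] smooth_Wf_S

lemma smooth_B_S: "smooth1 S (B1 \<phi>)" "smooth1 S (B2 \<phi>)" "smooth1 S Gam"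
  by (intro smooth_B smooth_Gam S pos; use phi_deriv S(2) in force)+

text \<open>This is q' = - q^2 for q = 1 / t.\<close>

lemma flat_D: "flat s * s\<^sup>2 * deriv flat s = (flat s)\<^sup>2" if "s \<in> S" for s
proof (cases "s > 0")
  case True
  have "deriv flat s = flat s / s\<^sup>2" using flat_deriv[OF True] by (rule DERIV_imp_deriv)
  then show ?thesis using True by (simp add: power2_eq_square)
qed (simp add: flat_def)

lemma kinetic: "s \<in> S \<Longrightarrow> (sg s)\<^sup>2 + (th s)\<^sup>2 + 2 * (Dt rho s)\<^sup>2 = 2 * mu / p * (flat s)\<^sup>2 * Pf s powr (2 / p - 1)"
proof -
  assume "s \<in> S"
  then have "(Wf s)\<^sup>2 = Wsq s" using pos(1)[of s] by (simp add: Wf_def)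
  then show ?thesis
    by (simp add: sg_def th_def Dt_def power_mult_distrib Wsq_def) (simp add: algebra_simps power2_eq_square power4_eq_xxxx)
qed

lemma Qf_eq: "s \<in> S \<Longrightarrow> 2 * mu * (rho s)\<^sup>2 + ((sg s)\<^sup>2 + (th s)\<^sup>2 + 2 * (Dt rho s)\<^sup>2) = Qf s"
proof -
  assume s: "s \<in> S"
  have r: "(rho s)\<^sup>2 = Pf s powr (2 / p) - (flat s)\<^sup>2 * Pf s powr (2 / p - 1) / p"
    using rho_arg_pos[of s] by (simp add: rho_def)
  show ?thesis unfolding kinetic[OF s] Qf_def r by (simp add: algebra_simps)
qed

text \<open>The powers of P cancel, so that Lam E is a constant times q^2; this is the reason for
  the exponents in \<open>Qf\<close> and \<open>rho\<close>.\<close>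

lemma Lam_kinetic: "s \<in> S \<Longrightarrow> Lam s * ((sg s)\<^sup>2 + (th s)\<^sup>2 + 2 * (Dt rho s)\<^sup>2) = (2 * mu) powr (p / 2) / p * (flat s)\<^sup>2"
proof -
  assume s: "s \<in> S"
  have "(2 * mu) powr (p / 2 - 1) * (2 * mu) = (2 * mu) powr (p / 2)"
    using mu_pos by (simp add: powr_diff)
  moreover have "Pf s powr (1 - 2 / p) * Pf s powr (2 / p - 1) = 1"
    using Pf_ge[of s] by (simp flip: powr_add)
  moreover have "Lam s * (2 * mu / p * (flat s)\<^sup>2 * Pf s powr (2 / p - 1)) =
     ((2 * mu) powr (p / 2 - 1) * (2 * mu)) * (Pf s powr (1 - 2 / p) * Pf s powr (2 / p - 1)) / p * (flat s)\<^sup>2"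
    by (simp add: Lam_def)
  ultimately show ?thesis unfolding kinetic[OF s] by simp
qed

lemma Lam_eq: "Lam s = Qf s powr (p / 2 - 1)"
proof -
  have "Qf s powr (p / 2 - 1) = (2 * mu) powr (p / 2 - 1) * (Pf s powr (2 / p)) powr (p / 2 - 1)"
    using mu_pos by (simp add: Qf_def powr_mult)
  also have "(Pf s powr (2 / p)) powr (p / 2 - 1) = Pf s powr (1 - 2 / p)"
  proof -
    have "2 / p * (p / 2 - 1) = 1 - 2 / p" using p_pos by (simp add: right_diff_distrib)
    then show ?thesis by (simp add: powr_powr)
  qed
  finally show ?thesis by (simp add: Lam_def)
qed

text \<open>The tangential part of the Euler--Lagrange equation along the curve: with \<open>E\<close> the kinetic
  term, it reads \<open>(Lam E)' = kap Lam E + Lam Qf' / 2\<close> in terms of \<open>t\<close>-derivatives.\<close>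

lemma tangential_equation:
  assumes s: "s \<in> S"
  shows "sg s * (kap * Lam s * sg s - Dt (\<lambda>s. Lam s * sg s) s)
     + th s * (kap * Lam s * th s - Dt (\<lambda>s. Lam s * th s) s) + 2 * Dt rho s * al s = 0"
proof -
  define c where "c = (2 * mu) powr (p / 2) / p"
  note sR = smooth_Dt[OF smooth_S(3) S(1)]
  note d = smooth_S[THEN smooth1_DERIV, OF s] smooth1_DERIV[OF sR s]
  define q a n where "q = flat s" and "a = Lam s" and "n = - flat s * s\<^sup>2"
  define L1 g1 h1 r1 R1 Q1 P1 q1 where "L1 = deriv Lam s" and "g1 = deriv sg s" and "h1 = deriv th s"
    and "r1 = deriv rho s" and "R1 = deriv (Dt rho) s" and "Q1 = deriv Qf s" and "P1 = deriv Pf s" and "q1 = deriv flat s"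
  note defs = q_def a_def n_def L1_def g1_def h1_def r1_def R1_def Q1_def P1_def q1_def
  let ?g = "sg s" and ?h = "th s" and ?r = "Dt rho s"
  let ?E = "?g\<^sup>2 + ?h\<^sup>2 + 2 * ?r\<^sup>2" and ?X = "?g * g1 + ?h * h1 + 2 * ?r * R1"
  have E0: "a * ?E = c * q\<^sup>2" using Lam_kinetic[OF s] by (simp add: c_def defs)
  have E1: "L1 * ?E + 2 * a * ?X = c * (2 * q * q1)"
  proof (rule deriv_eq_on_open[OF S(1) s, OF Lam_kinetic])
    show "((\<lambda>s. Lam s * ((sg s)\<^sup>2 + (th s)\<^sup>2 + 2 * (Dt rho s)\<^sup>2)) has_real_derivative L1 * ?E + 2 * a * ?X) (at s)"
      unfolding defs by (rule derivative_eq_intros d refl)+ (simp add: algebra_simps)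
    show "((\<lambda>s. (2 * mu) powr (p / 2) / p * (flat s)\<^sup>2) has_real_derivative c * (2 * q * q1)) (at s)"
      unfolding defs c_def by (rule derivative_eq_intros d refl)+ simp
  qed
  have E2: "4 * mu * rho s * r1 + 2 * ?X = Q1"
  proof (rule deriv_eq_on_open[OF S(1) s, OF Qf_eq])
    show "((\<lambda>s. 2 * mu * (rho s)\<^sup>2 + ((sg s)\<^sup>2 + (th s)\<^sup>2 + 2 * (Dt rho s)\<^sup>2)) has_real_derivative 4 * mu * rho s * r1 + 2 * ?X) (at s)"
      unfolding defs by (rule derivative_eq_intros d refl)+ (simp add: algebra_simps)
    show "(Qf has_real_derivative Q1) (at s)" unfolding defs by (rule d)
  qed
  have P1: "P1 = kap * q1 + 2 * q * q1"
  proof (rule DERIV_unique[OF d(6)[folded P1_def]])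
    show "(Pf has_real_derivative kap * q1 + 2 * q * q1) (at s)"
      unfolding Pf_def[abs_def] defs by (rule derivative_eq_intros d refl)+ (simp add: algebra_simps)
  qed
  have Q1: "Q1 = 2 * mu * (2 / p * Pf s powr (2 / p - 1) * P1)"
  proof (rule DERIV_unique[OF d(5)[folded Q1_def]])
    have "((\<lambda>s. Pf s powr (2 / p)) has_real_derivative 2 / p * Pf s powr (2 / p - 1) * P1) (at s)"
      using DERIV_fun_powr[OF d(6)[folded P1_def] Pf_ge(2), of "2 / p"] by simp
    then show "(Qf has_real_derivative 2 * mu * (2 / p * Pf s powr (2 / p - 1) * P1)) (at s)"
      unfolding Qf_def[abs_def] by (rule DERIV_cmult)
  qed
  have "Pf s powr (1 - 2 / p) * Pf s powr (2 / p - 1) = 1"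
    using Pf_ge[of s] by (simp flip: powr_add)
  moreover have "(2 * mu) powr (p / 2 - 1) * (2 * mu) = (2 * mu) powr (p / 2)"
    using mu_pos by (simp add: powr_diff)
  moreover have "a * Q1 = ((2 * mu) powr (p / 2 - 1) * (2 * mu)) * (Pf s powr (1 - 2 / p) * Pf s powr (2 / p - 1)) * 2 / p * P1"
    unfolding Q1 a_def Lam_def by simp
  \<comment> \<open>This is Lam Qf' / 2 = (Qf^(p/2))' / p, where Qf^(p/2) is a constant times
    P.\<close>
  ultimately have E3: "a * Q1 = 2 * c * P1" by (simp add: c_def)
  \<comment> \<open>Here the form of \<open>Pf\<close> is decisive: since q' = - q^2, an
    antiderivative of (q^2)' - kap q^2 is q^2 + kap q, which is \<open>Pf\<close> up to a
    constant.\<close>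
  have E4: "n * q1 + q\<^sup>2 = 0" using flat_D[OF s] by (simp add: defs)
  have D: "Dt f s = n * deriv f s" for f by (simp add: Dt_def n_def)
  have D1: "Dt (\<lambda>s. Lam s * sg s) s = n * (L1 * ?g + a * g1)" "Dt (\<lambda>s. Lam s * th s) s = n * (L1 * ?h + a * h1)"
    "Dt (\<lambda>s. Lam s * Dt rho s) s = n * (L1 * ?r + a * R1)"
    unfolding Dt_S[OF smooth_S(4) smooth_S(1) s] Dt_S[OF smooth_S(4) smooth_S(2) s] Dt_S[OF smooth_S(4) sR s]
    unfolding D[of Lam] D[of sg] D[of th] D[of "Dt rho"] defs by (simp_all add: algebra_simps)
  have R: "?r = n * r1" unfolding D defs by simp
  have "sg s * (kap * Lam s * sg s - Dt (\<lambda>s. Lam s * sg s) s)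
     + th s * (kap * Lam s * th s - Dt (\<lambda>s. Lam s * th s) s) + 2 * Dt rho s * al s
    = kap * (a * ?E) - n * (L1 * ?E + a * ?X) + 2 * mu * a * rho s * ?r"
    unfolding al_def D1 a_def[symmetric] by (simp add: algebra_simps power2_eq_square)
  also have "\<dots> = kap * (a * ?E) - n * (L1 * ?E + 2 * a * ?X) + n * a * (4 * mu * rho s * r1 + 2 * ?X) / 2"
    unfolding R by (simp add: algebra_simps)
  also have "\<dots> = kap * c * q\<^sup>2 - n * c * (2 * q * q1) + n * (a * Q1) / 2"
    unfolding E0 E1 E2 by simp
  also have "\<dots> = kap * c * (n * q1 + q\<^sup>2)" unfolding E3 P1 by (simp add: algebra_simps)
  also have "\<dots> = 0" unfolding E4 by simp
  finally show ?thesis .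
qed

text \<open>Affine in (z1, z2), so that along the curve the gradient in these variables can be
  prescribed by \<open>B1\<close>, \<open>B2\<close> and the value corrected by
  \<open>Gam\<close>.\<close>

definition J :: "real \<Rightarrow> real \<Rightarrow> real \<Rightarrow> real" where "J z1 z2 s = Gam s + B1 \<phi> s * z1 + B2 \<phi> s * z2"

text \<open>The partial derivative of \<open>J\<close> in its last argument at the curve; the phase
  inside the trigonometric factors is not differentiated.\<close>

definition dJ :: "real \<Rightarrow> real" where
  "dJ s = deriv Gam s + deriv (B1 \<phi>) s * cos (\<phi> s) + deriv (B2 \<phi>) s * sin (\<phi> s)"

lemma B_pos: "s > 0 \<Longrightarrow> B1 \<phi> s = flat s * (k1 s * cos (\<phi> s) - k2 s * sin (\<phi> s))"
   "s > 0 \<Longrightarrow> B2 \<phi> s = flat s * (k2 s * cos (\<phi> s) + k1 s * sin (\<phi> s))"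
  by (simp_all add: B1_def B2_def flat_osc_def flat_def)

lemma J_curve: "s > 0 \<Longrightarrow> J (cos (\<phi> s)) (sin (\<phi> s)) s = 1 / (rho s)\<^sup>2"
proof -
  assume "s > 0"
  then have "J (cos (\<phi> s)) (sin (\<phi> s)) s = Gam s + flat s * k1 s * ((cos (\<phi> s))\<^sup>2 + (sin (\<phi> s))\<^sup>2)"
    by (simp only: J_def B_pos algebra_simps power2_eq_square)
  then show ?thesis by (simp add: Gam_def)
qed

text \<open>\<open>k1\<close> and \<open>k2\<close> are components in the frame rotating with the
  phase: the radial one is the centripetal term, the angular one is the defect in the equation of
  the phase.\<close>

lemma al_k: assumes s: "s \<in> S" "s > 0"
  shows "al s * rho s ^ 3 * (flat s * k1 s) = Lam s * (th s)\<^sup>2" (is ?PA)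
    "al s * rho s ^ 3 * (flat s * k2 s) = kap * Lam s * th s - Dt (\<lambda>s. Lam s * th s) s" (is ?PB)
proof -
  have nz: "al s * rho s ^ 3 \<noteq> 0" using pos(2)[OF s(1)] rho_pos[of s] by simp
  have "(Wf s)\<^sup>2 = Wsq s" using pos(1)[OF s(1)] by (simp add: Wf_def)
  then show ?PA
    using nz by (simp add: k1_def th_def power_mult_distrib) (simp add: power2_eq_square)
  have sm: "smooth1 S (\<lambda>s. Lam s * Wf s)" by (intro smooth1_intros smooth_S)
  have "Dt (\<lambda>s. Lam s * th s) s = Dt (\<lambda>s. flat s * (Lam s * Wf s)) s"
    by (simp add: th_def[abs_def] mult_ac)
  also have "\<dots> = Dt flat s * (Lam s * Wf s) + flat s * Dt (\<lambda>s. Lam s * Wf s) s"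
    by (rule Dt_S[OF smooth1_flat' sm s(1)])
  also have "Dt flat s = - (flat s)\<^sup>2" using flat_D[OF s(1)] by (simp add: Dt_def)
  finally have "Dt (\<lambda>s. Lam s * th s) s = - (flat s)\<^sup>2 * (Lam s * Wf s) - flat s * (flat s * s\<^sup>2 * deriv (\<lambda>s. Lam s * Wf s) s)"
    by (simp add: Dt_def)
  then show ?PB
    using nz by (simp add: k2_def th_def) (simp add: algebra_simps power2_eq_square)
qed

text \<open>Normality requires the z-part of A to be \<open>al * rho^3\<close> times the gradient of
  \<open>J\<close>. Two components hold by the choice of \<open>B1\<close>, \<open>B2\<close>. The
  third is forced: \<open>J\<close> equals 1 / rho^2 along the curve, and A is orthogonal to the
  velocity of the curve by the tangential equation.\<close>

lemma normal_equation:
  assumes s: "s \<in> S" "s > 0"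
  shows "al s * rho s ^ 3 * B1 \<phi> s = Lam s * (th s)\<^sup>2 * cos (\<phi> s) - (kap * Lam s * th s - Dt (\<lambda>s. Lam s * th s) s) * sin (\<phi> s)" (is ?PA)
    "al s * rho s ^ 3 * B2 \<phi> s = Lam s * (th s)\<^sup>2 * sin (\<phi> s) + (kap * Lam s * th s - Dt (\<lambda>s. Lam s * th s) s) * cos (\<phi> s)" (is ?PB)
    "al s * rho s ^ 3 * dJ s = kap * Lam s * sg s - Dt (\<lambda>s. Lam s * sg s) s" (is ?PC)
proof -
  show ?PA
    ?PB
    unfolding al_k[OF s, symmetric] B_pos[OF s(2)] by (simp_all only: algebra_simps)
  note d = smooth_B_S[THEN smooth1_DERIV, OF s(1)] phi_deriv[OF s(2)] smooth1_DERIV[OF smooth_S(3) s(1)]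
  have s': "s < s1" using s by (simp add: S)
  have r: "rho s > 0" by (rule rho_pos)
  \<comment> \<open>The total derivative of \<open>J\<close> along the curve: the partial derivative
    in s plus the contribution of the rotating phase.\<close>
  have "dJ s + (B1 \<phi> s * sin (\<phi> s) - B2 \<phi> s * cos (\<phi> s)) * (Wf s / s\<^sup>2) = - (2 * deriv rho s / rho s ^ 3)"
  proof (rule deriv_eq_on_open[of "{0<..<s1}", OF _ _ J_curve])
    show "((\<lambda>s. J (cos (\<phi> s)) (sin (\<phi> s)) s) has_real_derivative dJ s + (B1 \<phi> s * sin (\<phi> s) - B2 \<phi> s * cos (\<phi> s)) * (Wf s / s\<^sup>2)) (at s)"
      unfolding J_def dJ_def by (rule derivative_eq_intros d s' refl)+ (simp add: algebra_simps)
    show "((\<lambda>s. 1 / (rho s)\<^sup>2) has_real_derivative - (2 * deriv rho s / rho s ^ 3)) (at s)"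
      by (rule derivative_eq_intros d refl)+ (use r in \<open>simp_all add: field_simps power2_eq_square power3_eq_cube\<close>)
  qed (use s s' in auto)
  moreover have "B1 \<phi> s * sin (\<phi> s) - B2 \<phi> s * cos (\<phi> s) = - (flat s * k2 s)"
  proof -
    have "B1 \<phi> s * sin (\<phi> s) - B2 \<phi> s * cos (\<phi> s) = - (flat s * k2 s * ((cos (\<phi> s))\<^sup>2 + (sin (\<phi> s))\<^sup>2))"
      by (simp only: B_pos[OF s(2)] algebra_simps power2_eq_square)
    then show ?thesis by simp
  qed
  ultimately have "dJ s = flat s * k2 s * (Wf s / s\<^sup>2) - 2 * deriv rho s / rho s ^ 3" by simp
  then have "rho s ^ 3 * dJ s = rho s ^ 3 * (flat s * k2 s * (Wf s / s\<^sup>2)) - 2 * deriv rho s"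
    using r by (simp add: right_diff_distrib)
  moreover have "sg s * (al s * rho s ^ 3 * dJ s) = sg s * al s * (rho s ^ 3 * dJ s)" by (simp add: mult_ac)
  ultimately have "sg s * (al s * rho s ^ 3 * dJ s) = al s * (rho s ^ 3 * (flat s * k2 s)) * (sg s * Wf s / s\<^sup>2)
     - 2 * al s * (sg s * deriv rho s)"
    by (simp add: right_diff_distrib mult_ac)
  also have "sg s * Wf s / s\<^sup>2 = - th s" using s(2) by (simp add: sg_def th_def)
  also have "sg s * deriv rho s = Dt rho s" by (simp add: sg_def Dt_def)
  also have "al s * (rho s ^ 3 * (flat s * k2 s)) = kap * Lam s * th s - Dt (\<lambda>s. Lam s * th s) s"
    using al_k(2)[OF s] by (simp add: mult_ac)
  finally have "sg s * (al s * rho s ^ 3 * dJ s) = sg s * (kap * Lam s * sg s - Dt (\<lambda>s. Lam s * sg s) s)"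
    using tangential_equation[OF s(1)] by (simp add: algebra_simps)
  \<comment> \<open>The s-component is recovered by dividing by the speed of s; this is where s > 0
    enters, since the speed vanishes at 0.\<close>
  moreover have "sg s \<noteq> 0" using s(2) by (simp add: sg_def flat_def)
  ultimately show ?PC by simp
qed

text \<open>A second-order expansion of the graph about a point of the curve. \<open>e\<close> is
  the radial component and \<open>n\<close> the length of the displacement in y, \<open>d\<close>
  the length of the displacement in z; the term subtracting \<open>rho s\<close> is the radial
  displacement in w. Normality cancels the first-order terms, and the remainder is quadratic with a
  constant that depends on \<open>m\<close> only through \<open>al\<close>.\<close>

lemma normal_deviation:
  assumes s: "s \<in> S" "s > 0" and z: "\<bar>z1\<bar> \<le> 2" "\<bar>z2\<bar> \<le> 2" "z3 \<in> S"
    and e: "\<bar>e\<bar> \<le> n" "n \<le> 5" "(rho s)\<^sup>2 + 2 * rho s * e + n\<^sup>2 \<le> 9" "0 \<le> (rho s)\<^sup>2 + 2 * rho s * e + n\<^sup>2"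
    and d: "d = sqrt ((z1 - cos (\<phi> s))\<^sup>2 + (z2 - sin (\<phi> s))\<^sup>2 + (z3 - s)\<^sup>2)"
  shows "\<bar>al s * (e + ((rho s + e) * (2 - ((rho s)\<^sup>2 + 2 * rho s * e + n\<^sup>2) * J z1 z2 z3) - rho s))
     + (al s * rho s ^ 3 * B1 \<phi> s * (z1 - cos (\<phi> s)) + al s * rho s ^ 3 * B2 \<phi> s * (z2 - sin (\<phi> s))
     + al s * rho s ^ 3 * dJ s * (z3 - s))\<bar> \<le> 200 * al s * (n\<^sup>2 + d\<^sup>2)"
proof -
  define r where "r = rho s"
  have r: "1/2 \<le> r" "r \<le> 2" using rho_bounds[of s] s by (auto simp: r_def S)
  define x1 x2 x3 where "x1 = z1 - cos (\<phi> s)" and "x2 = z2 - sin (\<phi> s)" and "x3 = z3 - s"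
  define D where "D = J z1 z2 z3 - 1 / r\<^sup>2"
  define Y where "Y = r\<^sup>2 + 2 * r * e + n\<^sup>2"
  \<comment> \<open>The Taylor remainder of \<open>J\<close> after its linear part.\<close>
  define T where "T = D - (B1 \<phi> s * x1 + B2 \<phi> s * x2 + dJ s * x3)"
  have n0: "0 \<le> n" using e by linarith
  have d2: "d\<^sup>2 = x1\<^sup>2 + x2\<^sup>2 + x3\<^sup>2" unfolding d x1_def x2_def x3_def by (intro real_sqrt_pow2) simp
  have d0: "0 \<le> d" unfolding d by simp
  have xd: "\<bar>x1\<bar> \<le> d" "\<bar>x2\<bar> \<le> d" "\<bar>x3\<bar> \<le> d"
    using d0 d2 by (auto intro!: power2_le_imp_le[of "\<bar>_\<bar>" d])
  have ctl: "controlled f x \<Longrightarrow> \<bar>f x\<bar> \<le> 2" "controlled f x \<Longrightarrow> \<bar>deriv f x\<bar> \<le> 1"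
     "controlled f x \<Longrightarrow> \<bar>deriv (deriv f) x\<bar> \<le> 1" for f x by (auto simp: controlled_def)
  have ss: "s \<in> {-s1<..<s1}" "z3 \<in> {-s1<..<s1}" using s z by (auto simp: S_def)
  have c: "\<And>x. x \<in> {-s1<..<s1} \<Longrightarrow> controlled Gam x" "\<And>x. x \<in> {-s1<..<s1} \<Longrightarrow> controlled (B1 \<phi>) x"
    "\<And>x. x \<in> {-s1<..<s1} \<Longrightarrow> controlled (B2 \<phi>) x" using controlled by auto
  have sob: "\<bar>f z3 - f s\<bar> \<le> \<bar>x3\<bar> \<and> \<bar>f z3 - f s - deriv f s * x3\<bar> \<le> x3\<^sup>2"
    if "smooth1 {-s1<..<s1} f" "\<And>x. x \<in> {-s1<..<s1} \<Longrightarrow> controlled f x" for f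
    unfolding x3_def using second_order_bound[OF that(1) ss(2,1) ctl(2)[OF that(2)] ctl(3)[OF that(2)]] by simp
  have G: "\<bar>Gam z3 - Gam s\<bar> \<le> \<bar>x3\<bar>" "\<bar>Gam z3 - Gam s - deriv Gam s * x3\<bar> \<le> x3\<^sup>2"
    and b1: "\<bar>B1 \<phi> z3 - B1 \<phi> s\<bar> \<le> \<bar>x3\<bar>" "\<bar>B1 \<phi> z3 - B1 \<phi> s - deriv (B1 \<phi>) s * x3\<bar> \<le> x3\<^sup>2"
    and b2: "\<bar>B2 \<phi> z3 - B2 \<phi> s\<bar> \<le> \<bar>x3\<bar>" "\<bar>B2 \<phi> z3 - B2 \<phi> s - deriv (B2 \<phi>) s * x3\<bar> \<le> x3\<^sup>2"
    using sob[OF smooth_B_S(3)[unfolded S_def] c(1)] sob[OF smooth_B_S(1)[unfolded S_def] c(2)]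
      sob[OF smooth_B_S(2)[unfolded S_def] c(3)] by simp_all
  have BB: "\<bar>B1 \<phi> s\<bar> \<le> 2" "\<bar>B2 \<phi> s\<bar> \<le> 2" "\<bar>deriv (B1 \<phi>) s\<bar> \<le> 1" "\<bar>deriv (B2 \<phi>) s\<bar> \<le> 1"
    using ctl(1,2)[OF c(2)[OF ss(1)]] ctl(1,2)[OF c(3)[OF ss(1)]] by simp_all
  have tri5: "\<bar>a + (b + c) + (e + f)\<bar> \<le> \<bar>a\<bar> + (\<bar>b\<bar> + \<bar>c\<bar>) + (\<bar>e\<bar> + \<bar>f\<bar>)" for a b c e f :: real by linarith
  have tri3: "\<bar>a + b + c\<bar> \<le> \<bar>a\<bar> + \<bar>b\<bar> + \<bar>c\<bar>" "\<bar>- a - b - c\<bar> \<le> \<bar>a\<bar> + \<bar>b\<bar> + \<bar>c\<bar>" for a b c :: real by linarith+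
  have prod: "\<bar>a * b\<bar> \<le> A * B" if "\<bar>a\<bar> \<le> A" "\<bar>b\<bar> \<le> B" for a b A B :: real
    using that by (auto simp: abs_mult intro!: mult_mono order_trans[OF abs_ge_zero])
  have Deq: "D = (Gam z3 - Gam s) + ((B1 \<phi> z3 - B1 \<phi> s) * z1 + B1 \<phi> s * x1) + ((B2 \<phi> z3 - B2 \<phi> s) * z2 + B2 \<phi> s * x2)"
    unfolding D_def r_def J_curve[OF s(2), symmetric] by (simp add: J_def x1_def x2_def algebra_simps)
  have "\<bar>(B1 \<phi> z3 - B1 \<phi> s) * z1\<bar> \<le> d * 2" "\<bar>(B2 \<phi> z3 - B2 \<phi> s) * z2\<bar> \<le> d * 2"
    "\<bar>B1 \<phi> s * x1\<bar> \<le> 2 * d" "\<bar>B2 \<phi> s * x2\<bar> \<le> 2 * d"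
    by (rule prod[OF order_trans[OF b1(1) xd(3)] z(1)], rule prod[OF order_trans[OF b2(1) xd(3)] z(2)],
      rule prod[OF BB(1) xd(1)], rule prod[OF BB(2) xd(2)])
  then have "\<bar>D\<bar> \<le> d + (d * 2 + 2 * d) + (d * 2 + 2 * d)"
    unfolding Deq by (intro order_trans[OF tri5] add_mono order_trans[OF G(1) xd(3)])
  then have Dle: "\<bar>D\<bar> \<le> 9 * d" by simp
  have Teq: "T = (Gam z3 - Gam s - deriv Gam s * x3)
     + ((B1 \<phi> z3 - B1 \<phi> s - deriv (B1 \<phi>) s * x3) * z1 + (deriv (B1 \<phi>) s * x3) * x1)
     + ((B2 \<phi> z3 - B2 \<phi> s - deriv (B2 \<phi>) s * x3) * z2 + (deriv (B2 \<phi>) s * x3) * x2)"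
    unfolding T_def Deq dJ_def by (simp add: x1_def x2_def algebra_simps)
  have x32: "x3\<^sup>2 \<le> d\<^sup>2" using d2 by simp
  have "\<bar>(B1 \<phi> z3 - B1 \<phi> s - deriv (B1 \<phi>) s * x3) * z1\<bar> \<le> d\<^sup>2 * 2"
    "\<bar>(B2 \<phi> z3 - B2 \<phi> s - deriv (B2 \<phi>) s * x3) * z2\<bar> \<le> d\<^sup>2 * 2"
    "\<bar>(deriv (B1 \<phi>) s * x3) * x1\<bar> \<le> (1 * d) * d" "\<bar>(deriv (B2 \<phi>) s * x3) * x2\<bar> \<le> (1 * d) * d"
    by (rule prod[OF order_trans[OF b1(2) x32] z(1)], rule prod[OF order_trans[OF b2(2) x32] z(2)],
      rule prod[OF prod[OF BB(3) xd(3)] xd(1)], rule prod[OF prod[OF BB(4) xd(3)] xd(2)])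
  then have "\<bar>T\<bar> \<le> d\<^sup>2 + (d\<^sup>2 * 2 + 1 * d * d) + (d\<^sup>2 * 2 + 1 * d * d)"
    unfolding Teq by (intro order_trans[OF tri5] add_mono order_trans[OF G(2) x32])
  then have Tle: "\<bar>T\<bar> \<le> 7 * d\<^sup>2" by (simp add: power2_eq_square)
  have Y: "0 \<le> Y" "Y \<le> 9" using e by (auto simp: Y_def r_def)
  have n2: "\<bar>n\<^sup>2\<bar> \<le> 5 * n" using prod[of n n n 5] n0 e by (simp add: power2_eq_square mult_ac)
  have W: "\<bar>e * Y + r * (2 * r * e + n\<^sup>2)\<bar> \<le> 27 * n"
  proof -
    have "\<bar>e * Y\<bar> \<le> n * 9" using e Y by (intro prod) auto
    moreover have "\<bar>2 * r * e\<bar> \<le> 4 * n" using r e by (intro prod) auto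
    then have "\<bar>2 * r * e + n\<^sup>2\<bar> \<le> 9 * n" using n2 by linarith
    then have "\<bar>r * (2 * r * e + n\<^sup>2)\<bar> \<le> 2 * (9 * n)" using r by (intro prod) auto
    ultimately show ?thesis by linarith
  qed
  have e2: "e\<^sup>2 \<le> n\<^sup>2" using e by (simp add: abs_le_square_iff[symmetric])
  have br: "\<bar>n\<^sup>2 / r + 2 * e\<^sup>2 / r + e * n\<^sup>2 / r\<^sup>2\<bar> \<le> 26 * n\<^sup>2"
  proof -
    have i: "\<bar>1 / r\<bar> \<le> 2" using r by (simp add: field_simps)
    have "\<bar>n\<^sup>2 * (1 / r)\<bar> \<le> n\<^sup>2 * 2" "\<bar>(2 * e\<^sup>2) * (1 / r)\<bar> \<le> (2 * n\<^sup>2) * 2"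
      "\<bar>(e * n\<^sup>2) * ((1 / r) * (1 / r))\<bar> \<le> (5 * n\<^sup>2) * (2 * 2)"
      by (rule prod[OF _ i], simp, rule prod[OF _ i], use e2 in simp,
        rule prod[OF prod prod[OF i i]], use e in linarith, simp)
    then have "\<bar>n\<^sup>2 * (1 / r) + (2 * e\<^sup>2) * (1 / r) + (e * n\<^sup>2) * ((1 / r) * (1 / r))\<bar> \<le> n\<^sup>2 * 2 + (2 * n\<^sup>2) * 2 + (5 * n\<^sup>2) * (2 * 2)"
      by (intro order_trans[OF tri3(1)] add_mono)
    then show ?thesis by (simp add: power2_eq_square)
  qed
  have r3: "\<bar>r ^ 3\<bar> \<le> 8" using power_mono[of r 2 3] r by simp
  \<comment> \<open>An exact identity: what survives is the quadratic part of the radial expansion,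
    a product of increments in y and z, and the Taylor remainder of \<open>J\<close>.\<close>
  have main: "e + ((r + e) * (2 - Y * J z1 z2 z3) - r) + r ^ 3 * (B1 \<phi> s * x1 + B2 \<phi> s * x2 + dJ s * x3)
     = - (n\<^sup>2 / r + 2 * e\<^sup>2 / r + e * n\<^sup>2 / r\<^sup>2) - (e * Y + r * (2 * r * e + n\<^sup>2)) * D - r ^ 3 * T"
  proof -
    have J: "J z1 z2 z3 = D + 1 / r\<^sup>2" by (simp add: D_def)
    have g: "B1 \<phi> s * x1 + B2 \<phi> s * x2 + dJ s * x3 = D - T" by (simp add: T_def)
    have "e + ((r + e) * (2 - Y / r\<^sup>2) - r) = - (n\<^sup>2 / r + 2 * e\<^sup>2 / r + e * n\<^sup>2 / r\<^sup>2)"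
      unfolding Y_def using r by (simp add: field_simps power2_eq_square)
    moreover have "(r + e) * Y - r ^ 3 = e * Y + r * (2 * r * e + n\<^sup>2)"
      unfolding Y_def by (simp add: algebra_simps power2_eq_square power3_eq_cube)
    moreover have "e + ((r + e) * (2 - Y * J z1 z2 z3) - r) = e + ((r + e) * (2 - Y / r\<^sup>2) - r) - ((r + e) * Y) * D"
      unfolding J by (simp add: algebra_simps)
    ultimately show ?thesis unfolding g by (simp add: algebra_simps)
  qed
  \<comment> \<open>The mixed term 243 n d is split by 2 n d \<le> n^2 + d^2. The coefficients of
    n^2 and d^2 become 148 and 178; both are below 200.\<close>
  have gen: "26 * A + 243 * X + 8 * (7 * B) \<le> 26 * A + 122 * (A + B) + 56 * B"
    if "2 * X \<le> A + B" "0 \<le> A" "0 \<le> B" for A B X :: real using that by argo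
  have nd: "2 * (n * d) \<le> n\<^sup>2 + d\<^sup>2" using zero_le_power2[of "n - d"] by (simp add: power2_eq_square algebra_simps)
  have "\<bar>e + ((r + e) * (2 - Y * J z1 z2 z3) - r) + r ^ 3 * (B1 \<phi> s * x1 + B2 \<phi> s * x2 + dJ s * x3)\<bar>
    \<le> 26 * n\<^sup>2 + (27 * n) * (9 * d) + 8 * (7 * d\<^sup>2)"
    unfolding main by (intro order_trans[OF tri3(2)] add_mono br prod[OF W Dle] prod[OF r3 Tle])
  also have "(27 * n) * (9 * d) = 243 * (n * d)" by simp
  also have "26 * n\<^sup>2 + 243 * (n * d) + 8 * (7 * d\<^sup>2) \<le> 26 * n\<^sup>2 + 122 * (n\<^sup>2 + d\<^sup>2) + 56 * d\<^sup>2" by (rule gen[OF nd]) simp_all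
  also have "\<dots> \<le> 200 * (n\<^sup>2 + d\<^sup>2)" by simp
  finally have "\<bar>e + ((r + e) * (2 - Y * J z1 z2 z3) - r) + r ^ 3 * (B1 \<phi> s * x1 + B2 \<phi> s * x2 + dJ s * x3)\<bar> \<le> 200 * (n\<^sup>2 + d\<^sup>2)" .
  then have "\<bar>al s * (e + ((r + e) * (2 - Y * J z1 z2 z3) - r) + r ^ 3 * (B1 \<phi> s * x1 + B2 \<phi> s * x2 + dJ s * x3))\<bar> \<le> al s * (200 * (n\<^sup>2 + d\<^sup>2))"
    using pos(2)[OF s(1)] by (intro prod) auto
  then show ?thesis by (simp only: r_def x1_def x2_def x3_def Y_def algebra_simps)
qed

end

section \<open>Functions of class C^k and graphs\<close>

text \<open>Moving one coordinate slightly stays in a relatively open set; this makes the partial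
  derivatives \<open>pd\<close> local there.\<close>

lemma line_eventually:
  assumes "openin (top_of_set (Rn d)) W" "x \<in> W" "i < d"
  shows "\<forall>\<^sub>F t in nhds (x i). x(i := t) \<in> W"
proof -
  obtain T where T: "open T" "W = Rn d \<inter> T" using assms(1) by (auto simp: openin_open)
  have "continuous_on UNIV (\<lambda>t. x(i := t))"
  proof (rule continuous_on_coordinatewise_then_product)
    show "continuous_on UNIV (\<lambda>t. (x(i := t)) j)" for j
      by (cases "j = i") (auto intro: continuous_intros)
  qed
  then have "isCont (\<lambda>t. x(i := t)) (x i)" by (simp add: continuous_on_eq_continuous_at)
  then have "((\<lambda>t. x(i := t)) \<longlongrightarrow> x(i := x i)) (nhds (x i))"
    by (simp only: isCont_def tendsto_at_iff_tendsto_nhds)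
  then have "\<forall>\<^sub>F t in nhds (x i). x(i := t) \<in> T"
    by (rule topological_tendstoD) (use T assms(2) in auto)
  moreover have "x(i := t) \<in> Rn d" for t
    using assms T by (auto simp: Rn_def PiE_def extensional_def)
  ultimately show ?thesis unfolding T(2) by (auto elim: eventually_mono)
qed

lemma line_cong:
  assumes "openin (top_of_set (Rn d)) W" "x \<in> W" "i < d" "\<And>x. x \<in> W \<Longrightarrow> f x = g x"
  shows "((\<lambda>t. f (x(i := t))) has_real_derivative D) (at (x i)) \<longleftrightarrow>
         ((\<lambda>t. g (x(i := t))) has_real_derivative D) (at (x i))" (is ?PA)
    and "pd i f x = pd i g x"
proof -
  have "\<forall>\<^sub>F t in nhds (x i). f (x(i := t)) = g (x(i := t))"
    using line_eventually[OF assms(1-3)] by eventually_elim (rule assms(4))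
  then show ?PA "pd i f x = pd i g x"
    unfolding pd_def by (rule DERIV_cong_ev[OF refl _ refl] deriv_cong_ev[OF _ refl]; assumption)+
qed

lemma Ck_cong:
  assumes "openin (top_of_set (Rn d)) W" "\<And>x. x \<in> W \<Longrightarrow> f x = g x"
  shows "Ck k d W f \<longleftrightarrow> Ck k d W g"
  using assms(2)
proof (induction k arbitrary: f g)
  case 0
  then show ?case by (auto cong: continuous_on_cong)
next
  case (Suc k)
  have "Ck k d W (pd i f) \<longleftrightarrow> Ck k d W (pd i g)" if "i < d" for i
    using that Suc.prems by (intro Suc.IH line_cong(2)[OF assms(1)]) auto
  moreover have "(\<lambda>t. f (x(i := t))) field_differentiable at (x i) \<longleftrightarrow> (\<lambda>t. g (x(i := t))) field_differentiable at (x i)"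
    if "i < d" "x \<in> W" for i x
    unfolding field_differentiable_def using line_cong(1)[OF assms(1) that(2,1), of f g] Suc.prems by simp
  moreover have "continuous_on W f \<longleftrightarrow> continuous_on W g" using Suc.prems by (auto cong: continuous_on_cong)
  ultimately show ?case by simp
qed

lemma Ck_DERIV:
  "Ck (Suc k) d W f \<Longrightarrow> x \<in> W \<Longrightarrow> i < d \<Longrightarrow> ((\<lambda>t. f (x(i := t))) has_real_derivative pd i f x) (at (x i))"
  by (simp add: pd_def DERIV_deriv_iff_field_differentiable)

lemma Ck_pd: "Ck (Suc k) d W f \<Longrightarrow> i < d \<Longrightarrow> Ck k d W (pd i f)"
  by simp

lemma Ck_SucI:
  assumes "openin (top_of_set (Rn d)) W" "continuous_on W f"
    "\<And>i x. i < d \<Longrightarrow> x \<in> W \<Longrightarrow> ((\<lambda>t. f (x(i := t))) has_real_derivative g i x) (at (x i))"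
    "\<And>i. i < d \<Longrightarrow> Ck k d W (g i)"
  shows "Ck (Suc k) d W f"
proof -
  have "Ck k d W (pd i f)" if "i < d" for i
    using Ck_cong[OF assms(1), of "pd i f" "g i"] assms(3,4) that by (auto simp: pd_def intro: DERIV_imp_deriv)
  then show ?thesis using assms(2,3) by (auto simp: field_differentiable_def)
qed

lemma Ck_continuous: "Ck k d W f \<Longrightarrow> continuous_on W f"
  by (cases k) auto

lemma Ck_Suc_imp: "Ck (Suc k) d W f \<Longrightarrow> Ck k d W f"
proof (induction k arbitrary: f)
  case (Suc k)
  then show ?case using Ck.simps(2)[of "Suc k" d W f] Ck.simps(2)[of k d W f] by blast
qed simp

lemma Ck_subset:
  "Ck k d W f \<Longrightarrow> V \<subseteq> W \<Longrightarrow> Ck k d V f"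
  by (induction k arbitrary: f) (auto intro: continuous_on_subset)

lemma Ck_const: "openin (top_of_set (Rn d)) W \<Longrightarrow> Ck k d W (\<lambda>x. c)"
proof (induction k arbitrary: c)
  case (Suc k)
  show ?case by (rule Ck_SucI[where g = "\<lambda>i x. 0"]) (use Suc in auto)
qed simp

lemma Ck_coord: "openin (top_of_set (Rn d)) W \<Longrightarrow> Ck k d W (\<lambda>x. x j)"
proof (induction k)
  case 0
  show ?case using continuous_on_subset[OF continuous_on_product_coordinates] by auto
next
  case (Suc k)
  show ?case
  proof (rule Ck_SucI[where g = "\<lambda>i x. if i = j then 1 else 0"])
    show "((\<lambda>t. (x(i := t)) j) has_real_derivative (if i = j then 1 else 0)) (at (x i))" for i and x :: "nat \<Rightarrow> real"
      by (auto intro!: derivative_eq_intros)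
    show "Ck k d W (\<lambda>x. if i = j then 1 else 0)" for i by (auto intro!: Ck_const Suc)
  qed (use Suc Ck_continuous in auto)
qed

lemma Ck_add: "openin (top_of_set (Rn d)) W \<Longrightarrow> Ck k d W f \<Longrightarrow> Ck k d W g \<Longrightarrow> Ck k d W (\<lambda>x. f x + g x)"
proof (induction k arbitrary: f g)
  case 0
  then show ?case by (auto intro: continuous_on_add)
next
  case (Suc k)
  show ?case
  proof (rule Ck_SucI[where g = "\<lambda>i x. pd i f x + pd i g x"])
    show "((\<lambda>t. f (x(i := t)) + g (x(i := t))) has_real_derivative pd i f x + pd i g x) (at (x i))"
      if "i < d" "x \<in> W" for i x
      using that by (intro DERIV_add Ck_DERIV[OF Suc.prems(2)] Ck_DERIV[OF Suc.prems(3)])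
    show "Ck k d W (\<lambda>x. pd i f x + pd i g x)" if "i < d" for i
      by (rule Suc.IH[OF Suc.prems(1) Ck_pd[OF Suc.prems(2) that] Ck_pd[OF Suc.prems(3) that]])
  qed (use Suc.prems Ck_continuous in \<open>auto intro!: continuous_on_add\<close>)
qed

lemma Ck_mult: "openin (top_of_set (Rn d)) W \<Longrightarrow> Ck k d W f \<Longrightarrow> Ck k d W g \<Longrightarrow> Ck k d W (\<lambda>x. f x * g x)"
proof (induction k arbitrary: f g)
  case 0
  then show ?case by (auto intro: continuous_on_mult)
next
  case (Suc k)
  show ?case
  proof (rule Ck_SucI[where g = "\<lambda>i x. pd i f x * g x + pd i g x * f x"])
    show "((\<lambda>t. f (x(i := t)) * g (x(i := t))) has_real_derivative pd i f x * g x + pd i g x * f x) (at (x i))"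
      if "i < d" "x \<in> W" for i x
      using DERIV_mult[OF Ck_DERIV[OF Suc.prems(2) that(2,1)] Ck_DERIV[OF Suc.prems(3) that(2,1)]]
      unfolding fun_upd_triv .
    show "Ck k d W (\<lambda>x. pd i f x * g x + pd i g x * f x)" if "i < d" for i
      by (rule Ck_add[OF Suc.prems(1) Suc.IH[OF Suc.prems(1) Ck_pd[OF Suc.prems(2) that] Ck_Suc_imp[OF Suc.prems(3)]]
        Suc.IH[OF Suc.prems(1) Ck_pd[OF Suc.prems(3) that] Ck_Suc_imp[OF Suc.prems(2)]]])
  qed (use Suc.prems Ck_continuous in \<open>auto intro!: continuous_on_mult\<close>)
qed

lemma Ck_minus:
  assumes "openin (top_of_set (Rn d)) W" "Ck k d W f"
  shows "Ck k d W (\<lambda>x. - f x)"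
  using Ck_mult[OF assms(1) Ck_const[OF assms(1), of k "-1"] assms(2)] by simp

lemma Ck_diff:
  assumes "openin (top_of_set (Rn d)) W" "Ck k d W f" "Ck k d W g"
  shows "Ck k d W (\<lambda>x. f x - g x)"
  using Ck_add[OF assms(1,2) Ck_minus[OF assms(1,3)]] by simp

lemma Ck_sum:
  "openin (top_of_set (Rn d)) W \<Longrightarrow> (\<And>j. j \<in> A \<Longrightarrow> Ck k d W (f j)) \<Longrightarrow> Ck k d W (\<lambda>x. \<Sum>j\<in>A. f j x)"
  by (induction A rule: infinite_finite_induct) (auto intro: Ck_const Ck_add)

lemma Ck_prod:
  "openin (top_of_set (Rn d)) W \<Longrightarrow> (\<And>j. j \<in> A \<Longrightarrow> Ck k d W (f j)) \<Longrightarrow> Ck k d W (\<lambda>x. \<Prod>j\<in>A. f j x)"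
  by (induction A rule: infinite_finite_induct) (auto intro: Ck_const Ck_mult)

lemma Ck_compose:
  "openin (top_of_set (Rn d)) W \<Longrightarrow> diff_upto k T h \<Longrightarrow> Ck k d W f \<Longrightarrow> f ` W \<subseteq> T \<Longrightarrow> Ck k d W (\<lambda>x. h (f x))"
proof (induction k arbitrary: h f)
  case 0
  then show ?case by (auto intro: continuous_on_compose2)
next
  case (Suc k)
  obtain h' where h': "\<And>x. x \<in> T \<Longrightarrow> (h has_real_derivative h' x) (at x)" "diff_upto k T h'"
    using Suc.prems(2) by auto
  show ?case
  proof (rule Ck_SucI[where g = "\<lambda>i x. h' (f x) * pd i f x"])
    show "continuous_on W (\<lambda>x. h (f x))"
      using diff_upto_mono[OF Suc.prems(2), of 0] Ck_continuous[OF Suc.prems(3)] Suc.prems(4)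
      by (auto intro: continuous_on_compose2)
    show "((\<lambda>t. h (f (x(i := t)))) has_real_derivative h' (f x) * pd i f x) (at (x i))"
      if "i < d" "x \<in> W" for i x
    proof (rule DERIV_chain2[of h])
      show "(h has_real_derivative h' (f x)) (at (f (x(i := x i))))"
        using h'(1)[of "f x"] that Suc.prems(4) by auto
    qed (rule Ck_DERIV[OF Suc.prems(3) that(2,1)])
    show "Ck k d W (\<lambda>x. h' (f x) * pd i f x)" if "i < d" for i
      by (rule Ck_mult[OF Suc.prems(1) Suc.IH[OF Suc.prems(1) h'(2) Ck_Suc_imp[OF Suc.prems(3)] Suc.prems(4)]
        Ck_pd[OF Suc.prems(3) that]])
  qed (rule Suc.prems(1))
qed

lemma Ck_compose_smooth1:
  assumes "openin (top_of_set (Rn d)) W" "smooth1 T h" "Ck k d W f" "\<And>x. x \<in> W \<Longrightarrow> f x \<in> T"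
  shows "Ck k d W (\<lambda>x. h (f x))"
  by (rule Ck_compose[OF assms(1) smooth1D[OF assms(2)] assms(3)], rule image_subsetI, rule assms(4))

text \<open>A shear straightens the graph. Since \<open>F\<close> depends only on the first
  \<open>n\<close> coordinates, which the shear fixes, the opposite shear is its inverse, and the
  cylindrical set \<open>W\<close> is preserved.\<close>

lemma graph_submanifold:
  assumes "n \<le> l" and W: "openin (top_of_set (Rn l)) W"
    and W_dep: "\<And>v v'. v \<in> W \<Longrightarrow> v' \<in> Rn l \<Longrightarrow> (\<And>a. a < n \<Longrightarrow> v' a = v a) \<Longrightarrow> v' \<in> W"
    and F_dep: "\<And>a v v'. (\<And>a. a < n \<Longrightarrow> v' a = v a) \<Longrightarrow> F a v' = F a v"
    and F: "\<And>a k. n \<le> a \<Longrightarrow> a < l \<Longrightarrow> Ck k l W (F a)"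
  shows "smooth_submanifold l n {v \<in> W. \<forall>a\<in>{n..<l}. v a = F a v}"
proof -
  define shear where "shear = (\<lambda>(c::real) v. \<lambda>a\<in>{..<l}. if a < n then v a else v a + c * F a v)"
  have WR: "W \<subseteq> Rn l" using W by (simp add: openin_subset_topspace_eq openin_imp_subset)
  have Rn: "shear c v \<in> Rn l" for c v by (auto simp: shear_def Rn_def)
  have low: "shear c v a = v a" if "a < n" for c v a using that assms(1) by (simp add: shear_def)
  have dep: "F a (shear c v) = F a v" for a c v by (rule F_dep) (rule low)
  have inW: "shear c v \<in> W" if "v \<in> W" for c v
    by (rule W_dep[OF that Rn low])
  have inv: "shear (-c) (shear c v) = v" if "v \<in> W" for c v
  proof
    fix a
    show "shear (- c) (shear c v) a = v a"
    proof (cases "a < l")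
      case True
      then show ?thesis by (simp add: shear_def dep[unfolded shear_def])
    next
      case False
      then show ?thesis using that WR by (auto simp: shear_def Rn_def PiE_def extensional_def)
    qed
  qed
  have im: "shear c ` W = W" for c
  proof
    show "shear c ` W \<subseteq> W" using inW by blast
    show "W \<subseteq> shear c ` W"
    proof
      fix v assume v: "v \<in> W"
      have "shear c (shear (-c) v) = v" using inv[OF v, of "-c"] by simp
      with inW[OF v, of "-c"] show "v \<in> shear c ` W" by (metis imageI)
    qed
  qed
  have sm: "smooth_map l l W (shear c)" for c
    unfolding smooth_map_def Ck_map_def
  proof (intro allI impI)
    fix k a assume a: "a < l"
    show "Ck k l W (\<lambda>x. shear c x a)"
    proof (cases "a < n")
      case True
      then show ?thesis using a by (simp add: shear_def Ck_coord[OF W])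
    next
      case False
      then have "(\<lambda>x. shear c x a) = (\<lambda>x. x a + c * F a x)" using a by (simp add: shear_def fun_eq_iff)
      moreover have "Ck k l W (\<lambda>x. x a + c * F a x)"
        using False a by (intro Ck_add[OF W] Ck_coord[OF W] Ck_mult[OF W] Ck_const[OF W] F) auto
      ultimately show ?thesis by simp
    qed
  qed
  have slice: "shear (-1) ` ({v \<in> W. \<forall>a\<in>{n..<l}. v a = F a v} \<inter> W) = {z \<in> W. \<forall>i\<in>{n..<l}. z i = 0}" (is "?L = ?R")
  proof (intro equalityI subsetI)
    fix z assume "z \<in> ?L"
    then show "z \<in> ?R" using inW by (auto simp: shear_def)
  next
    fix z assume z: "z \<in> ?R"
    have "shear 1 z \<in> {v \<in> W. \<forall>a\<in>{n..<l}. v a = F a v} \<inter> W"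
      using z inW[of z 1] dep[of _ 1 z] by (auto simp: shear_def)
    moreover have "z = shear (-1) (shear 1 z)" using inv[of z 1] z by simp
    ultimately show "z \<in> ?L" by blast
  qed
  show ?thesis
    unfolding smooth_submanifold_def
  proof (intro conjI ballI)
    fix y assume "y \<in> {v \<in> W. \<forall>a\<in>{n..<l}. v a = F a v}"
    then have "y \<in> W" by simp
    then show "\<exists>V V' \<Phi> \<Psi>. openin (top_of_set (Rn l)) V \<and> openin (top_of_set (Rn l)) V' \<and> y \<in> V \<and>
        \<Phi> ` V = V' \<and> \<Psi> ` V' = V \<and> (\<forall>x\<in>V. \<Psi> (\<Phi> x) = x) \<and> (\<forall>z\<in>V'. \<Phi> (\<Psi> z) = z) \<and>
        smooth_map l l V \<Phi> \<and> smooth_map l l V' \<Psi> \<and>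
        \<Phi> ` ({v \<in> W. \<forall>a\<in>{n..<l}. v a = F a v} \<inter> V) = {z \<in> V'. \<forall>i\<in>{n..<l}. z i = 0}"
      using W \<open>y \<in> W\<close> im sm slice inv[of _ "-1"] inv[of _ 1]
      by (intro exI[of _ W] exI[of _ "shear (-1)"] exI[of _ "shear 1"] conjI ballI) (simp_all only: minus_minus)
  qed (use assms(1) WR in auto)
qed

section \<open>Euclidean balls about the origin\<close>

abbreviation oball :: "nat \<Rightarrow> real \<Rightarrow> (nat \<Rightarrow> real) set" where
  "oball m R \<equiv> vball m (origin m) R"

abbreviation punct :: "nat \<Rightarrow> real \<Rightarrow> (nat \<Rightarrow> real) set" where
  "punct m R \<equiv> oball m R - {origin m}"

lemma vnorm_nonneg: "0 \<le> vnorm m x" by (simp add: vnorm_def)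

lemma vnorm_sq: "(vnorm m x)\<^sup>2 = (\<Sum>j<m. (x j)\<^sup>2)"
  by (simp add: vnorm_def L2_set_def sum_nonneg)

lemma vnorm_cong: "(\<And>i. i < m \<Longrightarrow> x i = y i) \<Longrightarrow> vnorm m x = vnorm m y"
  by (auto simp: vnorm_def intro!: L2_set_cong)

lemma vball_origin: "oball m r = {x \<in> Rn m. vnorm m x < r}"
proof -
  have "vnorm m (vdiff m x (origin m)) = vnorm m x" for x
    by (rule vnorm_cong) (simp add: vdiff_def origin_def)
  then show ?thesis by (simp add: vball_def)
qed

lemma vnorm_component: "j < m \<Longrightarrow> \<bar>x j\<bar> \<le> vnorm m x"
  by (rule power2_le_imp_le) (auto simp: vnorm_sq vnorm_nonneg intro!: member_le_sum[of j _ "\<lambda>j. (x j)\<^sup>2"])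

lemma origin_in: "origin m \<in> Rn m" by (simp add: origin_def Rn_def)

lemma Rn_eqI: "x \<in> Rn m \<Longrightarrow> y \<in> Rn m \<Longrightarrow> (\<And>i. i < m \<Longrightarrow> x i = y i) \<Longrightarrow> x = y"
  by (auto simp: Rn_def intro: PiE_ext)

lemma vnorm_eq_0: "x \<in> Rn m \<Longrightarrow> vnorm m x = 0 \<longleftrightarrow> x = origin m"
  by (auto simp: vnorm_def L2_set_eq_0_iff origin_def intro: Rn_eqI[OF _ origin_in] intro!: Rn_eqI[of x m, OF _ origin_in, unfolded origin_def])

lemma vnorm_pos: "x \<in> Rn m \<Longrightarrow> x \<noteq> origin m \<Longrightarrow> vnorm m x > 0"
  using vnorm_eq_0[of x m] vnorm_nonneg[of m x] by linarith

lemma continuous_vnorm: "continuous_on A (vnorm m)"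
  unfolding vnorm_def[abs_def] L2_set_def
  by (intro continuous_intros continuous_on_subset[OF continuous_on_product_coordinates]) auto

lemma openin_vball: "openin (top_of_set (Rn m)) (oball m r)"
proof -
  have "open {x. vnorm m x < r}"
    by (rule open_Collect_less) (auto intro: continuous_vnorm)
  then show ?thesis unfolding vball_origin openin_open by blast
qed

lemma openin_punctured: "openin (top_of_set (Rn m)) (punct m r)"
proof -
  have "open ({x. vnorm m x < r} \<inter> {x. 0 < vnorm m x})"
    by (intro open_Int open_Collect_less) (auto intro: continuous_vnorm)
  moreover have "punct m r = Rn m \<inter> ({x. vnorm m x < r} \<inter> {x. 0 < vnorm m x})"
    unfolding vball_origin using vnorm_pos vnorm_eq_0[of _ m] by force
  ultimately show ?thesis unfolding openin_open by blast
qed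

text \<open>Radial functions are written as functions of ln |x|, so that dilations become
  translations; their regularity off the origin rests on this fact.\<close>

lemma Ck_ln_vnorm:
  assumes "openin (top_of_set (Rn m)) W" "\<And>x. x \<in> W \<Longrightarrow> x \<noteq> origin m"
  shows "Ck k m W (\<lambda>x. ln (vnorm m x))"
proof -
  have W: "x \<in> Rn m" if "x \<in> W" for x using assms(1) that openin_imp_subset by blast
  have "Ck k m W (\<lambda>x. 1 / 2 * ln (\<Sum>j<m. x j * x j))"
  proof (intro Ck_mult Ck_const assms(1) Ck_compose_smooth1[OF _ smooth1_ln] Ck_sum Ck_coord)
    fix x assume x: "x \<in> W"
    have "(vnorm m x)\<^sup>2 > 0" using vnorm_pos[OF W[OF x] assms(2)[OF x]] by simp
    then show "(\<Sum>j<m. x j * x j) \<in> {0<..}" by (simp add: vnorm_sq) (simp add: power2_eq_square)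
  qed
  moreover have "1 / 2 * ln (\<Sum>j<m. x j * x j) = ln (vnorm m x)" if "x \<in> W" for x
  proof -
    have "ln ((vnorm m x)\<^sup>2) = 2 * ln (vnorm m x)"
      using vnorm_pos[OF W[OF that] assms(2)[OF that]] by (simp add: ln_realpow)
    then have "ln (\<Sum>j<m. (x j)\<^sup>2) = 2 * ln (vnorm m x)" by (simp only: vnorm_sq)
    then show ?thesis by (simp add: power2_eq_square)
  qed
  ultimately show ?thesis
    using Ck_cong[OF assms(1), of "\<lambda>x. 1 / 2 * ln (\<Sum>j<m. x j * x j)" "\<lambda>x. ln (vnorm m x)" k] by simp
qed

lemma DERIV_ln_vnorm:
  assumes "x \<in> Rn m" "x \<noteq> origin m" "i < m"
  shows "((\<lambda>t. ln (vnorm m (x(i := t)))) has_real_derivative x i / (vnorm m x)\<^sup>2) (at (x i))"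
proof -
  have pos: "vnorm m x > 0" using assms vnorm_pos by blast
  have upd: "(\<Sum>j<m. ((x(i := t)) j)\<^sup>2) = (\<Sum>j\<in>{..<m}-{i}. (x j)\<^sup>2) + t\<^sup>2" for t
    using assms(3) by (subst sum.remove[of _ i]) auto
  have "((\<lambda>t. (\<Sum>j\<in>{..<m}-{i}. (x j)\<^sup>2) + t\<^sup>2) has_real_derivative 2 * x i) (at (x i))"
    by (auto intro!: derivative_eq_intros)
  then have "((\<lambda>t. (\<Sum>j<m. ((x(i := t)) j)\<^sup>2)) has_real_derivative 2 * x i) (at (x i))"
    unfolding upd .
  moreover have "(\<Sum>j<m. ((x(i := x i)) j)\<^sup>2) = (vnorm m x)\<^sup>2" by (simp add: vnorm_sq)
  moreover have "((\<lambda>t. ln (sqrt (h t))) has_real_derivative D / 2 / N\<^sup>2) (at y)"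
    if "(h has_real_derivative D) (at y)" "h y = N\<^sup>2" "N > 0" for h D y and N :: real
    using that by (auto intro!: derivative_eq_intros simp: field_simps power2_eq_square)
  ultimately have "((\<lambda>t. ln (sqrt (\<Sum>j<m. ((x(i := t)) j)\<^sup>2))) has_real_derivative (2 * x i) / 2 / (vnorm m x)\<^sup>2) (at (x i))"
    using pos by blast
  then show ?thesis by (simp only: vnorm_def L2_set_def) simp
qed

section \<open>Lebesgue measure on balls\<close>

abbreviation lebP :: "nat set \<Rightarrow> (nat \<Rightarrow> real) measure" where
  "lebP I \<equiv> PiM I (\<lambda>_. lborel)"

interpretation lborel_prod: product_sigma_finite "\<lambda>_::nat. lborel :: real measure" by standard

lemma space_lebP: "space (lebP {..<m}) = Rn m"
  by (simp add: space_PiM Rn_def)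

text \<open>The product sigma-algebra on finitely many coordinates is compared with the Borel sets
  of all functions; coordinates beyond \<open>m\<close> are constantly \<open>undefined\<close> and
  hence measurable.\<close>

lemma lebP_id_measurable: "(\<lambda>x. x) \<in> measurable (lebP {..<m}) borel"
proof (rule measurable_coordinatewise_then_product)
  fix i
  show "(\<lambda>x. x i) \<in> borel_measurable (lebP {..<m})"
  proof (cases "i < m")
    case True
    then show ?thesis by (intro measurable_compose[OF measurable_component_singleton[of i]]) auto
  next
    case False
    then have "(\<lambda>x. x i) \<in> borel_measurable (lebP {..<m}) \<longleftrightarrow> (\<lambda>x. undefined :: real) \<in> borel_measurable (lebP {..<m})"
      by (intro measurable_cong) (auto simp: space_PiM PiE_def extensional_def)
    then show ?thesis by simp
  qed
qed

lemma borel_in_lebP: "B \<in> sets borel \<Longrightarrow> B \<subseteq> Rn m \<Longrightarrow> B \<in> sets (lebP {..<m})"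
proof -
  assume B: "B \<in> sets borel" "B \<subseteq> Rn m"
  have "(\<lambda>x. x) -` B \<inter> space (lebP {..<m}) \<in> sets (lebP {..<m})"
    by (rule measurable_sets[OF lebP_id_measurable B(1)])
  moreover have "(\<lambda>x. x) -` B \<inter> space (lebP {..<m}) = B" using B(2) by (auto simp: space_lebP)
  ultimately show ?thesis by simp
qed

lemma closed_Rn: "closed (Rn m)"
proof -
  have "Rn m = (\<Inter>i\<in>{m..}. {x. x i = undefined})"
    by (auto simp: Rn_def PiE_def extensional_def)
  moreover have "closed {x :: nat \<Rightarrow> real. x i = undefined}" for i
    by (intro closed_Collect_eq continuous_on_product_coordinates continuous_intros)
  ultimately show ?thesis by auto
qed

lemma openin_borel: "openin (top_of_set (Rn m)) W \<Longrightarrow> W \<in> sets borel"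
  using closed_Rn by (auto simp: openin_open)

lemma continuous_on_lebP_measurable:
  assumes "continuous_on W f" "openin (top_of_set (Rn m)) W"
  shows "(\<lambda>x. indicator W x * f x :: real) \<in> borel_measurable (lebP {..<m})"
proof -
  have "(\<lambda>x. indicator W x *\<^sub>R f x) \<in> borel_measurable borel"
    by (rule borel_measurable_continuous_on_indicator[OF openin_borel[OF assms(2)] assms(1)])
  from measurable_compose[OF lebP_id_measurable this] show ?thesis by simp
qed

lemma vnorm_measurable: "vnorm m \<in> borel_measurable (lebP {..<m})"
  using continuous_on_lebP_measurable[OF continuous_vnorm[of "Rn m"]]
  by (subst measurable_cong[of _ _ "\<lambda>x. indicator (Rn m) x * vnorm m x"]) (auto simp: space_lebP)

lemma AE_coord_nonzero:
  assumes "finite I" "i \<in> I"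
  shows "AE x in lebP I. x i \<noteq> 0"
proof -
  let ?A = "\<lambda>j. if j = i then {0::real} else UNIV"
  have "emeasure (lebP I) (PiE I ?A) = (\<Prod>j\<in>I. emeasure lborel (?A j))"
    using assms by (intro lborel_prod.emeasure_PiM) auto
  also have "\<dots> = 0" using assms by (auto simp: prod_zero_iff intro!: bexI[of _ i])
  finally have "PiE I ?A \<in> null_sets (lebP I)"
    using assms by (intro null_setsI sets_PiM_I_finite) auto
  then show ?thesis
    by (rule AE_I'[rotated 1, OF _ , rotated]) (use assms in \<open>auto simp: space_PiM PiE_def\<close>)
qed

definition lebball :: "nat \<Rightarrow> real \<Rightarrow> (nat \<Rightarrow> real) measure" where
  "lebball m R = restrict_space (leb m) (oball m R)"

lemma vball_Rn: "oball m R \<subseteq> Rn m" by (auto simp: vball_def)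

lemma space_leb: "space (leb m) = Rn m" by (simp add: leb_def space_lebP)

lemma sets_leb_borel: "B \<in> sets borel \<Longrightarrow> B \<subseteq> Rn m \<Longrightarrow> B \<in> sets (leb m)"
  using borel_in_lebP by (auto simp: leb_def)

lemma vball_sets [measurable]: "oball m R \<in> sets (leb m)"
  by (intro sets_leb_borel openin_borel[OF openin_vball] vball_Rn)

lemma space_lebball: "space (lebball m R) = oball m R"
  using vball_Rn by (auto simp: lebball_def space_restrict_space space_leb)

lemma lebball_set_integrable:
  "set_integrable (leb m) (oball m R) f \<longleftrightarrow> integrable (lebball m R) f" for f :: "_ \<Rightarrow> real"
  unfolding lebball_def set_integrable_def
  by (subst integrable_restrict_space) (auto simp: vball_Rn space_leb Int_absorb2 simp flip: Int_absorb2[OF sets.sets_into_space])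

lemma lebball_integral:
  "(LINT x:oball m R|leb m. f x) = integral\<^sup>L (lebball m R) f" for f :: "_ \<Rightarrow> real"
  unfolding lebball_def set_lebesgue_integral_def
  by (subst integral_restrict_space) (auto simp: sets.Int_space_eq2)

lemma lebball_AE:
  "(AE x in lebball m R. P x) \<longleftrightarrow> (AE x in leb m. x \<in> oball m R \<longrightarrow> P x)"
  unfolding lebball_def by (rule AE_restrict_space_iff) (auto simp: sets.Int_space_eq2)

lemma lebball_measurable:
  "set_borel_measurable (leb m) (oball m R) f \<longleftrightarrow> f \<in> borel_measurable (lebball m R)" for f :: "_ \<Rightarrow> real"
  unfolding lebball_def set_borel_measurable_def
  by (subst borel_measurable_restrict_space_iff) (auto simp: sets.Int_space_eq2)

lemma lebP_measurable_lebball: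
  "f \<in> borel_measurable (lebP {..<m}) \<Longrightarrow> f \<in> borel_measurable (lebball m R)" for f :: "_ \<Rightarrow> real"
  unfolding lebball_def leb_def by (intro measurable_restrict_space1 measurable_completion)

lemma lebball_continuous_measurable:
  fixes f :: "(nat \<Rightarrow> real) \<Rightarrow> real"
  assumes "continuous_on (punct m R) f"
  shows "f \<in> borel_measurable (lebball m R)"
proof -
  have "(\<lambda>x. indicator (punct m R) x * f x) \<in> borel_measurable (lebball m R)"
    by (intro lebP_measurable_lebball continuous_on_lebP_measurable assms openin_punctured)
  moreover have "(\<lambda>x. indicator {origin m} x :: real) \<in> borel_measurable (lebball m R)"
  proof (rule lebP_measurable_lebball)
    show "(\<lambda>x. indicator {origin m} x :: real) \<in> borel_measurable (lebP {..<m})"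
      by (intro borel_measurable_indicator borel_in_lebP) (auto simp: origin_in)
  qed
  ultimately have "(\<lambda>x. indicator (punct m R) x * f x + f (origin m) * indicator {origin m} x) \<in> borel_measurable (lebball m R)"
    by measurable
  then show ?thesis
    by (rule measurable_cong[THEN iffD1, rotated]) (auto simp: space_lebball indicator_def)
qed

lemma AE_leb_nonzero: "m > 0 \<Longrightarrow> AE x in leb m. x \<noteq> origin m"
proof -
  assume "m > 0"
  then have "AE x in lebP {..<m}. x 0 \<noteq> 0" by (intro AE_coord_nonzero) auto
  then have "AE x in leb m. x 0 \<noteq> 0" unfolding leb_def by (rule AE_completion)
  then show ?thesis by eventually_elim (use \<open>m > 0\<close> in \<open>auto simp: origin_def\<close>)
qed

lemma AE_lebball_nonzero: "m > 0 \<Longrightarrow> AE x in lebball m R. x \<noteq> origin m"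
  unfolding lebball_AE using AE_leb_nonzero[of m] by auto

lemma AE_lebball_punct: "m > 0 \<Longrightarrow> AE x in lebball m R. x \<in> punct m R"
  using AE_lebball_nonzero[of m R] AE_space[of "lebball m R"] by (auto simp: space_lebball)

lemma emeasure_vball: "emeasure (leb m) (oball m R) < \<infinity>"
proof -
  have "emeasure (leb m) (oball m R) = emeasure (lebP {..<m}) (oball m R)"
    unfolding leb_def by (simp add: borel_in_lebP openin_borel[OF openin_vball] vball_Rn)
  also have "\<dots> \<le> emeasure (lebP {..<m}) (PiE {..<m} (\<lambda>_. {-R..R}))"
  proof (rule emeasure_mono)
    show "oball m R \<subseteq> PiE {..<m} (\<lambda>_. {-R..R})"
    proof
      fix x assume x: "x \<in> oball m R"
      have "x i \<in> {-R..R}" if "i < m" for i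
        using vnorm_component[OF that, of x] x by (auto simp: vball_origin)
      then show "x \<in> PiE {..<m} (\<lambda>_. {-R..R})" using x by (auto simp: vball_origin Rn_def PiE_iff)
    qed
  qed (auto intro: sets_PiM_I_finite)
  also have "\<dots> = (\<Prod>j<m. emeasure lborel {-R..R})"
    by (intro lborel_prod.emeasure_PiM) auto
  also have "\<dots> < \<infinity>" by (simp add: emeasure_lborel_Icc_eq power_less_top_ennreal)
  finally show ?thesis .
qed

lemma finite_lebball: "finite_measure (lebball m R)"
proof (rule finite_measureI)
  show "emeasure (lebball m R) (space (lebball m R)) \<noteq> \<infinity>"
    using emeasure_vball[of m R] unfolding space_lebball unfolding lebball_def
    by (subst emeasure_restrict_space) (auto simp: sets.Int_space_eq2)
qed

lemma lebball_const_integrable: "integrable (lebball m R) (\<lambda>x. c :: real)"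
  by (rule finite_measure.integrable_const[OF finite_lebball])

lemma powr_integrable_interval:
  assumes "0 \<le> \<gamma>" "\<gamma> < 1"
  shows "integrable lborel (\<lambda>y::real. indicator {-R..R} y * \<bar>y\<bar> powr (- \<gamma>))"
proof -
  have pos: "integrable lborel (\<lambda>y::real. indicator {0..\<bar>R\<bar>} y * y powr (- \<gamma>))"
  proof -
    have "(\<lambda>y::real. y powr (- \<gamma>)) integrable_on {0..\<bar>R\<bar>}"
      using assms by (intro integrable_on_powr_from_0) auto
    then have "(\<lambda>y::real. y powr (- \<gamma>)) absolutely_integrable_on {0..\<bar>R\<bar>}"
      by (intro nonnegative_absolutely_integrable_1) auto
    then have "integrable lebesgue (\<lambda>y::real. indicator {0..\<bar>R\<bar>} y * y powr (- \<gamma>))"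
      by (simp add: set_integrable_def)
    then show ?thesis by (subst (asm) integrable_completion) auto
  qed
  have neg: "integrable lborel (\<lambda>y::real. indicator {0..\<bar>R\<bar>} (- y) * (- y) powr (- \<gamma>))"
    using lborel_integrable_real_affine[OF pos, of "-1" 0] by simp
  show ?thesis
  proof (rule Bochner_Integration.integrable_bound[OF Bochner_Integration.integrable_add[OF pos neg]])
    show "AE x in lborel. norm (indicator {-R..R} x * \<bar>x\<bar> powr (- \<gamma>) :: real) \<le>
      norm (indicator {0..\<bar>R\<bar>} x * x powr (- \<gamma>) + indicator {0..\<bar>R\<bar>} (- x) * (- x) powr (- \<gamma>))"
      by (intro AE_I2) (auto simp: indicator_def abs_if)
  qed auto
qed

text \<open>In place of polar coordinates, |x i| \<le> |x| bounds |x|^(-\<beta>) by the product of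
  the |x i|^(-\<beta> / m), and each factor is integrable because \<beta> / m < 1.\<close>

lemma vnorm_powr_integrable:
  assumes "0 \<le> \<beta>" "\<beta> < m"
  shows "integrable (lebball m R) (\<lambda>x. vnorm m x powr (- \<beta>))"
proof -
  have m: "m > 0" using assms by auto
  let ?g = "\<lambda>y::real. indicator {-R..R} y * \<bar>y\<bar> powr (- (\<beta> / m))"
  have int: "integrable (lebP {..<m}) (\<lambda>x. \<Prod>i<m. ?g (x i))"
    using assms by (intro lborel_prod.product_integrable_prod powr_integrable_interval) (auto simp: field_simps)
  have vm: "oball m R \<in> sets (lebP {..<m})"
    by (intro borel_in_lebP openin_borel[OF openin_vball] vball_Rn)
  \<comment> \<open>The coordinate hyperplanes are removed because \<open>0 powr\<close> any
    exponent is 0, which would break the comparison.\<close>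
  have "AE x in lebP {..<m}. \<forall>i\<in>{..<m}. x i \<noteq> 0"
    by (intro AE_finite_allI AE_coord_nonzero) auto
  then have bound: "AE x in lebP {..<m}. norm (indicator (oball m R) x * vnorm m x powr (- \<beta>)) \<le> norm (\<Prod>i<m. ?g (x i))"
  proof eventually_elim
    case (elim x)
    show ?case
    proof (cases "x \<in> oball m R")
      case True
      then have x: "vnorm m x < R" by (simp add: vball_origin)
      have "vnorm m x > 0" using elim m vnorm_component[of 0 m x] by (auto intro: less_le_trans[of 0 "\<bar>x 0\<bar>"])
      then have "vnorm m x powr (- \<beta>) = (\<Prod>i<m. vnorm m x powr (- (\<beta> / m)))"
        using m by (simp add: powr_realpow[symmetric] powr_powr)
      also have "\<dots> \<le> (\<Prod>i<m. ?g (x i))"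
      proof (rule prod_mono, intro conjI)
        fix i assume i: "i \<in> {..<m}"
        then have "\<bar>x i\<bar> \<le> vnorm m x" "0 < \<bar>x i\<bar>" using vnorm_component[of i m x] elim by auto
        moreover from this x have "x i \<in> {-R..R}" by auto
        ultimately show "vnorm m x powr (- (\<beta> / m)) \<le> ?g (x i)"
          using assms by (auto intro!: powr_mono2')
      qed auto
      finally show ?thesis using True by (simp add: prod_nonneg)
    qed auto
  qed
  have "integrable (lebP {..<m}) (\<lambda>x. indicator (oball m R) x * vnorm m x powr (- \<beta>))"
    by (rule Bochner_Integration.integrable_bound[OF int _ bound])
      (intro borel_measurable_times borel_measurable_indicator vm powr_real_measurable vnorm_measurable borel_measurable_const)
  then have "integrable (leb m) (\<lambda>x. indicator (oball m R) x * vnorm m x powr (- \<beta>))"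
    unfolding leb_def by (subst integrable_completion) auto
  then show ?thesis by (simp flip: lebball_set_integrable add: set_integrable_def)
qed

section \<open>Integration by parts\<close>

text \<open>Fubini and the fundamental theorem on lines in direction \<open>i\<close>. Almost every
  such line misses the origin, because some other coordinate is nonzero on it; this uses m \<ge>
  2.\<close>

lemma line_integral_zero:
  fixes \<psi> \<psi>' :: "(nat \<Rightarrow> real) \<Rightarrow> real"
  assumes m: "m \<ge> 2" "i < m" and int: "integrable (lebP {..<m}) \<psi>'"
    and deriv: "\<And>x. x \<in> Rn m \<Longrightarrow> x \<noteq> origin m \<Longrightarrow> ((\<lambda>t. \<psi> (x(i := t))) has_real_derivative \<psi>' x) (at (x i))"
    and supp: "\<And>x. x \<in> Rn m \<Longrightarrow> R \<le> \<bar>x i\<bar> \<Longrightarrow> \<psi> x = 0 \<and> \<psi>' x = 0"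
  shows "integral\<^sup>L (lebP {..<m}) \<psi>' = 0"
proof -
  define I where "I = {..<m} - {i}"
  have I: "finite I" "i \<notin> I" "insert i I = {..<m}" using m by (auto simp: I_def)
  obtain j where j: "j \<in> I"
    using m by (cases "i = 0") (auto simp: I_def intro: that[of 0] that[of 1])
  have "integral\<^sup>L (lebP {..<m}) \<psi>' = (\<integral>x. (\<integral>y. \<psi>' (x(i := y)) \<partial>lborel) \<partial>lebP I)"
    using lborel_prod.product_integral_insert[OF I(1,2), of \<psi>'] int I(3) by simp
  also have "\<dots> = 0"
  proof (rule integral_eq_zero_AE)
    have "AE x in lebP I. x \<in> space (lebP I)" by (rule AE_space)
    with AE_coord_nonzero[OF I(1) j] show "AE x in lebP I. (\<integral>y. \<psi>' (x(i := y)) \<partial>lborel) = 0"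
    proof eventually_elim
      case (elim x)
      have xR: "x(i := y) \<in> Rn m" for y
        using elim(2) I(3) by (auto simp: space_PiM Rn_def PiE_def extensional_def)
      have x0: "x(i := y) \<noteq> origin m" for y
      proof
        assume "x(i := y) = origin m"
        then have "(x(i := y)) j = origin m j" by simp
        then show False using elim(1) j I by (auto simp: I_def origin_def)
      qed
      show ?case
      proof (cases "integrable lborel (\<lambda>y. \<psi>' (x(i := y)))")
        case True
        define S where "S = max R 0"
        have "((\<lambda>y. \<psi>' (x(i := y))) has_integral (\<integral>y. \<psi>' (x(i := y)) \<partial>lborel)) UNIV"
          by (rule has_integral_integral_lborel[OF True])
        moreover have "((\<lambda>y. \<psi>' (x(i := y))) has_integral (\<psi> (x(i := S)) - \<psi> (x(i := -S)))) {-S..S}"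
        proof (rule fundamental_theorem_of_calculus)
          fix y assume "y \<in> {-S..S}"
          have "((\<lambda>t. \<psi> (x(i := t))) has_real_derivative \<psi>' (x(i := y))) (at y)"
            using deriv[OF xR[of y] x0[of y]] by simp
          then show "((\<lambda>t. \<psi> (x(i := t))) has_vector_derivative \<psi>' (x(i := y))) (at y within {-S..S})"
            by (simp add: has_real_derivative_iff_has_vector_derivative has_vector_derivative_at_within)
        qed (simp add: S_def)
        moreover have "\<psi> (x(i := S)) = 0" "\<psi> (x(i := -S)) = 0"
          using supp[OF xR[of S]] supp[OF xR[of "-S"]] by (auto simp: S_def)
        ultimately have 1: "((\<lambda>y. \<psi>' (x(i := y))) has_integral (\<integral>y. \<psi>' (x(i := y)) \<partial>lborel)) UNIV"
          and 2: "((\<lambda>y. \<psi>' (x(i := y))) has_integral 0) {-S..S}" by simp_all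
        from 2 have "((\<lambda>y. \<psi>' (x(i := y))) has_integral 0) UNIV"
        proof (rule has_integral_on_superset)
          fix y assume "y \<notin> {-S..S}"
          then have "R \<le> \<bar>(x(i := y)) i\<bar>" by (auto simp: S_def)
          with supp[OF xR[of y]] show "\<psi>' (x(i := y)) = 0" by auto
        qed auto
        with 1 show ?thesis by (rule has_integral_unique)
      \<comment> \<open>On a line where the integrand is not integrable the Bochner integral is 0 by
        convention.\<close>
      qed (rule not_integrable_integral_eq)
    qed
  qed
  finally show ?thesis .
qed

text \<open>Only one derivative is kept, because compositions of test maps with the functions of the
  chain rule below are followed only to that order.\<close>

definition C1c :: "nat \<Rightarrow> (nat \<Rightarrow> real) set \<Rightarrow> ((nat \<Rightarrow> real) \<Rightarrow> real) \<Rightarrow> bool" where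
  "C1c m \<Omega> f \<longleftrightarrow> Ck 1 m (Rn m) f \<and> (\<exists>K. compact K \<and> K \<subseteq> \<Omega> \<and> (\<forall>x\<in>Rn m - K. f x = 0))"

lemma test_fun_C1c: "test_fun m \<Omega> f \<Longrightarrow> C1c m \<Omega> f"
  by (auto simp: test_fun_def C1c_def)

lemma openin_Rn: "openin (top_of_set (Rn m)) (Rn m)"
  by (simp add: openin_subtopology_self)

lemma compact_compl_openin: "compact K \<Longrightarrow> openin (top_of_set (Rn m)) (Rn m - K)"
  by (metis compact_imp_closed Diff_eq open_Compl openin_open_Int)

lemma C1c_pd_zero:
  assumes "compact K" "\<forall>x\<in>Rn m - K. f x = 0" "x \<in> Rn m - K" "i < m"
  shows "pd i f x = 0" "((\<lambda>t. f (x(i := t))) has_real_derivative 0) (at (x i))"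
  using line_cong(1)[OF compact_compl_openin[OF assms(1)] assms(3,4), of f "\<lambda>_. 0" 0]
     line_cong(2)[OF compact_compl_openin[OF assms(1)] assms(3,4), of f "\<lambda>_. 0"] assms(2)
  by (auto simp: pd_def)

lemma C1c_bounded:
  assumes "C1c m \<Omega> f" "\<Omega> \<subseteq> Rn m"
  shows "\<exists>B. \<forall>x\<in>Rn m. \<bar>f x\<bar> \<le> B \<and> (\<forall>i<m. \<bar>pd i f x\<bar> \<le> B)"
proof -
  obtain K where K: "compact K" "K \<subseteq> \<Omega>" "\<forall>x\<in>Rn m - K. f x = 0" and f: "Ck 1 m (Rn m) f"
    using assms by (auto simp: C1c_def)
  have KR: "K \<subseteq> Rn m" using K assms by blast
  have "continuous_on K (\<lambda>x. \<bar>f x\<bar> + (\<Sum>i<m. \<bar>pd i f x\<bar>))"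
    using f KR by (intro continuous_intros) (auto intro: continuous_on_subset)
  then have "bounded ((\<lambda>x. \<bar>f x\<bar> + (\<Sum>i<m. \<bar>pd i f x\<bar>)) ` K)"
    using K(1) by (intro compact_imp_bounded compact_continuous_image)
  then obtain B where B: "\<And>x. x \<in> K \<Longrightarrow> \<bar>f x\<bar> + (\<Sum>i<m. \<bar>pd i f x\<bar>) \<le> B"
    unfolding bounded_iff by (auto simp: abs_le_iff)
  have "\<bar>f x\<bar> \<le> max B 0 \<and> (\<forall>i<m. \<bar>pd i f x\<bar> \<le> max B 0)" if x: "x \<in> Rn m" for x
  proof (cases "x \<in> K")
    case True
    have "\<bar>pd i f x\<bar> \<le> (\<Sum>i<m. \<bar>pd i f x\<bar>)" if "i < m" for i
      using that by (intro member_le_sum) auto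
    moreover have "0 \<le> (\<Sum>i<m. \<bar>pd i f x\<bar>)" by (simp add: sum_nonneg)
    ultimately show ?thesis using B[OF True] abs_ge_zero[of "f x"] by (fastforce intro: order_trans[of _ B])
  next
    case False
    then show ?thesis using C1c_pd_zero(1)[OF K(1,3)] K(3) x by auto
  qed
  then show ?thesis by blast
qed

text \<open>A singularity of order below \<open>m\<close> leaves no boundary term at the origin,
  because almost all lines miss it. Integrability of both products comes from that of
  |x|^(-\<beta>).\<close>

lemma integration_by_parts:
  fixes f \<phi> :: "(nat \<Rightarrow> real) \<Rightarrow> real"
  assumes m: "m \<ge> 2" "i < m" and \<beta>: "0 \<le> \<beta>" "\<beta> < m"
    and f: "Ck 1 m (punct m R) f"
    and bound: "\<And>x. x \<in> oball m R \<Longrightarrow> x \<noteq> origin m \<Longrightarrow> \<bar>f x\<bar> \<le> C * vnorm m x powr (- \<beta>)"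
      "\<And>x. x \<in> oball m R \<Longrightarrow> x \<noteq> origin m \<Longrightarrow> \<bar>pd i f x\<bar> \<le> C * vnorm m x powr (- \<beta>)"
    and \<phi>: "C1c m (oball m R) \<phi>"
  shows "integrable (lebball m R) (\<lambda>x. f x * pd i \<phi> x)" "integrable (lebball m R) (\<lambda>x. pd i f x * \<phi> x)"
    "integral\<^sup>L (lebball m R) (\<lambda>x. f x * pd i \<phi> x) = - integral\<^sup>L (lebball m R) (\<lambda>x. pd i f x * \<phi> x)" (is ?PA)
proof -
  let ?B = "oball m R" and ?W = "punct m R"
  obtain K where K: "compact K" "K \<subseteq> ?B" "\<forall>x\<in>Rn m - K. \<phi> x = 0" and \<phi>1: "Ck 1 m (Rn m) \<phi>"
    using \<phi> by (auto simp: C1c_def)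
  obtain Q where Q: "\<And>x. x \<in> Rn m \<Longrightarrow> \<bar>\<phi> x\<bar> \<le> Q" "\<And>x. x \<in> Rn m \<Longrightarrow> \<bar>pd i \<phi> x\<bar> \<le> Q"
    using C1c_bounded[OF \<phi> vball_Rn] m(2) by blast
  have cont: "continuous_on ?W f" "continuous_on ?W (pd i f)" "continuous_on ?W \<phi>" "continuous_on ?W (pd i \<phi>)"
  proof -
    have sub: "?W \<subseteq> Rn m" using vball_Rn by blast
    show "continuous_on ?W f" "continuous_on ?W (pd i f)" using f m(2) by auto
    have "continuous_on (Rn m) \<phi>" "continuous_on (Rn m) (pd i \<phi>)" using \<phi>1 m(2) by auto
    then show "continuous_on ?W \<phi>" "continuous_on ?W (pd i \<phi>)" using sub continuous_on_subset by blast+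
  qed
  have AEb: "AE x in lebball m R. x \<in> ?W"
    using m by (intro AE_lebball_punct) auto
  have nn: "0 \<le> C * vnorm m x powr (- \<beta>)" if "x \<in> ?W" for x
    using bound(1)[of x] that by (auto intro: order_trans[OF abs_ge_zero])
  have int: "integrable (lebball m R) (\<lambda>x. (C * Q) * vnorm m x powr (- \<beta>))"
    by (intro integrable_mult_right vnorm_powr_integrable \<beta>)
  show i1: "integrable (lebball m R) (\<lambda>x. f x * pd i \<phi> x)"
  proof (rule Bochner_Integration.integrable_bound[OF int])
    show "(\<lambda>x. f x * pd i \<phi> x) \<in> borel_measurable (lebball m R)"
      by (intro lebball_continuous_measurable continuous_on_mult cont)
    show "AE x in lebball m R. norm (f x * pd i \<phi> x) \<le> norm (C * Q * vnorm m x powr (- \<beta>))"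
      using AEb
    proof eventually_elim
      case (elim x)
      then have "\<bar>f x\<bar> * \<bar>pd i \<phi> x\<bar> \<le> (C * vnorm m x powr (- \<beta>)) * Q"
        using nn vball_Rn by (intro mult_mono bound Q) auto
      then have "\<bar>f x * pd i \<phi> x\<bar> \<le> C * Q * vnorm m x powr (- \<beta>)" by (simp add: abs_mult mult_ac)
      then show ?case unfolding real_norm_def by (rule order_trans[OF _ abs_ge_self])
    qed
  qed
  show i2: "integrable (lebball m R) (\<lambda>x. pd i f x * \<phi> x)"
  proof (rule Bochner_Integration.integrable_bound[OF int])
    show "(\<lambda>x. pd i f x * \<phi> x) \<in> borel_measurable (lebball m R)"
      by (intro lebball_continuous_measurable continuous_on_mult cont)
    show "AE x in lebball m R. norm (pd i f x * \<phi> x) \<le> norm (C * Q * vnorm m x powr (- \<beta>))"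
      using AEb
    proof eventually_elim
      case (elim x)
      then have "\<bar>pd i f x\<bar> * \<bar>\<phi> x\<bar> \<le> (C * vnorm m x powr (- \<beta>)) * Q"
        using nn vball_Rn by (intro mult_mono bound Q) auto
      then have "\<bar>pd i f x * \<phi> x\<bar> \<le> C * Q * vnorm m x powr (- \<beta>)" by (simp add: abs_mult mult_ac)
      then show ?case unfolding real_norm_def by (rule order_trans[OF _ abs_ge_self])
    qed
  qed
  \<comment> \<open>The product extended by zero: on the support of \<phi> the product rule holds,
    off the support everything vanishes, and only the origin is excluded.\<close>
  define \<psi> \<psi>' where "\<psi> = (\<lambda>x. indicator ?W x * (f x * \<phi> x))"
    and "\<psi>' = (\<lambda>x. indicator ?W x * (f x * pd i \<phi> x + pd i f x * \<phi> x))"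
  have "integrable (lebball m R) (\<lambda>x. f x * pd i \<phi> x + pd i f x * \<phi> x)"
    using i1 i2 by (rule Bochner_Integration.integrable_add)
  then have hi: "integrable (leb m) (\<lambda>x. indicator ?B x * (f x * pd i \<phi> x + pd i f x * \<phi> x))"
    by (simp flip: lebball_set_integrable add: set_integrable_def)
  have AE0: "AE x in leb m. indicator ?B x * (f x * pd i \<phi> x + pd i f x * \<phi> x) = \<psi>' x"
    using AE_leb_nonzero[of m] m by (auto simp: \<psi>'_def indicator_def)
  have \<psi>'m: "\<psi>' \<in> borel_measurable (lebP {..<m})"
    unfolding \<psi>'_def by (intro continuous_on_lebP_measurable openin_punctured continuous_on_add continuous_on_mult cont)
  then have \<psi>'m': "\<psi>' \<in> borel_measurable (leb m)" unfolding leb_def by (rule measurable_completion)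
  have "integrable (leb m) \<psi>'"
    using AE0 by (intro integrable_cong_AE_imp[OF hi \<psi>'m']) (auto simp: eq_commute)
  then have int\<psi>: "integrable (lebP {..<m}) \<psi>'"
    unfolding leb_def using integrable_completion[OF \<psi>'m] by simp
  have "integral\<^sup>L (lebP {..<m}) \<psi>' = 0"
  proof (rule line_integral_zero[OF m int\<psi>, where \<psi> = \<psi> and R = R])
    fix x assume x: "x \<in> Rn m" "x \<noteq> origin m"
    show "((\<lambda>t. \<psi> (x(i := t))) has_real_derivative \<psi>' x) (at (x i))"
    proof (cases "x \<in> K")
      case True
      then have xW: "x \<in> ?W" using K x by auto
      have "((\<lambda>t. f (x(i := t)) * \<phi> (x(i := t))) has_real_derivative pd i f x * \<phi> (x(i := x i)) + pd i \<phi> x * f (x(i := x i))) (at (x i))"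
        by (rule DERIV_mult[OF Ck_DERIV[OF f[unfolded One_nat_def] xW m(2)] Ck_DERIV[OF \<phi>1[unfolded One_nat_def] x(1) m(2)]])
      then show ?thesis
        using line_cong(1)[OF openin_punctured xW m(2), of \<psi> "\<lambda>x. f x * \<phi> x" "\<psi>' x"] xW
        by (simp add: \<psi>_def \<psi>'_def algebra_simps)
    next
      case False
      then have z: "\<phi> x = 0" "pd i \<phi> x = 0" using K x C1c_pd_zero(1)[OF K(1,3) _ m(2)] by auto
      have "((\<lambda>t. \<psi> (x(i := t))) has_real_derivative 0) (at (x i))"
        by (rule C1c_pd_zero(2)[OF K(1) _ _ m(2)]) (use K False x in \<open>auto simp: \<psi>_def\<close>)
      then show ?thesis by (simp add: \<psi>'_def z)
    qed
  next
    fix x assume x: "x \<in> Rn m" "R \<le> \<bar>x i\<bar>"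
    then have "x \<notin> ?B" using vnorm_component[OF m(2), of x] by (auto simp: vball_origin)
    then show "\<psi> x = 0 \<and> \<psi>' x = 0" by (simp add: \<psi>_def \<psi>'_def)
  qed
  then have "integral\<^sup>L (leb m) \<psi>' = 0" unfolding leb_def using integral_completion[OF \<psi>'m] by simp
  then have "(LINT x:?B|leb m. f x * pd i \<phi> x + pd i f x * \<phi> x) = 0"
    unfolding set_lebesgue_integral_def real_scaleR_def
    using integral_cong_AE[OF borel_measurable_integrable[OF hi] \<psi>'m' AE0] by (rule trans[rotated])
  then show ?PA
    unfolding lebball_integral using Bochner_Integration.integral_add[OF i1 i2] by simp
qed

section \<open>Uniqueness of weak derivatives\<close>

definition obox :: "nat \<Rightarrow> (nat \<Rightarrow> real) \<Rightarrow> (nat \<Rightarrow> real) \<Rightarrow> (nat \<Rightarrow> real) set" where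
  "obox m a b = PiE {..<m} (\<lambda>i. {a i<..<b i})"

lemma obox_Int: "obox m a b \<inter> obox m a' b' = obox m (\<lambda>i. max (a i) (a' i)) (\<lambda>i. min (b i) (b' i))"
  unfolding obox_def PiE_Int by (intro PiE_cong) auto

lemma obox_sets: "obox m a b \<in> sets (lebP {..<m})"
  unfolding obox_def by (rule sets_PiM_I_finite) auto

lemma sets_lebP_oboxes: "sets (lebP {..<m}) = sigma_sets (Rn m) {obox m a b | a b. True}"
proof -
  define E where "E = range (\<lambda>(a::real, b). {a<..<b})"
  define P where "P = {{f \<in> PiE {..<m} (\<lambda>_. UNIV). \<forall>i\<in>j. f i \<in> A i} |A j. j \<in> {{..<m}} \<and> A \<in> Pi j (\<lambda>_. E)}"
  have alt: "obox m a b = {f \<in> PiE {..<m} (\<lambda>_. UNIV). \<forall>i\<in>{..<m}. f i \<in> {a i<..<b i}}" for a b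
    unfolding obox_def PiE_def Pi_def by blast
  have "(UNIV :: real set) = \<Union> (range (\<lambda>n::nat. {- real n<..<real n}))"
  proof -
    have "\<exists>n::nat. x \<in> {- real n<..<real n}" for x :: real
      using reals_Archimedean2[of "\<bar>x\<bar>"] by (auto simp: abs_less_iff minus_less_iff)
    then show ?thesis by auto
  qed
  then have cover: "\<exists>S\<subseteq>E. countable S \<and> (UNIV :: real set) = \<Union>S"
    by (intro exI[of _ "range (\<lambda>n::nat. {- real n<..<real n})"]) (auto simp: E_def)
  have "sets (lebP {..<m}) = sets (PiM {..<m} (\<lambda>_. sigma UNIV E))"
    by (rule sets_PiM_cong) (auto simp: borel_eq_box E_def box_real)
  also have "\<dots> = sets (sigma (PiE {..<m} (\<lambda>_. UNIV)) P)"
    unfolding P_def by (rule sets_PiM_sigma) (use cover in auto)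
  also have "P = {obox m a b | a b. True}"
  proof (intro equalityI subsetI)
    fix X assume "X \<in> P"
    then obtain A where A: "X = {f \<in> PiE {..<m} (\<lambda>_. UNIV). \<forall>i\<in>{..<m}. f i \<in> A i}" "\<And>i. i < m \<Longrightarrow> A i \<in> E"
      by (auto simp: P_def Pi_iff)
    then have "\<forall>i. \<exists>a b. i < m \<longrightarrow> A i = {a<..<b}" by (auto simp: E_def image_def)
    then obtain a b where ab: "\<And>i. i < m \<Longrightarrow> A i = {a i<..<b i}" by metis
    have "X = obox m a b" unfolding A(1) alt by (intro Collect_cong conj_cong ball_cong refl) (simp add: ab)
    then show "X \<in> {obox m a b | a b. True}" by blast
  next
    fix X assume "X \<in> {obox m a b | a b. True}"
    then obtain a b where "X = obox m a b" by blast
    then have "X = {f \<in> PiE {..<m} (\<lambda>_. UNIV). \<forall>i\<in>{..<m}. f i \<in> {a i<..<b i}}"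
      by (simp only: alt)
    then show "X \<in> P" unfolding P_def
      by (intro CollectI exI[of _ "\<lambda>i. {a i<..<b i}"] exI[of _ "{..<m}"]) (auto simp: E_def)
  qed
  finally show ?thesis
    by (subst (asm) sets_measure_of) (auto simp: obox_def Rn_def PiE_iff)
qed

text \<open>The positive and the negative part of \<open>h\<close> are densities of two measures
  that agree on the boxes, a generator stable under intersection, hence everywhere.\<close>

lemma AE_zero_of_oboxes:
  fixes h :: "(nat \<Rightarrow> real) \<Rightarrow> real"
  assumes h: "integrable (lebP {..<m}) h"
    and zero: "\<And>a b. (\<integral>x. h x * indicator (obox m a b) x \<partial>lebP {..<m}) = 0"
  shows "AE x in lebP {..<m}. h x = 0"
proof -
  let ?M = "lebP {..<m}"
  interpret sigma_finite_measure ?M by (rule lborel_prod.sigma_finite) simp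
  have hm [measurable]: "h \<in> borel_measurable ?M" using h by simp
  define M1 M2 where "M1 = density ?M (\<lambda>x. ennreal (h x))" and "M2 = density ?M (\<lambda>x. ennreal (- h x))"
  have eq: "emeasure M1 X = emeasure M2 X" "emeasure M1 X \<noteq> \<infinity>" if X: "X \<in> {obox m a b | a b. True}" for X
  proof -
    obtain a b where X: "X = obox m a b" using X by blast
    have Xs: "X \<in> sets ?M" unfolding X by (rule obox_sets)
    have int: "integrable ?M (\<lambda>x. h x * indicator X x)"
      using integrable_mult_indicator[OF Xs h] by (simp add: mult.commute)
    have e: "emeasure M1 X = (\<integral>\<^sup>+x. ennreal (h x * indicator X x) \<partial>?M)"
       "emeasure M2 X = (\<integral>\<^sup>+x. ennreal (- (h x * indicator X x)) \<partial>?M)"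
      unfolding M1_def M2_def using Xs
      by (auto simp: emeasure_density intro!: nn_integral_cong split: split_indicator)
    have fin: "(\<integral>\<^sup>+x. ennreal (h x * indicator X x) \<partial>?M) \<noteq> \<infinity>"
       "(\<integral>\<^sup>+x. ennreal (- (h x * indicator X x)) \<partial>?M) \<noteq> \<infinity>"
      using int by (auto simp: real_integrable_def)
    have "enn2real (emeasure M1 X) = enn2real (emeasure M2 X)"
      using real_lebesgue_integral_def[OF int] zero[of a b, folded X] unfolding e by simp
    moreover have "emeasure M1 X = ennreal (enn2real (emeasure M1 X))" "emeasure M2 X = ennreal (enn2real (emeasure M2 X))"
      using fin unfolding e by (simp_all add: less_top)
    ultimately show "emeasure M1 X = emeasure M2 X" by simp
    show "emeasure M1 X \<noteq> \<infinity>" using fin unfolding e by simp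
  qed
  have "M1 = M2"
  proof (rule measure_eqI_generator_eq[where E = "{obox m a b | a b. True}" and \<Omega> = "Rn m"
      and A = "\<lambda>n. obox m (\<lambda>_. - real n) (\<lambda>_. real n)"])
    show "Int_stable {obox m a b | a b. True}" by (simp add: Int_stable_def) (metis obox_Int)
    show "{obox m a b | a b. True} \<subseteq> Pow (Rn m)" by (auto simp: obox_def Rn_def PiE_iff)
    show "sets M1 = sigma_sets (Rn m) {obox m a b | a b. True}" "sets M2 = sigma_sets (Rn m) {obox m a b | a b. True}"
      by (simp_all add: M1_def M2_def sets_lebP_oboxes)
    show "(\<Union>n. obox m (\<lambda>_. - real n) (\<lambda>_. real n)) = Rn m"
    proof (intro equalityI subsetI)
      fix x assume x: "x \<in> Rn m"
      obtain n :: nat where n: "vnorm m x < real n" using reals_Archimedean2 by blast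
      have "- real n < x i \<and> x i < real n" if "i < m" for i
        using vnorm_component[OF that, of x] n by auto
      then have "x \<in> obox m (\<lambda>_. - real n) (\<lambda>_. real n)" using x by (auto simp: obox_def Rn_def PiE_iff)
      then show "x \<in> (\<Union>n. obox m (\<lambda>_. - real n) (\<lambda>_. real n))" by blast
    qed (auto simp: obox_def Rn_def PiE_iff)
  qed (use eq in blast)+
  \<comment> \<open>\<open>ennreal\<close> sends negative numbers to 0, so equality of the two
    truncations leaves only h x = 0.\<close>
  then have "AE x in ?M. ennreal (h x) = ennreal (- h x)"
    unfolding M1_def M2_def by (intro density_unique) auto
  then show ?thesis
  proof eventually_elim
    case (elim x)
    then show ?case by (cases "h x" "0 :: real" rule: linorder_cases) (auto simp: ennreal_neg)
  qed
qed

lemma compact_vcball: "compact {x \<in> Rn m. vnorm m x \<le> r}"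
proof -
  \<comment> \<open>Beyond index \<open>m\<close> the factor is the singleton of
    \<open>undefined\<close>, so the set is a product of compact sets over all indices and
    Tychonoff's theorem applies.\<close>
  define S where "S = (\<lambda>i. if i < m then {-r..r} else {undefined :: real})"
  have "compactin (product_topology (\<lambda>_. euclidean) UNIV) (PiE UNIV S)"
    unfolding compactin_PiE by (auto simp: S_def)
  then have "compact (PiE UNIV S)" by (simp add: euclidean_product_topology)
  moreover have "closed {x. vnorm m x \<le> r}"
    by (intro closed_Collect_le continuous_vnorm continuous_intros)
  ultimately have "compact (PiE UNIV S \<inter> {x. vnorm m x \<le> r})" by (rule compact_Int_closed)
  moreover have "PiE UNIV S \<inter> {x. vnorm m x \<le> r} = {x \<in> Rn m. vnorm m x \<le> r}"
  proof (intro equalityI subsetI)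
    fix x assume x: "x \<in> {x \<in> Rn m. vnorm m x \<le> r}"
    have "x i \<in> {-r..r}" if "i < m" for i using vnorm_component[OF that, of x] x by auto
    moreover have "x i = undefined" if "\<not> i < m" for i using x that by (auto simp: Rn_def PiE_def extensional_def)
    ultimately show "x \<in> PiE UNIV S \<inter> {x. vnorm m x \<le> r}" using x by (auto simp: S_def)
  next
    fix x assume "x \<in> PiE UNIV S \<inter> {x. vnorm m x \<le> r}"
    then show "x \<in> {x \<in> Rn m. vnorm m x \<le> r}"
      by (fastforce simp: S_def Rn_def PiE_iff extensional_def split: if_splits)
  qed
  ultimately show ?thesis by simp
qed

text \<open>A smooth approximation of an interval indicator from below; both edges sharpen as
  \<open>n\<close> grows.\<close>

definition bump :: "nat \<Rightarrow> real \<Rightarrow> real \<Rightarrow> real \<Rightarrow> real" where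
  "bump n a b y = flat (real n * (y - a)) * flat (real n * (b - y))"

lemma flat_le_1: "flat s \<le> 1" by (simp add: flat_def)

lemma smooth1_bump: "smooth1 UNIV (bump n a b)"
  unfolding bump_def[abs_def]
  by (intro smooth1_mult smooth1_compose[OF smooth1_flat] smooth1_intros) auto

lemma bump_bounds: "0 \<le> bump n a b y" "bump n a b y \<le> 1"
  by (auto simp: bump_def flat_nonneg flat_le_1 intro!: mult_le_one)

lemma bump_tendsto: "(\<lambda>n. bump n a b y) \<longlonglongrightarrow> indicator {a<..<b} y"
proof -
  have 1: "(\<lambda>n. flat (real n * c)) \<longlonglongrightarrow> (if c > 0 then 1 else 0)" for c
  proof (cases "c > 0")
    case True
    have "(\<lambda>n. exp (- (inverse (real n) * inverse c))) \<longlonglongrightarrow> exp (- (0 * inverse c))"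
      by (intro tendsto_intros lim_inverse_n)
    moreover have "\<forall>\<^sub>F n in sequentially. exp (- (inverse (real n) * inverse c)) = flat (real n * c)"
      using eventually_gt_at_top[of 0]
      by eventually_elim (use True in \<open>simp add: flat_def mult_le_0_iff field_simps\<close>)
    ultimately show ?thesis using True by (auto intro: Lim_transform_eventually)
  next
    case False
    then have "flat (real n * c) = 0" for n by (simp add: flat_def mult_nonneg_nonpos)
    then show ?thesis using False by simp
  qed
  have "(\<lambda>n. bump n a b y) \<longlonglongrightarrow> (if y - a > 0 then 1 else 0) * (if b - y > 0 then 1 else 0)"
    unfolding bump_def by (intro tendsto_mult 1)
  then show ?thesis by (simp add: indicator_def split: if_splits)
qed

lemma locally_integrable_mult:
  assumes f: "locally_integrable m (oball m R) f"
    and K: "compact K" "K \<subseteq> oball m R"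
    and g: "continuous_on (Rn m) g" "\<And>x. x \<in> Rn m - K \<Longrightarrow> g x = 0"
  shows "integrable (lebball m R) (\<lambda>x. f x * g x)"
proof -
  have KR: "K \<subseteq> Rn m" using K vball_Rn by blast
  have "bounded (g ` K)"
    using K KR by (intro compact_imp_bounded compact_continuous_image) (auto intro: continuous_on_subset[OF g(1)])
  then obtain B where B: "\<And>x. x \<in> K \<Longrightarrow> \<bar>g x\<bar> \<le> B" unfolding bounded_iff by auto
  have int: "integrable (leb m) (\<lambda>x. indicator K x * f x)"
    using f K by (simp add: locally_integrable_def set_integrable_def)
  have gm: "(\<lambda>x. indicator (Rn m) x * g x) \<in> borel_measurable (leb m)"
    unfolding leb_def by (intro measurable_completion continuous_on_lebP_measurable g(1) openin_Rn)
  have "integrable (leb m) (\<lambda>x. (indicator K x * f x) * (indicator (Rn m) x * g x))"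
  proof (rule Bochner_Integration.integrable_bound[OF integrable_mult_right[OF int, of B]])
    show "(\<lambda>x. (indicator K x * f x) * (indicator (Rn m) x * g x)) \<in> borel_measurable (leb m)"
      by (rule borel_measurable_times[OF borel_measurable_integrable[OF int] gm])
    have "\<bar>f x\<bar> * \<bar>g x\<bar> \<le> \<bar>B\<bar> * \<bar>f x\<bar>" if "x \<in> K" for x
      using B[OF that] mult_mono[of "\<bar>f x\<bar>" "\<bar>f x\<bar>" "\<bar>g x\<bar>" "\<bar>B\<bar>"] by (simp add: mult.commute)
    then show "AE x in leb m. norm ((indicator K x * f x) * (indicator (Rn m) x * g x)) \<le> norm (B * (indicator K x * f x))"
      using KR by (intro AE_I2) (auto simp: indicator_def abs_mult)
  qed
  moreover have "integrable (leb m) (\<lambda>x. (indicator K x * f x) * (indicator (Rn m) x * g x)) \<longleftrightarrow>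
     integrable (leb m) (\<lambda>x. indicator (oball m R) x * (f x * g x))"
    by (intro Bochner_Integration.integrable_cong refl)
      (use K KR g(2) vball_Rn in \<open>auto simp: indicator_def space_leb\<close>)
  ultimately show ?thesis by (simp flip: lebball_set_integrable add: set_integrable_def)
qed

lemma locally_integrable_test:
  assumes "locally_integrable m (oball m R) f" "test_fun m (oball m R) \<phi>"
  shows "integrable (lebball m R) (\<lambda>x. f x * \<phi> x)" (is ?PA) "i < m \<Longrightarrow> integrable (lebball m R) (\<lambda>x. f x * pd i \<phi> x)"
proof -
  obtain K where K: "compact K" "K \<subseteq> oball m R" "\<forall>x\<in>Rn m - K. \<phi> x = 0"
    and \<phi>: "\<And>k. Ck k m (Rn m) \<phi>" using assms(2) by (auto simp: test_fun_def)
  show ?PA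
    using K Ck_continuous[OF \<phi>] by (intro locally_integrable_mult[OF assms(1) K(1,2)]) auto
  assume i: "i < m"
  have "continuous_on (Rn m) (pd i \<phi>)" using \<phi>[of 1] i by simp
  then show "integrable (lebball m R) (\<lambda>x. f x * pd i \<phi> x)"
    using C1c_pd_zero(1)[OF K(1,3) _ i] by (intro locally_integrable_mult[OF assms(1) K(1,2)]) auto
qed

text \<open>Multiplied by a smooth weight that is positive on a smaller ball and zero outside,
  \<open>f\<close> becomes integrable. Tests with products of bumps then show that the integrals
  over all boxes vanish.\<close>

lemma locally_integrable_zero:
  assumes m: "m > 0" and f: "locally_integrable m (oball m R) f"
    and zero: "\<And>\<phi>. test_fun m (oball m R) \<phi> \<Longrightarrow> integral\<^sup>L (lebball m R) (\<lambda>x. f x * \<phi> x) = 0"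
  shows "AE x in lebball m R. f x = 0"
proof -
  let ?B = "oball m R"
  have inner: "AE x in leb m. x \<in> ?B \<longrightarrow> vnorm m x < r \<longrightarrow> f x = 0" if r: "0 < r" "r < R" for r
  proof -
    define \<eta> where "\<eta> = (\<lambda>x. flat (r\<^sup>2 - (\<Sum>j<m. x j * x j)))"
    have \<eta>: "\<eta> x = flat (r\<^sup>2 - (vnorm m x)\<^sup>2)" for x unfolding vnorm_sq by (simp add: \<eta>_def power2_eq_square)
    let ?K = "{x \<in> Rn m. vnorm m x \<le> r}"
    have K: "compact ?K" "?K \<subseteq> ?B" using compact_vcball r by (auto simp: vball_origin)
    have \<eta>0: "\<eta> x = 0" if "x \<in> Rn m - ?K" for x
    proof -
      have "r\<^sup>2 \<le> (vnorm m x)\<^sup>2" using that r by (intro power_mono) auto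
      then show ?thesis unfolding \<eta> by (simp add: flat_def)
    qed
    have \<eta>C: "Ck k m (Rn m) \<eta>" for k
      unfolding \<eta>_def
      by (rule Ck_compose_smooth1[OF openin_Rn smooth1_flat])
        (intro Ck_diff Ck_const Ck_sum Ck_mult Ck_coord openin_Rn, simp)
    define F where "F = (\<lambda>x. indicator ?B x * (f x * \<eta> x))"
    have F: "integrable (leb m) F"
      using locally_integrable_mult[OF f K Ck_continuous[OF \<eta>C] \<eta>0]
      by (simp flip: lebball_set_integrable add: set_integrable_def F_def)
    have box0: "(\<integral>x. F x * indicator (obox m a b) x \<partial>leb m) = 0" for a b
    proof -
      define \<Phi> where "\<Phi> = (\<lambda>n x. \<Prod>i<m. bump n (a i) (b i) (x i))"
      have \<Phi>C: "Ck k m (Rn m) (\<Phi> n)" for k n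
        unfolding \<Phi>_def
      proof (intro Ck_prod openin_Rn)
        show "Ck k m (Rn m) (\<lambda>x. bump n (a j) (b j) (x j))" for j
          by (rule Ck_compose_smooth1[OF openin_Rn smooth1_bump Ck_coord[OF openin_Rn]]) simp
      qed
      have \<Phi>b: "\<bar>\<Phi> n x\<bar> \<le> 1" for n x
        unfolding \<Phi>_def abs_prod using bump_bounds by (auto intro!: prod_le_1)
      have z: "(\<integral>x. F x * \<Phi> n x \<partial>leb m) = 0" for n
      proof -
        have "test_fun m ?B (\<lambda>x. \<eta> x * \<Phi> n x)"
          unfolding test_fun_def using K \<eta>0
          by (auto intro!: Ck_mult openin_Rn \<eta>C \<Phi>C exI[of _ ?K])
        from zero[OF this] show ?thesis
          by (simp flip: lebball_integral add: set_lebesgue_integral_def F_def mult_ac)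
      qed
      have "(\<lambda>n. \<integral>x. F x * \<Phi> n x \<partial>leb m) \<longlonglongrightarrow> (\<integral>x. F x * indicator (obox m a b) x \<partial>leb m)"
      proof (rule integral_dominated_convergence[where w = "\<lambda>x. \<bar>F x\<bar>"])
        have [measurable]: "F \<in> borel_measurable (leb m)" using F by simp
        have [measurable]: "obox m a b \<in> sets (leb m)" using obox_sets by (simp add: leb_def)
        show "(\<lambda>x. F x * indicator (obox m a b) x) \<in> borel_measurable (leb m)" by measurable
        have "(\<lambda>x. indicator (Rn m) x * \<Phi> n x) \<in> borel_measurable (leb m)" for n
          unfolding leb_def by (intro measurable_completion continuous_on_lebP_measurable openin_Rn Ck_continuous[OF \<Phi>C])
        then have [measurable]: "\<Phi> n \<in> borel_measurable (leb m)" for n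
          by (rule measurable_cong[THEN iffD1, rotated]) (simp add: space_leb)
        show "(\<lambda>x. F x * \<Phi> n x) \<in> borel_measurable (leb m)" for n by measurable
        show "integrable (leb m) (\<lambda>x. \<bar>F x\<bar>)" using F by (rule integrable_abs)
        show "AE x in leb m. (\<lambda>n. F x * \<Phi> n x) \<longlonglongrightarrow> F x * indicator (obox m a b) x"
        proof (rule AE_I2)
          fix x assume "x \<in> space (leb m)"
          then have ext: "x \<in> Rn m" by (simp add: space_leb)
          have "(\<lambda>n. \<Phi> n x) \<longlonglongrightarrow> (\<Prod>i<m. indicator {a i<..<b i} (x i))"
            unfolding \<Phi>_def by (intro tendsto_prod bump_tendsto)
          also have "(\<Prod>i<m. indicator {a i<..<b i} (x i)) = (indicator (obox m a b) x :: real)"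
            using ext by (auto simp: obox_def PiE_iff Rn_def indicator_def intro!: prod.neutral)
          finally show "(\<lambda>n. F x * \<Phi> n x) \<longlonglongrightarrow> F x * indicator (obox m a b) x"
            by (intro tendsto_intros)
        qed
        show "AE x in leb m. norm (F x * \<Phi> n x) \<le> \<bar>F x\<bar>" for n
          using \<Phi>b by (auto simp: abs_mult intro!: mult_left_le AE_I2)
      qed
      then show ?thesis unfolding z by (simp add: LIMSEQ_const_iff)
    qed
    have Fm: "F \<in> borel_measurable (completion (lebP {..<m}))" using F by (simp add: leb_def)
    \<comment> \<open>The box argument concerns the product measure before completion, so
      \<open>F\<close> is replaced by a measurable representative.\<close>
    obtain F' where F': "F' \<in> borel_measurable (lebP {..<m})" "AE x in lebP {..<m}. F x = F' x"
      using completion_ex_borel_measurable_real[OF Fm] by blast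
    have AE': "AE x in leb m. F x = F' x" unfolding leb_def by (rule AE_completion[OF F'(2)])
    have F'm: "F' \<in> borel_measurable (leb m)" unfolding leb_def by (rule measurable_completion[OF F'(1)])
    have "integrable (leb m) F'" using integrable_cong_AE_imp[OF F F'm] AE' by (simp add: eq_commute)
    then have F'i: "integrable (lebP {..<m}) F'" unfolding leb_def using integrable_completion[OF F'(1)] by simp
    have "(\<integral>x. F' x * indicator (obox m a b) x \<partial>lebP {..<m}) = 0" for a b
    proof -
      have mm: "(\<lambda>x. F' x * indicator (obox m a b) x) \<in> borel_measurable (lebP {..<m})"
        using F'(1) obox_sets by (intro borel_measurable_times borel_measurable_indicator)
      have "(\<integral>x. F' x * indicator (obox m a b) x \<partial>lebP {..<m}) = (\<integral>x. F' x * indicator (obox m a b) x \<partial>leb m)"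
        unfolding leb_def using integral_completion[OF mm] by simp
      also have "\<dots> = (\<integral>x. F x * indicator (obox m a b) x \<partial>leb m)"
        using AE' F'm Fm obox_sets[of m a b]
        by (intro integral_cong_AE borel_measurable_times borel_measurable_indicator) (auto simp: leb_def)
      finally show ?thesis using box0 by simp
    qed
    from AE_zero_of_oboxes[OF F'i this] have "AE x in leb m. F' x = 0"
      unfolding leb_def by (rule AE_completion)
    with AE' show ?thesis
    proof eventually_elim
      case (elim x)
      show ?case
      proof (intro impI)
        assume x: "x \<in> ?B" "vnorm m x < r"
        then have "(vnorm m x)\<^sup>2 < r\<^sup>2" by (intro power_strict_mono vnorm_nonneg) auto
        then have "\<eta> x \<noteq> 0" unfolding \<eta> by (simp add: flat_def)
        then show "f x = 0" using elim x by (simp add: F_def)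
      qed
    qed
  qed
  \<comment> \<open>Countably many radii below R exhaust the ball; the shift by 2 keeps all of them
    positive.\<close>
  have "AE x in leb m. \<forall>n::nat. x \<in> ?B \<longrightarrow> vnorm m x < R * (1 - 1 / (real n + 2)) \<longrightarrow> f x = 0"
  proof (cases "R > 0")
    case True
    then show ?thesis unfolding AE_all_countable by (intro allI inner) (auto simp: field_simps intro: add_pos_nonneg)
  next
    case False
    then have "?B = {}" using vnorm_nonneg[of m] by (auto simp: vball_origin not_less intro: order_trans)
    then show ?thesis by simp
  qed
  then have "AE x in leb m. x \<in> ?B \<longrightarrow> f x = 0"
  proof eventually_elim
    case (elim x)
    show ?case
    proof
      assume x: "x \<in> ?B"
      then have lt: "vnorm m x < R" by (simp add: vball_origin)
      have "(\<lambda>n. R * (1 - 1 / (real (n + 2)))) \<longlonglongrightarrow> R * (1 - 0)"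
        by (intro tendsto_intros LIMSEQ_ignore_initial_segment[OF lim_1_over_n])
      then have "\<forall>\<^sub>F n in sequentially. vnorm m x < R * (1 - 1 / (real (n + 2)))"
        using lt by (intro order_tendstoD) auto
      then obtain n where "vnorm m x < R * (1 - 1 / (real (n + 2)))" by (auto simp: eventually_sequentially)
      then show "f x = 0" using elim x by (auto simp: add_ac)
    qed
  qed
  then show ?thesis unfolding lebball_AE .
qed

lemma set_integrable_leb_subset:
  fixes f :: "(nat \<Rightarrow> real) \<Rightarrow> real"
  assumes "integrable (lebball m R) f"
  shows "locally_integrable m (oball m R) f"
  unfolding locally_integrable_def
proof (intro allI impI)
  fix K assume K: "compact K" "K \<subseteq> oball m R"
  have "K \<in> sets (leb m)" using K vball_Rn
    by (intro sets_leb_borel) (auto intro: borel_closed compact_imp_closed)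
  then show "set_integrable (leb m) K f"
    using set_integrable_subset[of "leb m" "oball m R" f K] K assms by (simp add: lebball_set_integrable)
qed

lemma locally_integrable_diff:
  "locally_integrable m \<Omega> f \<Longrightarrow> locally_integrable m \<Omega> g \<Longrightarrow> locally_integrable m \<Omega> (\<lambda>x. f x - g x)"
  unfolding locally_integrable_def by (auto intro: set_integral_diff)

lemma has_weak_pd_unique:
  assumes "m > 0" "has_weak_pd m (oball m R) i f g" "has_weak_pd m (oball m R) i f h"
  shows "AE x in lebball m R. g x = h x"
proof -
  have li: "locally_integrable m (oball m R) g" "locally_integrable m (oball m R) h"
    using assms by (auto simp: has_weak_pd_def)
  have "AE x in lebball m R. g x - h x = 0"
  proof (rule locally_integrable_zero[OF assms(1) locally_integrable_diff[OF li]])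
    fix \<phi> assume t: "test_fun m (oball m R) \<phi>"
    have "integral\<^sup>L (lebball m R) (\<lambda>x. g x * \<phi> x) = integral\<^sup>L (lebball m R) (\<lambda>x. h x * \<phi> x)"
      using assms t by (auto simp: has_weak_pd_def lebball_integral)
    then show "integral\<^sup>L (lebball m R) (\<lambda>x. (g x - h x) * \<phi> x) = 0"
      using locally_integrable_test(1)[OF li(1) t] locally_integrable_test(1)[OF li(2) t]
      by (simp add: left_diff_distrib)
  qed
  then show ?thesis by simp
qed

lemma has_weak_pd_diff:
  assumes "i < m" "has_weak_pd m (oball m R) i f1 g1" "has_weak_pd m (oball m R) i f2 g2"
  shows "has_weak_pd m (oball m R) i (\<lambda>x. f1 x - f2 x) (\<lambda>x. g1 x - g2 x)"
  unfolding has_weak_pd_def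
proof (intro conjI allI impI)
  have li: "locally_integrable m (oball m R) f1" "locally_integrable m (oball m R) f2"
    "locally_integrable m (oball m R) g1" "locally_integrable m (oball m R) g2"
    using assms by (auto simp: has_weak_pd_def)
  then show "locally_integrable m (oball m R) (\<lambda>x. f1 x - f2 x)"
    "locally_integrable m (oball m R) (\<lambda>x. g1 x - g2 x)" by (auto intro: locally_integrable_diff)
  fix \<phi> assume t: "test_fun m (oball m R) \<phi>"
  have "integral\<^sup>L (lebball m R) (\<lambda>x. f1 x * pd i \<phi> x) = - integral\<^sup>L (lebball m R) (\<lambda>x. g1 x * \<phi> x)"
    "integral\<^sup>L (lebball m R) (\<lambda>x. f2 x * pd i \<phi> x) = - integral\<^sup>L (lebball m R) (\<lambda>x. g2 x * \<phi> x)"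
    using assms t by (auto simp: has_weak_pd_def lebball_integral)
  then show "(LINT x:oball m R|leb m. (f1 x - f2 x) * pd i \<phi> x) =
      - (LINT x:oball m R|leb m. (g1 x - g2 x) * \<phi> x)"
    unfolding lebball_integral
    using locally_integrable_test(1)[OF li(3) t] locally_integrable_test(1)[OF li(4) t]
      locally_integrable_test(2)[OF li(1) t assms(1)] locally_integrable_test(2)[OF li(2) t assms(1)]
    by (simp add: left_diff_distrib)
qed

lemma locally_integrable_cong:
  assumes "\<And>x. x \<in> \<Omega> \<Longrightarrow> f x = f' x" "locally_integrable m \<Omega> f"
  shows "locally_integrable m \<Omega> f'"
  unfolding locally_integrable_def
proof (intro allI impI)
  fix K assume K: "compact K" "K \<subseteq> \<Omega>"
  have "(\<lambda>x. indicator K x *\<^sub>R f x) = (\<lambda>x. indicator K x *\<^sub>R f' x)"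
    using assms(1) K(2) by (auto simp: fun_eq_iff indicator_def)
  moreover have "set_integrable (leb m) K f" using assms(2) K by (simp add: locally_integrable_def)
  ultimately show "set_integrable (leb m) K f'" unfolding set_integrable_def by simp
qed

lemma has_weak_pd_cong:
  assumes eq: "\<And>x. x \<in> \<Omega> \<Longrightarrow> f x = f' x" and f: "has_weak_pd m \<Omega> i f g"
  shows "has_weak_pd m \<Omega> i f' g"
proof -
  have "(LINT x:\<Omega>|leb m. f x * pd i \<phi> x) = (LINT x:\<Omega>|leb m. f' x * pd i \<phi> x)" for \<phi>
    unfolding set_lebesgue_integral_def
    by (intro Bochner_Integration.integral_cong refl) (simp add: eq split: split_indicator)
  then show ?thesis
    using f locally_integrable_cong[OF eq, of \<Omega>] by (auto simp: has_weak_pd_def)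
qed

lemma has_weak_pd_wpd: "has_weak_pd m \<Omega> i f g \<Longrightarrow> has_weak_pd m \<Omega> i f (wpd m \<Omega> i f)"
  unfolding wpd_def by (rule someI[of "has_weak_pd m \<Omega> i f"])

lemma wpd_AE:
  "m > 0 \<Longrightarrow> has_weak_pd m (oball m R) i f g \<Longrightarrow> AE x in lebball m R. wpd m (oball m R) i f x = g x"
  by (blast intro: has_weak_pd_unique has_weak_pd_wpd)

lemma has_weak_pd_classical:
  assumes m: "m \<ge> 2" "i < m" and \<beta>: "0 \<le> \<beta>" "\<beta> < m"
    and f: "Ck 1 m (punct m R) f"
    and bound: "\<And>x. x \<in> oball m R \<Longrightarrow> x \<noteq> origin m \<Longrightarrow> \<bar>f x\<bar> \<le> C * vnorm m x powr (- \<beta>)"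
      "\<And>x. x \<in> oball m R \<Longrightarrow> x \<noteq> origin m \<Longrightarrow> \<bar>pd i f x\<bar> \<le> C * vnorm m x powr (- \<beta>)"
  shows "has_weak_pd m (oball m R) i f (pd i f)"
proof -
  let ?W = "punct m R"
  have int: "integrable (lebball m R) (\<lambda>x. C * vnorm m x powr (- \<beta>))"
    by (intro integrable_mult_right vnorm_powr_integrable \<beta>)
  have AEb: "AE x in lebball m R. x \<in> ?W"
    using m by (intro AE_lebball_punct) auto
  have ii: "integrable (lebball m R) g" if "continuous_on ?W g" "\<And>x. x \<in> ?W \<Longrightarrow> \<bar>g x\<bar> \<le> C * vnorm m x powr (- \<beta>)" for g
  proof (rule Bochner_Integration.integrable_bound[OF int lebball_continuous_measurable[OF that(1)]])
    show "AE x in lebball m R. norm (g x) \<le> norm (C * vnorm m x powr (- \<beta>))"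
      using AEb by eventually_elim (use that(2) in \<open>auto intro: order_trans[OF _ abs_ge_self]\<close>)
  qed
  have "integrable (lebball m R) f" "integrable (lebball m R) (pd i f)"
    using f m(2) bound by (auto intro!: ii)
  then show ?thesis
    unfolding has_weak_pd_def lebball_integral
    using integration_by_parts(3)[OF m \<beta> f bound test_fun_C1c] by (auto intro: set_integrable_leb_subset)
qed

section \<open>Sobolev functions on balls\<close>

text \<open>Completeness of Lebesgue measure. It matters because \<open>wpd\<close> is an arbitrary
  representative, known only almost everywhere.\<close>

lemma lebball_measurable_AE:
  fixes f g :: "(nat \<Rightarrow> real) \<Rightarrow> real"
  assumes f: "f \<in> borel_measurable (lebball m R)" and eq: "AE x in lebball m R. f x = g x"
  shows "g \<in> borel_measurable (lebball m R)"
proof -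
  let ?B = "oball m R"
  define F G where "F = (\<lambda>x. indicator ?B x *\<^sub>R f x)" and "G = (\<lambda>x. indicator ?B x *\<^sub>R g x)"
  have F: "F \<in> borel_measurable (leb m)" using f unfolding lebball_measurable[symmetric] set_borel_measurable_def F_def .
  have FG: "AE x in leb m. F x = G x"
    using eq unfolding lebball_AE by (auto simp: F_def G_def indicator_def elim: eventually_mono)
  have "G \<in> borel_measurable (leb m)"
  proof (rule measurableI)
    fix A :: "real set" assume A: "A \<in> sets borel"
    have FA: "F -` A \<inter> space (leb m) \<in> sets (leb m)" using F A by (rule measurable_sets)
    have "AE x in completion (lebP {..<m}). x \<in> F -` A \<inter> space (leb m) \<longleftrightarrow> x \<in> G -` A \<inter> space (leb m)"
      using FG unfolding leb_def[symmetric] by eventually_elim auto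
    from completion.in_sets_AE[OF this] show "G -` A \<inter> space (leb m) \<in> sets (leb m)"
      using FA by (simp add: leb_def)
  qed simp
  then show ?thesis unfolding lebball_measurable[symmetric] set_borel_measurable_def G_def .
qed

lemma Lp_iff: "Lp m p (oball m R) f \<longleftrightarrow>
    f \<in> borel_measurable (lebball m R) \<and> integrable (lebball m R) (\<lambda>x. \<bar>f x\<bar> powr p)"
  unfolding Lp_def lebball_measurable lebball_set_integrable ..

lemma abs_le_one_plus_powr: "1 \<le> p \<Longrightarrow> \<bar>y\<bar> \<le> 1 + \<bar>y\<bar> powr p" for y p :: real
proof (cases "\<bar>y\<bar> \<le> 1")
  case False
  assume "1 \<le> p"
  then have "\<bar>y\<bar> powr 1 \<le> \<bar>y\<bar> powr p" using False by (intro powr_mono) auto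
  then show ?thesis using False by simp
qed (use powr_ge_zero[of "\<bar>y\<bar>" p] in linarith)

lemma Lp_integrable:
  assumes "1 \<le> p" "Lp m p (oball m R) f"
  shows "integrable (lebball m R) f"
proof (rule Bochner_Integration.integrable_bound)
  show "integrable (lebball m R) (\<lambda>x. 1 + \<bar>f x\<bar> powr p)"
    using assms lebball_const_integrable by (auto simp: Lp_iff)
  show "AE x in lebball m R. norm (f x) \<le> norm (1 + \<bar>f x\<bar> powr p)"
    using abs_le_one_plus_powr[OF assms(1)] by (auto intro: order_trans[OF _ abs_ge_self])
qed (use assms in \<open>auto simp: Lp_iff\<close>)

text \<open>The sum is at most the number of terms times the largest one.\<close>

lemma sum_powr_le:
  fixes x :: "'a \<Rightarrow> real"
  assumes "finite A" "\<And>k. k \<in> A \<Longrightarrow> 0 \<le> x k" "0 < p"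
  shows "(\<Sum>k\<in>A. x k) powr p \<le> (\<Sum>k\<in>A. (real (card A) * x k) powr p)"
proof (cases "A = {}")
  case False
  have "Max (x ` A) \<in> x ` A" using assms(1) False by (intro Max_in) auto
  then obtain j where "j \<in> A" "x j = Max (x ` A)" by auto
  then have j: "j \<in> A" "\<And>k. k \<in> A \<Longrightarrow> x k \<le> x j" using assms(1) by auto
  have "(\<Sum>k\<in>A. x k) \<le> real (card A) * x j" using sum_bounded_above[of A x "x j"] j by simp
  then have "(\<Sum>k\<in>A. x k) powr p \<le> (real (card A) * x j) powr p"
    using assms by (intro powr_mono2) (auto intro: sum_nonneg)
  also have "\<dots> \<le> (\<Sum>k\<in>A. (real (card A) * x k) powr p)"
    using j assms by (intro member_le_sum[of j]) auto
  finally show ?thesis .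
qed auto

lemma Lp_dominated:
  assumes p: "1 \<le> p" and A: "finite A" and f: "\<And>k. k \<in> A \<Longrightarrow> Lp m p (oball m R) (f k)"
    and g: "g \<in> borel_measurable (lebball m R)" "AE x in lebball m R. \<bar>g x\<bar> \<le> (\<Sum>k\<in>A. \<bar>f k x\<bar>)"
  shows "Lp m p (oball m R) g"
proof -
  have "integrable (lebball m R) (\<lambda>x. \<bar>g x\<bar> powr p)"
  proof (rule Bochner_Integration.integrable_bound)
    show "integrable (lebball m R) (\<lambda>x. \<Sum>k\<in>A. (real (card A) * \<bar>f k x\<bar>) powr p)"
      using f p by (intro Bochner_Integration.integrable_sum) (auto simp: Lp_iff powr_mult)
    show "AE x in lebball m R. norm (\<bar>g x\<bar> powr p) \<le> norm (\<Sum>k\<in>A. (real (card A) * \<bar>f k x\<bar>) powr p)"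
      using g(2)
    proof eventually_elim
      case (elim x)
      have "\<bar>g x\<bar> powr p \<le> (\<Sum>k\<in>A. \<bar>f k x\<bar>) powr p" using elim p by (intro powr_mono2) auto
      also have "\<dots> \<le> (\<Sum>k\<in>A. (real (card A) * \<bar>f k x\<bar>) powr p)" using A p by (intro sum_powr_le) auto
      finally show ?case by (simp add: sum_nonneg)
    qed
  qed (use g in measurable)
  then show ?thesis using g by (simp add: Lp_iff)
qed

lemma Lp_diff:
  assumes "1 \<le> p" "Lp m p (oball m R) f" "Lp m p (oball m R) g"
  shows "Lp m p (oball m R) (\<lambda>x. f x - g x)"
proof (rule Lp_dominated[of p "UNIV :: bool set" m R "\<lambda>b. if b then f else g"])
  show "AE x in lebball m R. \<bar>f x - g x\<bar> \<le> (\<Sum>k\<in>UNIV. \<bar>(if k then f else g) x\<bar>)"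
    by (intro AE_I2) (simp add: UNIV_bool)
qed (use assms in \<open>auto simp: Lp_iff\<close>)

lemma Lp_AE_cong:
  assumes "1 \<le> p" "Lp m p (oball m R) f" "AE x in lebball m R. f x = g x"
  shows "Lp m p (oball m R) g"
proof (rule Lp_dominated[of p "{()}" m R "\<lambda>_. f"])
  show "g \<in> borel_measurable (lebball m R)"
    using assms lebball_measurable_AE[of f m R g] by (auto simp: Lp_iff)
  show "AE x in lebball m R. \<bar>g x\<bar> \<le> (\<Sum>k\<in>{()}. \<bar>f x\<bar>)" using assms(3) by eventually_elim simp
qed (use assms in auto)

lemma W1pD:
  assumes "1 \<le> p" "m > 0" "u \<in> W1p m l p (oball m R)" "a < l"
  shows "Lp m p (oball m R) (\<lambda>x. u x a)"
    "i < m \<Longrightarrow> has_weak_pd m (oball m R) i (\<lambda>x. u x a) (wpd m (oball m R) i (\<lambda>x. u x a))"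
    "i < m \<Longrightarrow> Lp m p (oball m R) (wpd m (oball m R) i (\<lambda>x. u x a))"
proof -
  show "Lp m p (oball m R) (\<lambda>x. u x a)" using assms by (simp add: W1p_def)
  assume "i < m"
  then obtain g where g: "has_weak_pd m (oball m R) i (\<lambda>x. u x a) g" "Lp m p (oball m R) g"
    using assms by (force simp: W1p_def)
  show "has_weak_pd m (oball m R) i (\<lambda>x. u x a) (wpd m (oball m R) i (\<lambda>x. u x a))"
    using g(1) by (rule has_weak_pd_wpd)
  have "AE x in lebball m R. g x = wpd m (oball m R) i (\<lambda>x. u x a) x"
    using wpd_AE[OF assms(2) g(1)] by eventually_elim simp
  then show "Lp m p (oball m R) (wpd m (oball m R) i (\<lambda>x. u x a))"
    by (rule Lp_AE_cong[OF assms(1) g(2)])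
qed

lemma W1pI:
  assumes "u \<in> oball m R \<rightarrow> Rn l"
    "\<And>a. a < l \<Longrightarrow> Lp m p (oball m R) (\<lambda>x. u x a)"
    "\<And>a i. a < l \<Longrightarrow> i < m \<Longrightarrow> has_weak_pd m (oball m R) i (\<lambda>x. u x a) (g a i)"
    "\<And>a i. a < l \<Longrightarrow> i < m \<Longrightarrow> Lp m p (oball m R) (g a i)"
  shows "u \<in> W1p m l p (oball m R)"
  using assms unfolding W1p_def by blast

lemma vdiff_apply: "a < l \<Longrightarrow> (\<lambda>x. vdiff l (f x) (g x) a) = (\<lambda>x. f x a - g x a)"
  by (simp add: vdiff_def)

lemma vdiff_W1p:
  assumes p: "1 \<le> p" "m > 0" and u: "u \<in> W1p m l p (oball m R)" and v: "v \<in> W1p m l p (oball m R)"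
  shows "(\<lambda>x. vdiff l (u x) (v x)) \<in> W1p m l p (oball m R)"
proof (rule W1pI[where g = "\<lambda>a i x. wpd m (oball m R) i (\<lambda>x. u x a) x - wpd m (oball m R) i (\<lambda>x. v x a) x"])
  show "(\<lambda>x. vdiff l (u x) (v x)) \<in> oball m R \<rightarrow> Rn l" by (auto simp: vdiff_def Rn_def)
qed (use W1pD[OF p u] W1pD[OF p v] p in \<open>auto simp: vdiff_apply intro!: Lp_diff has_weak_pd_diff\<close>)

lemma wpd_vdiff:
  assumes p: "1 \<le> p" "m > 0" and u: "u \<in> W1p m l p (oball m R)" and v: "v \<in> W1p m l p (oball m R)"
    and "a < l" "i < m"
  shows "AE x in lebball m R. wpd m (oball m R) i (\<lambda>x. vdiff l (u x) (v x) a) x =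
     wpd m (oball m R) i (\<lambda>x. u x a) x - wpd m (oball m R) i (\<lambda>x. v x a) x"
  unfolding vdiff_apply[OF assms(5)]
  using W1pD[OF p u assms(5)] W1pD[OF p v assms(5)] assms by (intro wpd_AE has_weak_pd_diff)

lemma grad_inner_self: "grad_inner m l \<Omega> u u x = (\<Sum>(a, i)\<in>{..<l}\<times>{..<m}. (wpd m \<Omega> i (\<lambda>x. u x a) x)\<^sup>2)"
  by (simp add: grad_inner_def sum.cartesian_product power2_eq_square)

lemma grad_norm_L2: "grad_norm m l \<Omega> u x = L2_set (\<lambda>(a, i). wpd m \<Omega> i (\<lambda>x. u x a) x) ({..<l}\<times>{..<m})"
  by (simp add: grad_norm_def grad_inner_self L2_set_def case_prod_beta)

lemma grad_norm_nonneg: "0 \<le> grad_norm m l \<Omega> u x"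
  by (simp add: grad_norm_L2)

lemma grad_norm_ge: "a < l \<Longrightarrow> i < m \<Longrightarrow> \<bar>wpd m \<Omega> i (\<lambda>x. u x a) x\<bar> \<le> grad_norm m l \<Omega> u x"
  unfolding grad_norm_L2
  using member_le_L2_set[of "{..<l}\<times>{..<m}" "(a, i)" "\<lambda>(a, i). \<bar>wpd m \<Omega> i (\<lambda>x. u x a) x\<bar>"]
  by (auto simp: L2_set_def case_prod_beta)

lemma Lp_grad_norm:
  assumes p: "1 \<le> p" "m > 0" and u: "u \<in> W1p m l p (oball m R)"
  shows "Lp m p (oball m R) (grad_norm m l (oball m R) u)"
proof (rule Lp_dominated[OF p(1), where A = "{..<l}\<times>{..<m}"])
  let ?D = "\<lambda>k. wpd m (oball m R) (snd k) (\<lambda>x. u x (fst k))"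
  show D: "Lp m p (oball m R) (?D k)" if "k \<in> {..<l}\<times>{..<m}" for k
    using that W1pD(3)[OF p u] by auto
  have [measurable]: "(\<lambda>x. \<Sum>k\<in>{..<l}\<times>{..<m}. (?D k x)\<^sup>2) \<in> borel_measurable (lebball m R)"
    using D by (intro borel_measurable_sum borel_measurable_power) (auto simp: Lp_iff)
  have "(\<lambda>x. sqrt (\<Sum>k\<in>{..<l}\<times>{..<m}. (?D k x)\<^sup>2)) \<in> borel_measurable (lebball m R)" by measurable
  then show "grad_norm m l (oball m R) u \<in> borel_measurable (lebball m R)"
    unfolding grad_norm_L2 L2_set_def by (simp add: case_prod_beta)
  show "AE x in lebball m R. \<bar>grad_norm m l (oball m R) u x\<bar> \<le> (\<Sum>k\<in>{..<l}\<times>{..<m}. \<bar>?D k x\<bar>)"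
    unfolding grad_norm_L2 by (intro AE_I2) (simp add: case_prod_beta' L2_set_le_sum_abs)
qed auto

lemma Lp_vnorm:
  assumes p: "1 \<le> p" "m > 0" and u: "u \<in> W1p m l p (oball m R)"
  shows "Lp m p (oball m R) (\<lambda>x. vnorm l (u x))"
proof (rule Lp_dominated[OF p(1), where A = "{..<l}" and f = "\<lambda>a x. u x a"])
  show L: "Lp m p (oball m R) (\<lambda>x. u x a)" if "a \<in> {..<l}" for a
    using that W1pD(1)[OF p u] by auto
  have [measurable]: "(\<lambda>x. \<Sum>a<l. (u x a)\<^sup>2) \<in> borel_measurable (lebball m R)"
    using L by (intro borel_measurable_sum borel_measurable_power) (auto simp: Lp_iff)
  show "(\<lambda>x. vnorm l (u x)) \<in> borel_measurable (lebball m R)"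
    unfolding vnorm_def L2_set_def by measurable
  show "AE x in lebball m R. \<bar>vnorm l (u x)\<bar> \<le> (\<Sum>a\<in>{..<l}. \<bar>u x a\<bar>)"
    unfolding vnorm_def by (intro AE_I2) (use L2_set_le_sum_abs in auto)
qed auto

text \<open>The pointwise bound |y| \<le> d + d^(1-p) |y|^p with a small constant d is integrated;
  it plays the part of Hoelder's inequality.\<close>

lemma L1_of_Lp:
  fixes h :: "nat \<Rightarrow> 'a \<Rightarrow> real"
  assumes M: "finite_measure M" and p: "1 \<le> p" and h: "\<And>k. h k \<in> borel_measurable M"
    "\<And>k. integrable M (\<lambda>x. \<bar>h k x\<bar> powr p)" "(\<lambda>k. \<integral>x. \<bar>h k x\<bar> powr p \<partial>M) \<longlonglongrightarrow> 0"
  shows "\<And>k. integrable M (h k)" "(\<lambda>k. \<integral>x. \<bar>h k x\<bar> \<partial>M) \<longlonglongrightarrow> 0" (is ?PA)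
proof -
  interpret finite_measure M by (rule M)
  show int: "integrable M (h k)" for k
  proof (rule Bochner_Integration.integrable_bound)
    show "integrable M (\<lambda>x. 1 + \<bar>h k x\<bar> powr p)" using h by auto
    show "AE x in M. norm (h k x) \<le> norm (1 + \<bar>h k x\<bar> powr p)"
      using abs_le_one_plus_powr[OF p] by (auto intro: order_trans[OF _ abs_ge_self])
  qed (rule h)
  have le: "(\<integral>x. \<bar>h k x\<bar> \<partial>M) \<le> d * measure M (space M) + d powr (1 - p) * (\<integral>x. \<bar>h k x\<bar> powr p \<partial>M)" if d: "d > 0" for d k
  proof -
    have pt: "\<bar>y\<bar> \<le> d + d powr (1 - p) * \<bar>y\<bar> powr p" for y :: real
    proof (cases "\<bar>y\<bar> \<le> d")
      case False
      then have "\<bar>y\<bar> powr (1 - p) \<le> d powr (1 - p)" using d p by (intro powr_mono2') auto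
      then have "\<bar>y\<bar> powr (1 - p) * \<bar>y\<bar> powr p \<le> d powr (1 - p) * \<bar>y\<bar> powr p" by (intro mult_right_mono) auto
      moreover have "\<bar>y\<bar> powr (1 - p) * \<bar>y\<bar> powr p = \<bar>y\<bar>" using False d by (simp flip: powr_add)
      ultimately show ?thesis using d by simp
    qed (use d in \<open>simp add: add_increasing2\<close>)
    have "(\<integral>x. \<bar>h k x\<bar> \<partial>M) \<le> (\<integral>x. d + d powr (1 - p) * \<bar>h k x\<bar> powr p \<partial>M)"
      using int h by (intro integral_mono pt) auto
    then show ?thesis using h by (simp add: mult.commute)
  qed
  show ?PA
  proof (rule LIMSEQ_I)
    fix r :: real assume r: "r > 0"
    define V where "V = measure M (space M) + 1"
    have V: "V > 0" "measure M (space M) \<le> V" by (auto simp: V_def add_nonneg_pos)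
    define d where "d = r / (2 * V)"
    have d: "d > 0" using r V by (simp add: d_def)
    have "(\<lambda>k. d powr (1 - p) * (\<integral>x. \<bar>h k x\<bar> powr p \<partial>M)) \<longlonglongrightarrow> d powr (1 - p) * 0"
      by (intro tendsto_intros h)
    then have "\<forall>\<^sub>F k in sequentially. d powr (1 - p) * (\<integral>x. \<bar>h k x\<bar> powr p \<partial>M) < r / 2"
      using r by (intro order_tendstoD) auto
    then obtain N where N: "\<And>k. k \<ge> N \<Longrightarrow> d powr (1 - p) * (\<integral>x. \<bar>h k x\<bar> powr p \<partial>M) < r / 2"
      by (auto simp: eventually_sequentially)
    have "d * measure M (space M) \<le> d * V" using V d by (intro mult_left_mono) auto
    also have "d * V = r / 2" using V by (simp add: d_def)
    finally have "norm ((\<integral>x. \<bar>h k x\<bar> \<partial>M) - 0) < r" if "k \<ge> N" for k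
      using N[OF that] le[OF d, of k] by (simp add: integral_nonneg_AE abs_of_nonneg)
    then show "\<exists>no. \<forall>n\<ge>no. norm ((\<integral>x. \<bar>h n x\<bar> \<partial>M) - 0) < r" by blast
  qed
qed

lemma has_weak_pd_test:
  assumes "m \<ge> 2" "i < m" "test_fun m (oball m R) \<phi>"
  shows "has_weak_pd m (oball m R) i \<phi> (pd i \<phi>)"
proof -
  obtain B where B: "\<And>x. x \<in> Rn m \<Longrightarrow> \<bar>\<phi> x\<bar> \<le> B \<and> (\<forall>i<m. \<bar>pd i \<phi> x\<bar> \<le> B)"
    using C1c_bounded[OF test_fun_C1c[OF assms(3)] vball_Rn] by blast
  have "Ck 1 m (punct m R) \<phi>"
    by (rule Ck_subset[of 1 m "Rn m"]) (use assms vball_Rn in \<open>auto simp: test_fun_def\<close>)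
  then show ?thesis
    using assms B vball_Rn vnorm_pos
    by (intro has_weak_pd_classical[where \<beta> = 0 and C = B]) (auto simp: subset_iff less_imp_neq[THEN not_sym])
qed

lemma W1p_tendsto_L1:
  assumes m: "m > 0" and p: "1 \<le> p" and conv: "W1p_tendsto m l p (oball m R) f u"
    and f: "\<And>k. f k \<in> W1p m l p (oball m R)"
  shows "a < l \<Longrightarrow> (\<lambda>k. \<integral>x. \<bar>f k x a - u x a\<bar> \<partial>lebball m R) \<longlonglongrightarrow> 0"
    "a < l \<Longrightarrow> i < m \<Longrightarrow> (\<lambda>k. \<integral>x. \<bar>wpd m (oball m R) i (\<lambda>x. f k x a) x - wpd m (oball m R) i (\<lambda>x. u x a) x\<bar> \<partial>lebball m R) \<longlonglongrightarrow> 0"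
proof -
  let ?B = "oball m R"
  have u: "u \<in> W1p m l p ?B" using conv by (simp add: W1p_tendsto_def)
  define D where "D k = (\<lambda>x. vdiff l (f k x) (u x))" for k
  have D: "D k \<in> W1p m l p ?B" for k unfolding D_def by (rule vdiff_W1p[OF p m f u])
  define I where "I k = (\<integral>x. vnorm l (D k x) powr p \<partial>lebball m R)" for k
  define G where "G k = (\<integral>x. grad_norm m l ?B (D k) x powr p \<partial>lebball m R)" for k
  have IG: "0 \<le> I k" "0 \<le> G k" for k by (auto simp: I_def G_def)
  have "(\<lambda>k. (I k + G k) powr (1 / p)) \<longlonglongrightarrow> 0"
    using conv by (simp add: W1p_tendsto_def W1p_norm_def lebball_integral I_def G_def D_def)
  then have "(\<lambda>k. ((I k + G k) powr (1 / p)) powr p) \<longlonglongrightarrow> 0 powr p"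
    using p by (intro tendsto_powr') auto
  then have IG0: "(\<lambda>k. I k + G k) \<longlonglongrightarrow> 0" using p IG by (simp add: powr_powr add_nonneg_nonneg)
  have I0: "I \<longlonglongrightarrow> 0" by (rule tendsto_sandwich[OF _ _ tendsto_const IG0]) (use IG in auto)
  have G0: "G \<longlonglongrightarrow> 0" by (rule tendsto_sandwich[OF _ _ tendsto_const IG0]) (use IG in auto)
  show "(\<lambda>k. \<integral>x. \<bar>f k x a - u x a\<bar> \<partial>lebball m R) \<longlonglongrightarrow> 0" if a: "a < l"
  proof (rule L1_of_Lp(2)[OF finite_lebball p])
    have L: "Lp m p ?B (\<lambda>x. f k x a - u x a)" for k
      by (intro Lp_diff p W1pD(1)[OF p m f a] W1pD(1)[OF p m u a])
    then show "(\<lambda>x. f k x a - u x a) \<in> borel_measurable (lebball m R)"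
      and i: "integrable (lebball m R) (\<lambda>x. \<bar>f k x a - u x a\<bar> powr p)" for k by (auto simp: Lp_iff)
    have "(\<integral>x. \<bar>f k x a - u x a\<bar> powr p \<partial>lebball m R) \<le> I k" for k
      unfolding I_def
    proof (rule integral_mono[OF i])
      show "integrable (lebball m R) (\<lambda>x. vnorm l (D k x) powr p)"
        using Lp_vnorm[OF p m D[of k]] by (simp add: Lp_iff vnorm_nonneg abs_of_nonneg)
      fix x
      have "\<bar>f k x a - u x a\<bar> \<le> vnorm l (D k x)"
        using vnorm_component[OF a, of "D k x"] a by (simp add: D_def vdiff_def)
      then show "\<bar>f k x a - u x a\<bar> powr p \<le> vnorm l (D k x) powr p" using p by (intro powr_mono2) auto
    qed
    then show "(\<lambda>k. \<integral>x. \<bar>f k x a - u x a\<bar> powr p \<partial>lebball m R) \<longlonglongrightarrow> 0"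
      by (intro tendsto_sandwich[OF _ _ tendsto_const I0]) auto
  qed
  show "(\<lambda>k. \<integral>x. \<bar>wpd m ?B i (\<lambda>x. f k x a) x - wpd m ?B i (\<lambda>x. u x a) x\<bar> \<partial>lebball m R) \<longlonglongrightarrow> 0" if a: "a < l" "i < m"
  proof (rule L1_of_Lp(2)[OF finite_lebball p])
    let ?h = "\<lambda>k x. wpd m ?B i (\<lambda>x. f k x a) x - wpd m ?B i (\<lambda>x. u x a) x"
    have L: "Lp m p ?B (?h k)" for k
      by (intro Lp_diff p W1pD(3)[OF p m f a] W1pD(3)[OF p m u a])
    then show "?h k \<in> borel_measurable (lebball m R)"
      and i: "integrable (lebball m R) (\<lambda>x. \<bar>?h k x\<bar> powr p)" for k by (auto simp: Lp_iff)
    have "(\<integral>x. \<bar>?h k x\<bar> powr p \<partial>lebball m R) \<le> G k" for k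
      unfolding G_def
    proof (rule integral_mono_AE[OF i])
      show "integrable (lebball m R) (\<lambda>x. grad_norm m l ?B (D k) x powr p)"
        using Lp_grad_norm[OF p m D[of k]] by (simp add: Lp_iff grad_norm_nonneg abs_of_nonneg)
      show "AE x in lebball m R. \<bar>?h k x\<bar> powr p \<le> grad_norm m l ?B (D k) x powr p"
        using wpd_vdiff[OF p m f u a, of k]
      proof eventually_elim
        case (elim x)
        then have "\<bar>?h k x\<bar> \<le> grad_norm m l ?B (D k) x"
          using grad_norm_ge[OF a, of ?B "D k" x] by (simp add: D_def)
        then show ?case using p by (intro powr_mono2) auto
      qed
    qed
    then show "(\<lambda>k. \<integral>x. \<bar>?h k x\<bar> powr p \<partial>lebball m R) \<longlonglongrightarrow> 0"
      by (intro tendsto_sandwich[OF _ _ tendsto_const G0]) auto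
  qed
qed

lemma W1p_tendsto_AE_subseq:
  assumes m: "m > 0" and p: "1 \<le> p" and conv: "W1p_tendsto m l p (oball m R) f u"
    and f: "\<And>k. f k \<in> W1p m l p (oball m R)"
  obtains r :: "nat \<Rightarrow> nat" where "strict_mono r" "AE x in lebball m R. \<forall>a<l. (\<lambda>k. f (r k) x a) \<longlonglongrightarrow> u x a"
proof -
  have u: "u \<in> W1p m l p (oball m R)" using conv by (simp add: W1p_tendsto_def)
  have int: "integrable (lebball m R) (\<lambda>x. \<bar>f k x a - u x a\<bar>)" if "a < l" for k a
    by (intro integrable_abs Lp_integrable[OF p] Lp_diff p W1pD(1)[OF p m f that] W1pD(1)[OF p m u that])
  have "(\<lambda>k. \<Sum>a<l. \<integral>x. \<bar>f k x a - u x a\<bar> \<partial>lebball m R) \<longlonglongrightarrow> (\<Sum>a<l. 0)"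
    by (intro tendsto_sum W1p_tendsto_L1(1)[OF m p conv f]) auto
  then have c: "(\<lambda>k. \<integral>x. norm (\<Sum>a<l. \<bar>f k x a - u x a\<bar>) \<partial>lebball m R) \<longlonglongrightarrow> 0"
    using int by (simp add: sum_nonneg abs_of_nonneg)
  have int': "integrable (lebball m R) (\<lambda>x. \<Sum>a<l. \<bar>f k x a - u x a\<bar>)" for k
    using int by (intro Bochner_Integration.integrable_sum) auto
  obtain r :: "nat \<Rightarrow> nat" where r: "strict_mono r"
    "AE x in lebball m R. (\<lambda>k. \<Sum>a<l. \<bar>f (r k) x a - u x a\<bar>) \<longlonglongrightarrow> 0"
    using tendsto_L1_AE_subseq[OF int' c] by blast
  from r(2) have "AE x in lebball m R. \<forall>a<l. (\<lambda>k. f (r k) x a) \<longlonglongrightarrow> u x a"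
  proof eventually_elim
    case (elim x)
    show ?case
    proof (intro allI impI)
      fix a assume a: "a < l"
      have "(\<lambda>k. \<bar>f (r k) x a - u x a\<bar>) \<longlonglongrightarrow> 0"
      proof (rule tendsto_sandwich[OF _ _ tendsto_const elim])
        show "\<forall>\<^sub>F k in sequentially. \<bar>f (r k) x a - u x a\<bar> \<le> (\<Sum>a<l. \<bar>f (r k) x a - u x a\<bar>)"
          using a by (intro always_eventually allI member_le_sum) auto
      qed auto
      then show "(\<lambda>k. f (r k) x a) \<longlonglongrightarrow> u x a" by (simp add: tendsto_rabs_zero_iff LIM_zero_iff)
    qed
  qed
  with r(1) show ?thesis by (rule that)
qed

text \<open>One sequence for all limits below: values and classical derivatives converge in L^1, and
  the values converge almost everywhere along the same indices. The test maps are known to lie in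
  the space only eventually, hence the shift by \<open>N\<close>.\<close>

lemma W01p_approx:
  assumes m: "m \<ge> 2" and p: "1 \<le> p" and W: "W \<in> W01p m l p (oball m R)"
  obtains \<phi> :: "nat \<Rightarrow> (nat \<Rightarrow> real) \<Rightarrow> nat \<Rightarrow> real" where
    "\<And>k a. a < l \<Longrightarrow> test_fun m (oball m R) (\<lambda>x. \<phi> k x a)"
    "\<And>a. a < l \<Longrightarrow> (\<lambda>k. \<integral>x. \<bar>\<phi> k x a - W x a\<bar> \<partial>lebball m R) \<longlonglongrightarrow> 0"
    "\<And>a i. a < l \<Longrightarrow> i < m \<Longrightarrow> (\<lambda>k. \<integral>x. \<bar>pd i (\<lambda>x. \<phi> k x a) x - wpd m (oball m R) i (\<lambda>x. W x a) x\<bar> \<partial>lebball m R) \<longlonglongrightarrow> 0"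
    "AE x in lebball m R. \<forall>a<l. (\<lambda>k. \<phi> k x a) \<longlonglongrightarrow> W x a"
    "W \<in> W1p m l p (oball m R)"
proof -
  let ?B = "oball m R"
  have m0: "m > 0" using m by simp
  obtain \<phi> where \<phi>: "\<And>k. test_map m l ?B (\<phi> k)" and conv: "W1p_tendsto m l p ?B \<phi> W"
    using W by (auto simp: W01p_def)
  then have "\<forall>\<^sub>F k in sequentially. \<phi> k \<in> W1p m l p ?B" by (simp add: W1p_tendsto_def)
  then obtain N where N: "\<And>k. k \<ge> N \<Longrightarrow> \<phi> k \<in> W1p m l p ?B" by (auto simp: eventually_sequentially)
  have sh: "W1p_tendsto m l p ?B (\<lambda>k. \<phi> (s k)) W" "\<And>k. \<phi> (s k) \<in> W1p m l p ?B"
    if s: "\<And>k. s k \<ge> N" "filterlim s sequentially sequentially" for s :: "nat \<Rightarrow> nat"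
    using conv N[OF s(1)] s(2) unfolding W1p_tendsto_def
    by (auto intro: filterlim_compose[of "\<lambda>k. W1p_norm m l p ?B (\<lambda>x. vdiff l (\<phi> k x) (W x))"])
  have s0: "filterlim (\<lambda>k. k + N) sequentially sequentially" by (rule filterlim_add_const_nat_at_top)
  obtain r where r: "strict_mono r" "AE x in lebball m R. \<forall>a<l. (\<lambda>k. \<phi> (r k + N) x a) \<longlonglongrightarrow> W x a"
    using W1p_tendsto_AE_subseq[OF m0 p sh[of "\<lambda>k. k + N"]] s0 by auto
  have s1: "filterlim (\<lambda>k. r k + N) sequentially sequentially"
    using filterlim_compose[OF s0 filterlim_subseq[OF r(1)]] .
  note c = sh[of "\<lambda>k. r k + N", OF _ s1, simplified]
  have "(\<lambda>k. \<integral>x. \<bar>pd i (\<lambda>x. \<phi> (r k + N) x a) x - wpd m ?B i (\<lambda>x. W x a) x\<bar> \<partial>lebball m R) \<longlonglongrightarrow> 0"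
    if a: "a < l" "i < m" for a i
  proof -
    have t: "has_weak_pd m ?B i (\<lambda>x. \<phi> k x a) (pd i (\<lambda>x. \<phi> k x a))" for k
      using \<phi>[of k] a m by (intro has_weak_pd_test) (auto simp: test_map_def)
    have meas: "pd i (\<lambda>x. \<phi> k x a) \<in> borel_measurable (lebball m R)" for k
    proof -
      have "continuous_on (Rn m) (pd i (\<lambda>x. \<phi> k x a))"
      proof -
        have "Ck 1 m (Rn m) (\<lambda>x. \<phi> k x a)" using \<phi>[of k] a by (simp only: test_map_def test_fun_def)
        then show ?thesis using a by simp
      qed
      then show ?thesis
        by (intro lebball_continuous_measurable) (use vball_Rn in \<open>auto intro: continuous_on_subset\<close>)
    qed
    have wm: "wpd m ?B i (\<lambda>x. W x a) \<in> borel_measurable (lebball m R)"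
      using c(1) W1pD(3)[OF p m0 _ a(1,2)] by (auto simp: W1p_tendsto_def Lp_iff)
    have pm: "wpd m ?B i (\<lambda>x. \<phi> (r k + N) x a) \<in> borel_measurable (lebball m R)" for k
      using W1pD(3)[OF p m0 c(2) a(1,2)] by (simp add: Lp_iff)
    have "(\<integral>x. \<bar>pd i (\<lambda>x. \<phi> (r k + N) x a) x - wpd m ?B i (\<lambda>x. W x a) x\<bar> \<partial>lebball m R)
      = (\<integral>x. \<bar>wpd m ?B i (\<lambda>x. \<phi> (r k + N) x a) x - wpd m ?B i (\<lambda>x. W x a) x\<bar> \<partial>lebball m R)" for k
    proof (rule integral_cong_AE)
      show "AE x in lebball m R. \<bar>pd i (\<lambda>x. \<phi> (r k + N) x a) x - wpd m ?B i (\<lambda>x. W x a) x\<bar> =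
        \<bar>wpd m ?B i (\<lambda>x. \<phi> (r k + N) x a) x - wpd m ?B i (\<lambda>x. W x a) x\<bar>"
        using wpd_AE[OF m0 t, of "r k + N"] by eventually_elim simp
    qed (use meas wm pm in auto)
    then show ?thesis using W1p_tendsto_L1(2)[OF m0 p c a] by simp
  qed
  moreover have "(\<lambda>k. \<integral>x. \<bar>\<phi> (r k + N) x a - W x a\<bar> \<partial>lebball m R) \<longlonglongrightarrow> 0" if "a < l" for a
    using W1p_tendsto_L1(1)[OF m0 p c that] .
  moreover have "W \<in> W1p m l p ?B" using conv by (simp add: W1p_tendsto_def)
  ultimately show ?thesis using r(2) \<phi>
    by (intro that[of "\<lambda>k. \<phi> (r k + N)"]) (auto simp: test_map_def)
qed

section \<open>The chain rule for Lipschitz functions of Sobolev maps\<close>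

lemma pd_eqI: "((\<lambda>t. f (x(i := t))) has_real_derivative D) (at (x i)) \<Longrightarrow> pd i f x = D"
  unfolding pd_def by (rule DERIV_imp_deriv)

text \<open>The data that a passage to the limit through \<Psi> uses. There are two instances:
  coordinates, for the Euler-Lagrange equation, and \<open>bowl\<close>, for Hardy's
  inequality.\<close>

locale lipschitz_chain =
  fixes m l :: nat and \<Psi> :: "(nat \<Rightarrow> real) \<Rightarrow> real" and \<Psi>d :: "nat \<Rightarrow> (nat \<Rightarrow> real) \<Rightarrow> real"
  assumes zero: "\<And>w. (\<And>a. a < l \<Longrightarrow> w a = 0) \<Longrightarrow> \<Psi> w = 0"
    and chain_Ck: "\<And>\<phi>. (\<And>a. a < l \<Longrightarrow> Ck 1 m (Rn m) (\<lambda>x. \<phi> x a)) \<Longrightarrow> Ck 1 m (Rn m) (\<lambda>x. \<Psi> (\<phi> x))"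
    and chain_pd: "\<And>\<phi> i x. (\<And>a. a < l \<Longrightarrow> Ck 1 m (Rn m) (\<lambda>x. \<phi> x a)) \<Longrightarrow> i < m \<Longrightarrow> x \<in> Rn m \<Longrightarrow>
      pd i (\<lambda>x. \<Psi> (\<phi> x)) x = (\<Sum>a<l. \<Psi>d a (\<phi> x) * pd i (\<lambda>x. \<phi> x a) x)"
    and bound: "\<And>a w. a < l \<Longrightarrow> \<bar>\<Psi>d a w\<bar> \<le> 1"
    and lip: "\<And>w w'. \<bar>\<Psi> w - \<Psi> w'\<bar> \<le> (\<Sum>a<l. \<bar>w a - w' a\<bar>)"
    and cont: "\<And>(w :: nat \<Rightarrow> nat \<Rightarrow> real) w' b. (\<And>a. a < l \<Longrightarrow> (\<lambda>k. w k a) \<longlonglongrightarrow> w' a) \<Longrightarrow> b < l \<Longrightarrow> (\<lambda>k. \<Psi>d b (w k)) \<longlonglongrightarrow> \<Psi>d b w'"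
    and meas: "\<And>(M :: (nat \<Rightarrow> real) measure) W. (\<And>a. a < l \<Longrightarrow> (\<lambda>x. W x a) \<in> borel_measurable M) \<Longrightarrow> (\<lambda>x. \<Psi> (W x)) \<in> borel_measurable M"
    and meas_d: "\<And>(M :: (nat \<Rightarrow> real) measure) W b. (\<And>a. a < l \<Longrightarrow> (\<lambda>x. W x a) \<in> borel_measurable M) \<Longrightarrow> b < l \<Longrightarrow> (\<lambda>x. \<Psi>d b (W x)) \<in> borel_measurable M"
begin

lemma chain_C1c:
  assumes "\<And>a. a < l \<Longrightarrow> test_fun m \<Omega> (\<lambda>x. \<phi> x a)"
  shows "C1c m \<Omega> (\<lambda>x. \<Psi> (\<phi> x))"
proof -
  have "\<forall>a. \<exists>K. a < l \<longrightarrow> compact K \<and> K \<subseteq> \<Omega> \<and> (\<forall>x\<in>Rn m - K. \<phi> x a = 0)"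
    using assms by (auto simp: test_fun_def)
  then obtain K where K: "\<And>a. a < l \<Longrightarrow> compact (K a) \<and> K a \<subseteq> \<Omega> \<and> (\<forall>x\<in>Rn m - K a. \<phi> x a = 0)"
    by metis
  have "Ck 1 m (Rn m) (\<lambda>x. \<Psi> (\<phi> x))"
    by (rule chain_Ck) (use assms in \<open>simp only: test_fun_def\<close>)
  moreover have "compact (\<Union>a<l. K a)" using K by (intro compact_UN) auto
  moreover have "(\<Union>a<l. K a) \<subseteq> \<Omega>" using K by auto
  moreover have "\<Psi> (\<phi> x) = 0" if "x \<in> Rn m - (\<Union>a<l. K a)" for x
    using K that by (intro zero) auto
  ultimately show ?thesis unfolding C1c_def by blast
qed

lemma integrable_bounded_mult:
  assumes "integrable M g" "h \<in> borel_measurable M" "AE x in M. \<bar>h x\<bar> \<le> C"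
  shows "integrable M (\<lambda>x. h x * g x :: real)"
proof (rule Bochner_Integration.integrable_bound[OF integrable_mult_right[OF assms(1), of C]])
  show "(\<lambda>x. h x * g x) \<in> borel_measurable M" using assms by auto
  show "AE x in M. norm (h x * g x) \<le> norm (C * g x)"
    using assms(3) by eventually_elim (auto simp: abs_mult intro!: mult_right_mono)
qed

text \<open>Integration by parts holds for \<Psi> \<circ> \<phi> with test maps \<phi>, and both
  sides pass to the limit. The right side uses the Lipschitz bound of \<Psi>, the left side
  convergence of the derivatives in L^1.\<close>

lemma chain_identity_bounded:
  assumes m: "m \<ge> 2" "i < m" and p: "1 \<le> p" and W: "W \<in> W01p m l p (oball m R)"
    and f: "Ck 1 m (punct m R) f"
    and fb: "\<And>x. x \<in> oball m R \<Longrightarrow> x \<noteq> origin m \<Longrightarrow> \<bar>f x\<bar> \<le> C"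
      "\<And>x. x \<in> oball m R \<Longrightarrow> x \<noteq> origin m \<Longrightarrow> \<bar>pd i f x\<bar> \<le> C"
  shows "integral\<^sup>L (lebball m R) (\<lambda>x. f x * (\<Sum>a<l. \<Psi>d a (W x) * wpd m (oball m R) i (\<lambda>x. W x a) x))
    = - integral\<^sup>L (lebball m R) (\<lambda>x. pd i f x * \<Psi> (W x))"
proof -
  let ?B = "oball m R" and ?M = "lebball m R"
  have m0: "m > 0" using m by simp
  obtain \<phi> where \<phi>: "\<And>k a. a < l \<Longrightarrow> test_fun m ?B (\<lambda>x. \<phi> k x a)"
    "\<And>a. a < l \<Longrightarrow> (\<lambda>k. \<integral>x. \<bar>\<phi> k x a - W x a\<bar> \<partial>?M) \<longlonglongrightarrow> 0"
    "\<And>a. a < l \<Longrightarrow> (\<lambda>k. \<integral>x. \<bar>pd i (\<lambda>x. \<phi> k x a) x - wpd m ?B i (\<lambda>x. W x a) x\<bar> \<partial>?M) \<longlonglongrightarrow> 0"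
    "AE x in ?M. \<forall>a<l. (\<lambda>k. \<phi> k x a) \<longlonglongrightarrow> W x a"
    "W \<in> W1p m l p ?B"
    by (rule W01p_approx[OF m(1) p W]) (use m in blast)
  let ?D = "\<lambda>a. wpd m ?B i (\<lambda>x. W x a)" and ?p = "\<lambda>k a. pd i (\<lambda>x. \<phi> k x a)"
  let ?F = "\<lambda>k a x. f x * (\<Psi>d a (\<phi> k x) * ?p k a x)" and ?G = "\<lambda>k a x. f x * (\<Psi>d a (\<phi> k x) * ?D a x)"
    and ?H = "\<lambda>a x. f x * (\<Psi>d a (W x) * ?D a x)"
  have AEb: "AE x in ?M. x \<in> ?B - {origin m}"
    using m by (intro AE_lebball_punct) auto
  have fm: "f \<in> borel_measurable ?M" "pd i f \<in> borel_measurable ?M"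
    using f m(2) by (auto intro!: lebball_continuous_measurable)
  have fb': "AE x in ?M. \<bar>f x\<bar> \<le> C" "AE x in ?M. \<bar>pd i f x\<bar> \<le> C"
    using AEb fb by (auto elim: eventually_mono)
  have Wi: "integrable ?M (\<lambda>x. W x a)" "integrable ?M (?D a)" if "a < l" for a
    using Lp_integrable[OF p] W1pD(1)[OF p m0 \<phi>(5) that] W1pD(3)[OF p m0 \<phi>(5) that m(2)] by auto
  have \<phi>C: "Ck 1 m (Rn m) (\<lambda>x. \<phi> k x a)" if "a < l" for k a using \<phi>(1)[OF that] by (simp only: test_fun_def)
  have ci: "integrable ?M g" if g: "continuous_on (Rn m) g" "\<And>x. x \<in> Rn m \<Longrightarrow> \<bar>g x\<bar> \<le> B" for g and B :: real
  proof (rule Bochner_Integration.integrable_bound[OF lebball_const_integrable[of m R B]])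
    show "g \<in> borel_measurable ?M"
      by (rule lebball_continuous_measurable) (use g(1) vball_Rn in \<open>blast intro: continuous_on_subset\<close>)
    show "AE x in ?M. norm (g x) \<le> norm B"
      using AE_space[of ?M] by eventually_elim (use g(2) vball_Rn in \<open>force simp: space_lebball\<close>)
  qed
  have \<phi>i: "integrable ?M (\<lambda>x. \<phi> k x a)" "integrable ?M (?p k a)" if a: "a < l" for k a
  proof -
    obtain B where B: "\<forall>x\<in>Rn m. \<bar>\<phi> k x a\<bar> \<le> B \<and> (\<forall>i<m. \<bar>pd i (\<lambda>x. \<phi> k x a) x\<bar> \<le> B)"
      using C1c_bounded[OF test_fun_C1c[OF \<phi>(1)[OF a]] vball_Rn] by blast
    have "continuous_on (Rn m) (\<lambda>x. \<phi> k x a)" "continuous_on (Rn m) (?p k a)"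
      using \<phi>C[OF a] m(2) by auto
    then show "integrable ?M (\<lambda>x. \<phi> k x a)" "integrable ?M (?p k a)"
      using B m(2) by (auto intro!: ci[where B = B])
  qed
  have \<Psi>m: "(\<lambda>x. \<Psi> (W x)) \<in> borel_measurable ?M" "(\<lambda>x. \<Psi> (\<phi> k x)) \<in> borel_measurable ?M"
     "b < l \<Longrightarrow> (\<lambda>x. \<Psi>d b (W x)) \<in> borel_measurable ?M" "b < l \<Longrightarrow> (\<lambda>x. \<Psi>d b (\<phi> k x)) \<in> borel_measurable ?M" for k b
    using Wi \<phi>i by (auto intro!: meas meas_d)
  have \<Psi>0: "\<bar>\<Psi> w\<bar> \<le> (\<Sum>a<l. \<bar>w a\<bar>)" for w using lip[of w "\<lambda>_. 0"] zero[of "\<lambda>_. 0"] by simp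
  have \<Psi>i: "integrable ?M (\<lambda>x. \<Psi> (W x))" "integrable ?M (\<lambda>x. \<Psi> (\<phi> k x))" for k
  proof -
    show "integrable ?M (\<lambda>x. \<Psi> (W x))"
      by (rule Bochner_Integration.integrable_bound[of _ "\<lambda>x. \<Sum>a<l. \<bar>W x a\<bar>"])
        (use Wi \<Psi>m \<Psi>0 in \<open>auto intro!: AE_I2 Bochner_Integration.integrable_sum order_trans[OF _ abs_ge_self]\<close>)
    show "integrable ?M (\<lambda>x. \<Psi> (\<phi> k x))"
      by (rule Bochner_Integration.integrable_bound[of _ "\<lambda>x. \<Sum>a<l. \<bar>\<phi> k x a\<bar>"])
        (use \<phi>i \<Psi>m \<Psi>0 in \<open>auto intro!: AE_I2 Bochner_Integration.integrable_sum order_trans[OF _ abs_ge_self]\<close>)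
  qed
  have id: "(\<integral>x. f x * (\<Sum>a<l. \<Psi>d a (\<phi> k x) * ?p k a x) \<partial>?M) = - (\<integral>x. pd i f x * \<Psi> (\<phi> k x) \<partial>?M)" for k
  proof -
    have "(\<integral>x. f x * pd i (\<lambda>x. \<Psi> (\<phi> k x)) x \<partial>?M) = - (\<integral>x. pd i f x * \<Psi> (\<phi> k x) \<partial>?M)"
      using fb vball_Rn vnorm_pos[of _ m] m
      by (intro integration_by_parts(3)[where \<beta> = 0 and C = C] f chain_C1c \<phi>(1)) (auto simp: subset_iff less_imp_neq[THEN not_sym])
    moreover have "(\<integral>x. f x * pd i (\<lambda>x. \<Psi> (\<phi> k x)) x \<partial>?M) = (\<integral>x. f x * (\<Sum>a<l. \<Psi>d a (\<phi> k x) * ?p k a x) \<partial>?M)"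
      by (rule Bochner_Integration.integral_cong[OF refl])
        (use vball_Rn m(2) in \<open>auto simp: space_lebball chain_pd[OF \<phi>C] subset_iff\<close>)
    ultimately show ?thesis by simp
  qed
  have dom: "(\<lambda>k. \<integral>x. F k x \<partial>?M) \<longlonglongrightarrow> 0"
    if "\<And>k. integrable ?M (F k)" "\<And>k. AE x in ?M. \<bar>F k x\<bar> \<le> G k x" "\<And>k. integrable ?M (G k)" "(\<lambda>k. \<integral>x. G k x \<partial>?M) \<longlonglongrightarrow> 0" for F G :: "nat \<Rightarrow> (nat \<Rightarrow> real) \<Rightarrow> real"
  proof (rule Lim_null_comparison[OF always_eventually that(4)], intro allI)
    fix k
    have "norm (\<integral>x. F k x \<partial>?M) \<le> (\<integral>x. norm (F k x) \<partial>?M)" by (rule integral_norm_bound)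
    also have "\<dots> \<le> (\<integral>x. G k x \<partial>?M)" using that by (intro integral_mono_AE) auto
    finally show "norm (\<integral>x. F k x \<partial>?M) \<le> (\<integral>x. G k x \<partial>?M)" .
  qed
  have R: "(\<lambda>k. (\<integral>x. pd i f x * \<Psi> (\<phi> k x) \<partial>?M)) \<longlonglongrightarrow> (\<integral>x. pd i f x * \<Psi> (W x) \<partial>?M)"
  proof -
    have i1: "integrable ?M (\<lambda>x. pd i f x * \<Psi> (\<phi> k x))" "integrable ?M (\<lambda>x. pd i f x * \<Psi> (W x))" for k
      by (intro integrable_bounded_mult[OF _ fm(2) fb'(2)] \<Psi>i)+
    have "(\<lambda>k. \<integral>x. pd i f x * \<Psi> (\<phi> k x) - pd i f x * \<Psi> (W x) \<partial>?M) \<longlonglongrightarrow> 0"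
    proof (rule dom[where G = "\<lambda>k x. \<Sum>a<l. C * \<bar>\<phi> k x a - W x a\<bar>"])
      show "integrable ?M (\<lambda>x. pd i f x * \<Psi> (\<phi> k x) - pd i f x * \<Psi> (W x))" for k using i1 by auto
      show "AE x in ?M. \<bar>pd i f x * \<Psi> (\<phi> k x) - pd i f x * \<Psi> (W x)\<bar> \<le> (\<Sum>a<l. C * \<bar>\<phi> k x a - W x a\<bar>)" for k
        using fb'(2)
      proof eventually_elim
        case (elim x)
        have "\<bar>pd i f x\<bar> * \<bar>\<Psi> (\<phi> k x) - \<Psi> (W x)\<bar> \<le> C * (\<Sum>a<l. \<bar>\<phi> k x a - W x a\<bar>)"
          using elim by (intro mult_mono lip) auto
        then show ?case by (simp add: abs_mult[symmetric] right_diff_distrib sum_distrib_left)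
      qed
      show "integrable ?M (\<lambda>x. \<Sum>a<l. C * \<bar>\<phi> k x a - W x a\<bar>)" for k
        using \<phi>i Wi by (intro Bochner_Integration.integrable_sum integrable_mult_right integrable_abs Bochner_Integration.integrable_diff) auto
      have "(\<lambda>k. \<Sum>a<l. C * (\<integral>x. \<bar>\<phi> k x a - W x a\<bar> \<partial>?M)) \<longlonglongrightarrow> (\<Sum>a<l. C * 0)"
        by (intro tendsto_sum tendsto_mult tendsto_const \<phi>(2)) auto
      then show "(\<lambda>k. \<integral>x. (\<Sum>a<l. C * \<bar>\<phi> k x a - W x a\<bar>) \<partial>?M) \<longlonglongrightarrow> 0"
        using \<phi>i Wi by (subst Bochner_Integration.integral_sum) auto
    qed
    then show ?thesis using i1 by (simp add: LIM_zero_iff)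
  qed
  have L: "(\<lambda>k. (\<integral>x. f x * (\<Sum>a<l. \<Psi>d a (\<phi> k x) * ?p k a x) \<partial>?M)) \<longlonglongrightarrow>
     (\<integral>x. f x * (\<Sum>a<l. \<Psi>d a (W x) * ?D a x) \<partial>?M)"
  proof -
    have La: "(\<lambda>k. (\<integral>x. ?F k a x \<partial>?M)) \<longlonglongrightarrow> (\<integral>x. ?H a x \<partial>?M)"
      and ia: "\<And>k. integrable ?M (\<lambda>x. ?F k a x)"
        "integrable ?M (\<lambda>x. ?H a x)" if a: "a < l" for a
    proof -
      have b: "AE x in ?M. \<bar>\<Psi>d a (\<phi> k x)\<bar> \<le> 1" "AE x in ?M. \<bar>\<Psi>d a (W x)\<bar> \<le> 1" for k using bound[OF a] by auto
      show i1: "integrable ?M (\<lambda>x. ?F k a x)"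
        and i2: "integrable ?M (\<lambda>x. ?H a x)"
        for k
        by (intro integrable_bounded_mult[OF _ fm(1) fb'(1)] integrable_bounded_mult[OF _ \<Psi>m(3)[OF a] b(2)]
           integrable_bounded_mult[OF _ \<Psi>m(4)[OF a] b(1)] \<phi>i Wi a)+
      have i3: "integrable ?M (\<lambda>x. ?G k a x)" for k
        by (intro integrable_bounded_mult[OF _ fm(1) fb'(1)] integrable_bounded_mult[OF _ \<Psi>m(4)[OF a] b(1)] Wi a)
      \<comment> \<open>The derivative of the test map is exchanged first, against the bounded
        factor \<open>\<Psi>d\<close>; the factor itself is exchanged afterwards by dominated
        convergence.\<close>
      have "(\<lambda>k. \<integral>x. ?F k a x - ?G k a x \<partial>?M) \<longlonglongrightarrow> 0"
      proof (rule dom[where G = "\<lambda>k x. C * \<bar>?p k a x - ?D a x\<bar>"])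
        show "AE x in ?M. \<bar>?F k a x - ?G k a x\<bar>
            \<le> C * \<bar>?p k a x - ?D a x\<bar>" for k
          using fb'(1)
        proof eventually_elim
          case (elim x)
          have "\<bar>f x\<bar> * (\<bar>\<Psi>d a (\<phi> k x)\<bar> * \<bar>?p k a x - ?D a x\<bar>) \<le> C * (1 * \<bar>?p k a x - ?D a x\<bar>)"
            using elim bound[OF a] by (intro mult_mono) auto
          then show ?case by (simp only: abs_mult[symmetric] right_diff_distrib mult_1_left)
        qed
        show "integrable ?M (\<lambda>x. C * \<bar>?p k a x - ?D a x\<bar>)" for k
          using \<phi>i(2)[OF a] Wi(2)[OF a] by (intro integrable_mult_right integrable_abs Bochner_Integration.integrable_diff)
        show "(\<lambda>k. \<integral>x. C * \<bar>?p k a x - ?D a x\<bar> \<partial>?M) \<longlonglongrightarrow> 0"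
          using tendsto_mult_left[OF \<phi>(3)[OF a], of C] by simp
      qed (use i1 i3 in auto)
      moreover have "(\<lambda>k. \<integral>x. ?G k a x \<partial>?M) \<longlonglongrightarrow> (\<integral>x. ?H a x \<partial>?M)"
      proof (rule integral_dominated_convergence[where w = "\<lambda>x. C * \<bar>?D a x\<bar>"])
        show "AE x in ?M. (\<lambda>k. ?G k a x) \<longlonglongrightarrow> ?H a x"
          using \<phi>(4) by eventually_elim (intro tendsto_intros cont a; blast)
        show "AE x in ?M. norm (?G k a x) \<le> C * \<bar>?D a x\<bar>" for k
          using fb'(1)
        proof eventually_elim
          case (elim x)
          have "\<bar>f x\<bar> * (\<bar>\<Psi>d a (\<phi> k x)\<bar> * \<bar>?D a x\<bar>) \<le> C * (1 * \<bar>?D a x\<bar>)"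
            using elim bound[OF a] by (intro mult_mono) auto
          then show ?case by (simp add: abs_mult)
        qed
      qed (use i2 i3 Wi(2)[OF a] in auto)
      ultimately show "(\<lambda>k. (\<integral>x. ?F k a x \<partial>?M)) \<longlonglongrightarrow> (\<integral>x. ?H a x \<partial>?M)"
        using i1 i3 tendsto_add[of "\<lambda>k. \<integral>x. ?F k a x - ?G k a x \<partial>?M" 0 sequentially] by fastforce
    qed
    have "(\<lambda>k. (\<Sum>a<l. \<integral>x. ?F k a x \<partial>?M)) \<longlonglongrightarrow> (\<Sum>a<l. \<integral>x. ?H a x \<partial>?M)"
      by (intro tendsto_sum La) auto
    then show ?thesis using ia by (simp add: sum_distrib_left)
  qed
  show ?thesis using LIMSEQ_unique[OF L] tendsto_minus[OF R] unfolding id by blast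
qed

end

section \<open>Vector fields with a singularity at the origin\<close>

lemma powr_times_exp_le: "0 < y \<Longrightarrow> 0 < c \<Longrightarrow> y powr c * exp (- y) \<le> c powr c" for y c :: real
proof -
  assume y: "0 < y" "0 < c"
  have "y / c \<le> exp (y / c)" using exp_ge_add_one_self[of "y / c"] by linarith
  then have "(y / c) powr c \<le> exp (y / c) powr c" using y by (intro powr_mono2) auto
  then have "y powr c / c powr c \<le> exp y" using y by (simp add: powr_divide exp_powr_real)
  then show ?thesis using y by (simp add: exp_minus field_simps)
qed

text \<open>Young's inequality by cases: for b \<le> 1 / r the first term dominates, otherwise the
  second.\<close>

lemma powr_times_le: "0 < r \<Longrightarrow> 0 \<le> b \<Longrightarrow> 1 < p \<Longrightarrow> r powr (1 - p) * b \<le> r powr (- p) + b powr p" for r b p :: real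
proof -
  assume r: "0 < r" and b: "0 \<le> b" and p: "1 < p"
  show ?thesis
  proof (cases "b \<le> 1 / r")
    case True
    have "r powr (1 - p) * b \<le> r powr (1 - p) * (1 / r)" using True by (intro mult_left_mono) auto
    also have "\<dots> = r powr (- p)" using r by (simp add: powr_diff powr_minus field_simps)
    finally show ?thesis by (simp add: add_increasing2)
  next
    case False
    then have b0: "b > 0" using r by (auto intro: less_trans[of 0 "1 / r"])
    have "r powr (1 - p) = (1 / r) powr (p - 1)" using r by (simp add: powr_divide flip: powr_minus_divide)
    also have "\<dots> \<le> b powr (p - 1)" using False r p by (intro powr_mono2) auto
    finally have "r powr (1 - p) * b \<le> b powr (p - 1) * b" using b by (intro mult_right_mono) auto
    also have "\<dots> = b powr p" using b0 by (simp add: powr_diff)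
    finally show ?thesis by (simp add: add_increasing)
  qed
qed

text \<open>Flat to infinite order at the origin, so it makes any field with a power singularity
  bounded, and it tends to 1 off the origin as \<open>n\<close> grows. Written through ln |x| it is
  visibly smooth there.\<close>

definition cutoff :: "nat \<Rightarrow> nat \<Rightarrow> (nat \<Rightarrow> real) \<Rightarrow> real" where
  "cutoff m n x = exp (- (exp (- ln (vnorm m x)) / real (Suc n)))"

lemma cutoff_Ck: "Ck k m (punct m R) (cutoff m n)"
proof -
  have s: "smooth1 UNIV (\<lambda>u::real. exp (- (exp (- u) / real (Suc n))))"
    unfolding divide_inverse
    by (intro smooth1_compose[OF smooth1_exp] smooth1_minus smooth1_mult smooth1_const smooth1_id) auto
  show ?thesis unfolding cutoff_def
    by (rule Ck_compose_smooth1[OF openin_punctured s Ck_ln_vnorm]) (auto intro: openin_punctured)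
qed

lemma cutoff_eq: "x \<in> Rn m \<Longrightarrow> x \<noteq> origin m \<Longrightarrow> cutoff m n x = exp (- (1 / (real (Suc n) * vnorm m x)))"
  using vnorm_pos[of x m] by (simp add: cutoff_def exp_minus field_simps)

lemma cutoff_DERIV:
  assumes "x \<in> Rn m" "x \<noteq> origin m" "i < m"
  shows "((\<lambda>t. cutoff m n (x(i := t))) has_real_derivative
    cutoff m n x * (1 / (real (Suc n) * vnorm m x)) * (x i / (vnorm m x)\<^sup>2)) (at (x i))"
proof -
  have pos: "vnorm m x > 0" using assms vnorm_pos by blast
  have "((\<lambda>u. exp (- (exp (- u) / real (Suc n)))) has_real_derivative
     exp (- (exp (- u) / real (Suc n))) * (exp (- u) / real (Suc n))) (at u)" for u :: real
  proof -
    have "((\<lambda>u. exp (- (exp (- u) / N))) has_real_derivative exp (- (exp (- u) / N)) * (exp (- u) / N)) (at u)"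
      if "N > 0" for N :: real
      using that by (auto intro!: derivative_eq_intros simp: field_simps)
    from this[of "real (Suc n)"] show ?thesis by simp
  qed
  from DERIV_chain2[OF this DERIV_ln_vnorm[OF assms]] show ?thesis
    using pos by (simp add: cutoff_def exp_minus inverse_eq_divide mult_ac)
qed

context lipschitz_chain
begin

text \<open>The field is multiplied by the cutoff, so that the bounded case applies. With y = 1 /
  ((n + 1) |x|), the derivative of the cutoff adds a term of size |x|^(-p) y exp (- y), which is
  dominated by |x|^(-p) uniformly in \<open>n\<close> and tends to 0 pointwise; p < m makes the
  majorant integrable. Boundedness of \<Psi> \<circ> W enters in this domination.\<close>

lemma chain_identity:
  fixes p :: real
  assumes m: "m \<ge> 2" "i < m" and p: "1 < p" "p < m" and W: "W \<in> W01p m l p (oball m R)"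
    and f: "Ck 1 m (punct m R) f"
    and fb: "\<And>x. x \<in> oball m R \<Longrightarrow> x \<noteq> origin m \<Longrightarrow> \<bar>f x\<bar> \<le> C * vnorm m x powr (1 - p)"
      "\<And>x. x \<in> oball m R \<Longrightarrow> x \<noteq> origin m \<Longrightarrow> \<bar>pd i f x\<bar> \<le> C * vnorm m x powr (- p)"
    and Wb: "AE x in lebball m R. \<bar>\<Psi> (W x)\<bar> \<le> B"
  shows "integrable (lebball m R) (\<lambda>x. f x * (\<Sum>a<l. \<Psi>d a (W x) * wpd m (oball m R) i (\<lambda>x. W x a) x))"
    "integrable (lebball m R) (\<lambda>x. pd i f x * \<Psi> (W x))"
    "integral\<^sup>L (lebball m R) (\<lambda>x. f x * (\<Sum>a<l. \<Psi>d a (W x) * wpd m (oball m R) i (\<lambda>x. W x a) x))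
    = - integral\<^sup>L (lebball m R) (\<lambda>x. pd i f x * \<Psi> (W x))"
proof -
  let ?B = "oball m R" and ?X = "punct m R" and ?M = "lebball m R"
  let ?q = "\<lambda>x. vnorm m x powr (- p)"
  let ?D = "\<lambda>a. wpd m ?B i (\<lambda>x. W x a)"
  let ?S = "\<lambda>x. \<Sum>a<l. \<Psi>d a (W x) * ?D a x"
  have m0: "m > 0" and p': "1 \<le> p" using m p by auto
  have WW: "W \<in> W1p m l p ?B" using W by (auto simp: W01p_def W1p_tendsto_def)
  have AEb: "AE x in ?M. x \<in> ?X"
    using m by (intro AE_lebball_punct) auto
  have bp: "x \<in> Rn m" "vnorm m x > 0" "vnorm m x < R" if "x \<in> ?X" for x
    using that vnorm_pos[of x m] by (auto simp: vball_origin)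
  have Dp: "Lp m p ?B (?D a)" if "a < l" for a using W1pD(3)[OF p' m0 WW that m(2)] .
  have Wm: "(\<lambda>x. W x a) \<in> borel_measurable ?M" if "a < l" for a
    using W1pD(1)[OF p' m0 WW that] by (simp add: Lp_iff)
  have fm: "f \<in> borel_measurable ?M" "pd i f \<in> borel_measurable ?M"
    using f m(2) by (auto intro!: lebball_continuous_measurable)
  have Sm: "?S \<in> borel_measurable ?M" using Dp Wm by (intro borel_measurable_sum borel_measurable_times meas_d) (auto simp: Lp_iff)
  have \<Psi>m: "(\<lambda>x. \<Psi> (W x)) \<in> borel_measurable ?M" using Wm by (rule meas)
  have Sb: "\<bar>?S x\<bar> \<le> (\<Sum>a<l. \<bar>?D a x\<bar>)" for x
    by (rule order_trans[OF sum_abs]) (use bound in \<open>auto simp: abs_mult intro!: sum_mono mult_left_le_one_le\<close>)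
  \<comment> \<open>By \<open>powr_times_le\<close> this dominates |x|^(1-p) |D W|, and it is
    integrable because D W is in L^p and p < m.\<close>
  define w1 where "w1 = (\<lambda>x. \<bar>C\<bar> * (\<Sum>a<l. ?q x + \<bar>?D a x\<bar> powr p))"
  define w2 where "w2 = (\<lambda>x. (2 * \<bar>C\<bar> * \<bar>B\<bar>) * ?q x)"
  have w1: "integrable ?M w1" unfolding w1_def
    using Dp p by (intro integrable_mult_right Bochner_Integration.integrable_sum Bochner_Integration.integrable_add vnorm_powr_integrable) (auto simp: Lp_iff)
  have w2: "integrable ?M w2" unfolding w2_def using p by (intro integrable_mult_right vnorm_powr_integrable) auto
  have fS: "\<bar>f x * ?S x\<bar> \<le> w1 x" if x: "x \<in> ?X" for x
  proof -
    have "\<bar>f x\<bar> \<le> \<bar>C\<bar> * vnorm m x powr (1 - p)"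
      by (rule order_trans[OF fb(1) mult_right_mono[OF abs_ge_self]]) (use x in auto)
    then have "\<bar>f x\<bar> * \<bar>?S x\<bar> \<le> (\<bar>C\<bar> * vnorm m x powr (1 - p)) * (\<Sum>a<l. \<bar>?D a x\<bar>)"
      using Sb by (intro mult_mono) auto
    also have "\<dots> = \<bar>C\<bar> * (\<Sum>a<l. vnorm m x powr (1 - p) * \<bar>?D a x\<bar>)" by (simp add: sum_distrib_left mult_ac)
    also have "\<dots> \<le> w1 x" unfolding w1_def
      using bp[OF x] p by (intro mult_left_mono sum_mono powr_times_le) auto
    finally show ?thesis by (simp add: abs_mult)
  qed
  have pdf: "\<bar>pd i f x\<bar> \<le> \<bar>C\<bar> * ?q x" if x: "x \<in> ?X" for x
    by (rule order_trans[OF fb(2) mult_right_mono[OF abs_ge_self]]) (use x in auto)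
  show i1: "integrable ?M (\<lambda>x. f x * ?S x)"
  proof (rule Bochner_Integration.integrable_bound[OF w1])
    show "AE x in ?M. norm (f x * ?S x) \<le> norm (w1 x)"
      using AEb by eventually_elim (use fS in \<open>force intro: order_trans[OF _ abs_ge_self]\<close>)
  qed (use fm Sm in auto)
  define F where "F = (\<lambda>n x. f x * cutoff m n x)"
  define y where "y = (\<lambda>n x. 1 / (real (Suc n) * vnorm m x))"
  have F_Ck: "Ck 1 m (?X) (F n)" for n
    unfolding F_def by (intro Ck_mult openin_punctured f cutoff_Ck)
  have F_pd: "pd i (F n) x = pd i f x * cutoff m n x + f x * (cutoff m n x * y n x * (x i / (vnorm m x)\<^sup>2))"
    if x: "x \<in> ?X" for n x
  proof (rule pd_eqI)
    have "((\<lambda>t. f (x(i := t))) has_real_derivative pd i f x) (at (x i))"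
      by (rule Ck_DERIV[OF f[unfolded One_nat_def] x m(2)])
    from DERIV_mult[OF this cutoff_DERIV[of x m i n]] x bp(1)[OF x] m(2)
    show "((\<lambda>t. F n (x(i := t))) has_real_derivative
      pd i f x * cutoff m n x + f x * (cutoff m n x * y n x * (x i / (vnorm m x)\<^sup>2))) (at (x i))"
      by (simp add: F_def y_def algebra_simps)
  qed
  have ypos: "y n x > 0" and cut: "cutoff m n x = exp (- y n x)" if "x \<in> ?X" for n x
    using bp[OF that] cutoff_eq[of x m n] that by (auto simp: y_def)
  have xi: "\<bar>x i / (vnorm m x)\<^sup>2\<bar> \<le> 1 / vnorm m x" if x: "x \<in> ?X" for x
    using vnorm_component[OF m(2), of x] bp(2)[OF x] by (simp add: divide_simps power2_eq_square mult_right_mono)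
  \<comment> \<open>Powers of |x| are traded for powers of y, which exp (- y) controls. The factor
    growing with \<open>n\<close> is harmless, because boundedness is needed for each
    \<open>n\<close> separately.\<close>
  have ry: "vnorm m x powr (- c) = real (Suc n) powr c * y n x powr c" if x: "x \<in> ?X" for n x c
  proof -
    have "r powr (- c) = N powr c * (1 / (N * r)) powr c" if "r > 0" "N > 0" for r N :: real
      using that by (simp add: powr_divide powr_mult powr_minus field_simps)
    from this[OF bp(2)[OF x], of "real (Suc n)"] show ?thesis by (simp only: y_def of_nat_0_less_iff zero_less_Suc)
  qed
  have r1: "vnorm m x powr (1 - p) = vnorm m x * ?q x" if x: "x \<in> ?X" for x
    using bp(2)[OF x] by (simp add: powr_diff powr_minus field_simps)
  have second: "\<bar>f x * (cutoff m n x * y n x * (x i / (vnorm m x)\<^sup>2))\<bar> \<le> \<bar>C\<bar> * ?q x * (y n x * exp (- y n x))"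
    if x: "x \<in> ?X" for n x
  proof -
    have "\<bar>f x\<bar> \<le> \<bar>C\<bar> * (vnorm m x * ?q x)"
      unfolding r1[OF x, symmetric]
      by (rule order_trans[OF fb(1) mult_right_mono[OF abs_ge_self]]) (use x in auto)
    then have "\<bar>f x\<bar> * ((y n x * exp (- y n x)) * \<bar>x i / (vnorm m x)\<^sup>2\<bar>) \<le>
      (\<bar>C\<bar> * (vnorm m x * ?q x)) * ((y n x * exp (- y n x)) * (1 / vnorm m x))"
      using xi[OF x] ypos[OF x, of n] bp(2)[OF x] by (intro mult_mono mult_left_mono) auto
    then show ?thesis using bp(2)[OF x] ypos[OF x, of n] by (simp add: abs_mult cut[OF x] mult_ac)
  qed
  have yexp: "y n x * exp (- y n x) \<le> 1" if x: "x \<in> ?X" for n x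
    using powr_times_exp_le[of "y n x" 1] ypos[OF x, of n] by simp
  have F_pd_le: "\<bar>pd i (F n) x\<bar> \<le> 2 * \<bar>C\<bar> * ?q x" if x: "x \<in> ?X" for n x
  proof -
    have "\<bar>pd i f x * cutoff m n x\<bar> \<le> \<bar>C\<bar> * ?q x * 1"
      unfolding abs_mult using pdf[OF x] ypos[OF x, of n] by (intro mult_mono) (auto simp: cut[OF x])
    moreover have "\<bar>C\<bar> * ?q x * (y n x * exp (- y n x)) \<le> \<bar>C\<bar> * ?q x * 1"
      using yexp[OF x] by (intro mult_left_mono) auto
    ultimately have "\<bar>pd i (F n) x\<bar> \<le> \<bar>C\<bar> * ?q x * 1 + \<bar>C\<bar> * ?q x * 1"
      unfolding F_pd[OF x] by (intro order_trans[OF abs_triangle_ineq] add_mono order_trans[OF second[OF x, of n]])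
    then show ?thesis by simp
  qed
  have idn: "integral\<^sup>L ?M (\<lambda>x. F n x * ?S x) = - integral\<^sup>L ?M (\<lambda>x. pd i (F n) x * \<Psi> (W x))" for n
  proof (rule chain_identity_bounded[OF m p' W F_Ck])
    let ?c = "real (Suc n) powr p" and ?K1 = "p powr p" and ?K2 = "(p + 1) powr (p + 1)"
    let ?C = "\<bar>C\<bar> * \<bar>R\<bar> * (?c * ?K1) + (\<bar>C\<bar> * (?c * ?K1) + \<bar>C\<bar> * (?c * ?K2))"
    fix x assume "x \<in> ?B" "x \<noteq> origin m"
    then have x: "x \<in> ?X" by simp
    have k1: "?q x * exp (- y n x) \<le> ?c * ?K1"
      unfolding ry[OF x, of p n] using powr_times_exp_le[of "y n x" p] ypos[OF x, of n] p by (simp add: mult.assoc mult_left_mono)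
    have k2: "?q x * (y n x * exp (- y n x)) \<le> ?c * ?K2"
    proof -
      have "y n x powr p * y n x = y n x powr (p + 1)" using ypos[OF x, of n] by (simp add: powr_add)
      then show ?thesis unfolding ry[OF x, of p n]
        using powr_times_exp_le[of "y n x" "p + 1"] ypos[OF x, of n] p by (simp add: mult.assoc[symmetric])
    qed
    have nn: "0 \<le> \<bar>C\<bar> * \<bar>R\<bar> * (?c * ?K1)" "0 \<le> \<bar>C\<bar> * (?c * ?K1)" "0 \<le> \<bar>C\<bar> * (?c * ?K2)" by auto
    have "\<bar>f x\<bar> \<le> \<bar>C\<bar> * (vnorm m x * ?q x)"
      unfolding r1[OF x, symmetric]
      by (rule order_trans[OF fb(1) mult_right_mono[OF abs_ge_self]]) (use x in auto)
    then have "\<bar>F n x\<bar> \<le> (\<bar>C\<bar> * (vnorm m x * ?q x)) * exp (- y n x)"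
      unfolding F_def cut[OF x] abs_mult by (simp add: mult_right_mono)
    also have "\<dots> = (\<bar>C\<bar> * vnorm m x) * (?q x * exp (- y n x))" by simp
    also have "\<dots> \<le> (\<bar>C\<bar> * \<bar>R\<bar>) * (?c * ?K1)"
    proof (rule mult_mono[OF _ k1])
      show "\<bar>C\<bar> * vnorm m x \<le> \<bar>C\<bar> * \<bar>R\<bar>" using bp[OF x] by (intro mult_left_mono) auto
    qed auto
    finally show "\<bar>F n x\<bar> \<le> ?C" using nn by linarith
    have "\<bar>pd i f x * cutoff m n x\<bar> \<le> (\<bar>C\<bar> * ?q x) * exp (- y n x)"
      unfolding abs_mult cut[OF x] using pdf[OF x] by (simp add: mult_right_mono)
    also have "\<dots> \<le> \<bar>C\<bar> * (?c * ?K1)" unfolding mult.assoc using k1 by (intro mult_left_mono) auto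
    finally have a: "\<bar>pd i f x * cutoff m n x\<bar> \<le> \<bar>C\<bar> * (?c * ?K1)" .
    have "\<bar>C\<bar> * ?q x * (y n x * exp (- y n x)) \<le> \<bar>C\<bar> * (?c * ?K2)"
      unfolding mult.assoc[of "\<bar>C\<bar>"] using k2 by (intro mult_left_mono) auto
    then show "\<bar>pd i (F n) x\<bar> \<le> ?C" unfolding F_pd[OF x]
      by (intro order_trans[OF abs_triangle_ineq] add_increasing[OF nn(1)] add_mono a order_trans[OF second[OF x, of n]])
  qed
  have y0: "(\<lambda>n. y n x) \<longlonglongrightarrow> 0" if x: "x \<in> ?X" for x
  proof -
    have "(\<lambda>n. (1 / vnorm m x) * (1 / real (Suc n))) \<longlonglongrightarrow> (1 / vnorm m x) * 0"
      by (intro tendsto_intros LIMSEQ_Suc[OF lim_1_over_n])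
    then show ?thesis by (simp add: y_def mult_ac)
  qed
  have c1: "(\<lambda>n. cutoff m n x) \<longlonglongrightarrow> 1" if x: "x \<in> ?X" for x
    unfolding cut[OF x] using tendsto_exp[OF tendsto_minus[OF y0[OF x]]] by simp
  have Fm: "F n \<in> borel_measurable ?M" "pd i (F n) \<in> borel_measurable ?M" for n
    using F_Ck[of n] m(2) by (auto intro!: lebball_continuous_measurable)
  have L: "(\<lambda>n. integral\<^sup>L ?M (\<lambda>x. F n x * ?S x)) \<longlonglongrightarrow> integral\<^sup>L ?M (\<lambda>x. f x * ?S x)"
  proof (rule integral_dominated_convergence[OF _ _ w1])
    show "AE x in ?M. (\<lambda>n. F n x * ?S x) \<longlonglongrightarrow> f x * ?S x"
      using AEb
    proof eventually_elim
      case (elim x)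
      have "(\<lambda>n. (f x * cutoff m n x) * ?S x) \<longlonglongrightarrow> (f x * 1) * ?S x" by (intro tendsto_intros c1[OF elim])
      then show ?case by (simp add: F_def)
    qed
    show "AE x in ?M. norm (F n x * ?S x) \<le> w1 x" for n
      using AEb
    proof eventually_elim
      case (elim x)
      have "\<bar>f x * ?S x\<bar> * cutoff m n x \<le> \<bar>f x * ?S x\<bar> * 1"
        using ypos[OF elim, of n] by (intro mult_left_mono) (auto simp: cut[OF elim])
      then show ?case using fS[OF elim] by (simp add: F_def abs_mult cut[OF elim] mult_ac)
    qed
  qed (use fm Sm Fm in auto)
  have R: "(\<lambda>n. integral\<^sup>L ?M (\<lambda>x. pd i (F n) x * \<Psi> (W x))) \<longlonglongrightarrow> integral\<^sup>L ?M (\<lambda>x. pd i f x * \<Psi> (W x))"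
  proof (rule integral_dominated_convergence[OF _ _ w2])
    show "AE x in ?M. (\<lambda>n. pd i (F n) x * \<Psi> (W x)) \<longlonglongrightarrow> pd i f x * \<Psi> (W x)"
      using AEb
    proof eventually_elim
      case (elim x)
      have "(\<lambda>n. (pd i f x * cutoff m n x + f x * (cutoff m n x * y n x * (x i / (vnorm m x)\<^sup>2))) * \<Psi> (W x))
        \<longlonglongrightarrow> (pd i f x * 1 + f x * (1 * 0 * (x i / (vnorm m x)\<^sup>2))) * \<Psi> (W x)"
        by (intro tendsto_intros c1[OF elim] y0[OF elim])
      then show ?case by (simp add: F_pd[OF elim])
    qed
    show "AE x in ?M. norm (pd i (F n) x * \<Psi> (W x)) \<le> w2 x" for n
      using AEb Wb
    proof eventually_elim
      case (elim x)
      have "\<bar>pd i (F n) x\<bar> * \<bar>\<Psi> (W x)\<bar> \<le> (2 * \<bar>C\<bar> * ?q x) * \<bar>B\<bar>"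
        using F_pd_le[OF elim(1)] elim(2) by (intro mult_mono) auto
      then show ?case by (simp add: w2_def abs_mult mult_ac)
    qed
  qed (use fm \<Psi>m Fm in auto)
  show "integrable ?M (\<lambda>x. pd i f x * \<Psi> (W x))"
  proof (rule Bochner_Integration.integrable_bound[OF w2])
    show "AE x in ?M. norm (pd i f x * \<Psi> (W x)) \<le> norm (w2 x)"
      using AEb Wb
    proof eventually_elim
      case (elim x)
      have "\<bar>pd i f x\<bar> * \<bar>\<Psi> (W x)\<bar> \<le> (\<bar>C\<bar> * ?q x) * \<bar>B\<bar>"
        using pdf[OF elim(1)] elim(2) by (intro mult_mono) auto
      also have "\<dots> \<le> w2 x" by (simp add: w2_def mult_ac)
      finally show ?case by (simp add: abs_mult)
    qed
  qed (use fm \<Psi>m in auto)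
  show "integral\<^sup>L ?M (\<lambda>x. f x * ?S x) = - integral\<^sup>L ?M (\<lambda>x. pd i f x * \<Psi> (W x))"
    using LIMSEQ_unique[OF L] tendsto_minus[OF R] unfolding idn by blast
qed

end

section \<open>Instances of the chain rule\<close>

lemma lipschitz_chain_coord:
  assumes "b < l"
  shows "lipschitz_chain m l (\<lambda>w. w b) (\<lambda>a w. if a = b then 1 else 0)"
proof
  show "\<bar>w b - w' b\<bar> \<le> (\<Sum>a<l. \<bar>w a - w' a\<bar>)" for w w' :: "nat \<Rightarrow> real"
    using assms by (intro member_le_sum[of b "{..<l}" "\<lambda>a. \<bar>w a - w' a\<bar>"]) auto
  show "(\<lambda>x. if c = b then 1 else 0 :: real) \<in> borel_measurable M" for c and M :: "(nat \<Rightarrow> real) measure" by simp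
qed (use assms in \<open>auto simp: if_distrib[of "\<lambda>c. c * _"] sum.delta cong: if_cong\<close>)

text \<open>Quadratic for small and linear for large arguments, with gradient of length below 1. It
  therefore obeys the Lipschitz chain rule and is comparable to |w|^2 on bounded sets.\<close>

definition bowl :: "nat \<Rightarrow> (nat \<Rightarrow> real) \<Rightarrow> real" where "bowl l w = sqrt (1 + (\<Sum>a<l. (w a)\<^sup>2)) - 1"

lemma lipschitz_chain_bowl:
  "lipschitz_chain m l (bowl l) (\<lambda>a w. w a / sqrt (1 + (\<Sum>a<l. (w a)\<^sup>2)))"
proof
  have ge1: "1 \<le> 1 + (\<Sum>a<l. (w a)\<^sup>2)" for w :: "nat \<Rightarrow> real" by (simp add: sum_nonneg)
  have sq1: "1 \<le> sqrt (1 + (\<Sum>a<l. (w a)\<^sup>2))" for w :: "nat \<Rightarrow> real" using ge1[of w] by simp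
  have comp: "\<bar>w a\<bar> \<le> sqrt (1 + (\<Sum>a<l. (w a)\<^sup>2))" if "a < l" for w :: "nat \<Rightarrow> real" and a
  proof -
    have "(w a)\<^sup>2 \<le> (\<Sum>a<l. (w a)\<^sup>2)" using that by (intro member_le_sum) auto
    then have "sqrt ((w a)\<^sup>2) \<le> sqrt (1 + (\<Sum>a<l. (w a)\<^sup>2))" by (intro real_sqrt_le_mono) linarith
    then show ?thesis by simp
  qed
  show "bowl l w = 0" if "\<And>a. a < l \<Longrightarrow> w a = 0" for w using that by (simp add: bowl_def)
  show "\<bar>w a / sqrt (1 + (\<Sum>a<l. (w a)\<^sup>2))\<bar> \<le> 1" if "a < l" for a and w :: "nat \<Rightarrow> real"
    using comp[OF that, of w] sq1[of w] by (simp add: abs_div)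
  show "\<bar>bowl l w - bowl l w'\<bar> \<le> (\<Sum>a<l. \<bar>w a - w' a\<bar>)" for w w'
  proof -
    let ?A = "sqrt (1 + (\<Sum>a<l. (w a)\<^sup>2))" and ?B = "sqrt (1 + (\<Sum>a<l. (w' a)\<^sup>2))"
    have AB: "?A \<ge> 1" "?B \<ge> 1" using sq1 by auto
    \<comment> \<open>Difference of squares: |w a + w' a| is at most the sum of the two roots, which
      then cancels.\<close>
    have "(?A - ?B) * (?A + ?B) = ?A\<^sup>2 - ?B\<^sup>2" by (simp add: algebra_simps power2_eq_square)
    also have "\<dots> = (\<Sum>a<l. (w a)\<^sup>2) - (\<Sum>a<l. (w' a)\<^sup>2)" using ge1[of w] ge1[of w'] by simp
    also have "\<dots> = (\<Sum>a<l. (w a - w' a) * (w a + w' a))"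
      by (simp add: sum_subtractf[symmetric] algebra_simps power2_eq_square)
    finally have e: "(?A - ?B) * (?A + ?B) = (\<Sum>a<l. (w a - w' a) * (w a + w' a))" .
    have "\<bar>\<Sum>a<l. (w a - w' a) * (w a + w' a)\<bar> \<le> (\<Sum>a<l. \<bar>w a - w' a\<bar> * (?A + ?B))"
    proof (rule order_trans[OF sum_abs], rule sum_mono)
      fix a assume "a \<in> {..<l}"
      then have "\<bar>w a + w' a\<bar> \<le> ?A + ?B" using comp[of a w] comp[of a w'] by (intro order_trans[OF abs_triangle_ineq]) auto
      then show "\<bar>(w a - w' a) * (w a + w' a)\<bar> \<le> \<bar>w a - w' a\<bar> * (?A + ?B)" by (simp add: abs_mult mult_left_mono)
    qed
    then have "\<bar>?A - ?B\<bar> * (?A + ?B) \<le> (\<Sum>a<l. \<bar>w a - w' a\<bar>) * (?A + ?B)"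
      using AB unfolding e[symmetric] by (simp add: abs_mult sum_distrib_right)
    then have "\<bar>?A - ?B\<bar> \<le> (\<Sum>a<l. \<bar>w a - w' a\<bar>)" using AB by (simp add: mult_le_cancel_right)
    then show ?thesis by (simp add: bowl_def)
  qed
  show "(\<lambda>k. w k b / sqrt (1 + (\<Sum>a<l. (w k a)\<^sup>2))) \<longlonglongrightarrow> w' b / sqrt (1 + (\<Sum>a<l. (w' a)\<^sup>2))"
    if "\<And>a. a < l \<Longrightarrow> (\<lambda>k. w k a) \<longlonglongrightarrow> w' a" "b < l" for w :: "nat \<Rightarrow> nat \<Rightarrow> real" and w' b
  proof -
    have "sqrt (1 + (\<Sum>a<l. (w' a)\<^sup>2)) \<noteq> 0" using sq1[of w'] by linarith
    then show ?thesis using that by (intro tendsto_intros) auto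
  qed
  show "(\<lambda>x. bowl l (W x)) \<in> borel_measurable M"
    and "b < l \<Longrightarrow> (\<lambda>x. W x b / sqrt (1 + (\<Sum>a<l. (W x a)\<^sup>2))) \<in> borel_measurable M"
    if W: "\<And>a. a < l \<Longrightarrow> (\<lambda>x. W x a) \<in> borel_measurable M" for M :: "(nat \<Rightarrow> real) measure" and W b
  proof -
    have [measurable]: "(\<lambda>x. \<Sum>a<l. (W x a)\<^sup>2) \<in> borel_measurable M"
      using W by (intro borel_measurable_sum borel_measurable_power) auto
    show "(\<lambda>x. bowl l (W x)) \<in> borel_measurable M" unfolding bowl_def by measurable
    assume "b < l"
    then have [measurable]: "(\<lambda>x. W x b) \<in> borel_measurable M" by (rule W)
    show "(\<lambda>x. W x b / sqrt (1 + (\<Sum>a<l. (W x a)\<^sup>2))) \<in> borel_measurable M" by measurable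
  qed
  fix \<phi> :: "(nat \<Rightarrow> real) \<Rightarrow> nat \<Rightarrow> real" assume \<phi>: "\<And>a. a < l \<Longrightarrow> Ck 1 m (Rn m) (\<lambda>x. \<phi> x a)"
  have s: "smooth1 {0<..} (\<lambda>y::real. sqrt y - 1)" by (intro smooth1_intros) auto
  have C: "Ck 1 m (Rn m) (\<lambda>x. 1 + (\<Sum>a<l. \<phi> x a * \<phi> x a))"
    by (intro Ck_add Ck_const Ck_sum Ck_mult \<phi> openin_Rn) auto
  have "Ck 1 m (Rn m) (\<lambda>x. sqrt (1 + (\<Sum>a<l. \<phi> x a * \<phi> x a)) - 1)"
  proof (rule Ck_compose_smooth1[OF openin_Rn s C])
    show "1 + (\<Sum>a<l. \<phi> x a * \<phi> x a) \<in> {0<..}" for x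
      using ge1[of "\<phi> x"] by (simp add: power2_eq_square)
  qed
  then show "Ck 1 m (Rn m) (\<lambda>x. bowl l (\<phi> x))" by (simp add: bowl_def power2_eq_square)
  fix i x assume i: "i < m" and x: "x \<in> Rn m"
  let ?N = "sqrt (1 + (\<Sum>a<l. (\<phi> x a)\<^sup>2))"
  have d: "((\<lambda>t. \<phi> (x(i := t)) a) has_real_derivative pd i (\<lambda>x. \<phi> x a) x) (at (x i))" if "a < l" for a
    by (rule Ck_DERIV[OF \<phi>[OF that, unfolded One_nat_def] x i])
  have "((\<lambda>t. 1 + (\<Sum>a<l. (\<phi> (x(i := t)) a)\<^sup>2)) has_real_derivative 0 + (\<Sum>a<l. 2 * \<phi> x a * pd i (\<lambda>x. \<phi> x a) x)) (at (x i))"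
  proof (intro DERIV_add DERIV_const DERIV_sum)
    fix a assume "a \<in> {..<l}"
    then have a: "a < l" by simp
    show "((\<lambda>t. (\<phi> (x(i := t)) a)\<^sup>2) has_real_derivative 2 * \<phi> x a * pd i (\<lambda>x. \<phi> x a) x) (at (x i))"
      using DERIV_power[OF d[OF a], of 2] by (simp add: mult_ac)
  qed
  moreover have "((\<lambda>t. sqrt (h t) - 1) has_real_derivative D / (2 * sqrt (h y))) (at y)"
    if "(h has_real_derivative D) (at y)" "h y > 0" for h D and y :: real
    using that by (auto intro!: derivative_eq_intros simp: field_simps)
  ultimately have "((\<lambda>t. sqrt (1 + (\<Sum>a<l. (\<phi> (x(i := t)) a)\<^sup>2)) - 1) has_real_derivative
      (\<Sum>a<l. 2 * \<phi> x a * pd i (\<lambda>x. \<phi> x a) x) / (2 * ?N)) (at (x i))"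
    using ge1[of "\<phi> x"] by (force simp: fun_upd_triv)
  then have "pd i (\<lambda>x. bowl l (\<phi> x)) x = (\<Sum>a<l. 2 * \<phi> x a * pd i (\<lambda>x. \<phi> x a) x) / (2 * ?N)"
    unfolding bowl_def by (rule pd_eqI)
  also have "\<dots> = (\<Sum>a<l. \<phi> x a / ?N * pd i (\<lambda>x. \<phi> x a) x)"
    by (simp add: sum_divide_distrib)
  finally show "pd i (\<lambda>x. bowl l (\<phi> x)) x = (\<Sum>a<l. \<phi> x a / ?N * pd i (\<lambda>x. \<phi> x a) x)" .
qed

section \<open>Strong convexity of the p-th power of the norm\<close>

lemma powr_quadratic_upper:
  "\<exists>K\<ge>0. \<forall>x::real. \<bar>x\<bar> < 1 / 2 \<longrightarrow> (1 + x) powr r \<le> 1 + r * x + K * x\<^sup>2"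
proof -
  let ?S = "{-1<..<1::real}" and ?f = "\<lambda>x::real. (1 + x) powr r"
  have f: "smooth1 ?S ?f" by (intro smooth1_intros) auto
  have f1: "smooth1 ?S (deriv ?f)" and f2: "smooth1 ?S (deriv (deriv ?f))"
    by (auto intro!: smooth1_deriv f)
  have bnd: "\<exists>B. \<forall>x\<in>{-1/2..1/2}. \<bar>g x\<bar> \<le> B" if "smooth1 ?S g" for g
  proof -
    have "continuous_on {-1/2..1/2} g" by (rule continuous_on_subset[OF smooth1_continuous[OF that]]) auto
    then have "bounded (g ` {-1/2..1/2})" by (intro compact_imp_bounded compact_continuous_image) auto
    then show ?thesis unfolding bounded_iff by auto
  qed
  obtain b1 b2 where b: "\<forall>x\<in>{-1/2..1/2}. \<bar>deriv ?f x\<bar> \<le> b1" "\<forall>x\<in>{-1/2..1/2}. \<bar>deriv (deriv ?f) x\<bar> \<le> b2"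
    using bnd[OF f1] bnd[OF f2] by blast
  define B where "B = \<bar>b1\<bar> + \<bar>b2\<bar> + 1"
  have B: "B > 0" "b1 \<le> B" "b2 \<le> B" by (auto simp: B_def)
  let ?T = "{-(1/2)<..<1/2::real}"
  \<comment> \<open>Division by B brings both derivatives below 1, as the second-order bound
    requires.\<close>
  let ?g = "\<lambda>x. ?f x / B"
  have g: "smooth1 ?T ?g" using B by (intro smooth1_divide smooth1_subset[OF f] smooth1_const) auto
  have d1: "deriv ?g x = deriv ?f x / B" if "x \<in> ?S" for x
    by (rule DERIV_imp_deriv, rule DERIV_cdivide, rule smooth1_DERIV[OF f that])
  have d2: "deriv (deriv ?g) x = deriv (deriv ?f) x / B" if "x \<in> ?T" for x
  proof (rule DERIV_imp_deriv)
    have xS: "x \<in> ?S" using that by auto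
    have "((\<lambda>x. deriv ?f x / B) has_real_derivative deriv (deriv ?f) x / B) (at x)"
      by (rule DERIV_cdivide, rule smooth1_DERIV[OF f1 xS])
    then show "(deriv ?g has_real_derivative deriv (deriv ?f) x / B) (at x)"
      by (rule has_field_derivative_transform_within_open[of _ _ _ ?S]) (use d1 xS in auto)
  qed
  have "(1 + x) powr r \<le> 1 + r * x + B * x\<^sup>2" if x: "\<bar>x\<bar> < 1 / 2" for x
  proof -
    have "\<bar>?g x - ?g 0 - deriv ?g 0 * (x - 0)\<bar> \<le> (x - 0)\<^sup>2"
    proof (rule second_order_bound(2)[OF g])
      fix y assume y: "y \<in> ?T"
      have "y \<in> {-1/2..1/2}" "y \<in> ?S" using y by auto
      then have "\<bar>deriv ?f y\<bar> \<le> B" "\<bar>deriv (deriv ?f) y\<bar> \<le> B" and e: "deriv ?g y = deriv ?f y / B"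
        using b B d1[of y] by (meson order_trans)+
      then show "\<bar>deriv ?g y\<bar> \<le> 1" "\<bar>deriv (deriv ?g) y\<bar> \<le> 1"
        unfolding e d2[OF y] using B by (simp_all add: abs_div)
    qed (use x in auto)
    moreover have "deriv ?g 0 = r / B"
    proof -
      have "(?f has_real_derivative r) (at 0)" by (auto intro!: derivative_eq_intros)
      then show ?thesis using d1[of 0] DERIV_imp_deriv[of ?f r 0] by simp
    qed
    ultimately have "((1 + x) powr r - 1 - r * x) / B \<le> x\<^sup>2" by (simp add: diff_divide_distrib abs_le_iff)
    then have "(1 + x) powr r - 1 - r * x \<le> x\<^sup>2 * B" using B by (simp only: pos_divide_le_eq)
    then show ?thesis by (simp add: algebra_simps)
  qed
  then show ?thesis using B by (intro exI[of _ B]) auto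
qed

text \<open>Young's inequality with the dual vector \<open>a + \<lambda> b\<close>, where \<open>|a| = 1\<close> and \<open>\<lambda>\<close> is a small
  multiple of \<open>min 1 (1 / |b|)\<close>; this treats \<open>p < 2\<close> and \<open>p \<ge> 2\<close> alike.\<close>

lemma powr_convexity_normalized:
  assumes p: "1 < p"
  shows "\<exists>c>0. \<forall>\<sigma> \<beta> y::real. 0 \<le> \<beta> \<longrightarrow> \<bar>\<sigma>\<bar> \<le> \<beta> \<longrightarrow> 0 \<le> y \<longrightarrow> y\<^sup>2 = 1 + 2 * \<sigma> + \<beta>\<^sup>2 \<longrightarrow>
    1 + p * \<sigma> + c * min (\<beta>\<^sup>2) \<beta> \<le> y powr p"
proof -
  define q where "q = p / (p - 1)"
  define r where "r = q / 2"
  have q: "q > 1" "1 / p + 1 / q = 1" "p / q = p - 1" "(p - 1) * r = p / 2"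
    using p by (auto simp: q_def r_def field_simps)
  obtain K where K: "K \<ge> 0" "\<And>x::real. \<bar>x\<bar> < 1 / 2 \<Longrightarrow> (1 + x) powr r \<le> 1 + r * x + K * x\<^sup>2"
    using powr_quadratic_upper[of r] by blast
  \<comment> \<open>The bound 1/7 keeps |x| \<le> 3 lam0 below 1/2, where the Taylor estimate is
    valid; the other bound makes its quadratic error at most p / 4 times lam \<beta>^2.\<close>
  define lam0 where "lam0 = min (1 / 7) (p / (4 * (9 * (p - 1) * K + 1)))"
  have l0: "lam0 > 0" "lam0 \<le> 1 / 7" "9 * (p - 1) * K * lam0 \<le> p / 4"
  proof -
    have d: "9 * (p - 1) * K + 1 > 0" using K p by (intro add_nonneg_pos) auto
    then show "lam0 > 0" using p by (simp add: lam0_def)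
    show "lam0 \<le> 1 / 7" unfolding lam0_def by (rule min.cobounded1)
    have A: "A * (p / (4 * A)) = p / 4" if "A > 0" for A using that by simp
    have "9 * (p - 1) * K * lam0 \<le> (9 * (p - 1) * K + 1) * lam0" using \<open>lam0 > 0\<close> by simp
    also have "\<dots> \<le> (9 * (p - 1) * K + 1) * (p / (4 * (9 * (p - 1) * K + 1)))"
      using d by (intro mult_left_mono) (auto simp: lam0_def)
    finally show "9 * (p - 1) * K * lam0 \<le> p / 4" unfolding A[OF d] .
  qed
  show ?thesis
  proof (intro exI[of _ "lam0 * p / 8"] conjI allI impI)
    show "0 < lam0 * p / 8" using l0 p by simp
    fix \<sigma> \<beta> y :: real
    assume \<beta>: "0 \<le> \<beta>" and \<sigma>: "\<bar>\<sigma>\<bar> \<le> \<beta>" and y: "0 \<le> y" "y\<^sup>2 = 1 + 2 * \<sigma> + \<beta>\<^sup>2"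
    define lam where "lam = (if \<beta> \<le> 1 then lam0 else lam0 / \<beta>)"
    have lam: "0 < lam" "lam \<le> lam0" "lam * \<beta> \<le> lam0" "lam * \<beta>\<^sup>2 = lam0 * min (\<beta>\<^sup>2) \<beta>"
    proof -
      show "0 < lam" "lam \<le> lam0" using l0 by (auto simp: lam_def field_simps)
      show "lam * \<beta> \<le> lam0" using l0 by (auto simp: lam_def mult_left_le)
      show "lam * \<beta>\<^sup>2 = lam0 * min (\<beta>\<^sup>2) \<beta>"
        using \<beta> l0 by (auto simp: lam_def min_def power2_eq_square mult_left_le_one_le)
    qed
    define x where "x = 2 * lam * \<sigma> + lam\<^sup>2 * \<beta>\<^sup>2"
    have lb: "0 \<le> lam * \<beta>" using lam \<beta> by simp
    have x: "\<bar>x\<bar> \<le> 3 * (lam * \<beta>)"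
    proof -
      have "\<bar>2 * lam * \<sigma>\<bar> \<le> 2 * (lam * \<beta>)" using \<sigma> lam by (simp add: abs_mult)
      moreover have "\<bar>lam\<^sup>2 * \<beta>\<^sup>2\<bar> \<le> lam * \<beta>"
      proof -
        have "lam\<^sup>2 * \<beta>\<^sup>2 = (lam * \<beta>) * (lam * \<beta>)" by (simp add: power2_eq_square)
        also have "\<dots> \<le> lam * \<beta>" by (rule mult_left_le) (use lam(3) l0 lb in linarith)+
        finally show ?thesis by simp
      qed
      ultimately show ?thesis unfolding x_def by linarith
    qed
    then have x2: "\<bar>x\<bar> < 1 / 2" using lam(3) l0 by linarith
    have xsq: "x\<^sup>2 \<le> 9 * (lam\<^sup>2 * \<beta>\<^sup>2)"
    proof -
      have "x\<^sup>2 \<le> (3 * (lam * \<beta>))\<^sup>2" by (rule iffD1[OF abs_le_square_iff]) (use x lb in simp)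
      then show ?thesis by (simp add: power_mult_distrib)
    qed
    define \<xi> where "\<xi> = sqrt (1 + x)"
    have \<xi>: "0 \<le> \<xi>" "\<xi>\<^sup>2 = 1 + x" using x2 by (auto simp: \<xi>_def)
    \<comment> \<open>Cauchy-Schwarz for the vectors a + lam b and a + b, with \<xi> = |a + lam b|.
      The difference of the squares is (1 - lam)^2 times the Gram determinant of a and b.\<close>
    have inner: "1 + \<sigma> + lam * \<sigma> + lam * \<beta>\<^sup>2 \<le> \<xi> * y"
    proof (rule power2_le_imp_le)
      have "(\<xi> * y)\<^sup>2 - (1 + \<sigma> + lam * \<sigma> + lam * \<beta>\<^sup>2)\<^sup>2 = (1 - lam)\<^sup>2 * (\<beta>\<^sup>2 - \<sigma>\<^sup>2)"
        unfolding power_mult_distrib \<xi> y x_def by (simp add: algebra_simps power2_eq_square)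
      also have "\<dots> \<ge> 0" using \<sigma> \<beta> by (intro mult_nonneg_nonneg) (auto simp: abs_le_square_iff[symmetric])
      finally show "(1 + \<sigma> + lam * \<sigma> + lam * \<beta>\<^sup>2)\<^sup>2 \<le> (\<xi> * y)\<^sup>2" by simp
    qed (use \<xi> y in simp)
    have Y: "\<xi> * y \<le> \<xi> powr q / q + y powr p / p"
      using Youngs_inequality[of q p \<xi> y] q p \<xi> y by (simp add: add.commute)
    have "\<xi> powr q = (1 + x) powr r" using \<xi> by (simp add: \<xi>_def r_def powr_powr flip: powr_half_sqrt)
    then have "\<xi> powr q \<le> 1 + r * x + K * x\<^sup>2" using K(2)[OF x2] by simp
    then have "(p - 1) * \<xi> powr q \<le> (p - 1) * (1 + r * x + K * x\<^sup>2)" using p by (intro mult_left_mono) auto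
    also have "\<dots> = (p - 1) + p / 2 * x + (p - 1) * K * x\<^sup>2" by (simp only: q(4)[symmetric]) (simp add: algebra_simps)
    also have "(p - 1) * K * x\<^sup>2 \<le> (p - 1) * K * (9 * (lam\<^sup>2 * \<beta>\<^sup>2))" using xsq K p by (intro mult_left_mono) auto
    also have "(p - 1) * K * (9 * (lam\<^sup>2 * \<beta>\<^sup>2)) = (9 * (p - 1) * K * lam) * (lam * \<beta>\<^sup>2)" by (simp add: power2_eq_square)
    also have "\<dots> \<le> (p / 4) * (lam * \<beta>\<^sup>2)"
    proof (intro mult_right_mono)
      have "9 * (p - 1) * K * lam \<le> 9 * (p - 1) * K * lam0" using lam p K by (intro mult_left_mono) auto
      then show "9 * (p - 1) * K * lam \<le> p / 4" using l0 by linarith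
    qed (use lam(1) in simp)
    finally have up: "(p - 1) * \<xi> powr q \<le> (p - 1) + p / 2 * x + (p / 4) * (lam * \<beta>\<^sup>2)" by simp
    have "p * (1 + \<sigma> + lam * \<sigma> + lam * \<beta>\<^sup>2) \<le> p * (\<xi> powr q / q + y powr p / p)"
      using inner Y p by (intro mult_left_mono) auto
    also have "\<dots> = (p / q) * \<xi> powr q + y powr p" using p by (simp add: distrib_left)
    finally have "p * (1 + \<sigma> + lam * \<sigma> + lam * \<beta>\<^sup>2) \<le> (p - 1) + p / 2 * x + (p / 4) * (lam * \<beta>\<^sup>2) + y powr p"
      using up unfolding q(3) by linarith
    then have f1: "p + p * \<sigma> + p * (lam * \<sigma>) + p * (lam * \<beta>\<^sup>2) \<le> (p - 1) + (p * x) / 2 + (p * (lam * \<beta>\<^sup>2)) / 4 + y powr p"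
      by (simp add: distrib_left)
    have f2: "p * x = 2 * (p * (lam * \<sigma>)) + p * (lam * (lam * \<beta>\<^sup>2))" by (simp add: x_def algebra_simps power2_eq_square)
    have f3: "p * (lam * (lam * \<beta>\<^sup>2)) \<le> p * (1 / 7 * (lam * \<beta>\<^sup>2))"
      using lam(1,2) l0(2) p by (intro mult_left_mono mult_right_mono) auto
    have f3': "p * (1 / 7 * (lam * \<beta>\<^sup>2)) = (p * (lam * \<beta>\<^sup>2)) / 7" by simp
    have f4: "0 \<le> p * (lam * \<beta>\<^sup>2)" using lam(1) p by simp
    \<comment> \<open>The terms in lam \<sigma> cancel. Of the gain p lam \<beta>^2 the Taylor error
      takes 1/4 and the term quadratic in lam takes 1/14; keeping 1/8 is ample.\<close>
    have "1 + A + D / 8 \<le> v" if "p + A + B + D \<le> (p - 1) + H / 2 + D / 4 + v" "H = 2 * B + E" "E \<le> F" "F = D / 7" "0 \<le> D"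
      for A B D E F H v :: real using that by linarith
    from this[OF f1 f2 f3 f3' f4] have "1 + p * \<sigma> + p / 8 * (lam * \<beta>\<^sup>2) \<le> y powr p" by simp
    then show "1 + p * \<sigma> + lam0 * p / 8 * min (\<beta>\<^sup>2) \<beta> \<le> y powr p" unfolding lam(4) by (simp add: mult_ac)
  qed
qed

text \<open>Here \<open>\<alpha> = |a|\<close>, \<open>\<beta> = |b|\<close>, \<open>\<sigma> = \<langle>a, b\<rangle>\<close> and \<open>y = |a + b|\<close> for vectors \<open>a \<noteq> 0\<close> and \<open>b\<close>.\<close>

definition powr_gap :: "real \<Rightarrow> real \<Rightarrow> bool" where
  "powr_gap p c \<longleftrightarrow> (\<forall>\<alpha> \<sigma> \<beta> y::real. 0 < \<alpha> \<longrightarrow> 0 \<le> \<beta> \<longrightarrow> \<bar>\<sigma>\<bar> \<le> \<alpha> * \<beta> \<longrightarrow> 0 \<le> y \<longrightarrow> y\<^sup>2 = \<alpha>\<^sup>2 + 2 * \<sigma> + \<beta>\<^sup>2 \<longrightarrow>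
    \<alpha> powr p + p * \<alpha> powr (p - 2) * \<sigma> + c * \<alpha> powr (p - 2) * min (\<beta>\<^sup>2) (\<alpha> * \<beta>) \<le> y powr p)"

text \<open>By homogeneity everything can be divided by \<alpha>.\<close>

lemma powr_convexity:
  assumes p: "1 < p"
  shows "\<exists>c>0. powr_gap p c"
proof -
  obtain c where c: "c > 0" "\<And>\<sigma> \<beta> y::real. 0 \<le> \<beta> \<Longrightarrow> \<bar>\<sigma>\<bar> \<le> \<beta> \<Longrightarrow> 0 \<le> y \<Longrightarrow> y\<^sup>2 = 1 + 2 * \<sigma> + \<beta>\<^sup>2 \<Longrightarrow>
    1 + p * \<sigma> + c * min (\<beta>\<^sup>2) \<beta> \<le> y powr p"
    using powr_convexity_normalized[OF p] by blast
  show ?thesis unfolding powr_gap_def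
  proof (intro exI[of _ c] conjI c(1) allI impI)
    fix \<alpha> \<sigma> \<beta> y :: real
    assume a: "0 < \<alpha>" "0 \<le> \<beta>" "\<bar>\<sigma>\<bar> \<le> \<alpha> * \<beta>" "0 \<le> y" "y\<^sup>2 = \<alpha>\<^sup>2 + 2 * \<sigma> + \<beta>\<^sup>2"
    have "1 + p * (\<sigma> / \<alpha>\<^sup>2) + c * min ((\<beta> / \<alpha>)\<^sup>2) (\<beta> / \<alpha>) \<le> (y / \<alpha>) powr p"
    proof (rule c(2))
      show "\<bar>\<sigma> / \<alpha>\<^sup>2\<bar> \<le> \<beta> / \<alpha>" using a by (simp add: abs_div field_simps power2_eq_square)
      show "(y / \<alpha>)\<^sup>2 = 1 + 2 * (\<sigma> / \<alpha>\<^sup>2) + (\<beta> / \<alpha>)\<^sup>2" using a by (simp add: power_divide add_divide_distrib)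
    qed (use a in auto)
    then have le: "\<alpha> powr p * (1 + p * (\<sigma> / \<alpha>\<^sup>2) + c * min ((\<beta> / \<alpha>)\<^sup>2) (\<beta> / \<alpha>)) \<le> \<alpha> powr p * (y / \<alpha>) powr p"
      by (intro mult_left_mono) auto
    have y': "\<alpha> powr p * (y / \<alpha>) powr p = y powr p" using a by (simp add: powr_divide)
    have ap: "\<alpha> powr p = \<alpha> powr (p - 2) * \<alpha>\<^sup>2" using a by (simp add: powr_diff)
    have mn: "\<alpha>\<^sup>2 * min ((\<beta> / \<alpha>)\<^sup>2) (\<beta> / \<alpha>) = min (\<beta>\<^sup>2) (\<alpha> * \<beta>)"
    proof -
      have "\<alpha>\<^sup>2 * min ((\<beta> / \<alpha>)\<^sup>2) (\<beta> / \<alpha>) = min (\<alpha>\<^sup>2 * (\<beta> / \<alpha>)\<^sup>2) (\<alpha>\<^sup>2 * (\<beta> / \<alpha>))"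
        by (rule min_mult_distrib_left[THEN trans]) simp
      then show ?thesis using a by (simp add: power_divide power2_eq_square)
    qed
    have sg: "\<alpha>\<^sup>2 * (\<sigma> / \<alpha>\<^sup>2) = \<sigma>" using a by simp
    have ex: "e * q * (1 + p * X + c * Y) = e * q + p * e * (q * X) + c * e * (q * Y)" for e q X Y :: real
      by (simp add: algebra_simps)
    have "\<alpha> powr (p - 2) * \<alpha>\<^sup>2 * (1 + p * (\<sigma> / \<alpha>\<^sup>2) + c * min ((\<beta> / \<alpha>)\<^sup>2) (\<beta> / \<alpha>)) =
      \<alpha> powr p + p * \<alpha> powr (p - 2) * \<sigma> + c * \<alpha> powr (p - 2) * min (\<beta>\<^sup>2) (\<alpha> * \<beta>)"
      unfolding ex sg mn unfolding ap ..
    then show "\<alpha> powr p + p * \<alpha> powr (p - 2) * \<sigma> + c * \<alpha> powr (p - 2) * min (\<beta>\<^sup>2) (\<alpha> * \<beta>) \<le> y powr p"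
      using le unfolding y' unfolding ap by (simp only:)
  qed
qed

section \<open>A Hardy inequality\<close>

lemma bowl_nonneg: "0 \<le> bowl l w"
  by (simp add: bowl_def sum_nonneg)

text \<open>Factor |w|^2 = (s + 1) (s - 1) with s = sqrt (1 + |w|^2).\<close>

lemma bowl_lower:
  assumes "vnorm l w \<le> M" shows "(vnorm l w)\<^sup>2 \<le> (2 + M) * bowl l w"
proof -
  let ?s = "sqrt (1 + (vnorm l w)\<^sup>2)"
  have M: "0 \<le> vnorm l w" "0 \<le> M" using assms vnorm_nonneg[of l w] by auto
  have "?s \<le> 1 + vnorm l w"
    using M by (intro real_le_lsqrt) (auto simp: power2_eq_square algebra_simps)
  then have "?s + 1 \<le> 2 + M" using assms by simp
  moreover have "(vnorm l w)\<^sup>2 = (?s + 1) * (?s - 1)"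
    by (simp add: algebra_simps flip: power2_eq_square)
  moreover have b: "bowl l w = ?s - 1" by (simp add: bowl_def vnorm_sq)
  ultimately show ?thesis using bowl_nonneg[of l w] mult_right_mono[of "?s + 1" "2 + M" "?s - 1"] by simp
qed

lemma pd_coord_radial:
  assumes "x \<in> Rn m" "x \<noteq> origin m" "i < m"
  shows "((\<lambda>t. (x(i := t)) i * vnorm m (x(i := t)) powr c) has_real_derivative
     vnorm m x powr c + c * (x i)\<^sup>2 * vnorm m x powr (c - 2)) (at (x i))"
proof -
  have pos: "vnorm m x > 0" using assms vnorm_pos by blast
  have "((\<lambda>t. t * exp (c * ln (vnorm m (x(i := t))))) has_real_derivative
     1 * exp (c * ln (vnorm m (x(i := x i)))) + (exp (c * ln (vnorm m (x(i := x i)))) * (c * (x i / (vnorm m x)\<^sup>2))) * x i) (at (x i))"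
    by (rule DERIV_mult[OF DERIV_ident DERIV_fun_exp[OF DERIV_cmult[OF DERIV_ln_vnorm[OF assms]]]])
  moreover have "exp (c * ln (vnorm m y)) = vnorm m y powr c" if "vnorm m y \<noteq> 0" for y
    using that by (simp add: powr_def)
  moreover have ev: "\<forall>\<^sub>F t in nhds (x i). x(i := t) \<in> Rn m \<and> vnorm m (x(i := t)) > 0"
  proof -
    have "openin (top_of_set (Rn m)) (oball m (vnorm m x + 1) - {origin m})" by (rule openin_punctured)
    moreover have "x \<in> oball m (vnorm m x + 1) - {origin m}" using assms by (simp add: vball_origin)
    ultimately have "\<forall>\<^sub>F t in nhds (x i). x(i := t) \<in> oball m (vnorm m x + 1) - {origin m}"
      using assms(3) by (rule line_eventually)
    then show ?thesis by eventually_elim (use vnorm_pos in \<open>auto simp: vball_origin\<close>)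
  qed
  moreover have "\<forall>\<^sub>F t in nhds (x i). t * exp (c * ln (vnorm m (x(i := t)))) = (x(i := t)) i * vnorm m (x(i := t)) powr c"
    using ev by eventually_elim (simp add: powr_def)
  moreover have "vnorm m x powr (c - 2) = vnorm m x powr c / (vnorm m x)\<^sup>2" using pos by (simp add: powr_diff)
  ultimately show ?thesis
    using pos DERIV_cong_ev[OF refl _ refl, of "\<lambda>t. t * exp (c * ln (vnorm m (x(i := t))))" "\<lambda>t. (x(i := t)) i * vnorm m (x(i := t)) powr c" "x i"]
    by (simp add: power2_eq_square mult_ac)
qed

text \<open>The chain identity is applied to the field x |x|^(-p), whose divergence is (m - p)
  |x|^(-p). The gradient of \<open>bowl\<close> has length G = |w| / sqrt (1 + |w|^2). Estimating G
  by 1 gives the linear branch; G^2 \<le> 2 \<open>bowl\<close> and Young's inequality give the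
  quadratic one, at the cost of half the left side. The pointwise minimum is taken because the gain
  in \<open>powr_gap\<close> has that shape.\<close>

lemma hardy:
  fixes p M R :: real
  assumes m: "m \<ge> 2" and p: "1 < p" "p < m" and W: "W \<in> W01p m l p (oball m R)"
    and Wb: "AE x in lebball m R. vnorm l (W x) \<le> M"
  shows "integrable (lebball m R) (\<lambda>x. vnorm m x powr (- p) * bowl l (W x))" (is ?i1)
    "integrable (lebball m R) (\<lambda>x. min (vnorm m x powr (2 - p) * (grad_norm m l (oball m R) W x)\<^sup>2 / (m - p))
      (vnorm m x powr (1 - p) * grad_norm m l (oball m R) W x))" (is ?i2)
    "(m - p) * integral\<^sup>L (lebball m R) (\<lambda>x. vnorm m x powr (- p) * bowl l (W x)) \<le>
      2 * integral\<^sup>L (lebball m R) (\<lambda>x. min (vnorm m x powr (2 - p) * (grad_norm m l (oball m R) W x)\<^sup>2 / (m - p))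
      (vnorm m x powr (1 - p) * grad_norm m l (oball m R) W x))" (is ?le)
proof -
  let ?B = "oball m R" and ?M = "lebball m R"
  let ?b = "grad_norm m l ?B W"
  let ?D = "\<lambda>i a. wpd m ?B i (\<lambda>x. W x a)"
  let ?g = "\<lambda>a w. w a / sqrt (1 + (\<Sum>a<l. (w a)\<^sup>2)) :: real"
  define k where "k = real m - p"
  have k: "k > 0" using p by (simp add: k_def)
  have m0: "m > 0" and p': "1 \<le> p" using m p by auto
  have WW: "W \<in> W1p m l p ?B" using W by (auto simp: W01p_def W1p_tendsto_def)
  have AEb: "AE x in ?M. x \<in> ?B - {origin m}"
    using m by (intro AE_lebball_punct) auto
  have bp: "x \<in> Rn m" "vnorm m x > 0" if "x \<in> ?B - {origin m}" for x
    using that vnorm_pos[of x m] by (auto simp: vball_origin)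
  have bL: "Lp m p ?B ?b" by (rule Lp_grad_norm[OF p' m0 WW])
  define f where "f = (\<lambda>i (x :: nat \<Rightarrow> real). x i * vnorm m x powr (- p))"
  have f_pd: "pd i (f i) x = vnorm m x powr (- p) - p * (x i)\<^sup>2 * vnorm m x powr (- p - 2)"
    if "x \<in> ?B - {origin m}" "i < m" for i x
    unfolding f_def using pd_coord_radial[of x m i "- p"] that bp[OF that(1)] by (intro pd_eqI) auto
  have f_Ck: "Ck 1 m (?B - {origin m}) (f i)" for i
  proof -
    have "Ck 1 m (?B - {origin m}) (\<lambda>x. x i * exp (- p * ln (vnorm m x)))"
      by (intro Ck_mult Ck_coord openin_punctured Ck_compose_smooth1[OF openin_punctured smooth1_exp] Ck_const Ck_ln_vnorm) auto
    then show ?thesis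
      using Ck_cong[OF openin_punctured, of m R "\<lambda>x. x i * exp (- p * ln (vnorm m x))" "f i" 1] bp
      by (auto simp: f_def powr_def less_imp_neq[THEN not_sym])
  qed
  have comp: "(x i)\<^sup>2 \<le> (vnorm m x)\<^sup>2" if "i < m" for x i
    using vnorm_component[OF that, of x] vnorm_nonneg[of m x] by (simp add: abs_le_square_iff[symmetric])
  have pw2: "(vnorm m x)\<^sup>2 * vnorm m x powr (- p - 2) = vnorm m x powr (- p)" if "x \<in> ?B - {origin m}" for x
    using bp(2)[OF that] by (simp add: powr_diff)
  have fb: "\<bar>f i x\<bar> \<le> (1 + p) * vnorm m x powr (1 - p)" "\<bar>pd i (f i) x\<bar> \<le> (1 + p) * vnorm m x powr (- p)"
    if x: "x \<in> ?B - {origin m}" and i: "i < m" for x i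
  proof -
    have "\<bar>f i x\<bar> \<le> vnorm m x * vnorm m x powr (- p)"
      unfolding f_def abs_mult using vnorm_component[OF i, of x] by (simp add: mult_right_mono)
    also have "\<dots> = vnorm m x powr (1 - p)" using bp(2)[OF x] by (simp add: powr_diff powr_minus field_simps)
    also have "\<dots> \<le> (1 + p) * vnorm m x powr (1 - p)" using p by (simp add: algebra_simps)
    finally show "\<bar>f i x\<bar> \<le> (1 + p) * vnorm m x powr (1 - p)" .
    have "(x i)\<^sup>2 * vnorm m x powr (- p - 2) \<le> vnorm m x powr (- p)"
      unfolding pw2[OF x, symmetric] using comp[OF i] by (intro mult_right_mono) auto
    then have "p * ((x i)\<^sup>2 * vnorm m x powr (- p - 2)) \<le> p * vnorm m x powr (- p)" using p by (intro mult_left_mono) auto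
    moreover have "0 \<le> p * ((x i)\<^sup>2 * vnorm m x powr (- p - 2))" using p by simp
    moreover have "0 \<le> vnorm m x powr (- p)" by simp
    ultimately show "\<bar>pd i (f i) x\<bar> \<le> (1 + p) * vnorm m x powr (- p)"
      unfolding f_pd[OF x i] by (simp only: mult.assoc distrib_right mult_1_left)
  qed
  interpret lipschitz_chain m l "bowl l" ?g by (rule lipschitz_chain_bowl)
  have bowl_le: "bowl l w \<le> vnorm l w" for w
    using vnorm_nonneg[of l w] unfolding bowl_def vnorm_sq[symmetric]
    by (simp add: real_le_lsqrt power2_eq_square algebra_simps)
  have \<Psi>b: "AE x in ?M. \<bar>bowl l (W x)\<bar> \<le> M"
    using Wb by eventually_elim (use bowl_le bowl_nonneg in \<open>auto intro: order_trans\<close>)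
  note ci = chain_identity[OF m _ p W f_Ck fb \<Psi>b]
  have ci1: "integrable ?M (\<lambda>x. f i x * (\<Sum>a<l. ?g a (W x) * ?D i a x))"
    "integrable ?M (\<lambda>x. pd i (f i) x * bowl l (W x))"
    "integral\<^sup>L ?M (\<lambda>x. f i x * (\<Sum>a<l. ?g a (W x) * ?D i a x)) = - integral\<^sup>L ?M (\<lambda>x. pd i (f i) x * bowl l (W x))"
    if "i < m" for i using ci[OF that] that by auto
  have div: "(\<Sum>i<m. pd i (f i) x) = k * vnorm m x powr (- p)" if x: "x \<in> ?B - {origin m}" for x
  proof -
    have "(\<Sum>i<m. pd i (f i) x) = m * vnorm m x powr (- p) - p * ((\<Sum>i<m. (x i)\<^sup>2) * vnorm m x powr (- p - 2))"
      using f_pd[OF x] by (simp add: sum_subtractf sum_distrib_left sum_distrib_right mult_ac)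
    then show ?thesis unfolding vnorm_sq[symmetric] pw2[OF x] by (simp add: k_def algebra_simps)
  qed
  let ?P = "\<lambda>x. vnorm m x powr (- p) * bowl l (W x)"
  let ?Q = "\<lambda>x. min (vnorm m x powr (2 - p) * (?b x)\<^sup>2 / k) (vnorm m x powr (1 - p) * ?b x)"
  have AEP: "AE x in ?M. (1 / k) * (\<Sum>i<m. pd i (f i) x * bowl l (W x)) = ?P x"
    using AEb by eventually_elim (use k div in \<open>simp add: sum_distrib_right[symmetric]\<close>)
  have sumint: "integrable ?M (\<lambda>x. (1 / k) * (\<Sum>i<m. pd i (f i) x * bowl l (W x)))"
    using ci1 by (intro integrable_mult_right Bochner_Integration.integrable_sum) auto
  have Wm: "(\<lambda>x. W x a) \<in> borel_measurable ?M" if "a < l" for a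
    using W1pD(1)[OF p' m0 WW that] by (simp add: Lp_iff)
  have vm [measurable]: "vnorm m \<in> borel_measurable ?M" by (rule lebP_measurable_lebball[OF vnorm_measurable])
  have [measurable]: "(\<lambda>x. bowl l (W x)) \<in> borel_measurable ?M" by (rule meas[OF Wm])
  have [measurable]: "?b \<in> borel_measurable ?M" using bL by (simp add: Lp_iff)
  have Pm: "?P \<in> borel_measurable ?M" by measurable
  have Qm: "?Q \<in> borel_measurable ?M" by measurable
  have Pi: "integrable ?M ?P" by (rule integrable_cong_AE_imp[OF sumint Pm AEP])
  then show ?i1 .
  have bi: "integrable ?M (\<lambda>x. ?b x powr p)" using bL by (simp add: Lp_iff grad_norm_nonneg abs_of_nonneg)
  have Qi: "integrable ?M ?Q"
  proof (rule Bochner_Integration.integrable_bound[OF _ Qm])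
    show "integrable ?M (\<lambda>x. vnorm m x powr (- p) + ?b x powr p)"
      using bi p by (intro Bochner_Integration.integrable_add vnorm_powr_integrable) auto
    show "AE x in ?M. norm (?Q x) \<le> norm (vnorm m x powr (- p) + ?b x powr p)"
      using AEb
    proof eventually_elim
      case (elim x)
      have "0 \<le> ?Q x" using k grad_norm_nonneg by simp
      moreover have "?Q x \<le> vnorm m x powr (- p) + ?b x powr p"
        using powr_times_le[OF bp(2)[OF elim] grad_norm_nonneg p(1), of m l ?B W x] by (simp add: min.coboundedI2)
      ultimately show ?case by simp
    qed
  qed
  then show ?i2 by (simp add: k_def)
  have "k * integral\<^sup>L ?M ?P = k * integral\<^sup>L ?M (\<lambda>x. (1 / k) * (\<Sum>i<m. pd i (f i) x * bowl l (W x)))"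
    using integral_cong_AE[OF borel_measurable_integrable[OF sumint] Pm AEP] by simp
  also have "\<dots> = (\<Sum>i<m. integral\<^sup>L ?M (\<lambda>x. pd i (f i) x * bowl l (W x)))"
    using ci1 k by simp
  also have "\<dots> = integral\<^sup>L ?M (\<lambda>x. - (\<Sum>i<m. f i x * (\<Sum>a<l. ?g a (W x) * ?D i a x)))"
    using ci1 by (simp add: sum_negf)
  also have "\<dots> \<le> integral\<^sup>L ?M (\<lambda>x. k / 2 * ?P x + ?Q x)"
  proof (rule integral_mono_AE)
    show "integrable ?M (\<lambda>x. - (\<Sum>i<m. f i x * (\<Sum>a<l. ?g a (W x) * ?D i a x)))"
      using ci1 by (intro Bochner_Integration.integrable_minus Bochner_Integration.integrable_sum) auto
    show "integrable ?M (\<lambda>x. k / 2 * ?P x + ?Q x)"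
      using Pi Qi by (intro Bochner_Integration.integrable_add integrable_mult_right)
    show "AE x in ?M. - (\<Sum>i<m. f i x * (\<Sum>a<l. ?g a (W x) * ?D i a x)) \<le> k / 2 * ?P x + ?Q x"
      using AEb
    proof eventually_elim
      case (elim x)
      let ?r = "vnorm m x" and ?N = "sqrt (1 + (\<Sum>a<l. (W x a)\<^sup>2))"
      define G where "G = vnorm l (W x) / ?N"
      have r: "?r > 0" by (rule bp(2)[OF elim])
      have N: "?N \<ge> 1" by (simp add: sum_nonneg)
      have b0: "0 \<le> ?b x" by (rule grad_norm_nonneg)
      have "- (\<Sum>i<m. f i x * (\<Sum>a<l. ?g a (W x) * ?D i a x)) = - ((\<Sum>(a, i)\<in>{..<l}\<times>{..<m}. (x i * W x a) * ?D i a x) * ?r powr (- p) / ?N)"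
        unfolding f_def sum.cartesian_product[symmetric]
        by (subst sum.swap) (simp add: sum_distrib_left sum_distrib_right sum_divide_distrib mult_ac)
      also have "\<dots> \<le> (?r * vnorm l (W x) * ?b x) * ?r powr (- p) / ?N"
      proof -
        \<comment> \<open>Cauchy-Schwarz for the matrix with entries x i W a, whose norm is |x| |W|,
          and the matrix of derivatives.\<close>
        have "\<bar>\<Sum>(a, i)\<in>{..<l}\<times>{..<m}. (x i * W x a) * ?D i a x\<bar> \<le>
          L2_set (\<lambda>(a, i). x i * W x a) ({..<l}\<times>{..<m}) * ?b x"
          unfolding grad_norm_L2
          by (rule order_trans[OF sum_abs order_trans[OF _ L2_set_mult_ineq]]) (auto simp: abs_mult intro!: sum_mono)
        also have "L2_set (\<lambda>(a, i). x i * W x a) ({..<l}\<times>{..<m}) = ?r * vnorm l (W x)"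
        proof -
          have "(\<Sum>(a, i)\<in>{..<l}\<times>{..<m}. (x i * W x a)\<^sup>2) = (\<Sum>i<m. (x i)\<^sup>2) * (\<Sum>a<l. (W x a)\<^sup>2)"
            by (simp add: sum.cartesian_product[symmetric] sum_product power_mult_distrib mult.commute sum.swap[of _ "{..<m}"])
          then show ?thesis by (simp add: L2_set_def vnorm_def case_prod_beta' real_sqrt_mult)
        qed
        finally have "- (\<Sum>(a, i)\<in>{..<l}\<times>{..<m}. (x i * W x a) * ?D i a x) \<le> ?r * vnorm l (W x) * ?b x" by linarith
        then have "- (\<Sum>(a, i)\<in>{..<l}\<times>{..<m}. (x i * W x a) * ?D i a x) * (?r powr (- p) / ?N) \<le> ?r * vnorm l (W x) * ?b x * (?r powr (- p) / ?N)"
          using N by (intro mult_right_mono) auto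
        then show ?thesis by simp
      qed
      also have "\<dots> = (?r * ?r powr (- p)) * (G * ?b x)" by (simp add: G_def)
      also have rr: "?r * ?r powr (- p) = ?r powr (1 - p)" using r by (simp add: powr_diff powr_minus field_simps)
      finally have le: "- (\<Sum>i<m. f i x * (\<Sum>a<l. ?g a (W x) * ?D i a x)) \<le> ?r powr (1 - p) * (G * ?b x)" .
      have Nv: "?N\<^sup>2 = 1 + (vnorm l (W x))\<^sup>2" by (simp add: vnorm_sq sum_nonneg add_nonneg_nonneg)
      have bw: "bowl l (W x) = ?N - 1" by (simp add: bowl_def)
      have G0: "0 \<le> G" using N vnorm_nonneg[of l "W x"] by (simp add: G_def)
      have G1: "G \<le> 1"
      proof -
        have "(vnorm l (W x))\<^sup>2 \<le> ?N\<^sup>2" unfolding Nv by simp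
        then have "vnorm l (W x) \<le> ?N" by (rule power2_le_imp_le) (use N in linarith)
        then show ?thesis using N by (simp add: G_def)
      qed
      \<comment> \<open>G^2 = (N - 1) (N + 1) / N^2, and N + 1 \<le> 2 N^2 for N \<ge> 1.\<close>
      have G2: "G\<^sup>2 \<le> 2 * bowl l (W x)"
      proof -
        have "(vnorm l (W x))\<^sup>2 = (?N - 1) * (?N + 1)" using Nv by (simp add: algebra_simps power2_eq_square)
        also have "\<dots> \<le> (?N - 1) * (2 * ?N\<^sup>2)"
          using N mult_left_mono[of 1 "?N" "?N"] by (intro mult_left_mono) (auto simp: power2_eq_square)
        finally have v: "(vnorm l (W x))\<^sup>2 \<le> (?N - 1) * (2 * ?N\<^sup>2)" .
        have "(v / N)\<^sup>2 \<le> 2 * (N - 1)" if "v\<^sup>2 \<le> (N - 1) * (2 * N\<^sup>2)" "1 \<le> N" for v N :: real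
          unfolding power_divide using that by (subst pos_divide_le_eq) (auto simp: algebra_simps)
        from this[OF v N] show ?thesis unfolding G_def bw .
      qed
      have c1: "?r powr (1 - p) * (G * ?b x) \<le> k / 2 * ?P x + ?r powr (1 - p) * ?b x"
      proof -
        have "?r powr (1 - p) * (G * ?b x) \<le> ?r powr (1 - p) * (1 * ?b x)"
          using G1 b0 by (intro mult_left_mono mult_right_mono) auto
        moreover have "0 \<le> k / 2 * ?P x" using k bowl_nonneg by simp
        ultimately show ?thesis by simp
      qed
      have c2: "?r powr (1 - p) * (G * ?b x) \<le> k / 2 * ?P x + ?r powr (2 - p) * (?b x)\<^sup>2 / k"
      proof -
        \<comment> \<open>Young's inequality, weighted so that the term in G^2 becomes k / 2 times
          \<open>bowl\<close>.\<close>
        have "0 \<le> (k / 2 * G - ?r * ?b x)\<^sup>2" by simp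
        then have "k * (?r * (G * ?b x)) \<le> k\<^sup>2 / 4 * G\<^sup>2 + (?r * ?b x)\<^sup>2"
          by (simp add: power2_eq_square algebra_simps)
        also have "\<dots> \<le> k\<^sup>2 / 4 * (2 * bowl l (W x)) + (?r * ?b x)\<^sup>2" using G2 by (intro add_right_mono mult_left_mono) auto
        finally have "?r * (G * ?b x) \<le> (k\<^sup>2 / 4 * (2 * bowl l (W x)) + (?r * ?b x)\<^sup>2) / k"
          using k by (simp add: pos_le_divide_eq mult.commute)
        also have "\<dots> = k / 2 * bowl l (W x) + ?r\<^sup>2 * (?b x)\<^sup>2 / k"
          using k by (simp add: field_simps power2_eq_square)
        finally have "?r powr (- p) * (?r * (G * ?b x)) \<le> ?r powr (- p) * (k / 2 * bowl l (W x) + ?r\<^sup>2 * (?b x)\<^sup>2 / k)"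
          by (intro mult_left_mono) auto
        moreover have "?r powr (- p) * (k / 2 * bowl l (W x) + ?r\<^sup>2 * (?b x)\<^sup>2 / k) =
           k / 2 * ?P x + (?r powr (- p) * ?r\<^sup>2) * (?b x)\<^sup>2 / k" by (simp add: algebra_simps)
        moreover have "?r powr (- p) * ?r\<^sup>2 = ?r powr (2 - p)" using r by (simp add: powr_diff powr_minus field_simps)
        moreover have "?r powr (- p) * (?r * (G * ?b x)) = (?r * ?r powr (- p)) * (G * ?b x)" by simp
        ultimately show ?thesis unfolding rr[symmetric] by simp
      qed
      show ?case using le c1 c2 by (simp add: min_def)
    qed
  qed
  also have "\<dots> = k / 2 * integral\<^sup>L ?M ?P + integral\<^sup>L ?M ?Q" using Pi Qi by simp
  finally show ?le by (simp add: k_def)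
qed

section \<open>Maps built from a direction and radial profiles\<close>

lemma punct_D: "x \<in> punct m R \<Longrightarrow> x \<in> Rn m \<and> x \<noteq> origin m \<and> 0 < vnorm m x \<and> vnorm m x < R \<and> ln (vnorm m x) < ln R"
  using vnorm_pos[of x m] by (auto simp: vball_origin)

lemma radial_DERIV:
  assumes "(h has_real_derivative D) (at (ln (vnorm m x)))" "x \<in> punct m R" "i < m"
  shows "((\<lambda>t. h (ln (vnorm m (x(i := t))))) has_real_derivative D * (x i / (vnorm m x)\<^sup>2)) (at (x i))"
proof (rule DERIV_chain2[of h])
  show "(h has_real_derivative D) (at (ln (vnorm m (x(i := x i)))))" using assms(1) by simp
  show "((\<lambda>t. ln (vnorm m (x(i := t)))) has_real_derivative x i / (vnorm m x)\<^sup>2) (at (x i))"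
    using punct_D[OF assms(2)] assms(3) by (intro DERIV_ln_vnorm) auto
qed

lemma radial_Ck:
  assumes "smooth1 {..<ln R} h"
  shows "Ck k m (punct m R) (\<lambda>x. h (ln (vnorm m x)))"
  by (rule Ck_compose_smooth1[OF openin_punctured assms Ck_ln_vnorm[OF openin_punctured]]) (use punct_D in auto)

text \<open>A component of h \<omega>, with 1 / |x| written as exp (- ln |x|) to make it a
  coordinate times a radial function.\<close>

definition dirc :: "nat \<Rightarrow> (real \<Rightarrow> real) \<Rightarrow> nat \<Rightarrow> (nat \<Rightarrow> real) \<Rightarrow> real" where
  "dirc m h b x = x b * (exp (- ln (vnorm m x)) * h (ln (vnorm m x)))"

lemma dirc_eq: "x \<in> punct m R \<Longrightarrow> dirc m h b x = x b / vnorm m x * h (ln (vnorm m x))"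
  using punct_D[of x m R] by (simp add: dirc_def exp_minus divide_inverse)

lemma smooth1_exp_lin: "smooth1 S (\<lambda>u. exp (c * u))"
  by (rule smooth1_compose[OF smooth1_exp]) (intro smooth1_intros, simp)

lemma dirc_Ck:
  assumes "smooth1 {..<ln R} h" shows "Ck k m (punct m R) (dirc m h b)"
proof -
  have "smooth1 {..<ln R} (\<lambda>u. exp (-1 * u) * h u)" by (intro smooth1_mult smooth1_exp_lin assms)
  from Ck_mult[OF openin_punctured Ck_coord[OF openin_punctured] radial_Ck[OF this]] show ?thesis
    unfolding dirc_def[abs_def] by simp
qed

lemma dirc_pd:
  assumes h: "smooth1 {..<ln R} h" and x: "x \<in> punct m R" and i: "i < m"
  shows "pd i (dirc m h b) x = ((if i = b then 1 else 0) - (x b / vnorm m x) * (x i / vnorm m x)) * h (ln (vnorm m x)) / vnorm m x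
    + (x b / vnorm m x) * (x i / vnorm m x) * deriv h (ln (vnorm m x)) / vnorm m x"
proof (rule pd_eqI)
  let ?r = "vnorm m x" and ?u = "ln (vnorm m x)"
  have r: "?r > 0" "?u \<in> {..<ln R}" using punct_D[OF x] by auto
  have "((\<lambda>u. exp (- u) * h u) has_real_derivative exp (- ?u) * (deriv h ?u - h ?u)) (at ?u)"
    by (rule derivative_eq_intros smooth1_DERIV[OF h r(2)] refl)+ (simp add: algebra_simps)
  note g = radial_DERIV[OF this x i]
  have c: "((\<lambda>t. (x(i := t)) b) has_real_derivative (if i = b then 1 else 0)) (at (x i))"
    by (auto intro!: derivative_eq_intros)
  have e: "exp (- ?u) = 1 / ?r" using r by (simp add: exp_minus inverse_eq_divide)
  show "((\<lambda>t. dirc m h b (x(i := t))) has_real_derivative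
    ((if i = b then 1 else 0) - (x b / ?r) * (x i / ?r)) * h ?u / ?r + (x b / ?r) * (x i / ?r) * deriv h ?u / ?r) (at (x i))"
    unfolding dirc_def
    by (rule DERIV_cong[OF DERIV_mult[OF c g]]) (use r in \<open>simp add: e power2_eq_square field_simps\<close>)
qed

lemma rad_pd:
  assumes g: "smooth1 {..<ln R} g" and x: "x \<in> punct m R" and i: "i < m"
  shows "pd i (\<lambda>x. g (ln (vnorm m x))) x = (x i / vnorm m x) * deriv g (ln (vnorm m x)) / vnorm m x"
proof (rule pd_eqI)
  have "ln (vnorm m x) \<in> {..<ln R}" using punct_D[OF x] by auto
  from radial_DERIV[OF smooth1_DERIV[OF g this] x i]
  show "((\<lambda>t. g (ln (vnorm m (x(i := t))))) has_real_derivative (x i / vnorm m x) * deriv g (ln (vnorm m x)) / vnorm m x) (at (x i))"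
    by (rule DERIV_cong) (simp add: power2_eq_square)
qed

lemma unit_direction: "x \<in> punct m R \<Longrightarrow> (\<Sum>i<m. (x i / vnorm m x)\<^sup>2) = 1"
  using punct_D[of x m R] by (simp add: power_divide vnorm_sq[symmetric] sum_divide_distrib[symmetric])

lemma unit_direction_le: "i < m \<Longrightarrow> \<bar>x i / vnorm m x\<bar> \<le> 1"
  using vnorm_component[of i m x] vnorm_nonneg[of m x]
  by (cases "vnorm m x = 0") (auto simp: abs_div divide_le_eq_1)

text \<open>With \<open>\<omega> = x / |x|\<close> this is \<open>(h \<omega>, Z 0, Z 1, Z 2, h \<omega>)\<close>, the profiles being functions of \<open>ln |x|\<close>;
  at the origin it has the junk value \<open>0\<close>.\<close>

definition mk :: "nat \<Rightarrow> (real \<Rightarrow> real) \<Rightarrow> (nat \<Rightarrow> real \<Rightarrow> real) \<Rightarrow> (nat \<Rightarrow> real) \<Rightarrow> nat \<Rightarrow> real" where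
  "mk m h Z x = (\<lambda>a\<in>{..<2 * m + 3}. if x = origin m then 0 else if a < m then x a / vnorm m x * h (ln (vnorm m x))
     else if a < m + 3 then Z (a - m) (ln (vnorm m x)) else x (a - m - 3) / vnorm m x * h (ln (vnorm m x)))"

lemma mk_Rn: "mk m h Z x \<in> Rn (2 * m + 3)" by (simp add: mk_def Rn_def)

lemma mk_cases:
  assumes "x \<in> punct m R"
  shows "a < m \<Longrightarrow> mk m h Z x a = dirc m h a x" "b < m \<Longrightarrow> mk m h Z x (m + 3 + b) = dirc m h b x"
    "j < 3 \<Longrightarrow> mk m h Z x (m + j) = Z j (ln (vnorm m x))"
  using assms by (auto simp: mk_def dirc_eq[OF assms])

lemma index_cases:
  fixes a m :: nat
  assumes "a < 2 * m + 3"
  obtains "a < m" | j where "a = m + j" "j < 3" | b where "a = m + 3 + b" "b < m"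
proof -
  consider "a < m" | "m \<le> a" "a < m + 3" | "m + 3 \<le> a" by linarith
  then show ?thesis
  proof cases
    case 2 then show ?thesis by (intro that(2)[of "a - m"]) auto
  next
    case 3 then show ?thesis using assms by (intro that(3)[of "a - (m + 3)"]) auto
  qed (rule that)
qed

lemma sum_index_split:
  fixes G :: "nat \<Rightarrow> real"
  shows "(\<Sum>a<2 * m + 3. G a) = (\<Sum>a<m. G a) + (\<Sum>j<3. G (m + j)) + (\<Sum>b<m. G (m + 3 + b))"
proof -
  have s: "(\<Sum>a<n + k. G a) = (\<Sum>a<n. G a) + (\<Sum>j<k. G (n + j))" for n k by (induction k) auto
  have "2 * m + 3 = (m + 3) + m" by simp
  then show ?thesis using s[of "m + 3" m] s[of m 3] by simp
qed

text \<open>Derivatives are taken in ln |x|, so a dilation of the map shifts the profiles and keeps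
  the constant; the bounds are uniform over all blow-ups.\<close>

definition Bd :: "real \<Rightarrow> real \<Rightarrow> (real \<Rightarrow> real) \<Rightarrow> bool" where
  "Bd R C h \<longleftrightarrow> smooth1 {..<ln R} h \<and> (\<forall>u<ln R. \<bar>h u\<bar> \<le> C \<and> \<bar>deriv h u\<bar> \<le> C)"

context
  fixes m :: nat and R C :: real and h :: "real \<Rightarrow> real" and Z :: "nat \<Rightarrow> real \<Rightarrow> real"
  assumes h: "Bd R C h" and Z: "\<And>j. j < 3 \<Longrightarrow> Bd R C (Z j)" and m2: "m \<ge> 2"
begin

lemma Bd_smooth: "smooth1 {..<ln R} h" "j < 3 \<Longrightarrow> smooth1 {..<ln R} (Z j)"
  using h Z by (auto simp: Bd_def)

lemma mk_Ck: "a < 2 * m + 3 \<Longrightarrow> Ck k m (punct m R) (\<lambda>x. mk m h Z x a)"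
proof (erule index_cases)
  assume a: "a < m"
  have "Ck k m (punct m R) (\<lambda>x. mk m h Z x a) \<longleftrightarrow> Ck k m (punct m R) (dirc m h a)"
    by (rule Ck_cong[OF openin_punctured mk_cases(1)[OF _ a]])
  then show "Ck k m (punct m R) (\<lambda>x. mk m h Z x a)" using dirc_Ck[OF Bd_smooth(1)] by simp
next
  fix j assume a: "a = m + j" "j < 3"
  have "Ck k m (punct m R) (\<lambda>x. mk m h Z x (m + j)) \<longleftrightarrow> Ck k m (punct m R) (\<lambda>x. Z j (ln (vnorm m x)))"
    by (rule Ck_cong[OF openin_punctured mk_cases(3)[OF _ a(2)]])
  then show "Ck k m (punct m R) (\<lambda>x. mk m h Z x a)" using radial_Ck[OF Bd_smooth(2)[OF a(2)]] a by simp
next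
  fix b assume a: "a = m + 3 + b" "b < m"
  have "Ck k m (punct m R) (\<lambda>x. mk m h Z x (m + 3 + b)) \<longleftrightarrow> Ck k m (punct m R) (dirc m h b)"
    by (rule Ck_cong[OF openin_punctured mk_cases(2)[OF _ a(2)]])
  then show "Ck k m (punct m R) (\<lambda>x. mk m h Z x a)" using dirc_Ck[OF Bd_smooth(1)] a by simp
qed

lemma mk_pd:
  assumes "x \<in> punct m R" "i < m"
  shows "a < m \<Longrightarrow> pd i (\<lambda>x. mk m h Z x a) x = pd i (dirc m h a) x"
    "j < 3 \<Longrightarrow> pd i (\<lambda>x. mk m h Z x (m + j)) x = pd i (\<lambda>x. Z j (ln (vnorm m x))) x"
    "b < m \<Longrightarrow> pd i (\<lambda>x. mk m h Z x (m + 3 + b)) x = pd i (dirc m h b) x"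
  by (rule line_cong(2)[OF openin_punctured assms], rule mk_cases, assumption+)+

lemma C_nonneg: "x \<in> punct m R \<Longrightarrow> 0 \<le> C"
  using h punct_D[of x m R] by (force simp: Bd_def intro: order_trans[OF abs_ge_zero])

lemma dirc_bounds:
  assumes x: "x \<in> punct m R" and "b < m" and i: "i < m"
  shows "\<bar>dirc m h b x\<bar> \<le> C" "\<bar>pd i (dirc m h b) x\<bar> \<le> 3 * C / vnorm m x"
proof -
  let ?r = "vnorm m x" and ?u = "ln (vnorm m x)"
  have r: "?r > 0" "?u < ln R" using punct_D[OF x] by auto
  have hb: "\<bar>h ?u\<bar> \<le> C" "\<bar>deriv h ?u\<bar> \<le> C" using h r by (auto simp: Bd_def)
  have d: "\<bar>x b / ?r\<bar> \<le> 1" "\<bar>x i / ?r\<bar> \<le> 1" using unit_direction_le assms by auto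
  have C: "0 \<le> C" by (rule C_nonneg[OF x])
  have pr: "\<bar>a * b\<bar> \<le> A * B" if "\<bar>a\<bar> \<le> A" "\<bar>b\<bar> \<le> B" for a b A B :: real
    using that by (auto simp: abs_mult intro!: mult_mono order_trans[OF abs_ge_zero])
  show "\<bar>dirc m h b x\<bar> \<le> C" unfolding dirc_eq[OF x] using pr[OF d(1) hb(1)] by simp
  have dd: "\<bar>(x b / ?r) * (x i / ?r)\<bar> \<le> 1" using pr[OF d] by simp
  have "\<bar>(if Q then 1 else 0) - t\<bar> \<le> 2" if "\<bar>t\<bar> \<le> 1" for Q and t :: real using that by (auto simp: abs_le_iff)
  from this[OF dd] have A: "\<bar>(if i = b then 1 else 0) - (x b / ?r) * (x i / ?r)\<bar> \<le> 2" .
  have "\<bar>((if i = b then 1 else 0) - (x b / ?r) * (x i / ?r)) * h ?u + (x b / ?r) * (x i / ?r) * deriv h ?u\<bar> \<le> 2 * C + 1 * C"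
    by (rule order_trans[OF abs_triangle_ineq add_mono[OF pr[OF A hb(1)] pr[OF dd hb(2)]]])
  then have *: "\<bar>((if i = b then 1 else 0) - (x b / ?r) * (x i / ?r)) * h ?u + (x b / ?r) * (x i / ?r) * deriv h ?u\<bar> / ?r \<le> (2 * C + 1 * C) / ?r"
    using r by (intro divide_right_mono) auto
  have C3: "3 * C = 2 * C + 1 * C" by simp
  from * show "\<bar>pd i (dirc m h b) x\<bar> \<le> 3 * C / ?r"
    unfolding dirc_pd[OF Bd_smooth(1) x i] C3 add_divide_distrib[symmetric] abs_divide abs_of_pos[OF r(1)] .
qed

lemma rad_bounds:
  assumes x: "x \<in> punct m R" and j: "j < 3" and i: "i < m"
  shows "\<bar>Z j (ln (vnorm m x))\<bar> \<le> C" "\<bar>pd i (\<lambda>x. Z j (ln (vnorm m x))) x\<bar> \<le> 3 * C / vnorm m x" (is ?PA)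
proof -
  let ?r = "vnorm m x" and ?u = "ln (vnorm m x)"
  have r: "?r > 0" "?u < ln R" using punct_D[OF x] by auto
  have Zb: "\<bar>Z j ?u\<bar> \<le> C" "\<bar>deriv (Z j) ?u\<bar> \<le> C" using Z[OF j] r by (auto simp: Bd_def)
  then show "\<bar>Z j (ln (vnorm m x))\<bar> \<le> C" by simp
  have "\<bar>x i / ?r\<bar> * \<bar>deriv (Z j) ?u\<bar> \<le> 1 * C"
    using unit_direction_le[OF i, of x] Zb by (intro mult_mono) auto
  also have "\<dots> \<le> 3 * C" using C_nonneg[OF x] by simp
  finally have "\<bar>x i / ?r\<bar> * \<bar>deriv (Z j) ?u\<bar> / ?r \<le> 3 * C / ?r" using r by (intro divide_right_mono) auto
  then show ?PA
    unfolding rad_pd[OF Bd_smooth(2)[OF j] x i] using r by (simp add: abs_mult abs_div)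
qed

lemma mk_bounds:
  assumes x: "x \<in> punct m R" and a: "a < 2 * m + 3" and i: "i < m"
  shows "\<bar>mk m h Z x a\<bar> \<le> C" "\<bar>pd i (\<lambda>x. mk m h Z x a) x\<bar> \<le> 3 * C / vnorm m x"
proof -
  have "\<bar>mk m h Z x a\<bar> \<le> C \<and> \<bar>pd i (\<lambda>x. mk m h Z x a) x\<bar> \<le> 3 * C / vnorm m x"
    using a
  proof (cases rule: index_cases)
    case 1
    then show ?thesis using dirc_bounds[OF x 1 i] mk_pd(1)[OF x i 1] mk_cases(1)[OF x 1] by simp
  next
    case (2 j)
    then show ?thesis using rad_bounds[OF x 2(2) i] mk_pd(2)[OF x i 2(2)] mk_cases(3)[OF x 2(2)] by simp
  next
    case (3 b)
    then show ?thesis using dirc_bounds[OF x 3(2) i] mk_pd(3)[OF x i 3(2)] mk_cases(2)[OF x 3(2)] by simp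
  qed
  then show "\<bar>mk m h Z x a\<bar> \<le> C" "\<bar>pd i (\<lambda>x. mk m h Z x a) x\<bar> \<le> 3 * C / vnorm m x" by auto
qed

text \<open>Values are bounded by C and derivatives by 3 C / |x|; on the ball of radius R both are
  at most C (3 + R) / |x|, a singularity of order 1 < m.\<close>

lemma mk_weak_pd:
  assumes a: "a < 2 * m + 3" and i: "i < m"
  shows "has_weak_pd m (oball m R) i (\<lambda>x. mk m h Z x a) (pd i (\<lambda>x. mk m h Z x a))"
proof (rule has_weak_pd_classical[OF m2 i, where \<beta> = 1 and C = "C * (3 + R)"])
  show "Ck 1 m (punct m R) (\<lambda>x. mk m h Z x a)" by (rule mk_Ck[OF a])
  fix x assume "x \<in> oball m R" "x \<noteq> origin m"
  then have x: "x \<in> punct m R" by simp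
  have r: "vnorm m x > 0" "vnorm m x < R" using punct_D[OF x] by auto
  have C: "0 \<le> C" by (rule C_nonneg[OF x])
  have e: "vnorm m x powr - 1 = 1 / vnorm m x" using r by (simp add: powr_minus inverse_eq_divide)
  have "C = C * vnorm m x / vnorm m x" using r by simp
  also have "\<dots> \<le> C * (3 + R) / vnorm m x" using C r by (intro divide_right_mono mult_left_mono) auto
  finally show "\<bar>mk m h Z x a\<bar> \<le> C * (3 + R) * vnorm m x powr - 1"
    using mk_bounds(1)[OF x a i] unfolding e by simp
  have "3 * C / vnorm m x \<le> C * (3 + R) / vnorm m x" using C r by (intro divide_right_mono) (auto simp: algebra_simps)
  then show "\<bar>pd i (\<lambda>x. mk m h Z x a) x\<bar> \<le> C * (3 + R) * vnorm m x powr - 1"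
    using mk_bounds(2)[OF x a i] unfolding e by simp
qed (use m2 in auto)

lemma mk_Lp:
  fixes p :: real
  assumes a: "a < 2 * m + 3" and i: "i < m" and p: "1 < p" "p < m"
  shows "Lp m p (oball m R) (\<lambda>x. mk m h Z x a)" (is ?PA) "Lp m p (oball m R) (pd i (\<lambda>x. mk m h Z x a))" (is ?PB)
proof -
  have AEb: "AE x in lebball m R. x \<in> punct m R"
    using m2 by (intro AE_lebball_punct) auto
  have c: "continuous_on (punct m R) (\<lambda>x. mk m h Z x a)" "continuous_on (punct m R) (pd i (\<lambda>x. mk m h Z x a))"
    using mk_Ck[OF a, of 1] i by auto
  have mm: "(\<lambda>x. mk m h Z x a) \<in> borel_measurable (lebball m R)" "pd i (\<lambda>x. mk m h Z x a) \<in> borel_measurable (lebball m R)"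
    using c by (auto intro: lebball_continuous_measurable)
  have "integrable (lebball m R) (\<lambda>x. \<bar>mk m h Z x a\<bar> powr p)"
  proof (rule Bochner_Integration.integrable_bound[OF lebball_const_integrable[of m R "C powr p"]])
    show "AE x in lebball m R. norm (\<bar>mk m h Z x a\<bar> powr p) \<le> norm (C powr p)"
      using AEb by eventually_elim (use mk_bounds(1)[OF _ a i] p in \<open>auto intro!: powr_mono2\<close>)
  qed (use mm in measurable)
  then show ?PA using mm by (simp add: Lp_iff)
  have "integrable (lebball m R) (\<lambda>x. \<bar>pd i (\<lambda>x. mk m h Z x a) x\<bar> powr p)"
  proof (rule Bochner_Integration.integrable_bound)
    show "integrable (lebball m R) (\<lambda>x. (3 * C) powr p * vnorm m x powr (- p))"
      using p by (intro integrable_mult_right vnorm_powr_integrable) auto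
    show "AE x in lebball m R. norm (\<bar>pd i (\<lambda>x. mk m h Z x a) x\<bar> powr p) \<le> norm ((3 * C) powr p * vnorm m x powr (- p))"
      using AEb
    proof eventually_elim
      case (elim x)
      have "\<bar>pd i (\<lambda>x. mk m h Z x a) x\<bar> powr p \<le> (3 * C / vnorm m x) powr p"
        using mk_bounds(2)[OF elim a i] p by (intro powr_mono2) auto
      also have "\<dots> = (3 * C) powr p * vnorm m x powr (- p)"
        using punct_D[OF elim] C_nonneg[OF elim] by (simp add: powr_divide powr_minus_divide)
      finally show ?case by simp
    qed
  qed (use mm in measurable)
  then show ?PB using mm by (simp add: Lp_iff)
qed

lemma mk_W1p: "1 < p \<Longrightarrow> p < m \<Longrightarrow> mk m h Z \<in> W1p m (2 * m + 3) p (oball m R)" for p :: real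
  by (rule W1pI[where g = "\<lambda>a i. pd i (\<lambda>x. mk m h Z x a)"], use mk_Rn in blast)
    (use mk_Lp(1)[of _ 0 p] m2 in simp, rule mk_weak_pd, assumption+, rule mk_Lp(2))

lemma mk_wpd:
  "a < 2 * m + 3 \<Longrightarrow> i < m \<Longrightarrow> AE x in lebball m R. wpd m (oball m R) i (\<lambda>x. mk m h Z x a) x = pd i (\<lambda>x. mk m h Z x a) x"
  using mk_weak_pd m2 by (intro wpd_AE) auto

lemma mk_grad:
  assumes x: "x \<in> punct m R"
  shows "(\<Sum>a<2 * m + 3. \<Sum>i<m. (pd i (\<lambda>x. mk m h Z x a) x)\<^sup>2) =
    (2 * ((real m - 1) * (h (ln (vnorm m x)))\<^sup>2 + (deriv h (ln (vnorm m x)))\<^sup>2) + (\<Sum>j<3. (deriv (Z j) (ln (vnorm m x)))\<^sup>2)) / (vnorm m x)\<^sup>2"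
proof -
  let ?r = "vnorm m x" and ?u = "ln (vnorm m x)"
  let ?n = "\<lambda>i. x i / ?r" and ?h = "h ?u" and ?k = "deriv h ?u"
  have r: "?r > 0" using punct_D[OF x] by auto
  have n1: "(\<Sum>i<m. (?n i)\<^sup>2) = 1" by (rule unit_direction[OF x])
  \<comment> \<open>Up to the factor 1 / |x| this is row \<open>b\<close> of the matrix that
    multiplies by h across and by h' along the radial direction; summation over \<open>b\<close>
    gives (m - 1) h^2 + h'^2.\<close>
  have row: "(\<Sum>i<m. (((if i = b then 1 else 0) - ?n b * ?n i) * ?h / ?r + ?n b * ?n i * ?k / ?r)\<^sup>2) =
    (?h\<^sup>2 + (?k\<^sup>2 - ?h\<^sup>2) * (?n b)\<^sup>2) / ?r\<^sup>2" if b: "b < m" for b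
  proof -
    have "(((if i = b then 1 else 0) - ?n b * ?n i) * ?h / ?r + ?n b * ?n i * ?k / ?r)\<^sup>2 =
      ((if i = b then ?h\<^sup>2 + 2 * ?h * (?k - ?h) * (?n b)\<^sup>2 else 0) + (?n b)\<^sup>2 * (?k - ?h)\<^sup>2 * (?n i)\<^sup>2) / ?r\<^sup>2" for i
      using r by (simp add: power2_eq_square field_simps)
    then have "(\<Sum>i<m. (((if i = b then 1 else 0) - ?n b * ?n i) * ?h / ?r + ?n b * ?n i * ?k / ?r)\<^sup>2) =
      (\<Sum>i<m. ((if i = b then ?h\<^sup>2 + 2 * ?h * (?k - ?h) * (?n b)\<^sup>2 else 0) + (?n b)\<^sup>2 * (?k - ?h)\<^sup>2 * (?n i)\<^sup>2)) / ?r\<^sup>2"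
      by (simp only: sum_divide_distrib)
    also have "(\<Sum>i<m. ((if i = b then ?h\<^sup>2 + 2 * ?h * (?k - ?h) * (?n b)\<^sup>2 else 0) + (?n b)\<^sup>2 * (?k - ?h)\<^sup>2 * (?n i)\<^sup>2)) =
      (?h\<^sup>2 + 2 * ?h * (?k - ?h) * (?n b)\<^sup>2) + (?n b)\<^sup>2 * (?k - ?h)\<^sup>2 * (\<Sum>i<m. (?n i)\<^sup>2)"
      using b by (simp only: sum.distrib sum_distrib_left) simp
    also have "\<dots> = ?h\<^sup>2 + (?k\<^sup>2 - ?h\<^sup>2) * (?n b)\<^sup>2" unfolding n1 by (simp add: power2_eq_square algebra_simps)
    finally show ?thesis .
  qed
  have dirs: "(\<Sum>b<m. \<Sum>i<m. (pd i (dirc m h b) x)\<^sup>2) = ((real m - 1) * ?h\<^sup>2 + ?k\<^sup>2) / ?r\<^sup>2"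
  proof -
    have "(\<Sum>b<m. \<Sum>i<m. (pd i (dirc m h b) x)\<^sup>2) = (\<Sum>b<m. (?h\<^sup>2 + (?k\<^sup>2 - ?h\<^sup>2) * (?n b)\<^sup>2) / ?r\<^sup>2)"
      using dirc_pd[OF Bd_smooth(1) x] row by (intro sum.cong refl) simp
    also have "\<dots> = (real m * ?h\<^sup>2 + (?k\<^sup>2 - ?h\<^sup>2) * (\<Sum>b<m. (?n b)\<^sup>2)) / ?r\<^sup>2"
      by (simp only: sum_divide_distrib[symmetric] sum.distrib sum_distrib_left[symmetric]) simp
    finally show ?thesis unfolding n1 by (simp add: algebra_simps)
  qed
  have rads: "(\<Sum>j<3. \<Sum>i<m. (pd i (\<lambda>x. Z j (ln (vnorm m x))) x)\<^sup>2) = (\<Sum>j<3. (deriv (Z j) ?u)\<^sup>2) / ?r\<^sup>2"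
  proof -
    have "(\<Sum>i<m. (pd i (\<lambda>x. Z j (ln (vnorm m x))) x)\<^sup>2) = (deriv (Z j) ?u)\<^sup>2 / ?r\<^sup>2" if j: "j < 3" for j
    proof -
      have "(\<Sum>i<m. (pd i (\<lambda>x. Z j (ln (vnorm m x))) x)\<^sup>2) = (\<Sum>i<m. (?n i)\<^sup>2 * ((deriv (Z j) ?u)\<^sup>2 / ?r\<^sup>2))"
        using rad_pd[OF Bd_smooth(2)[OF j] x] by (intro sum.cong refl) (simp add: power_mult_distrib power_divide)
      then show ?thesis unfolding sum_distrib_right[symmetric] n1 by simp
    qed
    then show ?thesis by (simp add: sum_divide_distrib)
  qed
  have "(\<Sum>a<2 * m + 3. \<Sum>i<m. (pd i (\<lambda>x. mk m h Z x a) x)\<^sup>2) =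
    (\<Sum>b<m. \<Sum>i<m. (pd i (dirc m h b) x)\<^sup>2) + (\<Sum>j<3. \<Sum>i<m. (pd i (\<lambda>x. Z j (ln (vnorm m x))) x)\<^sup>2) + (\<Sum>b<m. \<Sum>i<m. (pd i (dirc m h b) x)\<^sup>2)"
    unfolding sum_index_split using mk_pd[OF x] by (intro arg_cong2[of _ _ _ _ "(+)"] sum.cong refl) simp_all
  then show ?thesis unfolding dirs rads by (simp add: add_divide_distrib[symmetric])
qed

end

text \<open>The flux of a component of h \<omega> is a combination of the identity and of x
  \<otimes> x with radial coefficients; \<open>g2\<close> is two orders more singular to compensate
  for the two factors x.\<close>

lemma flux_dirc:
  fixes p C R :: real and m :: nat and g1 g2 :: "real \<Rightarrow> real"
  assumes g1: "smooth1 {..<ln R} g1" and g2: "smooth1 {..<ln R} g2"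
    and b1: "\<forall>u<ln R. \<bar>g1 u\<bar> \<le> C * exp ((1 - p) * u) \<and> \<bar>deriv g1 u\<bar> \<le> C * exp ((1 - p) * u)"
    and b2: "\<forall>u<ln R. \<bar>g2 u\<bar> \<le> C * exp ((-1 - p) * u) \<and> \<bar>deriv g2 u\<bar> \<le> C * exp ((-1 - p) * u)"
  defines "f \<equiv> \<lambda>b i x. (if i = b then g1 (ln (vnorm m x)) else 0) - x b * (x i * g2 (ln (vnorm m x)))"
  assumes i: "i < m" and b: "b < m"
  shows "Ck 1 m (punct m R) (f b i)"
    "x \<in> punct m R \<Longrightarrow> \<bar>f b i x\<bar> \<le> 5 * C * vnorm m x powr (1 - p)"
    "x \<in> punct m R \<Longrightarrow> \<bar>pd i (f b i) x\<bar> \<le> 5 * C * vnorm m x powr (- p)"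
    "x \<in> punct m R \<Longrightarrow> (\<Sum>i<m. pd i (f b i) x) =
       x b * (deriv g1 (ln (vnorm m x)) / (vnorm m x)\<^sup>2 - (m + 1) * g2 (ln (vnorm m x)) - deriv g2 (ln (vnorm m x)))"
proof -
  show "Ck 1 m (punct m R) (f b i)"
    unfolding f_def
    by (intro Ck_diff[OF openin_punctured _ Ck_mult[OF openin_punctured Ck_coord[OF openin_punctured] Ck_mult[OF openin_punctured Ck_coord[OF openin_punctured] radial_Ck[OF g2]]]])
      (cases "i = b"; simp add: radial_Ck[OF g1] Ck_const[OF openin_punctured])
  assume x: "x \<in> punct m R"
  let ?r = "vnorm m x" and ?u = "ln (vnorm m x)"
  have r: "?r > 0" "?u < ln R" using punct_D[OF x] by auto
  have ex: "exp (c * ?u) = ?r powr c" for c using r by (simp add: powr_def)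
  have pw: "?r powr (-1 - p) = ?r powr (1 - p) / ?r\<^sup>2" "?r powr (- p) = ?r powr (1 - p) / ?r"
    using r by (simp_all add: powr_diff powr_minus divide_simps power2_eq_square)
  define E where "E = C * ?r powr (1 - p)"
  have G: "\<bar>g1 ?u\<bar> \<le> E" "\<bar>deriv g1 ?u\<bar> \<le> E" "\<bar>?r\<^sup>2 * g2 ?u\<bar> \<le> E" "\<bar>?r\<^sup>2 * deriv g2 ?u\<bar> \<le> E"
    using b1[rule_format, OF r(2)] b2[rule_format, OF r(2)] r unfolding ex pw E_def by (auto simp: abs_mult field_simps)
  have E: "0 \<le> E" using G(1) by linarith
  have pr: "\<bar>a * b\<bar> \<le> A * B" if "\<bar>a\<bar> \<le> A" "\<bar>b\<bar> \<le> B" for a b A B :: real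
    using that by (auto simp: abs_mult intro!: mult_mono order_trans[OF abs_ge_zero])
  have n: "\<bar>x j / ?r\<bar> \<le> 1" if "j < m" for j by (rule unit_direction_le[OF that])
  have nn: "\<bar>(x b / ?r) * (x i / ?r)\<bar> \<le> 1" using pr[OF n[OF b] n[OF i]] by simp
  have fe: "f b i x = (if i = b then g1 ?u else 0) - ((x b / ?r) * (x i / ?r)) * (?r\<^sup>2 * g2 ?u)"
    using r by (simp add: f_def power2_eq_square)
  have "\<bar>f b i x\<bar> \<le> E + 1 * E"
    unfolding fe by (rule order_trans[OF abs_triangle_ineq4 add_mono[OF _ pr[OF nn G(3)]]]) (use G(1) E in auto)
  then show "\<bar>f b i x\<bar> \<le> 5 * C * ?r powr (1 - p)" using E by (simp add: E_def)
  have der: "pd i (f b i) x = (if i = b then deriv g1 ?u * (x i / ?r\<^sup>2) else 0)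
     - ((if i = b then 1 else 0) * (x i * g2 ?u) + x b * (g2 ?u + x i * (deriv g2 ?u * (x i / ?r\<^sup>2))))" if i: "i < m" for i
  proof (rule pd_eqI)
    have ru: "?u \<in> {..<ln R}" using r by simp
    have d1: "((\<lambda>t. if i = b then g1 (ln (vnorm m (x(i := t)))) else 0) has_real_derivative (if i = b then deriv g1 ?u * (x i / ?r\<^sup>2) else 0)) (at (x i))"
      using radial_DERIV[OF smooth1_DERIV[OF g1 ru] x i] by auto
    have c: "((\<lambda>t. (x(i := t)) b) has_real_derivative (if i = b then 1 else 0)) (at (x i))"
      "((\<lambda>t. (x(i := t)) i) has_real_derivative 1) (at (x i))" by (auto intro!: derivative_eq_intros)
    show "((\<lambda>t. f b i (x(i := t))) has_real_derivative (if i = b then deriv g1 ?u * (x i / ?r\<^sup>2) else 0)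
     - ((if i = b then 1 else 0) * (x i * g2 ?u) + x b * (g2 ?u + x i * (deriv g2 ?u * (x i / ?r\<^sup>2))))) (at (x i))"
      unfolding f_def
      by (rule DERIV_cong[OF DERIV_diff[OF d1 DERIV_mult[OF c(1) DERIV_mult[OF c(2) radial_DERIV[OF smooth1_DERIV[OF g2 ru] x i]]]]])
        (simp add: algebra_simps)
  qed
  have "pd i (f b i) x = ((if i = b then deriv g1 ?u * (x i / ?r) else 0)
     - ((if i = b then (x i / ?r) * (?r\<^sup>2 * g2 ?u) else 0) + ((x b / ?r) * (?r\<^sup>2 * g2 ?u) + (x i / ?r) * (((x b / ?r) * (x i / ?r)) * (?r\<^sup>2 * deriv g2 ?u))))) / ?r"
    unfolding der[OF i] using r by (simp add: power2_eq_square field_simps)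
  moreover have "\<bar>(if i = b then deriv g1 ?u * (x i / ?r) else 0)
     - ((if i = b then (x i / ?r) * (?r\<^sup>2 * g2 ?u) else 0) + ((x b / ?r) * (?r\<^sup>2 * g2 ?u) + (x i / ?r) * (((x b / ?r) * (x i / ?r)) * (?r\<^sup>2 * deriv g2 ?u))))\<bar> \<le> 5 * E"
  proof -
    have t: "\<bar>deriv g1 ?u * (x i / ?r)\<bar> \<le> E * 1" "\<bar>(x i / ?r) * (?r\<^sup>2 * g2 ?u)\<bar> \<le> 1 * E" "\<bar>(x b / ?r) * (?r\<^sup>2 * g2 ?u)\<bar> \<le> 1 * E"
      "\<bar>(x i / ?r) * (((x b / ?r) * (x i / ?r)) * (?r\<^sup>2 * deriv g2 ?u))\<bar> \<le> 1 * (1 * E)"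
      by (rule pr[OF G(2) n[OF i]], rule pr[OF n[OF i] G(3)], rule pr[OF n[OF b] G(3)], rule pr[OF n[OF i] pr[OF nn G(4)]])
    have tri: "\<bar>(if Q then a1 else 0) - ((if Q then a2 else 0) + (a3 + a4))\<bar> \<le> 5 * E"
      if "\<bar>a1\<bar> \<le> E * 1" "\<bar>a2\<bar> \<le> 1 * E" "\<bar>a3\<bar> \<le> 1 * E" "\<bar>a4\<bar> \<le> 1 * (1 * E)" for Q a1 a2 a3 a4
      using that E by (auto simp: abs_le_iff)
    show ?thesis by (rule tri[OF t])
  qed
  ultimately have "\<bar>pd i (f b i) x\<bar> \<le> 5 * E / ?r" using r by (simp add: abs_div divide_right_mono)
  then show "\<bar>pd i (f b i) x\<bar> \<le> 5 * C * ?r powr (- p)" unfolding pw by (simp add: E_def)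
  have "(\<Sum>i<m. pd i (f b i) x) = (\<Sum>i<m. (if i = b then deriv g1 ?u * (x i / ?r\<^sup>2) - x i * g2 ?u else 0)
     - (x b * g2 ?u + (x b * deriv g2 ?u / ?r\<^sup>2) * (x i)\<^sup>2))"
    by (intro sum.cong refl) (simp add: der power2_eq_square algebra_simps)
  also have "\<dots> = (deriv g1 ?u * (x b / ?r\<^sup>2) - x b * g2 ?u) - (m * (x b * g2 ?u) + (x b * deriv g2 ?u / ?r\<^sup>2) * (\<Sum>i<m. (x i)\<^sup>2))"
    using b by (simp only: sum_subtractf sum.distrib sum_distrib_left[symmetric]) simp
  also have "\<dots> = x b * (deriv g1 ?u / ?r\<^sup>2 - (m + 1) * g2 ?u - deriv g2 ?u)"
    unfolding vnorm_sq[symmetric] using r by (simp add: algebra_simps)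
  finally show "(\<Sum>i<m. pd i (f b i) x) = x b * (deriv g1 ?u / ?r\<^sup>2 - (m + 1) * g2 ?u - deriv g2 ?u)" .
qed

lemma flux_rad:
  fixes p C R :: real and m :: nat and g :: "real \<Rightarrow> real"
  assumes g: "smooth1 {..<ln R} g"
    and b1: "\<forall>u<ln R. \<bar>g u\<bar> \<le> C * exp (- p * u) \<and> \<bar>deriv g u\<bar> \<le> C * exp (- p * u)"
  defines "f \<equiv> \<lambda>i x. x i * g (ln (vnorm m x))"
  assumes i: "i < m"
  shows "Ck 1 m (punct m R) (f i)"
    "x \<in> punct m R \<Longrightarrow> \<bar>f i x\<bar> \<le> 5 * C * vnorm m x powr (1 - p)"
    "x \<in> punct m R \<Longrightarrow> \<bar>pd i (f i) x\<bar> \<le> 5 * C * vnorm m x powr (- p)"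
    "x \<in> punct m R \<Longrightarrow> (\<Sum>i<m. pd i (f i) x) = m * g (ln (vnorm m x)) + deriv g (ln (vnorm m x))"
proof -
  show "Ck 1 m (punct m R) (f i)"
    unfolding f_def by (intro Ck_mult Ck_coord radial_Ck g openin_punctured)
  assume x: "x \<in> punct m R"
  let ?r = "vnorm m x" and ?u = "ln (vnorm m x)"
  have r: "?r > 0" "?u < ln R" using punct_D[OF x] by auto
  define E where "E = C * ?r powr (- p)"
  have G: "\<bar>g ?u\<bar> \<le> E" "\<bar>deriv g ?u\<bar> \<le> E"
    using b1[rule_format, OF r(2)] r by (auto simp: powr_def E_def)
  have E: "0 \<le> E" using G(1) by linarith
  have n: "\<bar>x i / ?r\<bar> \<le> 1" by (rule unit_direction_le[OF i])
  have rp: "?r * ?r powr (- p) = ?r powr (1 - p)" using r by (simp add: powr_diff powr_minus field_simps)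
  have "\<bar>f i x\<bar> \<le> ?r * E" unfolding f_def abs_mult using vnorm_component[OF i, of x] G(1) by (intro mult_mono) auto
  also have "\<dots> = C * ?r powr (1 - p)" unfolding rp[symmetric] E_def by simp
  also have "\<dots> \<le> 5 * C * ?r powr (1 - p)"
  proof -
    have "0 \<le> ?r * E" using E r by simp
    then show ?thesis unfolding rp[symmetric] E_def by (simp add: mult.left_commute)
  qed
  finally show "\<bar>f i x\<bar> \<le> 5 * C * ?r powr (1 - p)" .
  have der: "pd i (f i) x = g ?u + (x i)\<^sup>2 * (deriv g ?u / ?r\<^sup>2)" if i: "i < m" for i
  proof (rule pd_eqI)
    have ru: "?u \<in> {..<ln R}" using r by simp
    have c: "((\<lambda>t. (x(i := t)) i) has_real_derivative 1) (at (x i))" by (auto intro!: derivative_eq_intros)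
    show "((\<lambda>t. f i (x(i := t))) has_real_derivative g ?u + (x i)\<^sup>2 * (deriv g ?u / ?r\<^sup>2)) (at (x i))"
      unfolding f_def
      by (rule DERIV_cong[OF DERIV_mult[OF c radial_DERIV[OF smooth1_DERIV[OF g ru] x i]]]) (simp add: algebra_simps power2_eq_square)
  qed
  have "\<bar>(x i / ?r)\<^sup>2 * deriv g ?u\<bar> \<le> 1 * E"
    using n G(2) abs_square_le_1[of "x i / ?r"] by (simp only: abs_mult) (intro mult_mono, auto)
  moreover have "pd i (f i) x = g ?u + (x i / ?r)\<^sup>2 * deriv g ?u" unfolding der[OF i] by (simp add: power_divide)
  ultimately have "\<bar>pd i (f i) x\<bar> \<le> 2 * E" using G(1) by linarith
  then show "\<bar>pd i (f i) x\<bar> \<le> 5 * C * ?r powr (- p)" using E by (simp add: E_def)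
  have "(\<Sum>i<m. pd i (f i) x) = m * g ?u + (\<Sum>i<m. (x i)\<^sup>2) * (deriv g ?u / ?r\<^sup>2)"
  proof -
    have "(\<Sum>i<m. pd i (f i) x) = (\<Sum>i<m. g ?u + (x i)\<^sup>2 * (deriv g ?u / ?r\<^sup>2))"
      using der by (intro sum.cong refl) simp
    then show ?thesis by (simp only: sum.distrib sum_distrib_right[symmetric]) simp
  qed
  then show "(\<Sum>i<m. pd i (f i) x) = m * g ?u + deriv g ?u" unfolding vnorm_sq[symmetric] using r by simp
qed

section \<open>The spiralling map and its target\<close>

context spiral
begin

lemma m2: "m \<ge> 2" using p1 pm by linarith

text \<open>With this constant the punctured unit ball corresponds to 0 < s < s1 / 2.\<close>

definition T0 :: real where "T0 = exp (2 / s1)"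
definition sL :: "real \<Rightarrow> real" where "sL u = 1 / ln (T0 - u)"

lemma T0_gt: "T0 > 1" using s1 by (simp add: T0_def)

lemma ln_T0: "u < 0 \<Longrightarrow> 2 / s1 < ln (T0 - u)"
proof -
  assume u: "u < 0"
  then have "ln T0 < ln (T0 - u)" using T0_gt by (intro ln_less_cancel_iff[THEN iffD2]) auto
  then show ?thesis by (simp add: T0_def)
qed

lemma sL_range: "u < 0 \<Longrightarrow> 0 < sL u \<and> sL u < s1 / 2"
proof -
  assume u: "u < 0"
  have "0 < 2 / s1" using s1 by simp
  moreover from this ln_T0[OF u] have l: "0 < ln (T0 - u)" by linarith
  moreover have "1 / ln (T0 - u) < 1 / (2 / s1)" using \<open>0 < 2 / s1\<close> by (intro divide_strict_left_mono ln_T0[OF u] mult_pos_pos l) auto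
  ultimately show ?thesis by (simp add: sL_def)
qed

lemma sL_S: "u < 0 \<Longrightarrow> sL u \<in> S"
  using sL_range[of u] s1 by (auto simp: S)

lemma flat_sL: "u < 0 \<Longrightarrow> flat (sL u) = 1 / (T0 - u)"
  using sL_range[of u] T0_gt by (simp add: flat_def sL_def exp_minus inverse_eq_divide)

lemma sL_DERIV: "u < 0 \<Longrightarrow> (sL has_real_derivative flat (sL u) * (sL u)\<^sup>2) (at u)"
proof -
  assume u: "u < 0"
  have l: "ln (T0 - u) > 0" using sL_range[OF u] by (simp add: sL_def)
  have t: "T0 - u > 0" using T0_gt u by simp
  have "((\<lambda>u. 1 / ln (T0 - u)) has_real_derivative 1 / (T0 - u) * (1 / ln (T0 - u))\<^sup>2) (at u)"
    using l t by (auto intro!: derivative_eq_intros simp: field_simps power2_eq_square)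
  then show ?thesis unfolding flat_sL[OF u] by (simp add: sL_def[abs_def])
qed

lemma sL_smooth: "smooth1 {..<0} sL"
proof -
  have t: "T0 - u > 0" "ln (T0 - u) > 0" if "u < 0" for u
    using T0_gt that sL_range[OF that] by (auto simp: sL_def)
  have "smooth1 {..<0} (\<lambda>u. ln (T0 - u))"
    by (rule smooth1_compose[OF smooth1_ln]) (use t in \<open>auto intro!: smooth1_intros\<close>)
  then show ?thesis unfolding sL_def[abs_def] using t by (intro smooth1_divide smooth1_const) auto
qed

text \<open>Differentiation in ln |x| is - \<open>Dt\<close>. Boundedness holds because
  \<open>sL\<close> takes values in the compact interval from 0 to s1 / 2, which lies in
  \<open>S\<close> together with the limiting value 0.\<close>

lemma comp_sL:
  assumes f: "smooth1 S f"
  shows "smooth1 {..<0} (\<lambda>u. f (sL u))" "u < 0 \<Longrightarrow> ((\<lambda>u. f (sL u)) has_real_derivative - Dt f (sL u)) (at u)"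
    "u < 0 \<Longrightarrow> deriv (\<lambda>u. f (sL u)) u = - Dt f (sL u)"
    "\<exists>C. \<forall>u<0. \<bar>f (sL u)\<bar> \<le> C" (is ?PA)
proof -
  show "smooth1 {..<0} (\<lambda>u. f (sL u))" by (rule smooth1_compose[OF f sL_smooth]) (use sL_S in auto)
  show d: "((\<lambda>u. f (sL u)) has_real_derivative - Dt f (sL u)) (at u)" if u: "u < 0" for u
    by (rule DERIV_cong[OF DERIV_chain2[OF smooth1_DERIV[OF f sL_S[OF u]] sL_DERIV[OF u]]]) (simp add: Dt_def)
  show "u < 0 \<Longrightarrow> deriv (\<lambda>u. f (sL u)) u = - Dt f (sL u)" by (rule DERIV_imp_deriv[OF d])
  have "continuous_on {0..s1/2} f"
    using s1 by (intro continuous_on_subset[OF smooth1_continuous[OF f]]) (auto simp: S)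
  then have "bounded (f ` {0..s1/2})" by (intro compact_imp_bounded compact_continuous_image) auto
  then obtain C where "\<forall>s\<in>{0..s1/2}. \<bar>f s\<bar> \<le> C" unfolding bounded_iff by auto
  then show ?PA using sL_range by (intro exI[of _ C]) (auto simp: less_imp_le)
qed

text \<open>The derivative of \<phi> is an explicit smooth function for s > 0.\<close>

lemma smooth_phi: "smooth1 {0<..<s1} \<phi>"
proof (rule smooth1I)
  have "smooth1 {0<..<s1} (\<lambda>s. - Wf s / s\<^sup>2)"
    by (intro smooth1_divide smooth1_minus smooth1_power smooth1_id smooth1_subset[OF smooth_Wf_S]) (auto simp: S)
  then have "diff_upto (Suc k) {0<..<s1} \<phi>" for k
    using phi_deriv smooth1D unfolding diff_upto.simps by (intro exI[of _ "\<lambda>s. - Wf s / s\<^sup>2"]) auto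
  then show "diff_upto k {0<..<s1} \<phi>" for k by (rule diff_upto_Suc_imp)
qed

definition phL :: "real \<Rightarrow> real" where "phL u = \<phi> (sL u)"

lemma phL_smooth: "smooth1 {..<0} phL"
  unfolding phL_def[abs_def] by (rule smooth1_compose[OF smooth_phi sL_smooth]) (use sL_range s1 in force)

lemma phL_DERIV: "u < 0 \<Longrightarrow> (phL has_real_derivative - th (sL u)) (at u)"
proof -
  assume u: "u < 0"
  have s: "0 < sL u" "sL u < s1" using sL_range[OF u] by auto
  show ?thesis unfolding phL_def[abs_def]
    by (rule DERIV_cong[OF DERIV_chain2[OF phi_deriv[OF s] sL_DERIV[OF u]]]) (use s in \<open>simp add: th_def\<close>)
qed

lemma trig_smooth: "smooth1 {..<0} (\<lambda>u. cos (phL u))" "smooth1 {..<0} (\<lambda>u. sin (phL u))"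
  by (rule smooth1_compose[OF smooth1_cos phL_smooth] smooth1_compose[OF smooth1_sin phL_smooth]; simp)+

lemma trig_DERIV:
  assumes "u < 0"
  shows "((\<lambda>u. cos (phL u)) has_real_derivative th (sL u) * sin (phL u)) (at u)"
    "((\<lambda>u. sin (phL u)) has_real_derivative - th (sL u) * cos (phL u)) (at u)"
  by (rule DERIV_cong[OF DERIV_chain2[OF DERIV_cos phL_DERIV[OF assms]]] DERIV_cong[OF DERIV_chain2[OF DERIV_sin phL_DERIV[OF assms]]]; simp)+

definition hU :: "real \<Rightarrow> real" where "hU u = rho (sL u)"
definition ZU :: "nat \<Rightarrow> real \<Rightarrow> real" where
  "ZU j = (if j = 0 then (\<lambda>u. cos (phL u)) else if j = 1 then (\<lambda>u. sin (phL u)) else sL)"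
definition dZU :: "nat \<Rightarrow> real \<Rightarrow> real" where
  "dZU j u = (if j = 0 then th (sL u) * sin (phL u) else if j = 1 then - th (sL u) * cos (phL u) else - sg (sL u))"

lemma ZU_smooth: "smooth1 {..<0} (ZU j)"
  using trig_smooth sL_smooth by (simp add: ZU_def)

lemma ZU_deriv: "u < 0 \<Longrightarrow> deriv (ZU j) u = dZU j u"
  using trig_DERIV[of u] sL_DERIV[of u] by (auto simp: ZU_def dZU_def sg_def intro!: DERIV_imp_deriv)

lemma hU_smooth: "smooth1 {..<0} hU"
  unfolding hU_def[abs_def] by (rule comp_sL(1)[OF smooth_S(3)])

lemma hU_deriv: "u < 0 \<Longrightarrow> deriv hU u = - Dt rho (sL u)"
  unfolding hU_def[abs_def] by (rule comp_sL(3)[OF smooth_S(3)])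

lemma abs_mult_trig: "\<bar>a * sin t\<bar> \<le> \<bar>a\<bar>" "\<bar>a * cos t\<bar> \<le> \<bar>a\<bar>" for a t :: real
  by (auto simp: abs_mult intro: mult_left_le)

lemma ex_Bd: "\<exists>C. Bd 1 C hU \<and> (\<forall>j. Bd 1 C (ZU j)) \<and> C \<ge> 1"
proof -
  obtain C1 C2 C3 where C: "\<forall>u<0. \<bar>Dt rho (sL u)\<bar> \<le> C1" "\<forall>u<0. \<bar>th (sL u)\<bar> \<le> C2" "\<forall>u<0. \<bar>sg (sL u)\<bar> \<le> C3"
    using comp_sL(4)[OF smooth_Dt[OF smooth_S(3) S(1)]] comp_sL(4)[OF smooth_S(1)] comp_sL(4)[OF smooth_S(2)] by blast
  define K where "K = \<bar>C1\<bar> + \<bar>C2\<bar> + \<bar>C3\<bar> + 2"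
  have K: "C1 \<le> K" "C2 \<le> K" "C3 \<le> K" "2 \<le> K" "1 \<le> K" by (auto simp: K_def)
  have "Bd 1 K hU"
    unfolding Bd_def
  proof (intro conjI allI impI)
    fix u :: real assume "u < ln 1"
    then have u: "u < 0" by simp
    show "\<bar>hU u\<bar> \<le> K" using rho_bounds[of "sL u"] sL_S[OF u] K by (auto simp: hU_def S)
    show "\<bar>deriv hU u\<bar> \<le> K" unfolding hU_deriv[OF u] using C u K by (auto intro: order_trans)
  qed (simp add: hU_smooth)
  moreover have "Bd 1 K (ZU j)" for j
    unfolding Bd_def
  proof (intro conjI allI impI)
    fix u :: real assume "u < ln 1"
    then have u: "u < 0" by simp
    show "\<bar>ZU j u\<bar> \<le> K" using sL_range[OF u] s1 K by (auto simp: ZU_def intro: order_trans[OF abs_cos_le_one] order_trans[OF abs_sin_le_one])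
    have "\<bar>dZU j u\<bar> \<le> max \<bar>th (sL u)\<bar> \<bar>sg (sL u)\<bar>"
      using abs_mult_trig[of "th (sL u)" "phL u"] by (auto simp: dZU_def le_max_iff_disj)
    then show "\<bar>deriv (ZU j) u\<bar> \<le> K" unfolding ZU_deriv[OF u] using C u K by (fastforce simp: le_max_iff_disj)
  qed (simp add: ZU_smooth)
  ultimately show ?thesis using K by blast
qed

definition U :: "(nat \<Rightarrow> real) \<Rightarrow> nat \<Rightarrow> real" where "U = mk m hU ZU"

definition CU :: real where "CU = (SOME C. Bd 1 C hU \<and> (\<forall>j. Bd 1 C (ZU j)) \<and> C \<ge> 1)"

lemma CU: "Bd 1 CU hU" "Bd 1 CU (ZU j)" "CU \<ge> 1"
  using someI_ex[OF ex_Bd] unfolding CU_def by auto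

lemmas U_Ck = mk_Ck[where Z = ZU, OF CU(1) CU(2) m2, folded U_def]
lemmas U_W1p = mk_W1p[where Z = ZU, OF CU(1) CU(2) m2 p1 pm, folded U_def]
lemmas U_wpd = mk_wpd[where Z = ZU, OF CU(1) CU(2) m2, folded U_def]
lemmas U_pd = mk_pd[where Z = ZU, OF CU(1) CU(2) m2, folded U_def]

abbreviation sx :: "(nat \<Rightarrow> real) \<Rightarrow> real" where "sx x \<equiv> sL (ln (vnorm m x))"

lemma punct1: "x \<in> punct m 1 \<Longrightarrow> ln (vnorm m x) < 0 \<and> sx x \<in> S \<and> 0 < sx x"
  using punct_D[of x m 1] sL_S sL_range by auto

text \<open>The phase enters only through its speed, so the oscillation disappears from
  |DU|.\<close>

lemma U_grad:
  assumes x: "x \<in> punct m 1"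
  shows "(\<Sum>a<2 * m + 3. \<Sum>i<m. (pd i (\<lambda>x. U x a) x)\<^sup>2) = Qf (sx x) / (vnorm m x)\<^sup>2"
proof -
  have u: "ln (vnorm m x) < 0" using punct1[OF x] by simp
  have "(\<Sum>j<3. (deriv (ZU j) (ln (vnorm m x)))\<^sup>2) = (th (sx x))\<^sup>2 * ((sin (phL (ln (vnorm m x))))\<^sup>2 + (cos (phL (ln (vnorm m x))))\<^sup>2) + (sg (sx x))\<^sup>2"
    by (simp add: numeral_3_eq_3 lessThan_Suc ZU_deriv[OF u] dZU_def power_mult_distrib distrib_left[symmetric])
  moreover have "2 * (mu * (rho (sx x))\<^sup>2 + (Dt rho (sx x))\<^sup>2) + ((th (sx x))\<^sup>2 + (sg (sx x))\<^sup>2) = Qf (sx x)"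
    using Qf_eq[of "sx x"] punct1[OF x] by (simp add: algebra_simps)
  ultimately show ?thesis
    unfolding U_def mk_grad[OF CU(1) CU(2) m2 x] hU_deriv[OF u]
    by (simp add: hU_def mu_def[symmetric])
qed

section \<open>The target manifold\<close>

abbreviation ll :: nat where "ll \<equiv> 2 * m + 3"

text \<open>The target is the graph \<open>w = y (2 - |y|\<^sup>2 J z)\<close> over \<open>(y, z)\<close>. Along the curve \<open>|y|\<^sup>2 J z = 1\<close>, so that
  \<open>w = y\<close>, the radial derivative of the graph is \<open>-1\<close>, and its \<open>z\<close>-derivative is proportional to that of
  \<open>J\<close>, which is what the choice of \<open>J\<close> controls.\<close>

definition Fgr :: "nat \<Rightarrow> (nat \<Rightarrow> real) \<Rightarrow> real" where
  "Fgr a v = v (a - (m + 3)) * (2 - (\<Sum>j<m. v j * v j) * J (v m) (v (m + 1)) (v (m + 2)))"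

text \<open>The bounds leave room around the curve, where |y| \<le> 2 and (z1, z2) is on the unit
  circle; \<open>s1\<close> limits the domain of the coefficients. Boundedness of this set makes all
  competitors bounded.\<close>

definition Wn :: "(nat \<Rightarrow> real) set" where
  "Wn = {v \<in> Rn ll. (\<Sum>j<m. v j * v j) < 9 \<and> \<bar>v m\<bar> < 2 \<and> \<bar>v (m + 1)\<bar> < 2 \<and> \<bar>v (m + 2)\<bar> < s1}"

definition N :: "(nat \<Rightarrow> real) set" where
  "N = {v \<in> Wn. \<forall>a\<in>{m+3..<ll}. v a = Fgr a v}"

lemma Wn_open: "openin (top_of_set (Rn ll)) Wn"
proof -
  have c: "continuous_on UNIV (\<lambda>v :: nat \<Rightarrow> real. v j)" for j by (rule continuous_on_product_coordinates)
  have "open ({v. (\<Sum>j<m. v j * v j) < 9} \<inter> ({v. \<bar>v m\<bar> < 2} \<inter> ({v. \<bar>v (m + 1)\<bar> < 2} \<inter> {v :: nat \<Rightarrow> real. \<bar>v (m + 2)\<bar> < s1})))"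
    by (intro open_Int open_Collect_less continuous_intros c)
  moreover have "Wn = Rn ll \<inter> ({v. (\<Sum>j<m. v j * v j) < 9} \<inter> ({v. \<bar>v m\<bar> < 2} \<inter> ({v. \<bar>v (m + 1)\<bar> < 2} \<inter> {v. \<bar>v (m + 2)\<bar> < s1})))"
    by (auto simp: Wn_def)
  ultimately show ?thesis unfolding openin_open by blast
qed

lemma N_submanifold: "smooth_submanifold ll (m + 3) N"
proof -
  \<comment> \<open>\<open>Fgr a\<close> reads the coordinate a - (m + 3), which is among the first
    m coordinates only for a < ll. Larger indices get the value 0, so that the dependence hypothesis
    holds for every index.\<close>
  let ?F = "\<lambda>a v. if a < ll then Fgr a v else 0"
  have "smooth_submanifold ll (m + 3) {v \<in> Wn. \<forall>a\<in>{m+3..<ll}. v a = ?F a v}"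
  proof (rule graph_submanifold[OF _ Wn_open])
    show "v' \<in> Wn" if "v \<in> Wn" "v' \<in> Rn ll" "\<And>a. a < m + 3 \<Longrightarrow> v' a = v a" for v v'
      using that by (simp add: Wn_def)
    show "?F a v' = ?F a v" if "\<And>a. a < m + 3 \<Longrightarrow> v' a = v a" for a v v'
      using that by (auto simp: Fgr_def)
    show "Ck k ll Wn (?F a)" if "m + 3 \<le> a" "a < ll" for a k
    proof -
      have sm: "Ck k ll Wn (\<lambda>v. f (v (m + 2)))" if "smooth1 S f" for f
        by (rule Ck_compose_smooth1[OF Wn_open that Ck_coord[OF Wn_open]]) (auto simp: Wn_def S)
      have "Ck k ll Wn (Fgr a)"
        unfolding Fgr_def[abs_def] J_def
        by (intro Ck_mult[OF Wn_open] Ck_coord[OF Wn_open] Ck_diff[OF Wn_open] Ck_const[OF Wn_open] Ck_sum[OF Wn_open]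
          Ck_add[OF Wn_open] sm smooth_B_S)
      then show ?thesis using that by simp
    qed
  qed simp
  moreover have "{v \<in> Wn. \<forall>a\<in>{m+3..<ll}. v a = ?F a v} = N" by (auto simp: N_def)
  ultimately show ?thesis by simp
qed

lemma N_Rn: "N \<subseteq> Rn ll" by (auto simp: N_def Wn_def)

text \<open>Stated for general profiles because it serves both U and its tangent maps. With |y| = h0
  the factor 2 - h0^2 J is 1, so w = y.\<close>

lemma mk_in_N:
  assumes h: "0 < h0" "h0 \<le> 2" and z: "\<bar>z0\<bar> \<le> 1" "\<bar>z1\<bar> \<le> 1" "\<bar>z2\<bar> < s1" and J: "J z0 z1 z2 = 1 / h0\<^sup>2"
    and x: "x \<in> punct m R" and hz: "h (ln (vnorm m x)) = h0" "Z 0 (ln (vnorm m x)) = z0" "Z 1 (ln (vnorm m x)) = z1" "Z 2 (ln (vnorm m x)) = z2"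
  shows "mk m h Z x \<in> N"
proof -
  let ?v = "mk m h Z x" and ?r = "vnorm m x"
  have x0: "x \<noteq> origin m" using x by simp
  have y: "?v j = x j / ?r * h0" if "j < m" for j using that x0 by (simp add: mk_def hz)
  have w: "?v (m + 3 + b) = x b / ?r * h0" if "b < m" for b using that x0 by (simp add: mk_def hz)
  have zz: "?v m = z0" "?v (m + 1) = z1" "?v (m + 2) = z2" using x0 by (simp_all add: mk_def hz[symmetric])
  have "(\<Sum>j<m. ?v j * ?v j) = (\<Sum>j<m. (x j / ?r)\<^sup>2 * h0\<^sup>2)"
    by (intro sum.cong refl) (simp add: y power2_eq_square)
  also have "\<dots> = h0\<^sup>2" unfolding sum_distrib_right[symmetric] unit_direction[OF x] by simp
  finally have yy: "(\<Sum>j<m. ?v j * ?v j) = h0\<^sup>2" .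
  have "h0\<^sup>2 \<le> 2\<^sup>2" using h by (intro power_mono) auto
  then have "?v \<in> Wn" using z mk_Rn[of m h Z x] unfolding Wn_def by (simp only: mem_Collect_eq yy zz) auto
  moreover have "?v a = Fgr a ?v" if a: "a \<in> {m+3..<ll}" for a
  proof -
    obtain b where b: "a = m + 3 + b" "b < m" using a by (metis add.commute add_less_cancel_left atLeastLessThan_iff le_Suc_ex mult_2 group_cancel.add1)
    have "Fgr a ?v = ?v b * (2 - h0\<^sup>2 * (1 / h0\<^sup>2))" unfolding Fgr_def yy zz J using b by simp
    then show ?thesis using b h y[of b] w[of b] by simp
  qed
  ultimately show ?thesis by (simp add: N_def)
qed

text \<open>The default value at the origin has to be in the target, since membership in
  \<open>N\<close> is asserted at every point.\<close>

lemma zero_in_N: "mk m h Z (origin m) \<in> N"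
proof -
  have z: "mk m h Z (origin m) a = 0" if "a < ll" for a using that by (simp add: mk_def)
  have "mk m h Z (origin m) \<in> Wn" using mk_Rn[of m h Z "origin m"] s1 by (simp add: Wn_def z)
  then show ?thesis by (auto simp: N_def Fgr_def z)
qed

lemma U_in_N: "x \<in> oball m 1 \<Longrightarrow> U x \<in> N"
proof (cases "x = origin m")
  case False
  assume "x \<in> oball m 1"
  with False have x: "x \<in> punct m 1" by simp
  have s: "sx x \<in> S" "0 < sx x" using punct1[OF x] by auto
  show ?thesis unfolding U_def
  proof (rule mk_in_N[OF _ _ _ _ _ _ x refl refl refl refl])
    show "0 < hU (ln (vnorm m x))" "hU (ln (vnorm m x)) \<le> 2" using rho_pos rho_bounds[of "sx x"] s by (auto simp: hU_def S)
    show "\<bar>ZU 2 (ln (vnorm m x))\<bar> < s1" using s by (simp add: ZU_def S)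
    show "J (ZU 0 (ln (vnorm m x))) (ZU 1 (ln (vnorm m x))) (ZU 2 (ln (vnorm m x))) = 1 / (hU (ln (vnorm m x)))\<^sup>2"
      using J_curve[OF s(2)] by (simp add: ZU_def hU_def phL_def)
  qed (auto simp: ZU_def)
qed (simp add: U_def zero_in_N)

text \<open>\<open>|x|\<^bsup>p\<^esup>\<close> times \<open>- div (|DU|\<^bsup>p-2\<^esup> DU)\<close>.\<close>

definition Av :: "nat \<Rightarrow> (nat \<Rightarrow> real) \<Rightarrow> real" where
  "Av a x = (if a < m then al (sx x) * (x a / vnorm m x)
     else if a = m then al (sx x) * rho (sx x) ^ 3 * B1 \<phi> (sx x)
     else if a = m + 1 then al (sx x) * rho (sx x) ^ 3 * B2 \<phi> (sx x)
     else if a = m + 2 then al (sx x) * rho (sx x) ^ 3 * dJ (sx x)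
     else al (sx x) * (x (a - (m + 3)) / vnorm m x))"

text \<open>200 is the constant of \<open>normal_deviation\<close>, and the power of 2 mu bounds
  \<open>al\<close>.\<close>

definition KU :: real where "KU = 200 * (2 * mu) powr (p / 2)"

text \<open>In y and w the vector A points along \<omega>, and on the graph w is a multiple of y.
  Hence V - U enters only through its radial and full displacement in y and its displacement in z,
  and \<open>normal_deviation\<close> applies. The bound has both signs, which gives tangency as
  well as minimality.\<close>

lemma normal_inequality:
  assumes x: "x \<in> punct m 1" and V: "V \<in> N"
  shows "\<bar>\<Sum>a<ll. Av a x * (V a - U x a)\<bar> \<le> KU * (\<Sum>a<ll. (V a - U x a)\<^sup>2)"
proof -
  let ?r = "vnorm m x" and ?s = "sx x"
  let ?w = "\<lambda>j. x j / ?r"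
  have s: "?s \<in> S" "0 < ?s" using punct1[OF x] by auto
  have x0: "x \<noteq> origin m" using x by simp
  define R0 where "R0 = rho ?s"
  have R0: "1/2 \<le> R0" "R0 \<le> 2" using rho_bounds[of ?s] s by (auto simp: R0_def S)
  have Uy: "U x j = ?w j * R0" if "j < m" for j using that x0 by (simp add: U_def mk_def hU_def R0_def)
  have Uw: "U x (m + 3 + b) = ?w b * R0" if "b < m" for b using that x0 by (simp add: U_def mk_def hU_def R0_def)
  have Uz: "U x (m + 0) = cos (\<phi> ?s)" "U x (m + 1) = sin (\<phi> ?s)" "U x (m + 2) = ?s"
    using x0 by (simp_all add: U_def mk_def ZU_def phL_def)
  have w1: "(\<Sum>j<m. (?w j)\<^sup>2) = 1" by (rule unit_direction[OF x])
  define e where "e = (\<Sum>j<m. ?w j * V j) - R0"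
  define n where "n = sqrt (\<Sum>j<m. (V j - U x j)\<^sup>2)"
  have n2: "n\<^sup>2 = (\<Sum>j<m. (V j - U x j)\<^sup>2)" "0 \<le> n" by (auto simp: n_def sum_nonneg)
  have VW: "V \<in> Wn" using V by (simp add: N_def)
  define Y where "Y = (\<Sum>j<m. V j * V j)"
  have Y: "Y < 9" "0 \<le> Y" using VW by (auto simp: Wn_def Y_def sum_nonneg)
  have "n\<^sup>2 = (\<Sum>j<m. V j * V j - 2 * R0 * (?w j * V j) + R0\<^sup>2 * (?w j)\<^sup>2)"
    unfolding n2 by (intro sum.cong refl) (simp add: Uy power2_eq_square algebra_simps)
  also have "\<dots> = Y - 2 * R0 * (e + R0) + R0\<^sup>2"
    by (simp only: sum.distrib sum_subtractf sum_distrib_left[symmetric] w1) (simp add: Y_def e_def)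
  finally have nY: "n\<^sup>2 = Y - 2 * R0 * (e + R0) + R0\<^sup>2" .
  then have YY: "R0\<^sup>2 + 2 * R0 * e + n\<^sup>2 = Y" by (simp add: algebra_simps power2_eq_square)
  have "e = (\<Sum>j<m. ?w j * (V j - U x j))"
  proof -
    have "(\<Sum>j<m. ?w j * (V j - U x j)) = (\<Sum>j<m. ?w j * V j - R0 * (?w j)\<^sup>2)"
      by (intro sum.cong refl) (simp add: Uy power2_eq_square algebra_simps)
    also have "\<dots> = e" by (simp only: sum_subtractf sum_distrib_left[symmetric] w1) (simp add: e_def)
    finally show ?thesis by simp
  qed
  then have "e\<^sup>2 \<le> (\<Sum>j<m. (?w j)\<^sup>2) * (\<Sum>j<m. (V j - U x j)\<^sup>2)"
    using Cauchy_Schwarz_ineq_sum[of ?w "\<lambda>j. V j - U x j" "{..<m}"] by simp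
  then have "e\<^sup>2 \<le> n\<^sup>2" unfolding w1 n2 by simp
  then have en: "\<bar>e\<bar> \<le> n" using n2(2) by (simp add: abs_le_square_iff[symmetric])
  \<comment> \<open>5 = 3 + 2: in the target |y| < 3, and on the curve rho \<le> 2.\<close>
  have n5: "n \<le> 5"
  proof -
    have "(\<Sum>j<m. ?w j * V j)\<^sup>2 \<le> (\<Sum>j<m. (?w j)\<^sup>2) * (\<Sum>j<m. (V j)\<^sup>2)" by (rule Cauchy_Schwarz_ineq_sum)
    then have "(e + R0)\<^sup>2 \<le> 3\<^sup>2" using Y(1) unfolding w1 by (simp add: e_def Y_def power2_eq_square)
    then have "\<bar>e + R0\<bar> \<le> 3" using abs_le_square_iff[of "e + R0" 3] by simp
    then have "\<bar>R0 * (e + R0)\<bar> \<le> 2 * 3" unfolding abs_mult using R0 by (intro mult_mono) auto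
    moreover have "R0\<^sup>2 \<le> 2\<^sup>2" using R0 by (intro power_mono) auto
    ultimately have "n\<^sup>2 \<le> 5\<^sup>2" unfolding nY using Y(1) by (simp add: abs_le_iff)
    then show ?thesis by (rule power2_le_imp_le) simp
  qed
  define d where "d = sqrt ((V m - cos (\<phi> ?s))\<^sup>2 + (V (m + 1) - sin (\<phi> ?s))\<^sup>2 + (V (m + 2) - ?s)\<^sup>2)"
  have d2: "d\<^sup>2 = (\<Sum>j<3. (V (m + j) - U x (m + j))\<^sup>2)"
  proof -
    have "d\<^sup>2 = (V m - cos (\<phi> ?s))\<^sup>2 + (V (m + 1) - sin (\<phi> ?s))\<^sup>2 + (V (m + 2) - ?s)\<^sup>2"
      unfolding d_def by (intro real_sqrt_pow2) simp
    then show ?thesis using Uz by (simp add: eval_nat_numeral)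
  qed
  define JV where "JV = J (V m) (V (m + 1)) (V (m + 2))"
  have dev: "\<bar>al ?s * (e + ((R0 + e) * (2 - Y * JV) - R0))
     + (al ?s * R0 ^ 3 * B1 \<phi> ?s * (V m - cos (\<phi> ?s)) + al ?s * R0 ^ 3 * B2 \<phi> ?s * (V (m + 1) - sin (\<phi> ?s))
     + al ?s * R0 ^ 3 * dJ ?s * (V (m + 2) - ?s))\<bar> \<le> 200 * al ?s * (n\<^sup>2 + d\<^sup>2)"
    unfolding JV_def YY[symmetric] unfolding R0_def
  proof (rule normal_deviation[OF s _ _ _ en n5 _ _ d_def])
    show "\<bar>V m\<bar> \<le> 2" "\<bar>V (m + 1)\<bar> \<le> 2" "V (m + 2) \<in> S" using VW by (auto simp: Wn_def S)
  qed (use YY Y in \<open>simp_all add: R0_def[symmetric]\<close>)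
  have ring: "a * w * (v - w * r) = a * (w * v) - a * r * w\<^sup>2" for a w v r :: real
    by (simp add: power2_eq_square algebra_simps)
  have ring': "a * w * (v * q - w * r) = a * q * (w * v) - a * r * w\<^sup>2" for a q w v r :: real
    by (simp add: power2_eq_square algebra_simps)
  have S1: "(\<Sum>a<m. Av a x * (V a - U x a)) = al ?s * e"
  proof -
    have "(\<Sum>a<m. Av a x * (V a - U x a)) = (\<Sum>j<m. al ?s * (?w j * V j) - al ?s * R0 * (?w j)\<^sup>2)"
      by (intro sum.cong refl) (simp only: lessThan_iff Av_def if_True Uy ring)
    also have "\<dots> = al ?s * e"
      by (simp only: sum_subtractf sum_distrib_left[symmetric] w1) (simp add: e_def right_diff_distrib)
    finally show ?thesis .
  qed
  have S2: "(\<Sum>j<3. Av (m + j) x * (V (m + j) - U x (m + j))) =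
      al ?s * R0 ^ 3 * B1 \<phi> ?s * (V m - cos (\<phi> ?s)) + al ?s * R0 ^ 3 * B2 \<phi> ?s * (V (m + 1) - sin (\<phi> ?s))
     + al ?s * R0 ^ 3 * dJ ?s * (V (m + 2) - ?s)"
    using Uz by (simp add: eval_nat_numeral Av_def R0_def)
  have S3: "(\<Sum>b<m. Av (m + 3 + b) x * (V (m + 3 + b) - U x (m + 3 + b))) = al ?s * ((R0 + e) * (2 - Y * JV) - R0)"
  proof -
    have "(\<Sum>b<m. Av (m + 3 + b) x * (V (m + 3 + b) - U x (m + 3 + b))) =
      (\<Sum>b<m. al ?s * (2 - Y * JV) * (?w b * V b) - al ?s * R0 * (?w b)\<^sup>2)"
    proof (intro sum.cong refl)
      fix b assume "b \<in> {..<m}"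
      then have b: "b < m" by simp
      have "V (m + 3 + b) = Fgr (m + 3 + b) V" using V b by (simp add: N_def)
      then have Vw: "V (m + 3 + b) = V b * (2 - Y * JV)" by (simp add: Fgr_def Y_def JV_def)
      have "Av (m + 3 + b) x = al ?s * ?w b" by (simp add: Av_def)
      then show "Av (m + 3 + b) x * (V (m + 3 + b) - U x (m + 3 + b)) =
        al ?s * (2 - Y * JV) * (?w b * V b) - al ?s * R0 * (?w b)\<^sup>2"
        unfolding Vw Uw[OF b] by (simp only: ring')
    qed
    also have "\<dots> = al ?s * (2 - Y * JV) * (R0 + e) - al ?s * R0"
      by (simp only: sum_subtractf sum_distrib_left[symmetric] w1) (simp add: e_def)
    finally show ?thesis by (simp add: algebra_simps)
  qed
  have al: "0 < al ?s" "al ?s \<le> (2 * mu) powr (p / 2)" using al_bounds[of ?s] s by (auto simp: S)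
  have "(\<Sum>a<ll. Av a x * (V a - U x a)) = al ?s * (e + ((R0 + e) * (2 - Y * JV) - R0))
     + (al ?s * R0 ^ 3 * B1 \<phi> ?s * (V m - cos (\<phi> ?s)) + al ?s * R0 ^ 3 * B2 \<phi> ?s * (V (m + 1) - sin (\<phi> ?s))
     + al ?s * R0 ^ 3 * dJ ?s * (V (m + 2) - ?s))"
    unfolding sum_index_split S1 S2 S3 by (simp add: distrib_left)
  then have "\<bar>\<Sum>a<ll. Av a x * (V a - U x a)\<bar> \<le> 200 * al ?s * (n\<^sup>2 + d\<^sup>2)" using dev by simp
  also have "\<dots> \<le> KU * (n\<^sup>2 + d\<^sup>2)" unfolding KU_def using al by (intro mult_right_mono) auto
  also have "\<dots> \<le> KU * (\<Sum>a<ll. (V a - U x a)\<^sup>2)"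
  proof (rule mult_left_mono)
    show "n\<^sup>2 + d\<^sup>2 \<le> (\<Sum>a<ll. (V a - U x a)\<^sup>2)"
      unfolding sum_index_split n2 d2 by (simp add: sum_nonneg)
  qed (simp add: KU_def)
  finally show ?thesis .
qed

text \<open>On the target |J| \<le> 2 + 4 + 4 and |y|^2 < 9, so |w| is at most 3 times 92; the other
  coordinates are small, and the sum of squares stays below 300^2.\<close>

lemma N_bounded: "V \<in> N \<Longrightarrow> vnorm ll V \<le> 300"
proof -
  assume V: "V \<in> N"
  then have VW: "V \<in> Wn" by (simp add: N_def)
  define Y where "Y = (\<Sum>j<m. V j * V j)"
  define JV where "JV = J (V m) (V (m + 1)) (V (m + 2))"
  have Y: "Y < 9" "0 \<le> Y" using VW by (auto simp: Wn_def Y_def sum_nonneg)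
  have z: "\<bar>V m\<bar> \<le> 2" "\<bar>V (m + 1)\<bar> \<le> 2" "\<bar>V (m + 2)\<bar> < s1" using VW by (auto simp: Wn_def)
  have ctl: "\<bar>Gam (V (m + 2))\<bar> \<le> 2" "\<bar>B1 \<phi> (V (m + 2))\<bar> \<le> 2" "\<bar>B2 \<phi> (V (m + 2))\<bar> \<le> 2"
    using controlled[OF z(3)] by (auto simp: controlled_def)
  have "\<bar>B1 \<phi> (V (m + 2)) * V m\<bar> \<le> 2 * 2" "\<bar>B2 \<phi> (V (m + 2)) * V (m + 1)\<bar> \<le> 2 * 2"
    using mult_mono[OF ctl(2) z(1)] mult_mono[OF ctl(3) z(2)] by (simp_all add: abs_mult)
  then have JV: "\<bar>JV\<bar> \<le> 10" unfolding JV_def J_def using ctl(1) by linarith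
  have "\<bar>Y * JV\<bar> \<le> 9 * 10" unfolding abs_mult using Y JV by (intro mult_mono) auto
  then have "\<bar>2 - Y * JV\<bar> \<le> \<bar>92\<bar>" by linarith
  then have q: "(2 - Y * JV)\<^sup>2 \<le> 92\<^sup>2" by (rule iffD1[OF abs_le_square_iff])
  have "(\<Sum>b<m. (V (m + 3 + b))\<^sup>2) = (\<Sum>b<m. (V b * V b) * (2 - Y * JV)\<^sup>2)"
  proof (intro sum.cong refl)
    fix b assume "b \<in> {..<m}"
    then have "V (m + 3 + b) = Fgr (m + 3 + b) V" using V by (simp add: N_def)
    then show "(V (m + 3 + b))\<^sup>2 = (V b * V b) * (2 - Y * JV)\<^sup>2"
      by (simp add: Fgr_def Y_def JV_def power_mult_distrib power2_eq_square)
  qed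
  also have "\<dots> = Y * (2 - Y * JV)\<^sup>2" by (simp add: Y_def sum_distrib_right)
  also have "\<dots> \<le> 9 * 92\<^sup>2" using Y q by (intro mult_mono) auto
  finally have w: "(\<Sum>b<m. (V (m + 3 + b))\<^sup>2) \<le> 9 * 92\<^sup>2" .
  have "(V m)\<^sup>2 \<le> 2\<^sup>2" "(V (m + 1))\<^sup>2 \<le> 2\<^sup>2" "(V (m + 2))\<^sup>2 \<le> 2\<^sup>2"
    using z s1 by (intro iffD1[OF abs_le_square_iff]; simp)+
  then have "(vnorm ll V)\<^sup>2 \<le> 300\<^sup>2"
    unfolding vnorm_sq sum_index_split using w Y by (simp add: eval_nat_numeral Y_def power2_eq_square)
  then show ?thesis by (rule power2_le_imp_le) simp
qed

end

section \<open>The Euler--Lagrange equation\<close>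

text \<open>Here exp (c u) stands for |x|^c: bounds for a profile become bounds for its product with
  a power of |x|.\<close>

lemma exp_mult_smooth:
  fixes c A :: real and f :: "real \<Rightarrow> real"
  assumes f: "smooth1 {..<0} f" and A: "\<forall>u<0. \<bar>f u\<bar> \<le> A \<and> \<bar>deriv f u\<bar> \<le> A"
  shows "smooth1 {..<0} (\<lambda>u. exp (c * u) * f u)" (is ?PA)
    "u < 0 \<Longrightarrow> deriv (\<lambda>u. exp (c * u) * f u) u = exp (c * u) * (c * f u + deriv f u)"
    "u < 0 \<Longrightarrow> \<bar>exp (c * u) * f u\<bar> \<le> (\<bar>c\<bar> + 1) * A * exp (c * u) \<and> \<bar>deriv (\<lambda>u. exp (c * u) * f u) u\<bar> \<le> (\<bar>c\<bar> + 1) * A * exp (c * u)"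
proof -
  show ?PA by (intro smooth1_mult smooth1_exp_lin f)
  assume u: "u < 0"
  have "((\<lambda>u. exp (c * u) * f u) has_real_derivative exp (c * u) * (c * f u + deriv f u)) (at u)"
  proof (rule DERIV_cong[OF DERIV_mult[OF _ smooth1_DERIV[OF f]]])
    show "((\<lambda>u. exp (c * u)) has_real_derivative c * exp (c * u)) (at u)"
      by (auto intro!: derivative_eq_intros)
  qed (use u in \<open>simp_all add: algebra_simps\<close>)
  then show d: "deriv (\<lambda>u. exp (c * u) * f u) u = exp (c * u) * (c * f u + deriv f u)" by (rule DERIV_imp_deriv)
  have A0: "0 \<le> A" using A[rule_format, OF u] by linarith
  have "\<bar>c * f u\<bar> \<le> \<bar>c\<bar> * A" unfolding abs_mult using A[rule_format, OF u] by (intro mult_left_mono) auto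
  then have "\<bar>c * f u + deriv f u\<bar> \<le> (\<bar>c\<bar> + 1) * A" using A[rule_format, OF u] by (simp add: distrib_right abs_le_iff)
  moreover have "\<bar>f u\<bar> \<le> (\<bar>c\<bar> + 1) * A"
  proof -
    have "0 \<le> \<bar>c\<bar> * A" using A0 by simp
    with A[rule_format, OF u] show ?thesis unfolding distrib_right by linarith
  qed
  ultimately show "\<bar>exp (c * u) * f u\<bar> \<le> (\<bar>c\<bar> + 1) * A * exp (c * u) \<and> \<bar>deriv (\<lambda>u. exp (c * u) * f u) u\<bar> \<le> (\<bar>c\<bar> + 1) * A * exp (c * u)"
    unfolding d by (simp add: abs_mult mult.commute)
qed

lemma integral_double_sum:
  fixes f :: "'i \<Rightarrow> 'j \<Rightarrow> 'a \<Rightarrow> real"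
  assumes "\<And>a i. a \<in> A \<Longrightarrow> i \<in> B \<Longrightarrow> integrable M (f a i)"
  shows "integrable M (\<lambda>x. \<Sum>a\<in>A. \<Sum>i\<in>B. f a i x)" (is ?PA)
    "integral\<^sup>L M (\<lambda>x. \<Sum>a\<in>A. \<Sum>i\<in>B. f a i x) = (\<Sum>a\<in>A. \<Sum>i\<in>B. integral\<^sup>L M (f a i))" (is ?PB)
proof -
  have 1: "integrable M (\<lambda>x. \<Sum>i\<in>B. f a i x)" if "a \<in> A" for a
    by (rule Bochner_Integration.integrable_sum) (rule assms[OF that])
  show ?PA by (rule Bochner_Integration.integrable_sum) (rule 1)
  have "integral\<^sup>L M (\<lambda>x. \<Sum>a\<in>A. \<Sum>i\<in>B. f a i x) = (\<Sum>a\<in>A. integral\<^sup>L M (\<lambda>x. \<Sum>i\<in>B. f a i x))"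
    by (rule Bochner_Integration.integral_sum) (rule 1)
  also have "\<dots> = (\<Sum>a\<in>A. \<Sum>i\<in>B. integral\<^sup>L M (f a i))"
    by (intro sum.cong refl Bochner_Integration.integral_sum assms)
  finally show ?PB .
qed

context spiral
begin

lemma Dt_add: "smooth1 S f \<Longrightarrow> smooth1 S g \<Longrightarrow> s \<in> S \<Longrightarrow> Dt (\<lambda>s. f s + g s) s = Dt f s + Dt g s"
  using DERIV_imp_deriv[OF DERIV_add[OF smooth1_DERIV smooth1_DERIV]] by (simp add: Dt_def algebra_simps)

text \<open>Coefficients of the flux of rho \<omega> before the powers of |x| are restored:
  \<open>G1\<close> multiplies the identity and \<open>G2\<close>, which is Lam (h - h') with h' = -
  \<open>Dt rho\<close>, multiplies \<omega> \<otimes> \<omega>.\<close>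

definition G1 :: "real \<Rightarrow> real" where "G1 s = Lam s * rho s"
definition G2 :: "real \<Rightarrow> real" where "G2 s = Lam s * rho s + Lam s * Dt rho s"

lemma G_smooth: "smooth1 S G1" "smooth1 S G2" "smooth1 S (\<lambda>s. Lam s * Dt rho s)"
  unfolding G1_def[abs_def] G2_def[abs_def]
  by (intro smooth1_add smooth1_mult smooth_S smooth_Dt[OF _ S(1)])+

lemma G2_Dt: "s \<in> S \<Longrightarrow> Dt G2 s = Dt G1 s + Dt (\<lambda>s. Lam s * Dt rho s) s"
  using Dt_add[OF G_smooth(1) G_smooth(3)] by (simp add: G1_def[abs_def] G2_def[abs_def])

definition gg1 :: "real \<Rightarrow> real" where "gg1 u = exp ((1 - p) * u) * G1 (sL u)"
definition gg2 :: "real \<Rightarrow> real" where "gg2 u = exp ((-1 - p) * u) * G2 (sL u)"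
definition GZ :: "nat \<Rightarrow> real \<Rightarrow> real" where "GZ j u = Lam (sL u) * dZU j u"
definition gz :: "nat \<Rightarrow> real \<Rightarrow> real" where "gz j u = exp (- p * u) * GZ j u"

lemma comp_bound: "smooth1 S f \<Longrightarrow> \<exists>A. \<forall>u<0. \<bar>f (sL u)\<bar> \<le> A \<and> \<bar>deriv (\<lambda>u. f (sL u)) u\<bar> \<le> A"
proof -
  assume f: "smooth1 S f"
  obtain A B where "\<forall>u<0. \<bar>f (sL u)\<bar> \<le> A" "\<forall>u<0. \<bar>Dt f (sL u)\<bar> \<le> B"
    using comp_sL(4)[OF f] comp_sL(4)[OF smooth_Dt[OF f S(1)]] by blast
  then show ?thesis
    by (intro exI[of _ "max A B"]) (simp add: comp_sL(3)[OF f] le_max_iff_disj)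
qed

lemma gg_facts:
  "smooth1 {..<0} gg1" "smooth1 {..<0} gg2"
  "u < 0 \<Longrightarrow> deriv gg1 u = exp ((1 - p) * u) * ((1 - p) * G1 (sL u) - Dt G1 (sL u))"
  "u < 0 \<Longrightarrow> deriv gg2 u = exp ((-1 - p) * u) * ((-1 - p) * G2 (sL u) - Dt G2 (sL u))"
  "\<exists>C. (\<forall>u<0. \<bar>gg1 u\<bar> \<le> C * exp ((1 - p) * u) \<and> \<bar>deriv gg1 u\<bar> \<le> C * exp ((1 - p) * u)) \<and>
       (\<forall>u<0. \<bar>gg2 u\<bar> \<le> C * exp ((-1 - p) * u) \<and> \<bar>deriv gg2 u\<bar> \<le> C * exp ((-1 - p) * u))" (is ?PA)
proof -
  obtain A1 A2 where A: "\<forall>u<0. \<bar>G1 (sL u)\<bar> \<le> A1 \<and> \<bar>deriv (\<lambda>u. G1 (sL u)) u\<bar> \<le> A1"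
    "\<forall>u<0. \<bar>G2 (sL u)\<bar> \<le> A2 \<and> \<bar>deriv (\<lambda>u. G2 (sL u)) u\<bar> \<le> A2"
    using comp_bound[OF G_smooth(1)] comp_bound[OF G_smooth(2)] by blast
  note e1 = exp_mult_smooth[OF comp_sL(1)[OF G_smooth(1)] A(1), where c = "1 - p", folded gg1_def[abs_def], folded gg1_def]
  note e2 = exp_mult_smooth[OF comp_sL(1)[OF G_smooth(2)] A(2), where c = "-1 - p", folded gg2_def[abs_def], folded gg2_def]
  show "smooth1 {..<0} gg1" "smooth1 {..<0} gg2" by (rule e1(1), rule e2(1))
  show "u < 0 \<Longrightarrow> deriv gg1 u = exp ((1 - p) * u) * ((1 - p) * G1 (sL u) - Dt G1 (sL u))"
    "u < 0 \<Longrightarrow> deriv gg2 u = exp ((-1 - p) * u) * ((-1 - p) * G2 (sL u) - Dt G2 (sL u))"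
    using e1(2) e2(2) comp_sL(3)[OF G_smooth(1)] comp_sL(3)[OF G_smooth(2)] by simp_all
  define C where "C = max ((\<bar>1 - p\<bar> + 1) * A1) ((\<bar>-1 - p\<bar> + 1) * A2)"
  have C: "(\<bar>1 - p\<bar> + 1) * A1 * exp t \<le> C * exp t" "(\<bar>-1 - p\<bar> + 1) * A2 * exp t \<le> C * exp t" for t
    by (intro mult_right_mono; simp add: C_def)+
  show ?PA
    using e1(3)[THEN conjunct1, THEN order_trans[OF _ C(1)]] e1(3)[THEN conjunct2, THEN order_trans[OF _ C(1)]]
      e2(3)[THEN conjunct1, THEN order_trans[OF _ C(2)]] e2(3)[THEN conjunct2, THEN order_trans[OF _ C(2)]]
    by (intro exI[of _ C] conjI allI impI)
qed

text \<open>The last identity is the normal equation in the variable u = ln |x|: the divergence of x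
  |x|^(-p) g(u) is |x|^(-p) (kap g + g').\<close>

lemma GZ_facts:
  "smooth1 {..<0} (GZ j)" "\<exists>A. \<forall>u<0. \<bar>GZ j u\<bar> \<le> A \<and> \<bar>deriv (GZ j) u\<bar> \<le> A" (is ?PA)
  "u < 0 \<Longrightarrow> kap * GZ j u + deriv (GZ j) u =
    - (al (sL u) * rho (sL u) ^ 3 * (if j = 0 then B1 \<phi> (sL u) else if j = 1 then B2 \<phi> (sL u) else dJ (sL u)))"
proof -
  let ?F = "\<lambda>s. Lam s * th s" and ?H = "\<lambda>s. Lam s * sg s"
  have F: "smooth1 S ?F" and H: "smooth1 S ?H" by (intro smooth1_mult smooth_S)+
  have F2: "smooth1 S (\<lambda>s. ?F s * th s)" by (intro smooth1_mult smooth_S)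
  have GZ_eq: "GZ j = (\<lambda>u. if j = 0 then ?F (sL u) * sin (phL u) else if j = 1 then - (?F (sL u) * cos (phL u)) else - ?H (sL u))"
    by (auto simp: GZ_def dZU_def)
  show "smooth1 {..<0} (GZ j)"
    unfolding GZ_eq by (cases "j = 0"; cases "j = 1"; simp; intro smooth1_minus smooth1_mult[OF _ trig_smooth(1)] smooth1_mult[OF _ trig_smooth(2)] comp_sL(1)[OF F] comp_sL(1)[OF H])
  define D where "D = (\<lambda>u. if j = 0 then - Dt ?F (sL u) * sin (phL u) - ?F (sL u) * th (sL u) * cos (phL u)
     else if j = 1 then Dt ?F (sL u) * cos (phL u) - ?F (sL u) * th (sL u) * sin (phL u) else Dt ?H (sL u))"
  have D: "(GZ j has_real_derivative D u) (at u)" if u: "u < 0" for u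
  proof -
    have 0: "((\<lambda>u. ?F (sL u) * sin (phL u)) has_real_derivative - Dt ?F (sL u) * sin (phL u) - ?F (sL u) * th (sL u) * cos (phL u)) (at u)"
      by (rule DERIV_cong[OF DERIV_mult[OF comp_sL(2)[OF F u] trig_DERIV(2)[OF u]]]) (simp add: algebra_simps)
    have 1: "((\<lambda>u. - (?F (sL u) * cos (phL u))) has_real_derivative Dt ?F (sL u) * cos (phL u) - ?F (sL u) * th (sL u) * sin (phL u)) (at u)"
      by (rule DERIV_cong[OF DERIV_minus[OF DERIV_mult[OF comp_sL(2)[OF F u] trig_DERIV(1)[OF u]]]]) (simp add: algebra_simps)
    have 2: "((\<lambda>u. - ?H (sL u)) has_real_derivative Dt ?H (sL u)) (at u)"
      by (rule DERIV_cong[OF DERIV_minus[OF comp_sL(2)[OF H u]]]) simp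
    show ?thesis
    proof (cases "j = 0")
      case True then show ?thesis using 0 unfolding GZ_eq D_def by simp
    next
      case False
      then show ?thesis using 1 2 unfolding GZ_eq D_def by (cases "j = 1") simp_all
    qed
  qed
  have dGZ: "deriv (GZ j) u = D u" if "u < 0" for u by (rule DERIV_imp_deriv[OF D[OF that]])
  obtain C1 C2 C3 C4 C5 where C: "\<forall>u<0. \<bar>?F (sL u)\<bar> \<le> C1" "\<forall>u<0. \<bar>?H (sL u)\<bar> \<le> C2" "\<forall>u<0. \<bar>Dt ?F (sL u)\<bar> \<le> C3"
    "\<forall>u<0. \<bar>Dt ?H (sL u)\<bar> \<le> C4" "\<forall>u<0. \<bar>?F (sL u) * th (sL u)\<bar> \<le> C5"
    using comp_sL(4)[OF F] comp_sL(4)[OF H] comp_sL(4)[OF smooth_Dt[OF F S(1)]] comp_sL(4)[OF smooth_Dt[OF H S(1)]] comp_sL(4)[OF F2]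
    by blast
  define K where "K = \<bar>C1\<bar> + \<bar>C2\<bar> + \<bar>C3\<bar> + \<bar>C4\<bar> + \<bar>C5\<bar>"
  have tri: "\<bar>a * sin t - b * cos t\<bar> \<le> \<bar>a\<bar> + \<bar>b\<bar>" "\<bar>a * cos t - b * sin t\<bar> \<le> \<bar>a\<bar> + \<bar>b\<bar>" for a b t :: real
    by (rule order_trans[OF abs_triangle_ineq4 add_mono]; rule abs_mult_trig)+
  have tri3: "a + b \<le> \<bar>x\<bar> + \<bar>y\<bar> + \<bar>z\<bar>" if "a \<le> \<bar>x\<bar>" "b \<le> \<bar>z\<bar>" for a b x y z :: real
    using that by simp
  have "\<bar>GZ j u\<bar> \<le> K \<and> \<bar>D u\<bar> \<le> K" if u: "u < 0" for u
  proof -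
    have c: "\<bar>?F (sL u)\<bar> \<le> \<bar>C1\<bar>" "\<bar>?H (sL u)\<bar> \<le> \<bar>C2\<bar>" "\<bar>Dt ?F (sL u)\<bar> \<le> \<bar>C3\<bar>"
      "\<bar>Dt ?H (sL u)\<bar> \<le> \<bar>C4\<bar>" "\<bar>?F (sL u) * th (sL u)\<bar> \<le> \<bar>C5\<bar>"
      using C u by (auto intro: order_trans)
    have g: "\<bar>GZ j u\<bar> \<le> \<bar>C1\<bar> + \<bar>C2\<bar>"
    proof -
      have "\<bar>?F (sL u) * sin (phL u)\<bar> \<le> \<bar>C1\<bar> + \<bar>C2\<bar>" "\<bar>?F (sL u) * cos (phL u)\<bar> \<le> \<bar>C1\<bar> + \<bar>C2\<bar>"
        by (rule order_trans[OF order_trans[OF abs_mult_trig(1) c(1)]], simp, rule order_trans[OF order_trans[OF abs_mult_trig(2) c(1)]], simp)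
      moreover have "\<bar>?H (sL u)\<bar> \<le> \<bar>C1\<bar> + \<bar>C2\<bar>" by (rule order_trans[OF c(2)]) simp
      ultimately show ?thesis unfolding GZ_eq abs_minus_cancel if_distrib[of abs] by presburger
    qed
    have "\<bar>D u\<bar> \<le> \<bar>C3\<bar> + \<bar>C4\<bar> + \<bar>C5\<bar>"
    proof -
      have "\<bar>- Dt ?F (sL u) * sin (phL u) - ?F (sL u) * th (sL u) * cos (phL u)\<bar> \<le> \<bar>C3\<bar> + \<bar>C4\<bar> + \<bar>C5\<bar>"
        by (rule order_trans[OF tri(1) tri3[OF _ c(5)]]) (use c(3) in simp)
      moreover have "\<bar>Dt ?F (sL u) * cos (phL u) - ?F (sL u) * th (sL u) * sin (phL u)\<bar> \<le> \<bar>C3\<bar> + \<bar>C4\<bar> + \<bar>C5\<bar>"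
        by (rule order_trans[OF tri(2) tri3[OF c(3,5)]])
      moreover have "\<bar>Dt ?H (sL u)\<bar> \<le> \<bar>C3\<bar> + \<bar>C4\<bar> + \<bar>C5\<bar>" by (rule order_trans[OF c(4)]) simp
      ultimately show ?thesis unfolding D_def by presburger
    qed
    from this[THEN order_trans] g[THEN order_trans] show ?thesis by (simp add: K_def)
  qed
  then show ?PA using dGZ by auto
  assume u: "u < 0"
  have s: "sL u \<in> S" "0 < sL u" using sL_S[OF u] sL_range[OF u] by auto
  have ph: "\<phi> (sL u) = phL u" by (simp add: phL_def)
  note n = normal_equation[OF s, unfolded ph]
  consider "j = 0" | "j = 1" | "j \<noteq> 0" "j \<noteq> 1" by blast
  then show "kap * GZ j u + deriv (GZ j) u =
    - (al (sL u) * rho (sL u) ^ 3 * (if j = 0 then B1 \<phi> (sL u) else if j = 1 then B2 \<phi> (sL u) else dJ (sL u)))"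
  proof cases
    case 1
    show ?thesis unfolding dGZ[OF u] unfolding GZ_eq D_def using n(1) 1 by (simp add: power2_eq_square algebra_simps)
  next
    case 2
    show ?thesis unfolding dGZ[OF u] unfolding GZ_eq D_def using n(2) 2 by (simp add: power2_eq_square algebra_simps)
  next
    case 3
    show ?thesis unfolding dGZ[OF u] unfolding GZ_eq D_def using n(3) 3 by (simp add: algebra_simps)
  qed
qed

definition fd :: "nat \<Rightarrow> nat \<Rightarrow> (nat \<Rightarrow> real) \<Rightarrow> real" where
  "fd b i x = (if i = b then gg1 (ln (vnorm m x)) else 0) - x b * (x i * gg2 (ln (vnorm m x)))"

text \<open>\<open>flx a i\<close> is \<open>|DU|\<^bsup>p-2\<^esup>\<close> times the \<open>i\<close>-th partial derivative of the component \<open>a\<close>, written without the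
  derivative of \<open>U\<close> so that it can be differentiated again.\<close>

definition flx :: "nat \<Rightarrow> nat \<Rightarrow> (nat \<Rightarrow> real) \<Rightarrow> real" where
  "flx a i = (if a < m then fd a i else if a < m + 3 then (\<lambda>x. x i * gz (a - m) (ln (vnorm m x))) else fd (a - (m + 3)) i)"

lemma fd_facts:
  assumes i: "i < m" and b: "b < m"
  shows "Ck 1 m (punct m 1) (fd b i)"
    "\<exists>C. \<forall>x\<in>punct m 1. \<bar>fd b i x\<bar> \<le> C * vnorm m x powr (1 - p) \<and> \<bar>pd i (fd b i) x\<bar> \<le> C * vnorm m x powr (- p)" (is ?PA)
    "x \<in> punct m 1 \<Longrightarrow> (\<Sum>i<m. pd i (fd b i) x) = - (vnorm m x powr (- p) * (al (sx x) * (x b / vnorm m x)))"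
    "x \<in> punct m 1 \<Longrightarrow> fd b i x = vnorm m x powr (2 - p) * Lam (sx x) * pd i (dirc m hU b) x"
proof -
  obtain C where C: "\<forall>u<0. \<bar>gg1 u\<bar> \<le> C * exp ((1 - p) * u) \<and> \<bar>deriv gg1 u\<bar> \<le> C * exp ((1 - p) * u)"
    "\<forall>u<0. \<bar>gg2 u\<bar> \<le> C * exp ((-1 - p) * u) \<and> \<bar>deriv gg2 u\<bar> \<le> C * exp ((-1 - p) * u)"
    using gg_facts(5) by blast
  have g: "smooth1 {..<ln (1::real)} gg1" "smooth1 {..<ln (1::real)} gg2" using gg_facts(1,2) by simp_all
  have c: "\<forall>u<ln 1. \<bar>gg1 u\<bar> \<le> C * exp ((1 - p) * u) \<and> \<bar>deriv gg1 u\<bar> \<le> C * exp ((1 - p) * u)"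
    "\<forall>u<ln 1. \<bar>gg2 u\<bar> \<le> C * exp ((-1 - p) * u) \<and> \<bar>deriv gg2 u\<bar> \<le> C * exp ((-1 - p) * u)"
    using C by simp_all
  note f = flux_dirc[OF g c i b, folded fd_def, folded fd_def[abs_def]]
  show "Ck 1 m (punct m 1) (fd b i)" using f(1) by (simp add: fd_def[abs_def])
  show ?PA
    using f(2,3) unfolding fd_def[abs_def] by blast
  assume x: "x \<in> punct m 1"
  let ?r = "vnorm m x" and ?u = "ln (vnorm m x)"
  have r: "?r > 0" "?u < 0" using punct_D[OF x] by auto
  have s: "sx x \<in> S" using punct1[OF x] by simp
  have ex: "exp (c * ?u) = ?r powr c" for c using r by (simp add: powr_def)
  have pw: "?r powr (-1 - p) = ?r powr (- p) / ?r" "?r powr (1 - p) = ?r powr (- p) * ?r" "?r powr (2 - p) = ?r powr (- p) * ?r\<^sup>2"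
    using r by (simp_all add: powr_diff powr_minus divide_simps power2_eq_square powr_add powr_numeral)
  define L where "L = Dt (\<lambda>s. Lam s * Dt rho s) (sx x)"
  have al: "al (sx x) = mu * G1 (sx x) + kap * (Lam (sx x) * Dt rho (sx x)) - L" by (simp add: al_def G1_def L_def)
  \<comment> \<open>The contributions to the divergence add up to - mu for the coefficient of rho
    and to - kap for that of its derivative, while the derivatives of \<open>G1\<close>
    cancel.\<close>
  have alg: "(P * r * ((1 - p) * g - d)) / r\<^sup>2 - (m + 1) * (P / r * (g + l)) - P / r * ((-1 - p) * (g + l) - (d + L')) = - (P * ((mu * g + kap * l - L') / r))"
    if "r \<noteq> 0" for P r g d l L' :: real
    using that unfolding mu_def kap_def by (simp add: field_simps power2_eq_square)
  have "(\<Sum>i<m. pd i (fd b i) x) = x b * (deriv gg1 ?u / ?r\<^sup>2 - (m + 1) * gg2 ?u - deriv gg2 ?u)"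
    using f(4)[OF x] by (simp add: fd_def[abs_def])
  also have "\<dots> = x b * (- (?r powr (- p) * (al (sx x) / ?r)))"
    using alg[of ?r "?r powr (- p)" "G1 (sx x)" "Dt G1 (sx x)" "Lam (sx x) * Dt rho (sx x)" L] r
    unfolding gg_facts(3,4)[OF r(2)] gg2_def ex pw al G2_Dt[OF s] L_def[symmetric] by (simp add: G2_def G1_def)
  finally show "(\<Sum>i<m. pd i (fd b i) x) = - (?r powr (- p) * (al (sx x) * (x b / ?r)))" by simp
  have h: "smooth1 {..<ln (1::real)} hU" using hU_smooth by simp
  have alg2: "(if i = b then P * r * (l * g) else 0) - y * (z * (P / r * (l * g + l * d))) =
    P * r\<^sup>2 * l * (((if i = b then 1 else 0) - y / r * (z / r)) * g / r + y / r * (z / r) * (- d) / r)"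
    if "r \<noteq> 0" for P r l g d y z :: real
    using that by (auto simp: field_simps power2_eq_square)
  show "fd b i x = ?r powr (2 - p) * Lam (sx x) * pd i (dirc m hU b) x"
    unfolding dirc_pd[OF h x i] fd_def gg1_def gg2_def ex pw hU_deriv[OF r(2)] G1_def G2_def
    using alg2[of ?r] r by (simp add: hU_def)
qed

lemma flx_facts:
  assumes a: "a < ll" and i: "i < m"
  shows "Ck 1 m (punct m 1) (flx a i)"
    "\<exists>C. \<forall>x\<in>punct m 1. \<bar>flx a i x\<bar> \<le> C * vnorm m x powr (1 - p) \<and> \<bar>pd i (flx a i) x\<bar> \<le> C * vnorm m x powr (- p)" (is ?PA)
    "x \<in> punct m 1 \<Longrightarrow> (\<Sum>i<m. pd i (flx a i) x) = - (vnorm m x powr (- p) * Av a x)"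
    "x \<in> punct m 1 \<Longrightarrow> flx a i x = vnorm m x powr (2 - p) * Lam (sx x) * pd i (\<lambda>x. U x a) x"
proof -
  have "Ck 1 m (punct m 1) (flx a i) \<and>
    (\<exists>C. \<forall>x\<in>punct m 1. \<bar>flx a i x\<bar> \<le> C * vnorm m x powr (1 - p) \<and> \<bar>pd i (flx a i) x\<bar> \<le> C * vnorm m x powr (- p)) \<and>
    (\<forall>x\<in>punct m 1. (\<Sum>i<m. pd i (flx a i) x) = - (vnorm m x powr (- p) * Av a x) \<and>
       flx a i x = vnorm m x powr (2 - p) * Lam (sx x) * pd i (\<lambda>x. U x a) x)"
  proof (rule index_cases[OF a])
    assume a: "a < m"
    have "flx a = fd a" using a by (simp add: flx_def fun_eq_iff)
    then show ?thesis using fd_facts[OF i a] U_pd(1)[OF _ i a] a by (simp add: Av_def)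
  next
    fix b assume b: "a = m + 3 + b" "b < m"
    have "flx a = fd b" using b by (simp add: flx_def fun_eq_iff)
    then show ?thesis using fd_facts[OF i b(2)] U_pd(3)[OF _ i b(2)] b by (simp add: Av_def)
  next
    fix j assume j: "a = m + j" "j < 3"
    have fl: "flx a = (\<lambda>i x. x i * gz j (ln (vnorm m x)))" using j by (simp add: flx_def fun_eq_iff)
    obtain A where A: "\<forall>u<0. \<bar>GZ j u\<bar> \<le> A \<and> \<bar>deriv (GZ j) u\<bar> \<le> A" using GZ_facts(2) by blast
    note e = exp_mult_smooth[OF GZ_facts(1) A, where c = "- p", folded gz_def[abs_def], folded gz_def]
    have g: "smooth1 {..<ln (1::real)} (gz j)" using e(1) by simp
    have c: "\<forall>u<ln 1. \<bar>gz j u\<bar> \<le> (\<bar>- p\<bar> + 1) * A * exp (- p * u) \<and> \<bar>deriv (gz j) u\<bar> \<le> (\<bar>- p\<bar> + 1) * A * exp (- p * u)"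
      using e(3) by simp
    note f = flux_rad[OF g c i]
    have "(\<Sum>i<m. pd i (flx a i) x) = - (vnorm m x powr (- p) * Av a x) \<and>
       flx a i x = vnorm m x powr (2 - p) * Lam (sx x) * pd i (\<lambda>x. U x a) x" if x: "x \<in> punct m 1" for x
    proof
      let ?r = "vnorm m x" and ?u = "ln (vnorm m x)"
      have r: "?r > 0" "?u < 0" using punct_D[OF x] by auto
      have ex: "exp (c * ?u) = ?r powr c" for c using r by (simp add: powr_def)
      have "(\<Sum>i<m. pd i (flx a i) x) = m * gz j ?u + deriv (gz j) ?u" unfolding fl by (rule f(4)[OF x])
      also have "\<dots> = ?r powr (- p) * (kap * GZ j ?u + deriv (GZ j) ?u)"
        unfolding e(2)[OF r(2)] unfolding gz_def ex kap_def by (simp add: algebra_simps)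
      also have "\<dots> = - (?r powr (- p) * Av a x)"
        unfolding GZ_facts(3)[OF r(2)] using j by (simp add: Av_def)
      finally show "(\<Sum>i<m. pd i (flx a i) x) = - (?r powr (- p) * Av a x)" .
      have Z: "smooth1 {..<ln (1::real)} (ZU j)" using ZU_smooth by simp
      have pw: "?r powr (2 - p) = ?r powr (- p) * ?r\<^sup>2"
        using r by (simp add: powr_diff powr_minus divide_simps powr_numeral)
      show "flx a i x = ?r powr (2 - p) * Lam (sx x) * pd i (\<lambda>x. U x a) x"
        unfolding j(1) U_pd(2)[OF x i j(2)] rad_pd[OF Z x i] ZU_deriv[OF r(2)] pw
        unfolding j(1)[symmetric] fl gz_def GZ_def ex using r by (simp add: power2_eq_square)
    qed
    moreover have "Ck 1 m (punct m 1) (flx a i)" unfolding fl by (rule f(1))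
    moreover have "\<exists>C. \<forall>x\<in>punct m 1. \<bar>flx a i x\<bar> \<le> C * vnorm m x powr (1 - p) \<and> \<bar>pd i (flx a i) x\<bar> \<le> C * vnorm m x powr (- p)"
      using f(2,3) unfolding fl by blast
    ultimately show ?thesis by blast
  qed
  then show "Ck 1 m (punct m 1) (flx a i)"
    ?PA
    "x \<in> punct m 1 \<Longrightarrow> (\<Sum>i<m. pd i (flx a i) x) = - (vnorm m x powr (- p) * Av a x)"
    "x \<in> punct m 1 \<Longrightarrow> flx a i x = vnorm m x powr (2 - p) * Lam (sx x) * pd i (\<lambda>x. U x a) x"
    by blast+
qed

abbreviation "Om \<equiv> oball m 1"
abbreviation "MB \<equiv> lebball m 1"

lemma AE_punct: "AE x in MB. x \<in> punct m 1"
  using m2 by (intro AE_lebball_punct) auto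

lemma AE_U_wpd: "AE x in MB. x \<in> punct m 1 \<and> (\<forall>a<ll. \<forall>i<m. wpd m Om i (\<lambda>x. U x a) x = pd i (\<lambda>x. U x a) x)"
proof -
  have "AE x in MB. \<forall>a\<in>{..<ll}. \<forall>i\<in>{..<m}. wpd m Om i (\<lambda>x. U x a) x = pd i (\<lambda>x. U x a) x"
    by (intro AE_finite_allI finite_lessThan) (simp add: U_wpd)
  with AE_punct show ?thesis by eventually_elim simp
qed

text \<open>\<open>Qf\<close> is positive, so DU does not vanish off the origin and |DU|^(p-2) is
  regular there for p < 2 as well.\<close>

lemma AE_grad_U: "AE x in MB. x \<in> punct m 1 \<and> grad_norm m ll Om U x = sqrt (Qf (sx x)) / vnorm m x \<and>
   grad_norm m ll Om U x powr (p - 2) = Lam (sx x) * vnorm m x powr (2 - p) \<and>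
   (\<forall>W. grad_norm m ll Om U x powr (p - 2) * grad_inner m ll Om U W x = (\<Sum>a<ll. \<Sum>i<m. flx a i x * wpd m Om i (\<lambda>x. W x a) x))"
  using AE_U_wpd
proof eventually_elim
  case (elim x)
  then have x: "x \<in> punct m 1" by simp
  have r: "vnorm m x > 0" using punct_D[OF x] by simp
  have Q: "Qf (sx x) > 0" using Qf_bounds[of "sx x"] punct1[OF x] mu_pos by (auto simp: S)
  have "grad_inner m ll Om U U x = (\<Sum>a<ll. \<Sum>i<m. (pd i (\<lambda>x. U x a) x)\<^sup>2)"
    unfolding grad_inner_def using elim by (intro sum.cong refl) (simp add: power2_eq_square)
  then have g: "grad_norm m ll Om U x = sqrt (Qf (sx x)) / vnorm m x"
    unfolding grad_norm_def U_grad[OF x] using r by (simp add: real_sqrt_divide)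
  have gp: "grad_norm m ll Om U x powr (p - 2) = Lam (sx x) * vnorm m x powr (2 - p)"
  proof -
    have "grad_norm m ll Om U x powr (p - 2) = sqrt (Qf (sx x)) powr (p - 2) / vnorm m x powr (p - 2)"
      unfolding g using r Q by (simp add: powr_divide)
    also have "sqrt (Qf (sx x)) powr (p - 2) = Lam (sx x)"
      unfolding Lam_eq using Q by (simp add: powr_half_sqrt[symmetric] powr_powr field_simps)
    finally show ?thesis using powr_minus_divide[of "vnorm m x" "p - 2"] by simp
  qed
  have "grad_norm m ll Om U x powr (p - 2) * grad_inner m ll Om U W x = (\<Sum>a<ll. \<Sum>i<m. flx a i x * wpd m Om i (\<lambda>x. W x a) x)" for W
    unfolding gp grad_inner_def sum_distrib_left
    using elim flx_facts(4)[OF _ _ x] by (intro sum.cong refl) simp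
  then show ?case using x g gp by blast
qed

text \<open>Each component of the explicit flux is paired with the coordinate instance of the chain
  rule, so the derivative moves off the Sobolev field W and onto the flux, whose divergence is
  known.\<close>

lemma first_variation:
  assumes W: "W \<in> W01p m ll p Om" and B: "AE x in MB. vnorm ll (W x) \<le> B"
  shows "integrable MB (\<lambda>x. grad_norm m ll Om U x powr (p - 2) * grad_inner m ll Om U W x)"
    "integrable MB (\<lambda>x. vnorm m x powr (- p) * (\<Sum>a<ll. Av a x * W x a))" (is ?PA)
    "integral\<^sup>L MB (\<lambda>x. grad_norm m ll Om U x powr (p - 2) * grad_inner m ll Om U W x) =
     integral\<^sup>L MB (\<lambda>x. vnorm m x powr (- p) * (\<Sum>a<ll. Av a x * W x a))" (is ?PB)
proof -
  have W1: "W \<in> W1p m ll p Om" by (rule W01p_approx[OF m2 _ W]) (use p1 in auto)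
  have mp: "m > 0" "1 \<le> p" using m2 p1 by auto
  let ?w = "\<lambda>a i x. wpd m Om i (\<lambda>x. W x a) x"
  have ci: "integrable MB (\<lambda>x. flx a i x * ?w a i x) \<and> integrable MB (\<lambda>x. pd i (flx a i) x * W x a) \<and>
    integral\<^sup>L MB (\<lambda>x. flx a i x * ?w a i x) = - integral\<^sup>L MB (\<lambda>x. pd i (flx a i) x * W x a)"
    if a: "a < ll" and i: "i < m" for a i
  proof -
    obtain C where C: "\<forall>x\<in>punct m 1. \<bar>flx a i x\<bar> \<le> C * vnorm m x powr (1 - p) \<and> \<bar>pd i (flx a i) x\<bar> \<le> C * vnorm m x powr (- p)"
      using flx_facts(2)[OF a i] by blast
    have Ca: "\<bar>flx a i x\<bar> \<le> C * vnorm m x powr (1 - p)" "\<bar>pd i (flx a i) x\<bar> \<le> C * vnorm m x powr (- p)"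
      if "x \<in> Om" "x \<noteq> origin m" for x using C that by auto
    have Wb: "AE x in MB. \<bar>W x a\<bar> \<le> B"
      using B by eventually_elim (use vnorm_component[OF a] order_trans in blast)
    interpret c: lipschitz_chain m ll "\<lambda>w. w a" "\<lambda>b w. if b = a then 1 else 0" by (rule lipschitz_chain_coord[OF a])
    have e: "(\<Sum>b<ll. (if b = a then 1 else 0) * ?w b i x) = ?w a i x" for x
      using a by (simp add: if_distrib[of "\<lambda>c. c * _"] cong: if_cong)
    show ?thesis
      using c.chain_identity[OF m2 i p1 pm W flx_facts(1)[OF a i] Ca Wb] unfolding e by blast
  qed
  let ?L = "\<lambda>x. \<Sum>a<ll. \<Sum>i<m. flx a i x * ?w a i x"
  let ?R = "\<lambda>x. \<Sum>a<ll. \<Sum>i<m. pd i (flx a i) x * W x a"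
  have iL: "integrable MB ?L" and iR: "integrable MB ?R"
    by (rule integral_double_sum(1); use ci in simp)+
  have "integral\<^sup>L MB ?L = (\<Sum>a<ll. \<Sum>i<m. integral\<^sup>L MB (\<lambda>x. flx a i x * ?w a i x))"
    by (rule integral_double_sum(2); use ci in simp)
  also have "\<dots> = - (\<Sum>a<ll. \<Sum>i<m. integral\<^sup>L MB (\<lambda>x. pd i (flx a i) x * W x a))"
    unfolding sum_negf[symmetric] using ci by (intro sum.cong refl) simp
  also have "(\<Sum>a<ll. \<Sum>i<m. integral\<^sup>L MB (\<lambda>x. pd i (flx a i) x * W x a)) = integral\<^sup>L MB ?R"
    by (rule integral_double_sum(2)[symmetric]; use ci in simp)
  finally have I: "integral\<^sup>L MB ?L = integral\<^sup>L MB (\<lambda>x. - ?R x)" by simp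
  have aeL: "AE x in MB. ?L x = grad_norm m ll Om U x powr (p - 2) * grad_inner m ll Om U W x"
    using AE_grad_U by eventually_elim (drule conjunct2, drule conjunct2, drule conjunct2, drule spec[of _ W], erule sym)
  have aeR: "AE x in MB. - ?R x = vnorm m x powr (- p) * (\<Sum>a<ll. Av a x * W x a)"
    using AE_punct
  proof eventually_elim
    case (elim x)
    have "?R x = (\<Sum>a<ll. - (vnorm m x powr (- p) * (Av a x * W x a)))"
      using flx_facts(3)[OF _ _ elim, of _ 0] m2 by (intro sum.cong refl) (simp add: sum_distrib_right[symmetric])
    then show ?case by (simp add: sum_negf sum_distrib_left)
  qed
  have mW: "(\<lambda>x. W x a) \<in> borel_measurable MB" "(\<lambda>x. ?w a i x) \<in> borel_measurable MB" if "a < ll" "i < m" for a i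
    using W1pD[OF mp(2,1) W1 that(1)] that by (auto simp: Lp_iff)
  have mU: "(\<lambda>x. wpd m Om i (\<lambda>x. U x a) x) \<in> borel_measurable MB" if "a < ll" "i < m" for a i
    using W1pD[OF mp(2,1) U_W1p that(1)] that by (auto simp: Lp_iff)
  have gU: "grad_norm m ll Om U \<in> borel_measurable MB" using Lp_grad_norm[OF mp(2,1) U_W1p] by (simp add: Lp_iff)
  have mL: "(\<lambda>x. grad_norm m ll Om U x powr (p - 2) * grad_inner m ll Om U W x) \<in> borel_measurable MB"
    unfolding grad_inner_def using mW mU gU by measurable
  show I1: "integrable MB (\<lambda>x. grad_norm m ll Om U x powr (p - 2) * grad_inner m ll Om U W x)"
    by (rule integrable_cong_AE_imp[OF iL mL]) (use aeL in \<open>auto elim: eventually_mono\<close>)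
  have mAv: "(\<lambda>x. vnorm m x powr (- p) * (\<Sum>a<ll. Av a x * W x a)) \<in> borel_measurable MB"
  proof -
    have mc: "(\<lambda>x. vnorm m x powr (- p) * Av a x) \<in> borel_measurable MB" if a: "a < ll" for a
    proof (rule lebball_continuous_measurable)
      have "continuous_on (punct m 1) (pd i (flx a i))" if "i < m" for i
        using flx_facts(1)[OF a that] that by simp
      then have "continuous_on (punct m 1) (\<lambda>x. - (\<Sum>i<m. pd i (flx a i) x))"
        by (intro continuous_intros) simp
      moreover have "- (\<Sum>i<m. pd i (flx a i) x) = vnorm m x powr (- p) * Av a x" if "x \<in> punct m 1" for x
        using flx_facts(3)[OF a _ that, of 0] m2 by simp
      ultimately show "continuous_on (punct m 1) (\<lambda>x. vnorm m x powr (- p) * Av a x)"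
        by (rule continuous_on_eq)
    qed
    have "(\<lambda>x. \<Sum>a<ll. (vnorm m x powr (- p) * Av a x) * W x a) \<in> borel_measurable MB"
      by (rule borel_measurable_sum, rule borel_measurable_times[OF mc mW(1)[of _ 0]]) (use m2 in auto)
    then show ?thesis by (simp add: sum_distrib_left mult.assoc)
  qed
  show ?PA
    by (rule integrable_cong_AE_imp[OF Bochner_Integration.integrable_minus[OF iR] mAv]) (use aeR in \<open>auto elim: eventually_mono\<close>)
  have "integral\<^sup>L MB (\<lambda>x. grad_norm m ll Om U x powr (p - 2) * grad_inner m ll Om U W x) = integral\<^sup>L MB ?L"
    by (rule integral_cong_AE[OF mL _]) (use aeL iL in \<open>auto elim: eventually_mono\<close>)
  also have "\<dots> = integral\<^sup>L MB (\<lambda>x. vnorm m x powr (- p) * (\<Sum>a<ll. Av a x * W x a))"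
    unfolding I by (rule integral_cong_AE[OF _ mAv aeR]) (use iR in auto)
  finally show ?PB .
qed

end

section \<open>Harmonicity and minimality\<close>

context spiral
begin

text \<open>Along a curve c in \<open>N\<close> through U x, the function A \<cdot> (c - U) - KU |c
  - U|^2 is at most 0 by the normal inequality and vanishes at time 0, so its derivative there is 0;
  the quadratic term contributes nothing to it.\<close>

lemma tangent_Av:
  assumes x: "x \<in> punct m 1" and v: "v \<in> tangent_space ll N (U x)"
  shows "(\<Sum>a<ll. Av a x * v a) = 0"
proof -
  obtain c :: "real \<Rightarrow> nat \<Rightarrow> real" where c: "c 0 = U x" "\<forall>\<^sub>F t in nhds 0. c t \<in> N"
    "\<And>a. a < ll \<Longrightarrow> ((\<lambda>t. c t a) has_real_derivative v a) (at 0)"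
    using v unfolding tangent_space_def by blast
  define g where "g t = (\<Sum>a<ll. Av a x * (c t a - U x a)) - KU * (\<Sum>a<ll. (c t a - U x a) * (c t a - U x a))" for t
  obtain d where d: "d > 0" "\<And>t. \<bar>t\<bar> < d \<Longrightarrow> c t \<in> N"
    using c(2) by (auto simp: eventually_nhds_metric dist_real_def)
  have "(g has_real_derivative (\<Sum>a<ll. Av a x * v a) - KU * (\<Sum>a<ll. v a * (c 0 a - U x a) + v a * (c 0 a - U x a))) (at 0)"
    unfolding g_def[abs_def]
  proof (intro DERIV_diff DERIV_sum DERIV_cmult)
    fix a assume "a \<in> {..<ll}"
    then have a: "a < ll" by simp
    have d: "((\<lambda>t. c t a - U x a) has_real_derivative v a) (at 0)"
      by (rule DERIV_cong[OF DERIV_diff[OF c(3)[OF a] DERIV_const]]) simp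
    then show "((\<lambda>t. c t a - U x a) has_real_derivative v a) (at 0)" .
    show "((\<lambda>t. (c t a - U x a) * (c t a - U x a)) has_real_derivative v a * (c 0 a - U x a) + v a * (c 0 a - U x a)) (at 0)"
      by (rule DERIV_mult[OF d d])
  qed
  then have "(g has_real_derivative (\<Sum>a<ll. Av a x * v a)) (at 0)" by (simp add: c(1))
  moreover have "\<forall>y. \<bar>0 - y\<bar> < d \<longrightarrow> g y \<le> g 0"
  proof (intro allI impI)
    fix y :: real assume "\<bar>0 - y\<bar> < d"
    then have "c y \<in> N" using d by simp
    from normal_inequality[OF x this] show "g y \<le> g 0"
      by (simp add: g_def c(1) power2_eq_square abs_le_iff)
  qed
  ultimately show ?thesis by (rule DERIV_local_max[OF _ d(1)])
qed

lemma U_W1p_into: "U \<in> W1p_into m ll p Om N"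
  using U_W1p U_in_N by (simp add: W1p_into_def)

lemma U_p_harmonic: "p_harmonic m ll p Om N U"
  unfolding p_harmonic_def
proof (intro conjI ballI impI U_W1p_into)
  fix \<psi> assume \<psi>: "\<psi> \<in> W01p m ll p Om"
    and B: "\<exists>B. AE x in leb m. x \<in> Om \<longrightarrow> vnorm ll (\<psi> x) \<le> B"
    and T: "AE x in leb m. x \<in> Om \<longrightarrow> \<psi> x \<in> tangent_space ll N (U x)"
  obtain B where B: "AE x in MB. vnorm ll (\<psi> x) \<le> B" using B unfolding lebball_AE by blast
  have T: "AE x in MB. \<psi> x \<in> tangent_space ll N (U x)" using T unfolding lebball_AE .
  have z: "AE x in MB. vnorm m x powr (- p) * (\<Sum>a<ll. Av a x * \<psi> x a) = 0"
    using T AE_punct by eventually_elim (simp add: tangent_Av)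
  have "integral\<^sup>L MB (\<lambda>x. vnorm m x powr (- p) * (\<Sum>a<ll. Av a x * \<psi> x a)) = 0"
    by (rule integral_eq_zero_AE[OF z])
  then show "(LINT x:Om|leb m. grad_norm m ll Om U x powr (p - 2) * grad_inner m ll Om U \<psi> x) = 0"
    unfolding lebball_integral using first_variation(3)[OF \<psi> B] by simp
qed

text \<open>A bound for both Q / kap and sqrt Q when Q \<le> 4 mu: the losses in the quadratic and
  in the linear branch.\<close>

definition MX :: real where "MX = max (4 * mu / kap) (2 * sqrt mu)"
text \<open>In order: the factor p of the linear term, 602 from \<open>bowl_lower\<close> with |w|
  \<le> 600, 2 / kap from Hardy's inequality, and the comparison of the Hardy weight with the
  convexity weight.\<close>

definition Ctot :: real where "Ctot = p * 602 * (2 / kap) * (200 * 2 powr (p / 2) * MX)"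

lemma KU_pos: "KU > 0" using mu_pos by (simp add: KU_def)

text \<open>By mu \<le> Q, \<open>KU\<close> is at most a constant times Q^(p/2 - 1) Q; the spare
  factor Q is spent as Q / kap in the quadratic branch and as sqrt Q sqrt Q in the linear
  one.\<close>

lemma hardy_weight_le:
  assumes Q: "mu \<le> Q" "Q \<le> 4 * mu" and r: "0 < r" and b: "0 \<le> b" and g: "g = sqrt Q / r"
    "gp = Q powr (p / 2 - 1) * r powr (2 - p)"
  shows "KU * min (r powr (2 - p) * b\<^sup>2 / kap) (r powr (1 - p) * b) \<le>
    200 * 2 powr (p / 2) * MX * (gp * min (b\<^sup>2) (g * b))"
proof -
  have Q0: "Q > 0" using Q mu_pos by linarith
  define D where "D = 200 * 2 powr (p / 2)"
  have D: "D > 0" by (simp add: D_def)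
  define L where "L = Q powr (p / 2 - 1)"
  have L: "L > 0" using Q0 by (simp add: L_def)
  have "mu powr (p / 2) \<le> Q powr (p / 2)" using Q mu_pos p1 by (intro powr_mono2) auto
  also have "\<dots> = L * Q" using Q0 by (simp add: L_def powr_diff)
  finally have KU: "KU \<le> D * (L * Q)" using mu_pos D by (simp add: KU_def D_def powr_mult)
  have m1: "Q / kap \<le> MX" using Q kap_pos by (auto simp: MX_def divide_right_mono le_max_iff_disj)
  have "sqrt Q \<le> sqrt (4 * mu)" using Q by simp
  then have m2: "sqrt Q \<le> MX" by (simp add: MX_def real_sqrt_mult le_max_iff_disj)
  have r1: "r powr (1 - p) = r powr (2 - p) / r" using r by (simp add: powr_diff field_simps powr_numeral power2_eq_square)
  define P where "P = r powr (2 - p)"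
  have P: "P > 0" using r by (simp add: P_def)
  have A: "KU * min (P * b\<^sup>2 / kap) (P / r * b) \<le> D * (MX * L * P * b\<^sup>2)"
  proof -
    have "KU * min (P * b\<^sup>2 / kap) (P / r * b) \<le> KU * (P * b\<^sup>2 / kap)" using KU_pos by (intro mult_left_mono) auto
    also have "\<dots> \<le> (D * (L * Q)) * (P * b\<^sup>2 / kap)" using KU P kap_pos by (intro mult_right_mono) auto
    also have "\<dots> = (D * L * P * b\<^sup>2) * (Q / kap)" by simp
    also have "\<dots> \<le> (D * L * P * b\<^sup>2) * MX" using m1 D L P by (intro mult_left_mono) auto
    finally show ?thesis by (simp add: mult_ac)
  qed
  have B: "KU * min (P * b\<^sup>2 / kap) (P / r * b) \<le> D * (MX * L * P * (sqrt Q / r * b))"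
  proof -
    have "KU * min (P * b\<^sup>2 / kap) (P / r * b) \<le> KU * (P / r * b)" using KU_pos by (intro mult_left_mono) auto
    also have "\<dots> \<le> (D * (L * Q)) * (P / r * b)" using KU P r b by (intro mult_right_mono) auto
    also have "\<dots> = (D * (L * (sqrt Q * sqrt Q))) * (P / r * b)" using Q0 by simp
    also have "\<dots> = (D * L * P * (sqrt Q / r * b)) * sqrt Q" by (simp only: divide_inverse mult_ac)
    also have "\<dots> \<le> (D * L * P * (sqrt Q / r * b)) * MX" using m2 D L P r b Q0 by (intro mult_left_mono) auto
    finally show ?thesis by (simp add: mult_ac)
  qed
  have "KU * min (P * b\<^sup>2 / kap) (P / r * b) \<le> D * MX * ((L * P) * min (b\<^sup>2) (sqrt Q / r * b))"
  proof (cases "b\<^sup>2 \<le> sqrt Q / r * b")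
    case True then show ?thesis using A by (simp add: min_def mult_ac)
  next
    case False then show ?thesis using B by (simp add: min_def mult_ac)
  qed
  then show ?thesis unfolding g r1 P_def[symmetric] L_def[symmetric] D_def[symmetric] .
qed

text \<open>Convexity is applied to a = DU and b = - Dw with w = U - v, and integrated. The linear
  term equals the integral of |x|^(-p) A \<cdot> w, which the normal inequality, Hardy's inequality
  and the weight comparison bound by Ctot X, X being the integral of the gain without its constant.
  Half of the gain survives and controls w.\<close>

lemma energy_gap:
  assumes c: "0 < c" "powr_gap p c"
    and Ct: "Ctot \<le> c / 2"
    and v: "v \<in> W1p_into m ll p Om N" and W: "(\<lambda>x. vdiff ll (U x) (v x)) \<in> W01p m ll p Om"
  shows "\<exists>X\<ge>0. energy m ll p Om U + c / 2 * X \<le> energy m ll p Om v \<and> (X = 0 \<longrightarrow> (AE x in MB. v x = U x))"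
proof -
  define w where "w = (\<lambda>x. vdiff ll (U x) (v x))"
  have W: "w \<in> W01p m ll p Om" using W by (simp add: w_def)
  have mp: "m > 0" "1 \<le> p" using m2 p1 by auto
  have vW: "v \<in> W1p m ll p Om" and vN: "AE x in MB. v x \<in> N" using v by (auto simp: W1p_into_def lebball_AE)
  have wW: "w \<in> W1p m ll p Om" unfolding w_def by (rule vdiff_W1p[OF mp(2,1) U_W1p vW])
  have wa: "w x a = U x a - v x a" if "a < ll" for x a using that by (simp add: w_def vdiff_def)
  let ?al = "grad_norm m ll Om U" and ?b = "grad_norm m ll Om w" and ?y = "grad_norm m ll Om v"
  let ?ip = "grad_inner m ll Om U w"
  let ?d = "\<lambda>u a i x. wpd m Om i (\<lambda>x. u x a) x"
  have sup: "AE x in MB. x \<in> punct m 1 \<and> U x \<in> N \<and> v x \<in> N"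
    using vN AE_punct by eventually_elim (simp add: U_in_N)
  have wn: "AE x in MB. vnorm ll (w x) \<le> 600"
    using sup
  proof eventually_elim
    case (elim x)
    have "vnorm ll (w x) = L2_set (\<lambda>a. U x a + - v x a) {..<ll}"
      unfolding vnorm_def by (intro L2_set_cong refl) (simp add: wa)
    also have "\<dots> \<le> L2_set (U x) {..<ll} + L2_set (\<lambda>a. - v x a) {..<ll}" by (rule L2_set_triangle_ineq)
    also have "L2_set (\<lambda>a. - v x a) {..<ll} = vnorm ll (v x)" by (simp add: vnorm_def L2_set_def)
    also have "L2_set (U x) {..<ll} = vnorm ll (U x)" by (simp add: vnorm_def)
    finally show ?case using elim N_bounded[of "U x"] N_bounded[of "v x"] by linarith
  qed
  note fv = first_variation[OF W wn]
  have wd: "AE x in MB. \<forall>a\<in>{..<ll}. \<forall>i\<in>{..<m}. ?d w a i x = ?d U a i x - ?d v a i x"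
    unfolding w_def by (intro AE_finite_allI finite_lessThan wpd_vdiff[OF mp(2,1) U_W1p vW]) auto
  have key: "AE x in MB. ?al x powr p + p * (?al x powr (p - 2) * - ?ip x) + c * (?al x powr (p - 2) * min ((?b x)\<^sup>2) (?al x * ?b x)) \<le> ?y x powr p"
    using wd AE_grad_U
  proof eventually_elim
    case (elim x)
    have r: "vnorm m x > 0" "Qf (sx x) > 0" using punct_D[of x m 1] elim Qf_bounds[of "sx x"] punct1[of x] mu_pos by (auto simp: S)
    have al: "0 < ?al x" using elim r by simp
    have sq: "(grad_norm m ll Om u x)\<^sup>2 = (\<Sum>a<ll. \<Sum>i<m. (?d u a i x)\<^sup>2)" for u
      unfolding grad_norm_def grad_inner_def power2_eq_square[symmetric] by (rule real_sqrt_pow2) (simp add: sum_nonneg)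
    have vv: "?d v a i x = ?d U a i x - ?d w a i x" if "a < ll" "i < m" for a i
      using elim(1)[rule_format, of a i] that by simp
    have "(?y x)\<^sup>2 = (\<Sum>a<ll. \<Sum>i<m. (?d U a i x)\<^sup>2 + 2 * - (?d U a i x * ?d w a i x) + (?d w a i x)\<^sup>2)"
      unfolding sq by (intro sum.cong refl) (simp add: vv power2_eq_square algebra_simps)
    also have "\<dots> = (?al x)\<^sup>2 + 2 * - ?ip x + (?b x)\<^sup>2"
      unfolding sq grad_inner_def by (simp only: sum.distrib sum_distrib_left[symmetric] sum_negf)
    finally have y: "(?y x)\<^sup>2 = (?al x)\<^sup>2 + 2 * - ?ip x + (?b x)\<^sup>2" .
    have "\<bar>?ip x\<bar> \<le> ?al x * ?b x"
    proof -
      have e: "?ip x = (\<Sum>z\<in>{..<ll}\<times>{..<m}. (case z of (a, i) \<Rightarrow> ?d U a i x) * (case z of (a, i) \<Rightarrow> ?d w a i x))"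
        unfolding grad_inner_def by (simp add: sum.cartesian_product case_prod_beta')
      have "\<bar>?ip x\<bar> \<le> (\<Sum>z\<in>{..<ll}\<times>{..<m}. \<bar>case z of (a, i) \<Rightarrow> ?d U a i x\<bar> * \<bar>case z of (a, i) \<Rightarrow> ?d w a i x\<bar>)"
        unfolding e abs_mult[symmetric] by (rule sum_abs)
      also have "\<dots> \<le> ?al x * ?b x" unfolding grad_norm_L2 by (rule L2_set_mult_ineq)
      finally show ?thesis .
    qed
    then have ip: "\<bar>- ?ip x\<bar> \<le> ?al x * ?b x" by simp
    show ?case
      using c(2)[unfolded powr_gap_def, rule_format, OF al grad_norm_nonneg ip grad_norm_nonneg y] by (simp add: mult.assoc)
  qed
  have E: "energy m ll p Om u = integral\<^sup>L MB (\<lambda>x. grad_norm m ll Om u x powr p)" for u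
    unfolding energy_def lebball_integral ..
  have iE: "integrable MB (\<lambda>x. grad_norm m ll Om u x powr p)" "grad_norm m ll Om u \<in> borel_measurable MB" if "u \<in> W1p m ll p Om" for u
    using Lp_grad_norm[OF mp(2,1) that] grad_norm_nonneg by (auto simp: Lp_iff)
  define xi where "xi x = ?al x powr (p - 2) * min ((?b x)\<^sup>2) (?al x * ?b x)" for x
  have xi0: "0 \<le> xi x" for x unfolding xi_def using grad_norm_nonneg by (intro mult_nonneg_nonneg) auto
  have mxi: "xi \<in> borel_measurable MB"
    unfolding xi_def[abs_def] using iE(2)[OF U_W1p] iE(2)[OF wW] by measurable
  \<comment> \<open>Integrability of the gain is read off from the convexity inequality itself,
    whose other terms are integrable.\<close>
  have ixi: "integrable MB xi"
  proof (rule Bochner_Integration.integrable_bound[OF _ mxi])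
    show "integrable MB (\<lambda>x. (?y x powr p - ?al x powr p + p * (?al x powr (p - 2) * ?ip x)) / c)"
      using iE(1)[OF vW] iE(1)[OF U_W1p] fv(1) by (intro integrable_divide Bochner_Integration.integrable_add Bochner_Integration.integrable_diff integrable_mult_right) auto
    show "AE x in MB. norm (xi x) \<le> norm ((?y x powr p - ?al x powr p + p * (?al x powr (p - 2) * ?ip x)) / c)"
      using key
    proof eventually_elim
      case (elim x)
      then have "c * xi x \<le> ?y x powr p - ?al x powr p + p * (?al x powr (p - 2) * ?ip x)" by (simp add: xi_def)
      then have "xi x \<le> (?y x powr p - ?al x powr p + p * (?al x powr (p - 2) * ?ip x)) / c" using c(1) by (simp add: pos_le_divide_eq mult.commute)
      then show ?case unfolding real_norm_def using xi0[of x] by linarith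
    qed
  qed
  define X where "X = integral\<^sup>L MB xi"
  have X0: "0 \<le> X" unfolding X_def using xi0 by simp
  define H where "H = integral\<^sup>L MB (\<lambda>x. vnorm m x powr (- p) * bowl ll (w x))"
  define K where "K = integral\<^sup>L MB (\<lambda>x. min (vnorm m x powr (2 - p) * (?b x)\<^sup>2 / kap) (vnorm m x powr (1 - p) * ?b x))"
  note hd = hardy[OF m2 p1 pm W wn, folded kap_def]
  have hK: "kap * H \<le> 2 * K" unfolding H_def K_def by (rule hd(3))
  define D where "D = 200 * 2 powr (p / 2) * MX"
  have KX: "KU * K \<le> D * X"
    unfolding K_def X_def integral_mult_right_zero[symmetric]
  proof (rule integral_mono_AE)
    show "AE x in MB. KU * min (vnorm m x powr (2 - p) * (?b x)\<^sup>2 / kap) (vnorm m x powr (1 - p) * ?b x) \<le> D * xi x"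
      using AE_grad_U
    proof eventually_elim
      case (elim x)
      then have x: "x \<in> punct m 1" by simp
      have Q: "mu \<le> Qf (sx x)" "Qf (sx x) \<le> 4 * mu" using Qf_bounds[of "sx x"] punct1[OF x] by (auto simp: S)
      show ?case unfolding D_def xi_def
        by (rule hardy_weight_le[OF Q _ grad_norm_nonneg]) (use punct_D[OF x] elim in \<open>auto simp: Lam_eq\<close>)
    qed
  qed (use hd(2) ixi in simp_all)
  have "integral\<^sup>L MB (\<lambda>x. vnorm m x powr (- p) * (\<Sum>a<ll. Av a x * w x a)) \<le> integral\<^sup>L MB (\<lambda>x. (KU * 602) * (vnorm m x powr (- p) * bowl ll (w x)))"
  proof (rule integral_mono_AE[OF fv(2)])
    show "AE x in MB. vnorm m x powr (- p) * (\<Sum>a<ll. Av a x * w x a) \<le> (KU * 602) * (vnorm m x powr (- p) * bowl ll (w x))"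
      using sup wn
    proof eventually_elim
      case (elim x)
      have "(\<Sum>a<ll. Av a x * w x a) = - (\<Sum>a<ll. Av a x * (v x a - U x a))"
        unfolding sum_negf[symmetric] by (intro sum.cong refl) (simp add: wa algebra_simps)
      also have "\<dots> \<le> KU * (\<Sum>a<ll. (v x a - U x a)\<^sup>2)"
        using normal_inequality[of x "v x"] elim by (simp add: abs_le_iff)
      also have "(\<Sum>a<ll. (v x a - U x a)\<^sup>2) = (vnorm ll (w x))\<^sup>2"
        unfolding vnorm_sq by (intro sum.cong refl) (simp add: wa power2_commute)
      also have "KU * \<dots> \<le> KU * (602 * bowl ll (w x))"
        using bowl_lower[of ll "w x" 600] elim KU_pos by (intro mult_left_mono) auto
      finally have "vnorm m x powr (- p) * (\<Sum>a<ll. Av a x * w x a) \<le> vnorm m x powr (- p) * (KU * (602 * bowl ll (w x)))"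
        by (intro mult_left_mono) auto
      then show ?case by (simp add: mult_ac)
    qed
  qed (use hd(1) in simp)
  then have ipH: "integral\<^sup>L MB (\<lambda>x. ?al x powr (p - 2) * ?ip x) \<le> KU * 602 * H"
    unfolding fv(3) H_def by simp
  have kH: "KU * H \<le> (2 / kap) * (D * X)"
  proof -
    have "H \<le> 2 / kap * K" using hK kap_pos by (simp add: field_simps)
    then have "KU * H \<le> KU * (2 / kap * K)" using KU_pos by (intro mult_left_mono) auto
    also have "\<dots> = 2 / kap * (KU * K)" by simp
    also have "\<dots> \<le> 2 / kap * (D * X)" using KX kap_pos by (intro mult_left_mono) auto
    finally show ?thesis .
  qed
  have "energy m ll p Om U - p * integral\<^sup>L MB (\<lambda>x. ?al x powr (p - 2) * ?ip x) + c * X \<le> energy m ll p Om v"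
  proof -
    have "integral\<^sup>L MB (\<lambda>x. ?al x powr p + p * (?al x powr (p - 2) * - ?ip x) + c * xi x) \<le> energy m ll p Om v"
      unfolding E
    proof (rule integral_mono_AE)
      show "integrable MB (\<lambda>x. ?al x powr p + p * (?al x powr (p - 2) * - ?ip x) + c * xi x)"
        using iE(1)[OF U_W1p] fv(1) ixi by (intro Bochner_Integration.integrable_add integrable_mult_right) auto
    qed (use iE(1)[OF vW] key in \<open>simp_all add: xi_def\<close>)
    also have "integral\<^sup>L MB (\<lambda>x. ?al x powr p + p * (?al x powr (p - 2) * - ?ip x) + c * xi x) =
      energy m ll p Om U - p * integral\<^sup>L MB (\<lambda>x. ?al x powr (p - 2) * ?ip x) + c * X"
      unfolding E X_def using iE(1)[OF U_W1p] fv(1) ixi by simp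
    finally show ?thesis .
  qed
  moreover have "p * integral\<^sup>L MB (\<lambda>x. ?al x powr (p - 2) * ?ip x) \<le> Ctot * X"
  proof -
    have "p * integral\<^sup>L MB (\<lambda>x. ?al x powr (p - 2) * ?ip x) \<le> p * (602 * (KU * H))"
      using ipH p1 by (intro mult_left_mono) (auto simp: mult_ac)
    also have "\<dots> \<le> p * (602 * ((2 / kap) * (D * X)))" using kH p1 by (intro mult_left_mono) auto
    also have "\<dots> = Ctot * X" unfolding Ctot_def D_def by simp
    finally show ?thesis .
  qed
  moreover have "Ctot * X \<le> c / 2 * X" using Ct X0 by (rule mult_right_mono)
  ultimately have gap: "energy m ll p Om U + c / 2 * X \<le> energy m ll p Om v" by (simp add: field_simps)
  \<comment> \<open>For X = 0 the Hardy integral of \<open>bowl\<close> vanishes as well, hence w =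
    0 almost everywhere.\<close>
  have "AE x in MB. v x = U x" if "X = 0"
  proof -
    have "KU * H \<le> 0" using kH that by simp
    then have "H \<le> 0" using KU_pos by (simp add: mult_le_0_iff)
    moreover have "0 \<le> H" unfolding H_def using bowl_nonneg by simp
    ultimately have "H = 0" by simp
    then have "AE x in MB. vnorm m x powr (- p) * bowl ll (w x) = 0"
      unfolding H_def using integral_nonneg_eq_0_iff_AE[OF hd(1)] bowl_nonneg by simp
    then show ?thesis using sup wn
    proof eventually_elim
      case (elim x)
      have "vnorm m x > 0" using elim punct_D[of x m 1] by simp
      then have "bowl ll (w x) = 0" using elim by simp
      then have "(vnorm ll (w x))\<^sup>2 \<le> 0" using bowl_lower[of ll "w x" 600] elim by simp
      then have "vnorm ll (w x) = 0" by simp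
      then have "w x a = 0" if "a < ll" for a using vnorm_component[OF that, of "w x"] by simp
      then show "v x = U x" using N_Rn elim wa by (intro Rn_eqI[of _ ll]) auto
    qed
  qed
  with gap X0 show ?thesis by blast
qed

lemma U_unique_minimizing:
  assumes "0 < c" "powr_gap p c"
    and "Ctot \<le> c / 2"
  shows "unique_minimizing m ll p Om N U"
  unfolding unique_minimizing_def minimizing_def
proof (intro conjI ballI impI U_W1p_into)
  fix v assume v: "v \<in> W1p_into m ll p Om N" and w: "(\<lambda>x. vdiff ll (U x) (v x)) \<in> W01p m ll p Om"
  obtain X where X: "X \<ge> 0" "energy m ll p Om U + c / 2 * X \<le> energy m ll p Om v" "X = 0 \<longrightarrow> (AE x in MB. v x = U x)"
    using energy_gap[OF assms v w] by blast
  have cX: "0 \<le> c / 2 * X" using X(1) assms(1) by simp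
  show "energy m ll p Om U \<le> energy m ll p Om v" using X(2) cX by linarith
  assume "energy m ll p Om U = energy m ll p Om v"
  with X(2) cX have "c / 2 * X = 0" by linarith
  then have "X = 0" using assms(1) by simp
  then show "AE x in leb m. x \<in> Om \<longrightarrow> v x = U x" using X(3) unfolding lebball_AE by simp
qed

end

section \<open>Convergence of blow-ups\<close>

text \<open>A nonempty open box has positive measure; this locates points with a property known
  almost everywhere.\<close>

lemma AE_leb_obox:
  assumes P: "AE x in leb m. P x" and ab: "\<And>i. i < m \<Longrightarrow> a i < b i"
  shows "\<exists>x\<in>obox m a b. P x"
proof (rule ccontr)
  assume "\<not> (\<exists>x\<in>obox m a b. P x)"
  then have "AE x in leb m. x \<notin> obox m a b" using P by (auto elim: eventually_mono)
  then have "AE x in lebP {..<m}. x \<notin> obox m a b" unfolding leb_def AE_completion_iff .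
  then have "obox m a b \<in> null_sets (lebP {..<m})" using AE_iff_null_sets[OF obox_sets] by blast
  then have "emeasure (lebP {..<m}) (obox m a b) = 0" by auto
  have "emeasure (lebP {..<m}) (obox m a b) = (\<Prod>i<m. emeasure lborel {a i<..<b i})"
    unfolding obox_def by (rule lborel_prod.emeasure_PiM) auto
  also have "\<dots> = (\<Prod>i<m. ennreal (b i - a i))" using ab by (intro prod.cong refl) (simp add: less_imp_le)
  also have "\<dots> \<noteq> 0" using ab by (force simp: prod_zero_iff ennreal_eq_0_iff not_le)
  finally show False using \<open>emeasure (lebP {..<m}) (obox m a b) = 0\<close> by simp
qed

lemma W1p_cong:
  assumes eq: "\<And>x. x \<in> \<Omega> \<Longrightarrow> f x = g x" and f: "f \<in> W1p m l p \<Omega>"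
  shows "g \<in> W1p m l p \<Omega>"
proof -
  have Lp: "Lp m p \<Omega> (\<lambda>x. g x a)" if "Lp m p \<Omega> (\<lambda>x. f x a)" for a
  proof -
    have "(\<lambda>x. indicat_real \<Omega> x *\<^sub>R f x a) = (\<lambda>x. indicat_real \<Omega> x *\<^sub>R g x a)"
      "(\<lambda>x. indicat_real \<Omega> x *\<^sub>R \<bar>f x a\<bar> powr p) = (\<lambda>x. indicat_real \<Omega> x *\<^sub>R \<bar>g x a\<bar> powr p)"
      using eq by (auto simp: fun_eq_iff indicator_def)
    then show ?thesis using that by (simp only: Lp_def set_borel_measurable_def set_integrable_def)
  qed
  have wk: "has_weak_pd m \<Omega> i (\<lambda>x. g x a) G" if "has_weak_pd m \<Omega> i (\<lambda>x. f x a) G" for i a G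
    by (rule has_weak_pd_cong[OF _ that]) (simp add: eq)
  have fR: "f \<in> \<Omega> \<rightarrow> Rn l" and fa: "\<And>a. a < l \<Longrightarrow> Lp m p \<Omega> (\<lambda>x. f x a)"
    and fw: "\<And>a i. a < l \<Longrightarrow> i < m \<Longrightarrow> \<exists>g. has_weak_pd m \<Omega> i (\<lambda>x. f x a) g \<and> Lp m p \<Omega> g"
    using f by (auto simp: W1p_def)
  have "g \<in> \<Omega> \<rightarrow> Rn l" using fR eq by (auto simp: Pi_iff)
  moreover have "\<exists>G. has_weak_pd m \<Omega> i (\<lambda>x. g x a) G \<and> Lp m p \<Omega> G" if a: "a < l" "i < m" for a i
  proof -
    obtain G where "has_weak_pd m \<Omega> i (\<lambda>x. f x a) G" "Lp m p \<Omega> G" using fw[OF a] by blast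
    then show ?thesis using wk by blast
  qed
  ultimately show ?thesis using Lp fa by (simp add: W1p_def)
qed

text \<open>\<open>wpd\<close> is a choice from a predicate that sees only the values on the domain,
  so functions equal there have literally the same chosen derivatives.\<close>

lemma grad_norm_cong:
  assumes "\<And>x. x \<in> \<Omega> \<Longrightarrow> f x = g x"
  shows "grad_norm m l \<Omega> f x = grad_norm m l \<Omega> g x"
proof -
  have "has_weak_pd m \<Omega> i (\<lambda>x. f x a) = has_weak_pd m \<Omega> i (\<lambda>x. g x a)" for i a
    by (rule ext, rule iffI; erule has_weak_pd_cong[rotated]; simp add: assms)
  then show ?thesis unfolding grad_norm_def grad_inner_def wpd_def by simp
qed

lemma W1p_tendsto_cong:
  assumes eq: "\<And>k x. x \<in> oball m R \<Longrightarrow> f k x = g k x" and f: "W1p_tendsto m l p (oball m R) f u"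
  shows "W1p_tendsto m l p (oball m R) g u"
proof -
  have "W1p_norm m l p (oball m R) (\<lambda>x. vdiff l (f k x) (u x)) = W1p_norm m l p (oball m R) (\<lambda>x. vdiff l (g k x) (u x))" for k
  proof -
    have "grad_norm m l (oball m R) (\<lambda>x. vdiff l (f k x) (u x)) x = grad_norm m l (oball m R) (\<lambda>x. vdiff l (g k x) (u x)) x" for x
      by (rule grad_norm_cong) (simp add: eq)
    moreover have "integral\<^sup>L (lebball m R) (\<lambda>x. vnorm l (vdiff l (f k x) (u x)) powr p) = integral\<^sup>L (lebball m R) (\<lambda>x. vnorm l (vdiff l (g k x) (u x)) powr p)"
      by (rule Bochner_Integration.integral_cong) (simp_all add: space_lebball eq)
    ultimately show ?thesis unfolding W1p_norm_def lebball_integral by simp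
  qed
  moreover have "\<forall>\<^sub>F k in sequentially. g k \<in> W1p m l p (oball m R)"
    using f unfolding W1p_tendsto_def by (auto elim!: eventually_mono intro: W1p_cong[OF eq])
  ultimately show ?thesis using f unfolding W1p_tendsto_def by simp
qed

lemma W1p_tendsto_subseq:
  assumes "W1p_tendsto m l p \<Omega> f u" "filterlim s sequentially sequentially"
  shows "W1p_tendsto m l p \<Omega> (\<lambda>k. f (s k)) u"
  using assms(1) filterlim_compose[OF _ assms(2), of "\<lambda>k. W1p_norm m l p \<Omega> (\<lambda>x. vdiff l (f k x) (u x))"]
    eventually_compose_filterlim[OF _ assms(2)]
  unfolding W1p_tendsto_def by blast

lemma mk_pointwise:
  assumes x: "x \<in> punct m R" and h: "\<And>u. u < ln R \<Longrightarrow> (\<lambda>k. h k u) \<longlonglongrightarrow> h0 u"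
    and Z: "\<And>j u. j < 3 \<Longrightarrow> u < ln R \<Longrightarrow> (\<lambda>k. Z k j u) \<longlonglongrightarrow> Z0 j u" and a: "a < 2 * m + 3"
  shows "(\<lambda>k. mk m (h k) (Z k) x a) \<longlonglongrightarrow> mk m h0 Z0 x a"
proof (rule index_cases[OF a])
  have u: "ln (vnorm m x) < ln R" using punct_D[OF x] by simp
  show ?thesis if "a < m"
    unfolding mk_cases(1)[OF x that] dirc_eq[OF x] by (intro tendsto_intros h[OF u])
  show ?thesis if j: "a = m + j" "j < 3" for j
    unfolding j(1) mk_cases(3)[OF x j(2)] by (rule Z[OF j(2) u])
  show ?thesis if b: "a = m + 3 + b" "b < m" for b
    unfolding b(1) mk_cases(2)[OF x b(2)] dirc_eq[OF x] by (intro tendsto_intros h[OF u])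
qed

lemma L2_double_le:
  fixes f :: "nat \<Rightarrow> nat \<Rightarrow> real"
  shows "L2_set (\<lambda>(a, i). f a i) ({..<l}\<times>{..<m}) \<le> (\<Sum>a<l. \<Sum>i<m. \<bar>f a i\<bar>)"
  using L2_set_le_sum_abs[of "\<lambda>(a, i). f a i" "{..<l}\<times>{..<m}"] by (simp add: sum.cartesian_product case_prod_beta')

text \<open>Dominated convergence with a common constant C: values are dominated by a constant,
  gradients by a multiple of 1 / |x|, whose p-th power is integrable for p < m.\<close>

lemma mk_tendsto_all:
  fixes p C R :: real and m :: nat
  assumes m2: "m \<ge> 2" and p: "1 < p" "p < m"
    and B: "\<And>k. Bd R C (h k)" "\<And>k j. j < 3 \<Longrightarrow> Bd R C (Z k j)" and B0: "Bd R C h0" "\<And>j. j < 3 \<Longrightarrow> Bd R C (Z0 j)"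
    and h: "\<And>u. u < ln R \<Longrightarrow> (\<lambda>k. h k u) \<longlonglongrightarrow> h0 u" "\<And>u. u < ln R \<Longrightarrow> (\<lambda>k. deriv (h k) u) \<longlonglongrightarrow> deriv h0 u"
    and Z: "\<And>j u. j < 3 \<Longrightarrow> u < ln R \<Longrightarrow> (\<lambda>k. Z k j u) \<longlonglongrightarrow> Z0 j u"
      "\<And>j u. j < 3 \<Longrightarrow> u < ln R \<Longrightarrow> (\<lambda>k. deriv (Z k j) u) \<longlonglongrightarrow> deriv (Z0 j) u"
  shows "W1p_tendsto m (2 * m + 3) p (oball m R) (\<lambda>k. mk m (h k) (Z k)) (mk m h0 Z0)"
proof -
  let ?l = "2 * m + 3" and ?O = "oball m R" and ?M = "lebball m R"
  let ?f = "\<lambda>k. mk m (h k) (Z k)" and ?g = "mk m h0 Z0"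
  have mp: "m > 0" "1 \<le> p" using m2 p by auto
  have W: "?f k \<in> W1p m ?l p ?O" for k by (rule mk_W1p[OF B(1) B(2) m2 p])
  have W0: "?g \<in> W1p m ?l p ?O" by (rule mk_W1p[OF B0 m2 p])
  have Wd: "(\<lambda>x. vdiff ?l (?f k x) (?g x)) \<in> W1p m ?l p ?O" for k by (rule vdiff_W1p[OF mp(2,1) W W0])
  have AEp: "AE x in ?M. x \<in> punct m R"
    by (rule AE_lebball_punct[OF mp(1)])
  have pl: "(\<lambda>k. ?f k x a) \<longlonglongrightarrow> ?g x a" if "x \<in> punct m R" "a < ?l" for x a
    by (rule mk_pointwise[OF that(1) h(1) Z(1) that(2)])
  have dl: "(\<lambda>k. pd i (\<lambda>x. ?f k x a) x) \<longlonglongrightarrow> pd i (\<lambda>x. ?g x a) x" if x: "x \<in> punct m R" and a: "a < ?l" and i: "i < m" for x a i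
  proof (rule index_cases[OF a])
    have u: "ln (vnorm m x) < ln R" "vnorm m x \<noteq> 0" using punct_D[OF x] by auto
    have sm: "smooth1 {..<ln R} (h k)" "smooth1 {..<ln R} h0" for k using B(1) B0(1) by (auto simp: Bd_def)
    have dd: "(\<lambda>k. pd i (dirc m (h k) b) x) \<longlonglongrightarrow> pd i (dirc m h0 b) x" for b
      unfolding dirc_pd[OF sm(1) x i] dirc_pd[OF sm(2) x i] using u by (intro tendsto_intros h) auto
    show ?thesis if "a < m"
      using dd that by (simp add: mk_pd(1)[OF B(1) B(2) m2 x i that] mk_pd(1)[OF B0 m2 x i that])
    show ?thesis if b: "a = m + 3 + b" "b < m" for b
    proof -
      have "pd i (\<lambda>x. ?f k x a) x = pd i (dirc m (h k) b) x" for k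
        unfolding b(1) by (rule mk_pd(3)[OF B(1) _ m2 x i b(2)]) (rule B(2))
      moreover have "pd i (\<lambda>x. ?g x a) x = pd i (dirc m h0 b) x"
        unfolding b(1) by (rule mk_pd(3)[OF B0(1) _ m2 x i b(2)]) (rule B0(2))
      ultimately show ?thesis using dd by simp
    qed
    show ?thesis if j: "a = m + j" "j < 3" for j
    proof -
      have sj: "smooth1 {..<ln R} (Z k j)" "smooth1 {..<ln R} (Z0 j)" for k using B(2)[OF j(2)] B0(2)[OF j(2)] by (auto simp: Bd_def)
      have "pd i (\<lambda>x. ?f k x a) x = pd i (\<lambda>x. Z k j (ln (vnorm m x))) x" for k
        unfolding j(1) by (rule mk_pd(2)[OF B(1) _ m2 x i j(2)]) (rule B(2))
      moreover have "pd i (\<lambda>x. ?g x a) x = pd i (\<lambda>x. Z0 j (ln (vnorm m x))) x"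
        unfolding j(1) by (rule mk_pd(2)[OF B0(1) _ m2 x i j(2)]) (rule B0(2))
      moreover have "(\<lambda>k. pd i (\<lambda>x. Z k j (ln (vnorm m x))) x) \<longlonglongrightarrow> pd i (\<lambda>x. Z0 j (ln (vnorm m x))) x"
        unfolding rad_pd[OF sj(1) x i] rad_pd[OF sj(2) x i]
        using u by (intro tendsto_intros Z j) auto
      ultimately show ?thesis by simp
    qed
  qed
  define I where "I k = integral\<^sup>L ?M (\<lambda>x. vnorm ?l (vdiff ?l (?f k x) (?g x)) powr p)" for k
  define G where "G k = integral\<^sup>L ?M (\<lambda>x. grad_norm m ?l ?O (\<lambda>x. vdiff ?l (?f k x) (?g x)) x powr p)" for k
  have to0: "(\<lambda>k. X k powr p) \<longlonglongrightarrow> 0" if "\<And>k. 0 \<le> X k" "\<And>k. X k \<le> Y k" "Y \<longlonglongrightarrow> 0" for X Y :: "nat \<Rightarrow> real"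
  proof -
    have "X \<longlonglongrightarrow> 0" by (rule tendsto_sandwich[OF _ _ tendsto_const that(3)]) (use that in auto)
    then have "(\<lambda>k. X k powr p) \<longlonglongrightarrow> 0 powr p" using p that by (intro tendsto_powr') auto
    then show ?thesis using p by simp
  qed
  have "I \<longlonglongrightarrow> integral\<^sup>L ?M (\<lambda>x. 0)"
    unfolding I_def
  proof (rule integral_dominated_convergence[where w = "\<lambda>x. (?l * (2 * C)) powr p"])
    show "(\<lambda>x. vnorm ?l (vdiff ?l (?f k x) (?g x)) powr p) \<in> borel_measurable ?M" for k
      using Lp_vnorm[OF mp(2,1) Wd, of k] unfolding Lp_iff by (intro powr_real_measurable measurable_const) auto
    have le: "vnorm ?l (vdiff ?l (?f k x) (?g x)) \<le> (\<Sum>a<?l. \<bar>?f k x a - ?g x a\<bar>)" for k x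
      using L2_set_le_sum_abs[of "vdiff ?l (?f k x) (?g x)" "{..<?l}"] by (simp add: vnorm_def vdiff_def)
    show "AE x in ?M. (\<lambda>k. vnorm ?l (vdiff ?l (?f k x) (?g x)) powr p) \<longlonglongrightarrow> 0"
      using AEp
    proof eventually_elim
      case (elim x)
      have "(\<lambda>k. \<Sum>a<?l. \<bar>?f k x a - ?g x a\<bar>) \<longlonglongrightarrow> (\<Sum>a<?l. 0)"
        using pl[OF elim] by (intro tendsto_sum tendsto_rabs_zero) (simp add: LIM_zero)
      then show ?case by (intro to0[OF vnorm_nonneg le]) simp
    qed
    show "AE x in ?M. norm (vnorm ?l (vdiff ?l (?f k x) (?g x)) powr p) \<le> (?l * (2 * C)) powr p" for k
      using AEp
    proof eventually_elim
      case (elim x)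
      have "\<bar>?f k x a - ?g x a\<bar> \<le> 2 * C" if a: "a < ?l" for a
      proof -
        have "\<bar>?f k x a\<bar> \<le> C" by (rule mk_bounds(1)[where i = 0, OF B(1) B(2) m2 elim a]) (use m2 in auto)
        moreover have "\<bar>?g x a\<bar> \<le> C" by (rule mk_bounds(1)[where i = 0, OF B0 m2 elim a]) (use m2 in auto)
        ultimately have "\<bar>?f k x a - ?g x a\<bar> \<le> C + C" by (rule order_trans[OF abs_triangle_ineq4 add_mono])
        then show ?thesis by simp
      qed
      then have "(\<Sum>a<?l. \<bar>?f k x a - ?g x a\<bar>) \<le> (\<Sum>a<?l. 2 * C)" by (intro sum_mono) simp
      then have "vnorm ?l (vdiff ?l (?f k x) (?g x)) \<le> ?l * (2 * C)" using le[of k x] by simp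
      then show ?case using p vnorm_nonneg by (simp add: powr_mono2)
    qed
  qed (rule lebball_const_integrable measurable_const; simp)+
  then have I0: "I \<longlonglongrightarrow> 0" by simp
  let ?pd = "\<lambda>k a i x. pd i (\<lambda>x. ?f k x a) x - pd i (\<lambda>x. ?g x a) x"
  have gr: "AE x in ?M. x \<in> punct m R \<and> (\<forall>k. grad_norm m ?l ?O (\<lambda>x. vdiff ?l (?f k x) (?g x)) x = L2_set (\<lambda>(a, i). ?pd k a i x) ({..<?l}\<times>{..<m}))"
  proof -
    have "AE x in ?M. \<forall>k. \<forall>a\<in>{..<?l}. \<forall>i\<in>{..<m}. wpd m ?O i (\<lambda>x. vdiff ?l (?f k x) (?g x) a) x = ?pd k a i x"
      unfolding AE_all_countable
    proof (intro allI AE_finite_allI finite_lessThan)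
      fix k a i assume "a \<in> {..<?l}" "i \<in> {..<m}"
      then have a: "a < ?l" "i < m" by auto
      show "AE x in ?M. wpd m ?O i (\<lambda>x. vdiff ?l (?f k x) (?g x) a) x = ?pd k a i x"
      proof -
        have "AE x in ?M. wpd m ?O i (\<lambda>x. ?f k x a) x = pd i (\<lambda>x. ?f k x a) x" by (rule mk_wpd[OF B(1) B(2) m2 a])
        moreover have "AE x in ?M. wpd m ?O i (\<lambda>x. ?g x a) x = pd i (\<lambda>x. ?g x a) x" by (rule mk_wpd[OF B0 m2 a])
        ultimately show ?thesis using wpd_vdiff[OF mp(2,1) W[of k] W0 a] by eventually_elim simp
      qed
    qed
    with AEp show ?thesis
    proof eventually_elim
      case (elim x)
      then show ?case unfolding grad_norm_L2 by (auto intro!: L2_set_cong)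
    qed
  qed
  have "G \<longlonglongrightarrow> integral\<^sup>L ?M (\<lambda>x. 0)"
    unfolding G_def
  proof (rule integral_dominated_convergence[where w = "\<lambda>x. (?l * (m * (6 * C))) powr p * vnorm m x powr (- p)"])
    show "(\<lambda>x. grad_norm m ?l ?O (\<lambda>x. vdiff ?l (?f k x) (?g x)) x powr p) \<in> borel_measurable ?M" for k
      using Lp_grad_norm[OF mp(2,1) Wd, of k] unfolding Lp_iff by (intro powr_real_measurable measurable_const) auto
    show "integrable ?M (\<lambda>x. (?l * (m * (6 * C))) powr p * vnorm m x powr (- p))"
      using p by (intro integrable_mult_right vnorm_powr_integrable) auto
    show "AE x in ?M. (\<lambda>k. grad_norm m ?l ?O (\<lambda>x. vdiff ?l (?f k x) (?g x)) x powr p) \<longlonglongrightarrow> 0"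
      using gr
    proof eventually_elim
      case (elim x)
      have "(\<lambda>k. \<Sum>a<?l. \<Sum>i<m. \<bar>?pd k a i x\<bar>) \<longlonglongrightarrow> (\<Sum>a<?l. \<Sum>i<m. 0)"
        using dl elim by (intro tendsto_sum tendsto_rabs_zero) (simp add: LIM_zero)
      then show ?case using elim L2_double_le by (intro to0[OF grad_norm_nonneg]) auto
    qed
    show "AE x in ?M. norm (grad_norm m ?l ?O (\<lambda>x. vdiff ?l (?f k x) (?g x)) x powr p) \<le> (?l * (m * (6 * C))) powr p * vnorm m x powr (- p)" for k
      using gr
    proof eventually_elim
      case (elim x)
      then have x: "x \<in> punct m R" by simp
      have r: "vnorm m x > 0" and C0: "C \<ge> 0" using punct_D[OF x] C_nonneg[where Z = Z0, OF B0(1) _ m2 x] B0(2) by auto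
      have "\<bar>?pd k a i x\<bar> \<le> 6 * C / vnorm m x" if a: "a < ?l" "i < m" for a i
      proof -
        have "\<bar>pd i (\<lambda>x. ?f k x a) x\<bar> \<le> 3 * C / vnorm m x" by (rule mk_bounds(2)[OF B(1) B(2) m2 x a])
        moreover have "\<bar>pd i (\<lambda>x. ?g x a) x\<bar> \<le> 3 * C / vnorm m x" by (rule mk_bounds(2)[OF B0 m2 x a])
        ultimately have "\<bar>?pd k a i x\<bar> \<le> 3 * C / vnorm m x + 3 * C / vnorm m x"
          by (rule order_trans[OF abs_triangle_ineq4 add_mono])
        then show ?thesis by simp
      qed
      then have "(\<Sum>a<?l. \<Sum>i<m. \<bar>?pd k a i x\<bar>) \<le> (\<Sum>a<?l. \<Sum>i<m. 6 * C / vnorm m x)" by (intro sum_mono) simp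
      then have "grad_norm m ?l ?O (\<lambda>x. vdiff ?l (?f k x) (?g x)) x \<le> (?l * (m * (6 * C))) / vnorm m x"
        using elim L2_double_le[of "\<lambda>a i. ?pd k a i x" ?l m] by simp
      then have "grad_norm m ?l ?O (\<lambda>x. vdiff ?l (?f k x) (?g x)) x powr p \<le> ((?l * (m * (6 * C))) / vnorm m x) powr p"
        using p grad_norm_nonneg by (intro powr_mono2) auto
      also have "\<dots> = (?l * (m * (6 * C))) powr p * vnorm m x powr (- p)"
        using r C0 by (simp add: powr_divide powr_minus_divide)
      finally show ?case by simp
    qed
  qed simp
  then have G0: "G \<longlonglongrightarrow> 0" by simp
  have IG: "0 \<le> I k" "0 \<le> G k" for k unfolding I_def G_def by simp_all
  have "(\<lambda>k. (I k + G k) powr (1 / p)) \<longlonglongrightarrow> (0 + 0) powr (1 / p)"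
    using p IG by (intro tendsto_powr' tendsto_add I0 G0 tendsto_const) auto
  then have "(\<lambda>k. W1p_norm m ?l p ?O (\<lambda>x. vdiff ?l (?f k x) (?g x))) \<longlonglongrightarrow> 0"
    unfolding W1p_norm_def lebball_integral I_def G_def using p by simp
  then show ?thesis unfolding W1p_tendsto_def using W W0 by simp
qed

text \<open>On a fixed ball the bounds hold only once the scale is small, so an initial segment is
  dropped.\<close>

lemma mk_tendsto:
  fixes p C R :: real and m :: nat
  assumes m2: "m \<ge> 2" and p: "1 < p" "p < m"
    and B: "\<forall>\<^sub>F k in sequentially. Bd R C (h k) \<and> (\<forall>j<3. Bd R C (Z k j))" and B0: "Bd R C h0" "\<And>j. j < 3 \<Longrightarrow> Bd R C (Z0 j)"
    and h: "\<And>u. u < ln R \<Longrightarrow> (\<lambda>k. h k u) \<longlonglongrightarrow> h0 u" "\<And>u. u < ln R \<Longrightarrow> (\<lambda>k. deriv (h k) u) \<longlonglongrightarrow> deriv h0 u"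
    and Z: "\<And>j u. j < 3 \<Longrightarrow> u < ln R \<Longrightarrow> (\<lambda>k. Z k j u) \<longlonglongrightarrow> Z0 j u"
      "\<And>j u. j < 3 \<Longrightarrow> u < ln R \<Longrightarrow> (\<lambda>k. deriv (Z k j) u) \<longlonglongrightarrow> deriv (Z0 j) u"
  shows "W1p_tendsto m (2 * m + 3) p (oball m R) (\<lambda>k. mk m (h k) (Z k)) (mk m h0 Z0)"
proof -
  obtain n where n: "\<And>k. k \<ge> n \<Longrightarrow> Bd R C (h k) \<and> (\<forall>j<3. Bd R C (Z k j))"
    using B unfolding eventually_sequentially by blast
  have "W1p_tendsto m (2 * m + 3) p (oball m R) (\<lambda>k. mk m (h (k + n)) (Z (k + n))) (mk m h0 Z0)"
    by (rule mk_tendsto_all[OF m2 p _ _ B0]) (use n in \<open>auto intro!: LIMSEQ_ignore_initial_segment h Z\<close>)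
  then show ?thesis
    unfolding W1p_tendsto_def
    using eventually_sequentially_seg[of "\<lambda>k. mk m (h k) (Z k) \<in> W1p m (2 * m + 3) p (oball m R)" n]
      LIMSEQ_offset[of "\<lambda>k. W1p_norm m (2 * m + 3) p (oball m R) (\<lambda>x. vdiff (2 * m + 3) (mk m (h k) (Z k) x) (mk m h0 Z0 x))" n]
    by blast
qed

section \<open>The singularity and its tangent maps\<close>

lemma tendsto_coordinates:
  fixes X :: "'b \<Rightarrow> nat \<Rightarrow> real"
  assumes "\<And>i. ((\<lambda>k. X k i) \<longlongrightarrow> x i) F"
  shows "(X \<longlongrightarrow> x) F"
proof -
  have "limitin (product_topology (\<lambda>i. euclidean) UNIV) X x F"
    unfolding limitin_componentwise using assms by simp
  then show ?thesis unfolding euclidean_product_topology by simp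
qed

lemma ae_eq_class: "(S, T) \<in> ae_eq m \<Longrightarrow> ae_eq m `` {S} = ae_eq m `` {T}"
proof -
  assume ST: "(S, T) \<in> ae_eq m"
  have st: "AE x in leb m. S x = T x" using ST by (simp add: ae_eq_def)
  have "(AE x in leb m. S x = V x) \<longleftrightarrow> (AE x in leb m. T x = V x)" for V
    using st by (auto elim: eventually_elim2)
  then show ?thesis by (auto simp: ae_eq_def)
qed

text \<open>Dilation by r is translation by c = ln r; the condition keeps the shifted argument in
  the original domain.\<close>

lemma Bd_shift:
  assumes h: "Bd 1 C h" and c: "ln R + c \<le> 0"
  shows "Bd R C (\<lambda>u. h (u + c))"
    and "u < ln R \<Longrightarrow> deriv (\<lambda>u. h (u + c)) u = deriv h (u + c)"
proof -
  have sm: "smooth1 {..<0} h" using h by (simp add: Bd_def)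
  have d: "deriv (\<lambda>u. h (u + c)) u = deriv h (u + c)" if u: "u < ln R" for u
  proof (rule DERIV_imp_deriv)
    have "(h has_real_derivative deriv h (u + c)) (at (u + c))"
      by (rule smooth1_DERIV[OF sm]) (use u c in simp)
    moreover have "((\<lambda>u. u + c) has_real_derivative 1) (at u)" by (auto intro!: derivative_eq_intros)
    ultimately show "((\<lambda>u. h (u + c)) has_real_derivative deriv h (u + c)) (at u)"
      using DERIV_chain2[of h _ "\<lambda>u. u + c" u 1 UNIV] by simp
  qed
  then show "u < ln R \<Longrightarrow> deriv (\<lambda>u. h (u + c)) u = deriv h (u + c)" .
  have "smooth1 {..<ln R} (\<lambda>u. h (u + c))"
    by (rule smooth1_compose[OF sm smooth1_add[OF smooth1_id smooth1_const]]) (use c in auto)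
  then show "Bd R C (\<lambda>u. h (u + c))" using h c d unfolding Bd_def by auto
qed

context spiral
begin

text \<open>A thin box along the first axis has positive measure, so it contains a point where v =
  U. There |x 0| is at least half of |x| and rho is at least 1/2, which gives 1/4.\<close>

lemma U_near_pole:
  assumes \<sigma>: "\<sigma> = 1 \<or> \<sigma> = -1" and \<eta>: "0 < \<eta>" "\<eta> \<le> 1 / 2" and ae: "AE x in leb m. x \<in> Om \<longrightarrow> v x = U x"
  shows "\<exists>x\<in>Om. x \<noteq> origin m \<and> v x = U x \<and> (\<forall>i<m. \<bar>x i\<bar> \<le> \<eta>) \<and> 1 / 4 \<le> \<sigma> * U x 0"
proof -
  \<comment> \<open>The width \<eta> / (2 m) makes the remaining coordinates add up to at most
    \<eta> / 2, which is below |x 0|; \<sigma> selects the end of the axis.\<close>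
  define a where "a i = (if i = 0 then (if \<sigma> = 1 then \<eta> / 2 else - \<eta>) else - (\<eta> / (2 * m)))" for i :: nat
  define b where "b i = (if i = 0 then (if \<sigma> = 1 then \<eta> else - (\<eta> / 2)) else \<eta> / (2 * m))" for i :: nat
  have m0: "0 < real m" using m2 by simp
  have "\<exists>x\<in>obox m a b. x \<in> Om \<longrightarrow> v x = U x"
    by (rule AE_leb_obox[OF ae]) (use \<eta> m0 in \<open>auto simp: a_def b_def\<close>)
  then obtain x where x: "x \<in> obox m a b" "x \<in> Om \<longrightarrow> v x = U x" by blast
  have xR: "x \<in> Rn m" and xi: "\<And>i. i < m \<Longrightarrow> a i < x i \<and> x i < b i"
    using x(1) by (auto simp: obox_def Rn_def PiE_iff)
  have x0: "\<eta> / 2 < \<sigma> * x 0" "\<sigma> * x 0 < \<eta>" using xi[of 0] m2 \<sigma> by (auto simp: a_def b_def split: if_splits)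
  have ab0: "\<bar>x 0\<bar> = \<sigma> * x 0" using x0 \<eta> \<sigma> by auto
  have small: "\<bar>x i\<bar> \<le> \<eta> / (2 * m)" if "i < m" "i \<noteq> 0" for i using xi[of i] that by (simp add: a_def b_def abs_le_iff)
  have "vnorm m x \<le> (\<Sum>i<m. \<bar>x i\<bar>)" unfolding vnorm_def by (rule L2_set_le_sum_abs)
  also have "\<dots> = \<bar>x 0\<bar> + (\<Sum>i\<in>{..<m} - {0}. \<bar>x i\<bar>)" using m2 by (intro sum.remove) auto
  also have "(\<Sum>i\<in>{..<m} - {0}. \<bar>x i\<bar>) \<le> (\<Sum>i\<in>{..<m} - {0}. \<eta> / (2 * m))" using small by (intro sum_mono) auto
  also have "\<dots> \<le> (\<Sum>i<m. \<eta> / (2 * m))" using \<eta> by (intro sum_mono2) auto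
  also have "\<dots> = \<eta> / 2" using m0 by simp
  finally have nx: "vnorm m x \<le> 2 * \<bar>x 0\<bar>" using x0 ab0 by linarith
  have xne: "x \<noteq> origin m" using x0 \<eta> m2 by (auto simp: origin_def)
  have xO: "x \<in> Om" using nx x0 ab0 \<eta> xR by (simp add: vball_origin)
  then have xp: "x \<in> punct m 1" using xne by simp
  have r: "vnorm m x > 0" using punct_D[OF xp] by simp
  have "1 / 2 \<le> \<bar>x 0\<bar> / vnorm m x" using nx r by (simp add: field_simps)
  moreover have h: "1 / 2 \<le> hU (ln (vnorm m x))" using rho_bounds[of "sx x"] punct1[OF xp] by (auto simp: hU_def S)
  ultimately have "1 / 2 * (1 / 2) \<le> \<bar>x 0\<bar> / vnorm m x * hU (ln (vnorm m x))" by (intro mult_mono) (auto simp: vnorm_nonneg)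
  also have "\<dots> = \<sigma> * U x 0" unfolding ab0 using xne m2 by (simp add: U_def mk_def)
  finally have "1 / 4 \<le> \<sigma> * U x 0" by simp
  moreover have "\<bar>x i\<bar> \<le> \<eta>" if "i < m" for i
  proof (cases "i = 0")
    case True then show ?thesis using ab0 x0 by simp
  next
    case False
    have "\<eta> / (2 * m) \<le> \<eta> / 1" using \<eta> m2 by (intro divide_left_mono) auto
    then show ?thesis using small[OF that False] by simp
  qed
  ultimately show ?thesis using xO xne x(2) by blast
qed

text \<open>Points near both ends of the first axis converge to the origin, so a continuous
  representative would have a first component that is at least 1/4 and at most - 1/4 there.\<close>

lemma U_singular: "isolated_singularity m ll Om U (origin m)"
  unfolding isolated_singularity_def
proof (intro conjI notI)
  show "\<exists>\<rho>>0. oball m \<rho> \<subseteq> Om \<and> Ck_map 1 m ll (oball m \<rho> - {origin m}) U"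
    unfolding Ck_map_def by (intro exI[of _ 1] conjI allI impI U_Ck) auto
  assume "\<exists>v \<in> Om \<rightarrow> Rn ll. (AE x in leb m. x \<in> Om \<longrightarrow> v x = U x) \<and> continuous (at (origin m) within Om) v"
  then obtain v where ae: "AE x in leb m. x \<in> Om \<longrightarrow> v x = U x" and c: "continuous (at (origin m) within Om) v" by blast
  have lim: "\<exists>L. \<sigma> * v (origin m) 0 \<ge> 1 / 4" if \<sigma>: "\<sigma> = 1 \<or> \<sigma> = -1" for \<sigma> :: real
  proof -
    define \<eta> where "\<eta> k = inverse (real (Suc k)) / 2" for k
    have "0 < \<eta> k" "\<eta> k \<le> 1 / 2" for k by (auto simp: \<eta>_def field_simps)
    then have "\<forall>k. \<exists>x. x\<in>Om \<and> x \<noteq> origin m \<and> v x = U x \<and> (\<forall>i<m. \<bar>x i\<bar> \<le> \<eta> k) \<and> 1 / 4 \<le> \<sigma> * U x 0"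
      using U_near_pole[OF \<sigma> _ _ ae] by blast
    then obtain X where X: "\<And>k. X k \<in> Om" "\<And>k. X k \<noteq> origin m" "\<And>k. v (X k) = U (X k)" "\<And>k i. i < m \<Longrightarrow> \<bar>X k i\<bar> \<le> \<eta> k"
      "\<And>k. 1 / 4 \<le> \<sigma> * U (X k) 0"
      using choice[of "\<lambda>k x. x\<in>Om \<and> x \<noteq> origin m \<and> v x = U x \<and> (\<forall>i<m. \<bar>x i\<bar> \<le> \<eta> k) \<and> 1 / 4 \<le> \<sigma> * U x 0"] by blast
    have \<eta>0: "\<eta> \<longlonglongrightarrow> 0" unfolding \<eta>_def[abs_def] using tendsto_divide[OF LIMSEQ_inverse_real_of_nat tendsto_const, of 2] by simp
    have "X \<longlonglongrightarrow> origin m"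
    proof (rule tendsto_coordinates)
      fix i
      show "(\<lambda>k. X k i) \<longlonglongrightarrow> origin m i"
      proof (cases "i < m")
        case True
        have "(\<lambda>k. X k i) \<longlonglongrightarrow> 0" by (rule Lim_null_comparison[OF _ \<eta>0]) (use X(4)[OF True] in auto)
        then show ?thesis using True by (simp add: origin_def)
      next
        case False
        have "X k i = undefined" for k using X(1)[of k] False by (auto simp: vball_origin Rn_def PiE_iff extensional_def)
        then show ?thesis using False by (simp add: origin_def)
      qed
    qed
    then have "filterlim X (at (origin m) within Om) sequentially" using X(1,2) by (simp add: filterlim_at)
    moreover have "(v \<longlongrightarrow> v (origin m)) (at (origin m) within Om)" using c by (simp add: continuous_within)
    ultimately have "(\<lambda>k. v (X k)) \<longlonglongrightarrow> v (origin m)" by (rule filterlim_compose[rotated])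
    then have "(\<lambda>k. v (X k) 0) \<longlonglongrightarrow> v (origin m) 0"
      by (rule continuous_on_tendsto_compose[OF continuous_on_product_coordinates[of 0]]) auto
    then have "(\<lambda>k. \<sigma> * v (X k) 0) \<longlonglongrightarrow> \<sigma> * v (origin m) 0" by (intro tendsto_intros)
    then have "1 / 4 \<le> \<sigma> * v (origin m) 0" by (rule LIMSEQ_le_const) (use X(3,5) in auto)
    then show ?thesis by blast
  qed
  show False using lim[of 1] lim[of "-1"] by auto
qed

section \<open>Limits of the profiles at the origin\<close>

lemma sL_at_bot: "(sL \<longlongrightarrow> 0) at_bot"
proof -
  have "filterlim (\<lambda>u. T0 + - u) at_top at_bot"
    by (rule filterlim_tendsto_add_at_top[OF tendsto_const filterlim_uminus_at_top_at_bot])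
  then have "filterlim (\<lambda>u. ln (T0 - u)) at_top at_bot" using filterlim_compose[OF ln_at_top] by simp
  then show ?thesis
    unfolding sL_def[abs_def] by (intro tendsto_divide_0[OF tendsto_const] filterlim_at_top_imp_at_infinity)
qed

lemma f_sL_at_bot: "smooth1 S f \<Longrightarrow> ((\<lambda>u. f (sL u)) \<longlongrightarrow> f 0) at_bot"
proof -
  assume f: "smooth1 S f"
  have "isCont f 0" using smooth1_continuous[OF f] S(1) s1 by (simp add: continuous_on_eq_continuous_at S(2))
  then show ?thesis using sL_at_bot by (rule isCont_tendsto_compose)
qed

lemma profile_at_0: "th 0 = 0" "sg 0 = 0" "rho 0 = 1" "Dt f 0 = 0" "J z0 z1 0 = 1"
  by (simp_all add: th_def sg_def Dt_def rho_def Pf_def flat_def J_def Gam_def B1_def B2_def flat_osc_def)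

lemma dZU_at_bot: "(dZU j \<longlongrightarrow> 0) at_bot"
proof (rule Lim_null_comparison)
  have "\<bar>dZU j u\<bar> \<le> \<bar>th (sL u)\<bar> + \<bar>sg (sL u)\<bar>" for u
    using abs_mult_trig[of "th (sL u)" "phL u"] by (simp add: dZU_def add_increasing2)
  then show "\<forall>\<^sub>F u in at_bot. norm (dZU j u) \<le> \<bar>th (sL u)\<bar> + \<bar>sg (sL u)\<bar>" by simp
  have "((\<lambda>u. \<bar>th (sL u)\<bar> + \<bar>sg (sL u)\<bar>) \<longlongrightarrow> \<bar>th 0\<bar> + \<bar>sg 0\<bar>) at_bot"
    by (intro tendsto_intros f_sL_at_bot smooth_S)
  then show "((\<lambda>u. \<bar>th (sL u)\<bar> + \<bar>sg (sL u)\<bar>) \<longlongrightarrow> 0) at_bot" by (simp add: profile_at_0)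
qed

text \<open>The phase diverges, but so slowly that it is asymptotically constant on every bounded
  range of \<open>ln |x|\<close>; blow-ups along radii of equal phase therefore converge.\<close>

lemma phL_shift: "((\<lambda>v. phL (u + v) - phL v) \<longlongrightarrow> 0) at_bot"
proof (rule tendstoI)
  fix e :: real assume e: "e > 0"
  define d where "d = e / (\<bar>u\<bar> + 1)"
  have d: "d > 0" using e by (simp add: d_def)
  have t: "((\<lambda>u. th (sL u)) \<longlongrightarrow> 0) at_bot" using f_sL_at_bot[OF smooth_S(1)] by (simp add: profile_at_0)
  have "\<forall>\<^sub>F w in at_bot. \<bar>th (sL w)\<bar> < d" using tendstoD[OF t d] by (simp add: dist_real_def)
  then obtain V where V: "\<And>w. w \<le> V \<Longrightarrow> \<bar>th (sL w)\<bar> < d" unfolding eventually_at_bot_linorder by blast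
  define V' where "V' = min V (-1)"
  have "\<forall>\<^sub>F v in at_bot. v \<le> V' \<and> v \<le> V' - u" by (intro eventually_conj eventually_le_at_bot)
  then show "\<forall>\<^sub>F v in at_bot. dist (phL (u + v) - phL v) 0 < e"
  proof eventually_elim
    case (elim v)
    have "norm (phL (u + v) - phL v) \<le> d * norm (u + v - v)"
    proof (rule field_differentiable_bound[of "{..V'}"])
      fix z assume z: "z \<in> {..V'}"
      then have "z < 0" by (simp add: V'_def)
      from phL_DERIV[OF this] show "(phL has_field_derivative - th (sL z)) (at z within {..V'})"
        by (rule has_field_derivative_at_within)
      show "norm (- th (sL z)) \<le> d" using V[of z] z by (simp add: V'_def less_imp_le)
    qed (use elim in auto)
    also have "\<dots> \<le> d * \<bar>u\<bar>" by simp
    also have "\<dots> < d * (\<bar>u\<bar> + 1)" using d by simp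
    also have "\<dots> = e" by (simp add: d_def)
    finally show ?case by (simp add: dist_real_def)
  qed
qed

definition Tc :: "real \<Rightarrow> real \<Rightarrow> (nat \<Rightarrow> real) \<Rightarrow> nat \<Rightarrow> real" where
  "Tc c1 c2 = mk m (\<lambda>_. 1) (\<lambda>j _. if j = 0 then c1 else if j = 1 then c2 else 0)"

text \<open>A dilation leaves \<omega> alone and translates ln |x|.\<close>

lemma rescale_eq:
  assumes x: "x \<in> Rn m" and r: "0 < r"
  shows "rescale m U (origin m) r x = mk m (\<lambda>u. hU (u + ln r)) (\<lambda>j u. ZU j (u + ln r)) x"
proof -
  define y where "y = (\<lambda>i\<in>{..<m}. origin m i + r * x i)"
  have y: "y i = r * x i" if "i < m" for i using that by (simp add: y_def origin_def)
  have "vnorm m y = L2_set (\<lambda>i. r * x i) {..<m}" unfolding vnorm_def by (intro L2_set_cong refl) (simp add: y)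
  also have "\<dots> = r * vnorm m x" using r by (simp add: vnorm_def L2_set_right_distrib)
  finally have ny: "vnorm m y = r * vnorm m x" .
  have yR: "y \<in> Rn m" by (simp add: y_def Rn_def)
  have "mk m hU ZU y = mk m (\<lambda>u. hU (u + ln r)) (\<lambda>j u. ZU j (u + ln r)) x"
  proof (cases "x = origin m")
    case True
    then have "y = origin m" using yR y by (intro Rn_eqI[OF yR origin_in]) (simp add: origin_def)
    then show ?thesis using True by (simp add: mk_def)
  next
    case False
    have n: "vnorm m x > 0" by (rule vnorm_pos[OF x False])
    have y0: "y \<noteq> origin m"
    proof
      assume "y = origin m"
      then have "vnorm m y = 0" by (simp add: vnorm_def L2_set_def origin_def)
      then show False using ny n r by simp
    qed
    have l: "ln (vnorm m y) = ln (vnorm m x) + ln r" unfolding ny using n r by (simp add: ln_mult)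
    show ?thesis unfolding mk_def l using False y0 y ny r by (auto simp: fun_eq_iff)
  qed
  then show ?thesis by (simp add: rescale_def y_def U_def)
qed

context
  fixes r :: "nat \<Rightarrow> real" and c1 c2 :: real
  assumes r: "\<And>k. r k > 0" "r \<longlonglongrightarrow> 0"
    and c: "(\<lambda>k. cos (phL (ln (r k)))) \<longlonglongrightarrow> c1" "(\<lambda>k. sin (phL (ln (r k)))) \<longlonglongrightarrow> c2"
begin

lemma ln_r: "filterlim (\<lambda>k. u + ln (r k)) at_bot sequentially"
proof -
  have "filterlim r (at_right 0) sequentially" by (rule tendsto_imp_filterlim_at_right[OF r(2)]) (simp add: r(1))
  from filterlim_compose[OF ln_at_0 this] have "filterlim (\<lambda>k. ln (r k)) at_bot sequentially" .
  then have *: "\<forall>\<^sub>F k in sequentially. ln (r k) \<le> Z - u" for Z unfolding filterlim_at_bot by blast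
  show ?thesis unfolding filterlim_at_bot
  proof
    fix Z show "\<forall>\<^sub>F k in sequentially. u + ln (r k) \<le> Z" using *[of Z] by eventually_elim simp
  qed
qed

lemma r_small: "\<forall>\<^sub>F k in sequentially. u + ln (r k) < 0"
  using ln_r[of u, unfolded filterlim_at_bot_dense] by blast

lemma profile_lims:
  "(\<lambda>k. hU (u + ln (r k))) \<longlonglongrightarrow> 1" (is ?PA) "(\<lambda>k. - Dt rho (sL (u + ln (r k)))) \<longlonglongrightarrow> 0" (is ?PB)
  "j < 3 \<Longrightarrow> (\<lambda>k. ZU j (u + ln (r k))) \<longlonglongrightarrow> (if j = 0 then c1 else if j = 1 then c2 else 0)"
  "(\<lambda>k. dZU j (u + ln (r k))) \<longlonglongrightarrow> 0" (is ?PC)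
proof -
  show ?PA
    using filterlim_compose[OF f_sL_at_bot[OF smooth_S(3)] ln_r] by (simp add: hU_def profile_at_0)
  show ?PB
    using tendsto_minus[OF filterlim_compose[OF f_sL_at_bot[OF smooth_Dt[OF smooth_S(3) S(1)]] ln_r]] by (simp add: profile_at_0)
  show ?PC by (rule filterlim_compose[OF dZU_at_bot ln_r])
  \<comment> \<open>The phase at radius r |x| is compared with the phase at radius r; the addition
    theorems transfer the limit.\<close>
  define d where "d k = phL (u + ln (r k)) - phL (ln (r k))" for k
  have "d \<longlonglongrightarrow> 0" unfolding d_def[abs_def] using filterlim_compose[OF phL_shift[of u] ln_r[of 0]] by simp
  then have d: "(\<lambda>k. cos (d k)) \<longlonglongrightarrow> 1" "(\<lambda>k. sin (d k)) \<longlonglongrightarrow> 0"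
    using tendsto_cos[of d 0] tendsto_sin[of d 0] by simp_all
  have e: "phL (u + ln (r k)) = d k + phL (ln (r k))" for k by (simp add: d_def)
  have "(\<lambda>k. cos (d k) * cos (phL (ln (r k))) - sin (d k) * sin (phL (ln (r k)))) \<longlonglongrightarrow> 1 * c1 - 0 * c2"
    "(\<lambda>k. sin (d k) * cos (phL (ln (r k))) + cos (d k) * sin (phL (ln (r k)))) \<longlonglongrightarrow> 0 * c1 + 1 * c2"
    by (intro tendsto_intros d c)+
  then have "(\<lambda>k. cos (phL (u + ln (r k)))) \<longlonglongrightarrow> c1" "(\<lambda>k. sin (phL (u + ln (r k)))) \<longlonglongrightarrow> c2"
    unfolding e cos_add sin_add by simp_all
  moreover have "(\<lambda>k. sL (u + ln (r k))) \<longlonglongrightarrow> 0" by (rule filterlim_compose[OF sL_at_bot ln_r])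
  ultimately show "(\<lambda>k. ZU j (u + ln (r k))) \<longlonglongrightarrow> (if j = 0 then c1 else if j = 1 then c2 else 0)" by (simp add: ZU_def)
qed

lemma rescale_pointwise:
  assumes x: "x \<in> punct m R" and a: "a < ll"
  shows "(\<lambda>k. rescale m U (origin m) (r k) x a) \<longlonglongrightarrow> Tc c1 c2 x a"
proof -
  have xR: "x \<in> Rn m" using punct_D[OF x] by simp
  show ?thesis unfolding rescale_eq[OF xR r(1)] Tc_def
    by (rule mk_pointwise[OF x profile_lims(1) profile_lims(3) a])
qed

lemma rescale_tendsto:
  assumes c1: "\<bar>c1\<bar> \<le> 1" "\<bar>c2\<bar> \<le> 1"
  shows "W1p_tendsto m ll p (oball m R) (\<lambda>k. rescale m U (origin m) (r k)) (Tc c1 c2)"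
proof (rule W1p_tendsto_cong)
  show "mk m (\<lambda>u. hU (u + ln (r k))) (\<lambda>j u. ZU j (u + ln (r k))) x = rescale m U (origin m) (r k) x"
    if "x \<in> oball m R" for k x
    using that rescale_eq[OF _ r(1)] by (simp add: vball_origin)
  have ev: "\<forall>\<^sub>F k in sequentially. ln R + ln (r k) < 0" by (rule r_small)
  show "W1p_tendsto m ll p (oball m R) (\<lambda>k. mk m (\<lambda>u. hU (u + ln (r k))) (\<lambda>j u. ZU j (u + ln (r k)))) (Tc c1 c2)"
    unfolding Tc_def
  proof (rule mk_tendsto[OF m2 p1 pm, where C = CU])
    show "\<forall>\<^sub>F k in sequentially. Bd R CU (\<lambda>u. hU (u + ln (r k))) \<and> (\<forall>j<3. Bd R CU (\<lambda>u. ZU j (u + ln (r k))))"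
      using ev by eventually_elim (intro conjI allI impI Bd_shift(1) CU; simp)
    show "Bd R CU (\<lambda>_. 1)" "Bd R CU (\<lambda>_. if j = 0 then c1 else if j = 1 then c2 else 0)" for j :: nat
      using CU(3) c1 by (auto simp: Bd_def smooth1_const)
    show "(\<lambda>k. hU (u + ln (r k))) \<longlonglongrightarrow> 1" for u by (rule profile_lims(1))
    show "(\<lambda>k. ZU j (u + ln (r k))) \<longlonglongrightarrow> (if j = 0 then c1 else if j = 1 then c2 else 0)" if "j < 3" for j u
      by (rule profile_lims(3)[OF that])
    have e1: "\<forall>\<^sub>F k in sequentially. - Dt rho (sL (u + ln (r k))) = deriv (\<lambda>u. hU (u + ln (r k))) u" if "u < ln R" for u
      using ev by eventually_elim (use that in \<open>simp add: Bd_shift(2)[OF CU(1) _ that] hU_deriv\<close>)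
    show "(\<lambda>k. deriv (\<lambda>u. hU (u + ln (r k))) u) \<longlonglongrightarrow> deriv (\<lambda>_. 1) u" if "u < ln R" for u
      using Lim_transform_eventually[OF profile_lims(2) e1[OF that]] by simp
    have e2: "\<forall>\<^sub>F k in sequentially. dZU j (u + ln (r k)) = deriv (\<lambda>u. ZU j (u + ln (r k))) u" if "u < ln R" for u j
      using ev by eventually_elim (use that in \<open>simp add: Bd_shift(2)[OF CU(2) _ that] ZU_deriv\<close>)
    show "(\<lambda>k. deriv (\<lambda>u. ZU j (u + ln (r k))) u) \<longlonglongrightarrow> deriv (\<lambda>_. if j = 0 then c1 else if j = 1 then c2 else 0) u"
      if "u < ln R" for u j
      using Lim_transform_eventually[OF profile_lims(4) e2[OF that]] by simp
  qed
qed

end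

lemma Tc_in_N:
  assumes c: "c1\<^sup>2 + c2\<^sup>2 = 1" and x: "x \<in> Rn m"
  shows "Tc c1 c2 x \<in> N"
proof (cases "x = origin m")
  case True then show ?thesis unfolding Tc_def using zero_in_N by simp
next
  case False
  then have xp: "x \<in> punct m (vnorm m x + 1)" using x by (simp add: vball_origin)
  have c1: "\<bar>c1\<bar> \<le> 1" "\<bar>c2\<bar> \<le> 1"
    using c by (auto intro!: abs_square_le_1[THEN iffD1] simp: add_increasing2) (smt (verit) zero_le_power2)+
  show ?thesis unfolding Tc_def
    by (rule mk_in_N[OF _ _ c1 _ _ xp]) (use s1 in \<open>simp_all add: profile_at_0\<close>)
qed

text \<open>The phases along the given radii accumulate on the unit circle. Along such a subsequence
  the blow-ups converge pointwise to a map of the family, while strong convergence gives a further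
  subsequence converging almost everywhere to T.\<close>

lemma tangent_map_AE:
  assumes T: "T \<in> tangent_maps m ll p N U (origin m)"
  shows "\<exists>\<theta>. AE x in leb m. T x = Tc (cos \<theta>) (sin \<theta>) x"
proof -
  obtain r where r: "\<And>k. r k > 0" "decseq r" "r \<longlonglongrightarrow> 0" and TN: "T \<in> Rn m \<rightarrow> N"
    and conv: "\<And>R. R > 0 \<Longrightarrow> W1p_tendsto m ll p (oball m R) (\<lambda>k. rescale m U (origin m) (r k)) T"
    using T unfolding tangent_maps_def by blast
  have "\<forall>k. cis (phL (ln (r k))) \<in> sphere 0 1" by simp
  then have "\<exists>z\<in>sphere 0 1. \<exists>s. strict_mono s \<and> ((\<lambda>k. cis (phL (ln (r k)))) \<circ> s) \<longlonglongrightarrow> z"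
    by (rule spec[OF iffD1[OF compact_def compact_sphere], THEN mp])
  then obtain z s where z: "z \<in> sphere 0 1" "strict_mono s" "((\<lambda>k. cis (phL (ln (r k)))) \<circ> s) \<longlonglongrightarrow> z"
    by blast
  have "(Re z)\<^sup>2 + (Im z)\<^sup>2 = 1" using z(1) by (simp add: cmod_def)
  then obtain \<theta> where \<theta>: "Re z = cos \<theta>" "Im z = sin \<theta>" by (rule sincos_total_2pi)
  have cs: "(\<lambda>k. cos (phL (ln (r (s k))))) \<longlonglongrightarrow> cos \<theta>" "(\<lambda>k. sin (phL (ln (r (s k))))) \<longlonglongrightarrow> sin \<theta>"
    using tendsto_Re[OF z(3)] tendsto_Im[OF z(3)] by (simp_all add: \<theta> comp_def)
  have rs: "(\<lambda>k. r (s k)) \<longlonglongrightarrow> 0" using LIMSEQ_subseq_LIMSEQ[OF r(3) z(2)] by (simp add: comp_def)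
  let ?f = "\<lambda>k. rescale m U (origin m) (r (s k))" and ?T = "Tc (cos \<theta>) (sin \<theta>)"
  have "AE x in leb m. x \<in> oball m R \<longrightarrow> (\<forall>a<ll. T x a = ?T x a)" if R: "R > 0" for R
  proof -
    have "W1p_tendsto m ll p (oball m R) ?f T"
      by (rule W1p_tendsto_subseq[OF conv[OF R] filterlim_subseq[OF z(2)]])
    then obtain n where n: "\<And>k. k \<ge> n \<Longrightarrow> ?f k \<in> W1p m ll p (oball m R)" and W: "W1p_tendsto m ll p (oball m R) ?f T"
      unfolding W1p_tendsto_def eventually_sequentially by blast
    have t: "W1p_tendsto m ll p (oball m R) (\<lambda>k. ?f (k + n)) T"
      by (rule W1p_tendsto_subseq[where f = ?f, OF W filterlim_add_const_nat_at_top])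
    obtain q where q: "strict_mono q" "AE x in lebball m R. \<forall>a<ll. (\<lambda>k. ?f (q k + n) x a) \<longlonglongrightarrow> T x a"
      by (rule W1p_tendsto_AE_subseq[OF _ _ t n]) (use m2 p1 in auto)
    have qn: "filterlim (\<lambda>k. q k + n) sequentially sequentially"
      using filterlim_compose[OF filterlim_add_const_nat_at_top filterlim_subseq[OF q(1)]] .
    have AEp: "AE x in lebball m R. x \<in> punct m R"
      using m2 by (intro AE_lebball_punct) auto
    have "AE x in lebball m R. \<forall>a<ll. T x a = ?T x a"
      using q(2) AEp
    proof eventually_elim
      case (elim x)
      have "(\<lambda>k. ?f (q k + n) x a) \<longlonglongrightarrow> ?T x a" if "a < ll" for a
        using filterlim_compose[OF rescale_pointwise[of "\<lambda>k. r (s k)", OF r(1) rs cs elim(2) that] qn] .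
      then show ?case using elim(1) LIMSEQ_unique by blast
    qed
    then show ?thesis unfolding lebball_AE .
  qed
  then have "AE x in leb m. \<forall>n. x \<in> oball m (real (Suc n)) \<longrightarrow> (\<forall>a<ll. T x a = ?T x a)"
    unfolding AE_all_countable by simp
  then have "AE x in leb m. T x = ?T x"
    using AE_space[of "leb m"]
  proof eventually_elim
    case (elim x)
    then have xR: "x \<in> Rn m" by (simp add: space_leb)
    obtain n where "vnorm m x < real n" using reals_Archimedean2 by blast
    then have "x \<in> oball m (real (Suc n))" using xR by (simp add: vball_origin)
    then have "\<forall>a<ll. T x a = ?T x a" using elim by blast
    moreover have "T x \<in> Rn ll" using TN xR N_Rn by auto
    moreover have "?T x \<in> Rn ll" unfolding Tc_def by (rule mk_Rn)
    ultimately show "T x = ?T x" by (intro Rn_eqI[of _ ll]) auto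
  qed
  then show ?thesis by blast
qed

lemma phL_decreasing: "a < b \<Longrightarrow> b < 0 \<Longrightarrow> phL b < phL a"
proof -
  assume ab: "a < b" "b < 0"
  have "\<exists>y. DERIV phL x :> y \<and> y < 0" if "a \<le> x" "x \<le> b" for x
  proof -
    have x: "x < 0" using that ab by simp
    have "Wf (sL x) > 0" using Wsq_ge[of "sL x"] pos(1)[OF sL_S[OF x]] by (simp add: Wf_def)
    moreover have "flat (sL x) > 0" using flat_sL[OF x] T0_gt x by simp
    ultimately show ?thesis using phL_DERIV[OF x] by (intro exI[of _ "- th (sL x)"]) (simp add: th_def)
  qed
  then show ?thesis by (rule DERIV_neg_imp_decreasing[OF ab(1)])
qed

text \<open>The phase speed in t is at least sqrt (mu / p) / t, so the phase outgrows that multiple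
  of ln t.\<close>

lemma phL_at_bot: "filterlim phL at_top at_bot"
proof -
  define w where "w = sqrt (mu / p)"
  have w: "w > 0" using mu_pos p1 by (simp add: w_def)
  have "filterlim (\<lambda>u. T0 + - u) at_top at_bot"
    by (rule filterlim_tendsto_add_at_top[OF tendsto_const filterlim_uminus_at_top_at_bot])
  then have "filterlim (\<lambda>u. ln (T0 - u)) at_top at_bot" using filterlim_compose[OF ln_at_top] by simp
  then have "filterlim (\<lambda>u. (phL (-1) - w * ln (T0 - (-1))) + w * ln (T0 - u)) at_top at_bot"
    by (intro filterlim_tendsto_add_at_top[OF tendsto_const] filterlim_tendsto_pos_mult_at_top[OF tendsto_const w])
  moreover have "\<forall>\<^sub>F u in at_bot. (phL (-1) - w * ln (T0 - (-1))) + w * ln (T0 - u) \<le> phL u"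
    using eventually_le_at_bot[of "-1::real"]
  proof eventually_elim
    case (elim u)
    have "phL (-1) - w * ln (T0 - (-1)) \<le> phL u - w * ln (T0 - u)"
    proof (rule DERIV_nonpos_imp_nonincreasing[OF elim, of "\<lambda>u. phL u - w * ln (T0 - u)"])
      fix x assume "u \<le> x" "x \<le> -1"
      then have x: "x < 0" by simp
      have t: "T0 - x > 0" using T0_gt x by simp
      have "w \<le> Wf (sL x)" unfolding w_def Wf_def using Wsq_ge[of "sL x"] sL_S[OF x] by (simp add: S(2))
      then have "flat (sL x) * w \<le> flat (sL x) * Wf (sL x)" using flat_sL[OF x] t by (intro mult_left_mono) auto
      then have le: "- th (sL x) + w * (1 / (T0 - x)) \<le> 0" using flat_sL[OF x] by (simp add: th_def)
      have "((\<lambda>u. ln (T0 - u)) has_real_derivative - (1 / (T0 - x))) (at x)"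
        using t by (auto intro!: derivative_eq_intros simp: divide_inverse)
      from DERIV_diff[OF phL_DERIV[OF x] DERIV_cmult[OF this]]
      have "((\<lambda>u. phL u - w * ln (T0 - u)) has_real_derivative - th (sL x) - w * - (1 / (T0 - x))) (at x)" .
      then show "\<exists>y. ((\<lambda>u. phL u - w * ln (T0 - u)) has_real_derivative y) (at x) \<and> y \<le> 0"
        using le by (intro exI conjI) auto
    qed
    then show ?case by simp
  qed
  ultimately show ?thesis by (rule filterlim_at_top_mono)
qed

text \<open>The phase is continuous and unbounded, so it takes the values \<theta> + 2 k \<pi> for
  all large k; along the corresponding radii its cosine and sine are constant. Strict monotonicity
  of the phase orders these radii and drives them to 0.\<close>

lemma Tc_tangent: "Tc (cos \<theta>) (sin \<theta>) \<in> tangent_maps m ll p N U (origin m)"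
proof -
  \<comment> \<open>The offset puts all prescribed phases above the phase at ln |x| = -1, as the
    intermediate value theorem requires.\<close>
  obtain n :: nat where n: "(phL (-1) - \<theta>) / (2 * pi) \<le> real n" using real_arch_simple by blast
  have n': "phL (-1) \<le> \<theta> + 2 * real (k + n) * pi" for k
  proof -
    have "phL (-1) - \<theta> \<le> real n * (2 * pi)" using n by (simp add: divide_le_eq)
    also have "\<dots> \<le> real (k + n) * (2 * pi)" by (intro mult_right_mono) auto
    finally show ?thesis by (simp add: algebra_simps)
  qed
  have "\<exists>u\<le>-1. phL u = \<theta> + 2 * real (k + n) * pi" for k
  proof -
    have "\<forall>\<^sub>F u in at_bot. \<theta> + 2 * real (k + n) * pi \<le> phL u" using phL_at_bot unfolding filterlim_at_top by blast
    then obtain u0 where u0: "\<And>u. u \<le> u0 \<Longrightarrow> \<theta> + 2 * real (k + n) * pi \<le> phL u" unfolding eventually_at_bot_linorder by blast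
    have "\<exists>u. min u0 (-1) \<le> u \<and> u \<le> -1 \<and> phL u = \<theta> + 2 * real (k + n) * pi"
      by (rule IVT2[where f = phL, OF n'[of k] u0[of "min u0 (-1)"]]) (auto intro!: DERIV_isCont[OF phL_DERIV])
    then show ?thesis by blast
  qed
  then obtain u where u: "\<And>k. u k \<le> -1" "\<And>k. phL (u k) = \<theta> + 2 * real (k + n) * pi" by metis
  have dec: "decseq u"
  proof (rule decseq_SucI, rule ccontr)
    fix k assume "\<not> u (Suc k) \<le> u k"
    then have "phL (u (Suc k)) < phL (u k)" using u(1)[of "Suc k"] by (intro phL_decreasing) auto
    then show False unfolding u(2) by simp
  qed
  have ub: "filterlim u at_bot sequentially"
    unfolding filterlim_at_bot
  proof
    fix Z :: real
    define Z' where "Z' = min Z (-1)"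
    obtain K :: nat where K: "(phL Z' - \<theta>) / (2 * pi) < real K" using reals_Archimedean2 by blast
    show "\<forall>\<^sub>F k in sequentially. u k \<le> Z"
      unfolding eventually_sequentially
    proof (intro exI[of _ K] allI impI, rule ccontr)
      fix k assume k: "K \<le> k" and "\<not> u k \<le> Z"
      then have "Z' < u k" by (simp add: Z'_def)
      then have "phL (u k) < phL Z'" using u(1)[of k] by (intro phL_decreasing) auto
      moreover have "phL Z' - \<theta> < real K * (2 * pi)" using K by (simp add: divide_less_eq)
      moreover have "real K * (2 * pi) \<le> real (k + n) * (2 * pi)" using k by (intro mult_right_mono) auto
      moreover have "real (k + n) * (2 * pi) = 2 * real (k + n) * pi" by simp
      ultimately show False unfolding u(2) by linarith
    qed
  qed
  define r where "r k = exp (u k)" for k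
  have r: "\<And>k. r k > 0" "decseq r" "r \<longlonglongrightarrow> 0"
    using dec filterlim_compose[OF exp_at_bot ub] by (auto simp: r_def[abs_def] decseq_def)
  have ph: "cos (phL (ln (r k))) = cos \<theta>" "sin (phL (ln (r k))) = sin \<theta>" for k
    unfolding r_def ln_exp u(2) cos_add sin_add by (simp_all del: of_nat_add)
  have c: "(\<lambda>k. cos (phL (ln (r k)))) \<longlonglongrightarrow> cos \<theta>" "(\<lambda>k. sin (phL (ln (r k)))) \<longlonglongrightarrow> sin \<theta>"
    unfolding ph by simp_all
  have "W1p_tendsto m ll p (oball m R) (\<lambda>k. rescale m U (origin m) (r k)) (Tc (cos \<theta>) (sin \<theta>))" for R
    by (rule rescale_tendsto[OF r(1,3) c]) auto
  moreover have "Tc (cos \<theta>) (sin \<theta>) \<in> Rn m \<rightarrow> N" using Tc_in_N[of "cos \<theta>" "sin \<theta>"] by simp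
  ultimately show ?thesis unfolding tangent_maps_def using r by blast
qed

text \<open>The two parameters are the coordinates \<open>m\<close> and \<open>m + 1\<close>,
  constant off the origin, so a single common point suffices.\<close>

lemma Tc_inj:
  assumes "AE x in leb m. Tc c1 c2 x = Tc d1 d2 x"
  shows "c1 = d1" "c2 = d2"
proof -
  obtain x where x: "x \<in> obox m (\<lambda>_. 1) (\<lambda>_. 2)" "Tc c1 c2 x = Tc d1 d2 x"
    using AE_leb_obox[OF assms, of "\<lambda>_. 1" "\<lambda>_. 2"] by auto
  have "x 0 \<noteq> 0" using PiE_mem[OF x(1)[unfolded obox_def], of 0] m2 by simp
  then have "x \<noteq> origin m" using m2 by (auto simp: origin_def)
  then show "c1 = d1" "c2 = d2"
    using arg_cong[OF x(2), of "\<lambda>v. v m"] arg_cong[OF x(2), of "\<lambda>v. v (m + 1)"] by (simp_all add: Tc_def mk_def)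
qed

text \<open>The classes are indexed by a real angle, which bounds their number from above; angles
  between - \<pi> / 2 and \<pi> / 2 are told apart by their tangent, which bounds it from
  below.\<close>

lemma U_continuum: "continuum_of_tangent_maps m ll p N U (origin m)"
proof -
  define cl where "cl \<theta> = ae_eq m `` {Tc (cos \<theta>) (sin \<theta>)}" for \<theta> :: real
  have "tangent_maps m ll p N U (origin m) // ae_eq m = range cl"
  proof (intro subset_antisym subsetI)
    fix c assume "c \<in> tangent_maps m ll p N U (origin m) // ae_eq m"
    then obtain T where T: "T \<in> tangent_maps m ll p N U (origin m)" "c = ae_eq m `` {T}" by (rule quotientE)
    obtain \<theta> where "AE x in leb m. T x = Tc (cos \<theta>) (sin \<theta>) x" using tangent_map_AE[OF T(1)] by blast
    then have "c = cl \<theta>" unfolding T(2) cl_def by (intro ae_eq_class) (simp add: ae_eq_def)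
    then show "c \<in> range cl" by simp
  next
    fix c assume "c \<in> range cl"
    then show "c \<in> tangent_maps m ll p N U (origin m) // ae_eq m"
      unfolding cl_def using quotientI[OF Tc_tangent] by auto
  qed
  moreover have "range cl \<approx> (UNIV :: real set)"
  proof (rule lepoll_antisym[OF image_lepoll])
    have "inj (\<lambda>x. cl (arctan x))"
    proof (rule injI)
      fix x y assume "cl (arctan x) = cl (arctan y)"
      moreover have "Tc (cos (arctan x)) (sin (arctan x)) \<in> cl (arctan x)" by (simp add: cl_def ae_eq_def)
      ultimately have "Tc (cos (arctan x)) (sin (arctan x)) \<in> cl (arctan y)" by simp
      then have "AE z in leb m. Tc (cos (arctan y)) (sin (arctan y)) z = Tc (cos (arctan x)) (sin (arctan x)) z"
        by (simp add: cl_def ae_eq_def)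
      from Tc_inj[OF this] have "tan (arctan y) = tan (arctan x)" by (simp add: tan_def)
      then show "x = y" by (simp add: tan_arctan)
    qed
    then show "(UNIV :: real set) \<lesssim> range cl" unfolding lepoll_def by blast
  qed
  ultimately show ?thesis unfolding continuum_of_tangent_maps_def by simp
qed

end

theorem theorem0p1:
  fixes p :: real
  assumes "p > 1"
  shows "\<exists>c :: real. \<forall>m :: nat. real m > c \<longrightarrow>
    (\<exists>(l :: nat) (n :: nat) (N :: (nat \<Rightarrow> real) set) (U :: (nat \<Rightarrow> real) \<Rightarrow> nat \<Rightarrow> real).
       smooth_submanifold l n N \<and> n \<ge> m + 2 \<and>
       U \<in> vball m (origin m) 1 \<rightarrow> N \<and>
       p_harmonic m l p (vball m (origin m) 1) N U \<and>
       isolated_singularity m l (vball m (origin m) 1) U (origin m) \<and>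
       continuum_of_tangent_maps m l p N U (origin m) \<and>
       unique_minimizing m l p (vball m (origin m) 1) N U)"
proof -
  obtain c0 where c0: "0 < c0" "powr_gap p c0"
    using powr_convexity[OF assms] by blast
  define A where "A = p * 602 * (200 * 2 powr (p / 2))"
  have A: "A > 0" using assms by (simp add: A_def)
  \<comment> \<open>\<open>c0\<close> and \<open>A\<close> depend on p alone. The bound 2 p + 2
    yields kap \<ge> m / 2, hence Ctot \<le> 32 A / sqrt m; the square makes sqrt m at least 64 A /
    c0, so that Ctot \<le> c0 / 2.\<close>
  define c where "c = max (2 * p + 2) ((64 * A / c0)\<^sup>2)"
  show ?thesis
  proof (intro exI[of _ c] allI impI)
    fix m :: nat assume m: "real m > c"
    have mp: "2 * p + 2 < m" "(64 * A / c0)\<^sup>2 \<le> m" using m by (simp_all add: c_def)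
    have m4: "4 < real m" using mp(1) assms by linarith
    have "exponents p m" by unfold_locales (use assms mp(1) in auto)
    then obtain s1 \<phi> where "spiral p m s1 \<phi>" using exponents.ex_spiral by blast
    then interpret spiral p m s1 \<phi> .
    have kap: "m / 2 \<le> kap" "0 < kap" using mp(1) assms m4 by (simp_all add: kap_def field_simps)
    have sq: "sqrt m * sqrt m = m" "1 \<le> sqrt m" using m4 by simp_all
    have "4 * mu \<le> 8 * kap" using kap(1) by (simp add: mu_def)
    then have "4 * mu / kap \<le> 8" using kap(2) by (simp add: divide_le_eq)
    moreover have "2 * sqrt mu \<le> 2 * sqrt m" by (simp add: mu_def)
    ultimately have MX: "MX \<le> 8 * sqrt m" using sq(2) unfolding MX_def by (intro max.boundedI) linarith+
    have k2: "2 / kap \<le> 4 / m" using kap m4 by (simp add: field_simps)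
    have "Ctot = A * (2 / kap * MX)" by (simp add: Ctot_def A_def)
    also have "\<dots> \<le> A * (4 / m * (8 * sqrt m))"
    proof (intro mult_left_mono mult_mono k2 MX)
      show "0 \<le> MX" using mu_pos kap(2) by (simp add: MX_def le_max_iff_disj)
    qed (use A in auto)
    also have "\<dots> = 32 * A / sqrt m"
    proof -
      have "4 / m * (8 * sqrt m) = 32 / sqrt m" using sq m4 by (simp add: field_simps)
      then show ?thesis by simp
    qed
    also have "\<dots> \<le> c0 / 2"
    proof -
      have "64 * A / c0 \<le> sqrt m" by (rule real_le_rsqrt[OF mp(2)])
      then show ?thesis using c0(1) m4 by (simp add: field_simps)
    qed
    finally have Ct: "Ctot \<le> c0 / 2" .
    show "\<exists>(l :: nat) (n :: nat) (N :: (nat \<Rightarrow> real) set) (U :: (nat \<Rightarrow> real) \<Rightarrow> nat \<Rightarrow> real).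
       smooth_submanifold l n N \<and> n \<ge> m + 2 \<and>
       U \<in> vball m (origin m) 1 \<rightarrow> N \<and>
       p_harmonic m l p (vball m (origin m) 1) N U \<and>
       isolated_singularity m l (vball m (origin m) 1) U (origin m) \<and>
       continuum_of_tangent_maps m l p N U (origin m) \<and>
       unique_minimizing m l p (vball m (origin m) 1) N U"
      using N_submanifold U_in_N U_p_harmonic U_singular U_continuum U_unique_minimizing[OF c0 Ct]
      by (intro exI[of _ ll] exI[of _ "m + 3"] exI[of _ N] exI[of _ U]) auto
  qed
qed

end
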